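(* Let $p_2$ be the law on $\mathbb{R}^D$ of $x=A_2z_2+\varepsilon_2$, where $A_2\in\mathbb{R}^{D\times d_2}$ satisfies $A_2^\top A_2=I_{d_2}$, $z_2\sim p_{2,z}$ is a latent variable in $\mathbb{R}^{d_2}$, and $\varepsilon_2\sim\mathcal{N}(0,\sigma_2^2I_D)$ is independent of $z_2$, with $\sigma_2>0$. Suppose: (i) the density $p_{2,z}>0$ is twice continuously differentiable, and there exist constants $B_2,C_{1,2},C_{2,2}>0$ such that $p_{2,z}(z)\le(2\pi)^{-d_2/2}C_{1,2}\exp\{-C_{2,2}\|z\|_2^2/2\}$ for all $\|z\|_2\ge B_2$; (ii) the map $f_2^*(z,t):=\widetilde h_2(t)\nabla\log p_{2,t}^{\rm LD}(z)+z$ is uniformly $\beta_2$-Lipschitz in $z\in\mathbb{R}^{d_2}$ for all $t\in[0,T]$. Let $V_1\in\mathbb{R}^{D\times d_1}$, with $V_1^\top V_1=I_{d_1}$, be fixed independently of the target samples $x_1,\dots,x_{N_2}$, which are i.i.d. from $p_2$. For $\delta\in(0,1)$, set $$R_z=C_z(1+\sigma_2)\Big(\sqrt{d_2}+\sqrt{\log\tfrac{8N_2}{\delta}}\Big),\qquad R_\perp=C_\perp\sigma_2\Big(\sqrt{D-d_2}+\sqrt{\log\tfrac{8N_2}{\delta}}\Big),$$ and define $$\mathcal{T}_2(R_z,R_\perp):=\{x\in\mathbb{R}^D:\|A_2^\top x\|_2\le R_z,\ \|(I_D-A_2A_2^\top)x\|_2\le R_\perp\}.$$ For $\iota>0$,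 let $$\mathcal{N}_2(\iota):=\mathcal{N}\Big(\iota,\big\{\ell_2(\cdot;s)\mathbf{1}_{\mathcal{T}_2(R_z,R_\perp)}(\cdot):s\in\mathcal{S}_{\rm freeze}(V_1)\big\},\|\cdot\|_\infty\Big).$$ Let $\epsilon>0$. If the ReLU architecture is chosen so that $$\inf_{f_\theta\in\mathcal{F}_{\rm ReLU}^{(d_1)}}\mathcal{A}_{\rm comp}(f_\theta;V_1)\lesssim\frac{(d_1+1)\epsilon^2}{t_0(T-t_0)},$$ then, with probability at least $1-\delta$, $$\mathcal{L}_2(\widehat s_{\rm freeze})\le\widetilde{\mathcal{O}}\left(\frac{K^2+R_z^2+R_\perp^2}{N_2t_0(T-t_0)\epsilon^2}\Big[\log\mathcal{N}_2(\iota)+\log\frac{8}{\delta}\Big]+\iota\right)+\mathcal{O}\left(\frac{(d_1+1)\epsilon^2}{t_0(T-t_0)}\right)+\mathcal{O}\big(\mathcal{U}_{\rm comp}(V_1)\big).$$ Here $K$ is the uniform output bound of the ReLU network class, and $C_z,C_\perp$ depend only on the target latent tail constants and absolute Gaussian concentration constants.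
   Context: Forward process on $[0,T]$: $\alpha(t)=e^{-t/2}$, $h(t)=1-e^{-t}$, and $X_t\mid X_0\sim\mathcal{N}(\alpha(t)X_0,h(t)I_D)$, with Gaussian transition density $\phi_t(\cdot\mid X_0)$; $0<t_0<T$ is the early-stopping time. When $X_0\sim p_2$, $p_{2,t}$ denotes the density of $X_t$. Set $\widetilde h_2(t)=\alpha^2(t)\sigma_2^2+h(t)$, and for $y\in\mathbb{R}^{d_2}$ let $p_{2,t}^{\rm LD}(y)=\int_{\mathbb{R}^{d_2}}\phi_{2,t}(y\mid z)p_{2,z}(z)\,\mathrm{d}z$, where $\phi_{2,t}(\cdot\mid z)$ is the density of $\mathcal{N}(\alpha(t)z,\widetilde h_2(t)I_{d_2})$. Let $g_2(y,t)=h(t)\nabla\log p_{2,t}^{\rm LD}(y)+y$. Risks: $\mathcal{L}_2(s)=\frac{1}{T-t_0}\int_{t_0}^T\mathbb{E}_{X_t\sim p_{2,t}}\|s(X_t,t)-\nabla\log p_{2,t}(X_t)\|_2^2\,\mathrm{d}t$, and the denoising loss is $\ell_2(x;s)=\frac{1}{T-t_0}\int_{t_0}^T\mathbb{E}_{X_t\sim\phi_t(\cdot\mid x)}\|\nabla_{X_t}\log\phi_t(X_t\mid x)-s(X_t,t)\|_2^2\,\mathrm{d}t$. ReLU class: $\mathcal{F}_{\rm ReLU}^{(d_1)}=\mathcal{F}_{\rm ReLU}^{(d_1)}(L,M,J,K,\kappa,\gamma,\gamma_t)$ is the set of $\mathbb{R}^{d_1}$-valued functions $f(z,t)=W_L\sigma(\cdots\sigma(W_1[z^\top,t]^\top+b_1)\cdots)+b_L$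 of $z\in\mathbb{R}^{d_1}$ and $t$, with $\sigma$ the ReLU, width bounded by $M$, $\sup_{z,t}\|f(z,t)\|_2\le K$, $\max\{\|b_i\|_\infty,\|W_i\|_\infty\}\le\kappa$ for $i=1,\dots,L$, $\sum_{i=1}^L(\|W_i\|_0+\|b_i\|_0)\le J$, $\|f(z_1,t)-f(z_2,t)\|_2\le\gamma\|z_1-z_2\|_2$ for any $t\in[0,T]$, and $\|f(z,t_1)-f(z,t_2)\|_2\le\gamma_t|t_1-t_2|$ for any $z$. Frozen class and estimator: $\mathcal{S}_{\rm freeze}(V_1)=\{s_{V_1,\theta}(x,t)=\frac{1}{h(t)}V_1f_\theta(V_1^\top x,t)-\frac{1}{h(t)}x:\ f_\theta\in\mathcal{F}_{\rm ReLU}^{(d_1)}\}$, and $\widehat s_{\rm freeze}\in\arg\min_{s\in\mathcal{S}_{\rm freeze}(V_1)}\frac{1}{N_2}\sum_{i=1}^{N_2}\ell_2(x_i;s)$. Comparator: with $B:=V_1^\top A_2$ and $B^\dagger$ its Moore–Penrose pseudoinverse, $f_{\rm comp}(z,t):=B\,g_2(B^\dagger z,t)$, $s_{\rm comp}(x,t):=\frac{1}{h(t)}V_1f_{\rm comp}(V_1^\top x,t)-\frac{1}{h(t)}x$, $\mathcal{U}_{\rm comp}(V_1):=\mathcal{L}_2(s_{\rm comp})$, and $$\mathcal{A}_{\rm comp}(f_\theta;V_1):=\frac{1}{T-t_0}\int_{t_0}^T\frac{1}{h^2(t)}\mathbb{E}_{X_t\sim p_{2,t}}\|f_\theta(V_1^\top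 X_t,t)-f_{\rm comp}(V_1^\top X_t,t)\|_2^2\,\mathrm{d}t.$$ Notation: $\mathcal{N}(\iota,\mathcal{F},d)$ is the $\iota$-covering number of a metric class $(\mathcal{F},d)$; $a\lesssim b$ means $a\le Cb$ for an absolute constant $C$; $\widetilde{\mathcal{O}}(\cdot)$ hides logarithmic factors.
   Formalization: The constants in the O and Õ terms may depend on an arbitrary upper bound ε_max for ε (they are absolute for ε ≤ 1); with constants uniform over all ε > 0 the stated bound fails for large ε. *)

theory Defs
  imports "HOL-Probability.Probability" "Jordan_Normal_Form.Matrix"
begin

text \<open>
  The asymptotic constants of the theorem are uniform in the dimensions \<open>D\<close>, \<open>d\<^sub>1\<close>, \<open>d\<^sub>2\<close>, so
  \<open>\<real>\<^sup>n\<close> is rendered as \<^term>\<open>carrier_vec n :: real Matrix.vec set\<close> with \<open>n\<close> a term.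
  All risks and losses are extended nonnegative reals, so that a divergent integral
  is \<open>\<infinity>\<close> and never silently \<open>0\<close>.
\<close>

section \<open>Analysis and measure on \<open>\<real>\<^sup>n\<close>\<close>

type_synonym rvec = "real Matrix.vec"
type_synonym rmat = "real Matrix.mat"
type_synonym vfield = "rvec \<Rightarrow> real \<Rightarrow> rvec"  \<comment> \<open>functions of space and time\<close>

definition vnorm :: "rvec \<Rightarrow> real" where
  "vnorm v = sqrt (scalar_prod v v)"

definition lborel_vec :: "nat \<Rightarrow> rvec measure" where
  "lborel_vec n = embed_measure (\<Pi>\<^sub>M i\<in>{..<n}. (lborel :: real measure)) (Matrix.vec n)"

definition partial_deriv :: "nat \<Rightarrow> nat \<Rightarrow> (rvec \<Rightarrow> real) \<Rightarrow> rvec \<Rightarrow> real" where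
  "partial_deriv n i F x = deriv (\<lambda>u. F (x + u \<cdot>\<^sub>v unit_vec n i)) 0"

definition grad :: "nat \<Rightarrow> (rvec \<Rightarrow> real) \<Rightarrow> rvec \<Rightarrow> rvec" where
  "grad n F x = Matrix.vec n (\<lambda>i. partial_deriv n i F x)"

text \<open>Continuity on \<open>\<real>\<^sup>n\<close> is continuity in the first \<open>n\<close> coordinates, for the product topology.\<close>

definition continuous_vec :: "nat \<Rightarrow> (rvec \<Rightarrow> real) \<Rightarrow> bool" where
  "continuous_vec n F \<longleftrightarrow> continuous_on UNIV (\<lambda>y :: nat \<Rightarrow> real. F (Matrix.vec n y))"

primrec times_cont_diff :: "nat \<Rightarrow> nat \<Rightarrow> (rvec \<Rightarrow> real) \<Rightarrow> bool" where
  "times_cont_diff 0 n F \<longleftrightarrow> continuous_vec n F"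
| "times_cont_diff (Suc k) n F \<longleftrightarrow> continuous_vec n F \<and>
     (\<forall>i<n. (\<forall>x\<in>carrier_vec n. (\<lambda>u. F (x + u \<cdot>\<^sub>v unit_vec n i)) differentiable (at 0)) \<and>
            times_cont_diff k n (partial_deriv n i F))"

text \<open>The law \<open>N(m, v I\<^sub>n)\<close>; the second parameter is the variance, not the standard deviation.\<close>

definition gauss_pdf :: "nat \<Rightarrow> rvec \<Rightarrow> real \<Rightarrow> rvec \<Rightarrow> real" where
  "gauss_pdf n m v y = (\<Prod>i<n. normal_density (vec_index m i) (sqrt v) (vec_index y i))"

definition gaussian :: "nat \<Rightarrow> rvec \<Rightarrow> real \<Rightarrow> rvec measure" where
  "gaussian n m v = density (lborel_vec n) (\<lambda>y. ennreal (gauss_pdf n m v y))"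

definition is_pinv :: "rmat \<Rightarrow> rmat \<Rightarrow> bool" where
  "is_pinv B X \<longleftrightarrow> X \<in> carrier_mat (dim_col B) (dim_row B) \<and>
     B * X * B = B \<and> X * B * X = X \<and>
     transpose_mat (B * X) = B * X \<and> transpose_mat (X * B) = X * B"

definition pinv :: "rmat \<Rightarrow> rmat" where
  "pinv B = (THE X. is_pinv B X)"

definition orthonormal_cols :: "nat \<Rightarrow> nat \<Rightarrow> rmat \<Rightarrow> bool" where
  "orthonormal_cols D d A \<longleftrightarrow> A \<in> carrier_mat D d \<and> transpose_mat A * A = 1\<^sub>m d"

section \<open>Forward process, scores and risks\<close>

definition alpha :: "real \<Rightarrow> real" where "alpha t = exp (- t / 2)"

definition hvar :: "real \<Rightarrow> real" where "hvar t = 1 - exp (- t)"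

definition trans_pdf :: "nat \<Rightarrow> real \<Rightarrow> rvec \<Rightarrow> rvec \<Rightarrow> real" where
  "trans_pdf D t x0 = gauss_pdf D (alpha t \<cdot>\<^sub>v x0) (hvar t)"

definition marginal_pdf :: "nat \<Rightarrow> rvec measure \<Rightarrow> real \<Rightarrow> rvec \<Rightarrow> real" where
  "marginal_pdf D P t y = (\<integral>x0. trans_pdf D t x0 y \<partial>P)"

definition marginal_law :: "nat \<Rightarrow> rvec measure \<Rightarrow> real \<Rightarrow> rvec measure" where
  "marginal_law D P t = density (lborel_vec D) (\<lambda>y. ennreal (marginal_pdf D P t y))"

definition score :: "nat \<Rightarrow> rvec measure \<Rightarrow> vfield" where
  "score D P y t = grad D (\<lambda>y. ln (marginal_pdf D P t y)) y"

definition time_avg :: "real \<Rightarrow> real \<Rightarrow> (real \<Rightarrow> ennreal) \<Rightarrow> ennreal" where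
  "time_avg t0 T F = ennreal (1 / (T - t0)) * (\<integral>\<^sup>+t\<in>{t0..T}. F t \<partial>lborel)"

definition score_risk :: "nat \<Rightarrow> real \<Rightarrow> real \<Rightarrow> rvec measure \<Rightarrow> vfield \<Rightarrow> ennreal" where
  "score_risk D t0 T P s = time_avg t0 T
     (\<lambda>t. \<integral>\<^sup>+y. ennreal ((vnorm (s y t - score D P y t))\<^sup>2) \<partial>marginal_law D P t)"

definition denoising_loss :: "nat \<Rightarrow> real \<Rightarrow> real \<Rightarrow> rvec \<Rightarrow> vfield \<Rightarrow> ennreal" where
  "denoising_loss D t0 T x s = time_avg t0 T
     (\<lambda>t. \<integral>\<^sup>+y. ennreal ((vnorm (grad D (\<lambda>y. ln (trans_pdf D t x y)) y - s y t))\<^sup>2)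
        \<partial>gaussian D (alpha t \<cdot>\<^sub>v x) (hvar t))"

section \<open>Target distribution\<close>

text \<open>Law of \<open>A z + \<epsilon>\<close> with \<open>z\<close> of density \<open>pz\<close> and independent \<open>\<epsilon> \<sim> N(0, \<sigma>\<^sup>2 I\<^sub>D)\<close>.\<close>

definition target_law :: "nat \<Rightarrow> nat \<Rightarrow> rmat \<Rightarrow> (rvec \<Rightarrow> real) \<Rightarrow> real \<Rightarrow> rvec measure" where
  "target_law D d A pz \<sigma> =
     distr (density (lborel_vec d) (\<lambda>z. ennreal (pz z)) \<Otimes>\<^sub>M gaussian D (0\<^sub>v D) (\<sigma>\<^sup>2))
       (lborel_vec D) (\<lambda>(z, e). A *\<^sub>v z + e)"

definition htilde :: "real \<Rightarrow> real \<Rightarrow> real" where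
  "htilde \<sigma> t = (alpha t)\<^sup>2 * \<sigma>\<^sup>2 + hvar t"

definition ld_pdf :: "nat \<Rightarrow> (rvec \<Rightarrow> real) \<Rightarrow> real \<Rightarrow> real \<Rightarrow> rvec \<Rightarrow> real" where
  "ld_pdf d pz \<sigma> t y =
     (\<integral>z. gauss_pdf d (alpha t \<cdot>\<^sub>v z) (htilde \<sigma> t) y * pz z \<partial>lborel_vec d)"

definition ld_score :: "nat \<Rightarrow> (rvec \<Rightarrow> real) \<Rightarrow> real \<Rightarrow> vfield" where
  "ld_score d pz \<sigma> y t = grad d (\<lambda>y. ln (ld_pdf d pz \<sigma> t y)) y"

definition g_target :: "nat \<Rightarrow> (rvec \<Rightarrow> real) \<Rightarrow> real \<Rightarrow> vfield" where
  "g_target d pz \<sigma> y t = hvar t \<cdot>\<^sub>v ld_score d pz \<sigma> y t + y"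

definition f_star :: "nat \<Rightarrow> (rvec \<Rightarrow> real) \<Rightarrow> real \<Rightarrow> vfield" where
  "f_star d pz \<sigma> z t = htilde \<sigma> t \<cdot>\<^sub>v ld_score d pz \<sigma> z t + z"

definition latent_density :: "nat \<Rightarrow> (rvec \<Rightarrow> real) \<Rightarrow> bool" where
  "latent_density d pz \<longleftrightarrow> (\<forall>z\<in>carrier_vec d. 0 < pz z) \<and>
     times_cont_diff 2 d pz \<and> (\<integral>\<^sup>+z. ennreal (pz z) \<partial>lborel_vec d) = 1"

definition latent_tail :: "nat \<Rightarrow> (rvec \<Rightarrow> real) \<Rightarrow> real \<Rightarrow> real \<Rightarrow> real \<Rightarrow> bool" where
  "latent_tail d pz B C1 C2 \<longleftrightarrow> 0 < B \<and> 0 < C1 \<and> 0 < C2 \<and>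
     (\<forall>z\<in>carrier_vec d. B \<le> vnorm z \<longrightarrow>
        pz z \<le> (2 * pi) powr (- real d / 2) * C1 * exp (- C2 * (vnorm z)\<^sup>2 / 2))"

definition lipschitz_in_space :: "nat \<Rightarrow> real \<Rightarrow> real \<Rightarrow> vfield \<Rightarrow> bool" where
  "lipschitz_in_space d T c f \<longleftrightarrow> (\<forall>t\<in>{0..T}. \<forall>z1\<in>carrier_vec d. \<forall>z2\<in>carrier_vec d.
     vnorm (f z1 t - f z2 t) \<le> c * vnorm (z1 - z2))"

section \<open>ReLU networks\<close>

type_synonym net = "(rmat \<times> rvec) list"

fun net_eval :: "net \<Rightarrow> rvec \<Rightarrow> rvec" where
  "net_eval [] x = x"
| "net_eval [(W, b)] x = W *\<^sub>v x + b"
| "net_eval ((W, b) # l # ls) x = net_eval (l # ls) (map_vec (max 0) (W *\<^sub>v x + b))"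

text \<open>Input dimension \<open>n\<close>, output dimension \<open>m\<close>, at least one layer, hidden widths at most \<open>M\<close>.\<close>

fun net_shape :: "nat \<Rightarrow> nat \<Rightarrow> nat \<Rightarrow> net \<Rightarrow> bool" where
  "net_shape M n m [] \<longleftrightarrow> False"
| "net_shape M n m [(W, b)] \<longleftrightarrow> W \<in> carrier_mat m n \<and> b \<in> carrier_vec m"
| "net_shape M n m ((W, b) # l # ls) \<longleftrightarrow> dim_row W \<le> M \<and> dim_col W = n \<and>
     b \<in> carrier_vec (dim_row W) \<and> net_shape M (dim_row W) m (l # ls)"

definition mat_nnz :: "rmat \<Rightarrow> nat" where
  "mat_nnz W = card {(i, j). i < dim_row W \<and> j < dim_col W \<and> index_mat W (i, j) \<noteq> 0}"

definition vec_nnz :: "rvec \<Rightarrow> nat" where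
  "vec_nnz b = card {i. i < dim_vec b \<and> vec_index b i \<noteq> 0}"

text \<open>Here \<open>\<parallel>W\<parallel>\<^sub>\<infinity>\<close> is the largest magnitude of an entry.\<close>

definition weights_bounded :: "real \<Rightarrow> net \<Rightarrow> bool" where
  "weights_bounded \<kappa> ls \<longleftrightarrow> (\<forall>(W, b)\<in>set ls.
     (\<forall>i<dim_row W. \<forall>j<dim_col W. \<bar>index_mat W (i, j)\<bar> \<le> \<kappa>) \<and>
     (\<forall>i<dim_vec b. \<bar>vec_index b i\<bar> \<le> \<kappa>))"

definition relu_class ::
  "nat \<Rightarrow> real \<Rightarrow> nat \<Rightarrow> nat \<Rightarrow> nat \<Rightarrow> real \<Rightarrow> real \<Rightarrow> real \<Rightarrow> real \<Rightarrow> vfield set" where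
  "relu_class d T L M J K \<kappa> \<gamma> \<gamma>t = {f.
     (\<exists>ls. length ls = L \<and> net_shape M (d + 1) d ls \<and> weights_bounded \<kappa> ls \<and>
        (\<Sum>(W, b)\<leftarrow>ls. mat_nnz W + vec_nnz b) \<le> J \<and>
        f = (\<lambda>z t. net_eval ls (z @\<^sub>v vec_of_list [t]))) \<and>
     (\<forall>z\<in>carrier_vec d. \<forall>t\<in>{0..T}. vnorm (f z t) \<le> K) \<and>
     lipschitz_in_space d T \<gamma> f \<and>
     (\<forall>z\<in>carrier_vec d. \<forall>t1\<in>{0..T}. \<forall>t2\<in>{0..T}.
        vnorm (f z t1 - f z t2) \<le> \<gamma>t * \<bar>t1 - t2\<bar>)}"

section \<open>Frozen-subspace estimator and comparator\<close>

definition frozen_score :: "rmat \<Rightarrow> vfield \<Rightarrow> vfield" where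
  "frozen_score V f x t =
     (1 / hvar t) \<cdot>\<^sub>v (V *\<^sub>v f (transpose_mat V *\<^sub>v x) t) - (1 / hvar t) \<cdot>\<^sub>v x"

definition frozen_class :: "rmat \<Rightarrow> vfield set \<Rightarrow> vfield set" where
  "frozen_class V F = frozen_score V ` F"

definition empirical_loss ::
  "nat \<Rightarrow> real \<Rightarrow> real \<Rightarrow> nat \<Rightarrow> (nat \<Rightarrow> rvec) \<Rightarrow> vfield \<Rightarrow> ennreal" where
  "empirical_loss D t0 T N X s = ennreal (1 / real N) * (\<Sum>i<N. denoising_loss D t0 T (X i) s)"

definition empirical_minimizers ::
  "nat \<Rightarrow> real \<Rightarrow> real \<Rightarrow> nat \<Rightarrow> (nat \<Rightarrow> rvec) \<Rightarrow> vfield set \<Rightarrow> vfield set" where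
  "empirical_minimizers D t0 T N X S =
     {s \<in> S. \<forall>s'\<in>S. empirical_loss D t0 T N X s \<le> empirical_loss D t0 T N X s'}"

definition f_comp :: "nat \<Rightarrow> (rvec \<Rightarrow> real) \<Rightarrow> real \<Rightarrow> rmat \<Rightarrow> rmat \<Rightarrow> vfield" where
  "f_comp d2 pz \<sigma> A V z t =
     (transpose_mat V * A) *\<^sub>v g_target d2 pz \<sigma> (pinv (transpose_mat V * A) *\<^sub>v z) t"

definition comp_risk ::
  "nat \<Rightarrow> nat \<Rightarrow> real \<Rightarrow> real \<Rightarrow> (rvec \<Rightarrow> real) \<Rightarrow> real \<Rightarrow> rmat \<Rightarrow> rmat \<Rightarrow> ennreal" where
  "comp_risk D d2 t0 T pz \<sigma> A V =
     score_risk D t0 T (target_law D d2 A pz \<sigma>) (frozen_score V (f_comp d2 pz \<sigma> A V))"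

definition comp_approx_error ::
  "nat \<Rightarrow> nat \<Rightarrow> real \<Rightarrow> real \<Rightarrow> (rvec \<Rightarrow> real) \<Rightarrow> real \<Rightarrow> rmat \<Rightarrow> rmat \<Rightarrow> vfield \<Rightarrow> ennreal" where
  "comp_approx_error D d2 t0 T pz \<sigma> A V f = time_avg t0 T
     (\<lambda>t. ennreal (1 / (hvar t)\<^sup>2) *
        (\<integral>\<^sup>+x. ennreal ((vnorm (f (transpose_mat V *\<^sub>v x) t
                              - f_comp d2 pz \<sigma> A V (transpose_mat V *\<^sub>v x) t))\<^sup>2)
          \<partial>marginal_law D (target_law D d2 A pz \<sigma>) t))"

section \<open>Truncation and covering numbers\<close>

definition latent_radius :: "real \<Rightarrow> nat \<Rightarrow> real \<Rightarrow> nat \<Rightarrow> real \<Rightarrow> real" where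
  "latent_radius Cz d2 \<sigma> N \<delta> = Cz * (1 + \<sigma>) * (sqrt (real d2) + sqrt (ln (8 * real N / \<delta>)))"

definition perp_radius :: "real \<Rightarrow> nat \<Rightarrow> nat \<Rightarrow> real \<Rightarrow> nat \<Rightarrow> real \<Rightarrow> real" where
  "perp_radius Cp D d2 \<sigma> N \<delta> = Cp * \<sigma> * (sqrt (real D - real d2) + sqrt (ln (8 * real N / \<delta>)))"

definition trunc_set :: "nat \<Rightarrow> rmat \<Rightarrow> real \<Rightarrow> real \<Rightarrow> rvec set" where
  "trunc_set D A Rz Rp = {x \<in> carrier_vec D. vnorm (transpose_mat A *\<^sub>v x) \<le> Rz \<and>
     vnorm ((1\<^sub>m D - A * transpose_mat A) *\<^sub>v x) \<le> Rp}"

definition truncated_losses ::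
  "nat \<Rightarrow> real \<Rightarrow> real \<Rightarrow> rvec set \<Rightarrow> vfield set \<Rightarrow> (rvec \<Rightarrow> real) set" where
  "truncated_losses D t0 T U S =
     (\<lambda>s x. enn2real (denoising_loss D t0 T x s) * indicat_real U x) ` S"

definition sup_dist :: "'a set \<Rightarrow> ('a \<Rightarrow> real) \<Rightarrow> ('a \<Rightarrow> real) \<Rightarrow> ennreal" where
  "sup_dist X f g = (SUP x\<in>X. ennreal \<bar>f x - g x\<bar>)"

text \<open>Closed balls with centres in the class itself; \<open>\<infinity>\<close> if there is no finite net.\<close>

definition covering_number :: "real \<Rightarrow> 'f set \<Rightarrow> ('f \<Rightarrow> 'f \<Rightarrow> ennreal) \<Rightarrow> enat" where
  "covering_number \<iota> F d =
     Inf {enat (card G) | G. finite G \<and> G \<subseteq> F \<and> (\<forall>f\<in>F. \<exists>g\<in>G. d f g \<le> ennreal \<iota>)}"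

definition log_enat :: "enat \<Rightarrow> ennreal" where
  "log_enat n = (case n of enat m \<Rightarrow> ennreal (ln (real m)) | \<infinity> \<Rightarrow> \<infinity>)"

text \<open>
  The factor hidden by \<open>\<O>~\<close>: a power of one plus the absolute logarithms of the
  listed quantities.
\<close>

definition polylog :: "nat \<Rightarrow> real list \<Rightarrow> real" where
  "polylog k qs = (1 + (\<Sum>q\<leftarrow>qs. \<bar>ln q\<bar>)) ^ k"

end

theory Submission
  imports Defs
begin

text \<open>
  With \<open>a = \<alpha>(t) x\<close>, the denoising loss of a frozen score is the squared error of predicting \<open>a\<close> from \<open>X\<^sub>t\<close> by
  \<open>F = V f(V\<^sup>T X\<^sub>t, t)\<close>, and by Tweedie's formula the score risk is the squared distance of \<open>F\<close> to the
  posterior mean of \<open>a\<close>, both integrated over \<open>(t, y)\<close> against the kernel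
  \<open>k(x; t, y) = \<phi>\<^sub>t(y | x) / ((T - t\<^sub>0) h(t)\<^sup>2)\<close>. The excess loss is taken relative to the posterior mean \<open>m\<close> for the
  target law conditioned on the truncation set \<open>U\<close>: it equals \<open>W(x) + 2 Y(x)\<close> with \<open>W = \<integral> k |m - F|\<^sup>2\<close> and
  \<open>Y = \<integral> k \<langle>m - F, a - m\<rangle>\<close>, where \<open>Y\<close> has mean zero on \<open>U\<close>. Its deviation from its mean \<open>r\<close> on \<open>U\<close> is at most \<open>b\<close> and
  has second moment at most \<open>b r\<close>, so Bernstein's inequality and a union bound over a net give a fast rate with a
  multiplicative constant.

  The bound \<open>b = O((K\<^sup>2 + R\<^sup>2) log\<^sup>2 R / (t\<^sub>0 (T - t\<^sub>0)))\<close> must be uniform in \<open>T\<close>, although \<open>\<integral> dt / h(t)\<^sup>2\<close> grows linearly in \<open>T\<close>: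
  at large times \<open>X\<^sub>t\<close> forgets \<open>x\<close>, so the fluctuation of \<open>W\<close> is controlled by the total variation distance between
  \<open>N(\<alpha> x, h I)\<close> and \<open>N(\<alpha> x', h I)\<close>, which is at most \<open>\<alpha> |x - x'| / \<surd>h\<close>, and
  \<open>h\<^sup>-\<^sup>2 min(2, \<alpha> R / \<surd>h) = O(log\<^sup>2 R / t\<^sup>2)\<close>. Restricting to \<open>U\<close> costs only the mass and second moment outside \<open>U\<close>,
  which Gaussian exponential moments bound by \<open>\<delta> / (16 N)\<close>.
\<close>

section \<open>Exponential concentration\<close>

text \<open>The posterior mean for the conditioned law is the right centre for two reasons: as an
  average of signals from U it is bounded, and it makes Y centred on U exactly, so Bernstein's
  inequality meets no bias term. Jensen's inequality pays for exchanging it with the true posterior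
  mean, in both directions, at the cost of constant factors. The second moment is controlled by the
  mean because W is nonnegative and within O(B) of r, so that (W - r)^2 is at most O(B) (W + r), and
  because Cauchy-Schwarz gives Y^2 \<le> O(B) W. The loss itself is not of size B: K^2 integrated
  against k does not decay with T. Only a difference of two kernels, or a kernel times the signal,
  is ever bounded by B; this is why W is compared between two points and why the cross term must
  keep a factor |a - m|. The concentration bound carries no 1/\<epsilon>^2; that factor is
  introduced at the very end from \<epsilon> \<le> \<epsilon>max. The hidden logarithms reduce to
  \<Lambda>^2, where \<Lambda> bounds the logarithm of the truncation radius.\<close>

lemma exp_le_quadratic:
  fixes x :: real
  assumes "x \<le> 1"
  shows "exp x \<le> 1 + x + x\<^sup>2"
proof (cases "0 \<le> x")
  case True
  then show ?thesis using assms by (simp add: exp_bound)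
next
  case False
  define y where "y = - x"
  have y: "0 < y" using False by (simp add: y_def)
  have "1 + y + y\<^sup>2 / 2 \<le> exp y"
    using exp_lower_Taylor_quadratic[of y] y by simp
  \<comment> \<open>\<open>exp y\<close> is bounded below by its quadratic Taylor polynomial, so
    this product inequality bounds \<open>exp (- y)\<close> from above.\<close>
  moreover have "1 \<le> (1 - y + y\<^sup>2) * (1 + y + y\<^sup>2 / 2)"
  proof -
    have "(1 - y + y\<^sup>2) * (1 + y + y\<^sup>2 / 2) = 1 + y\<^sup>2 / 2 + y ^ 3 / 2 + y ^ 4 / 2"
      by (simp add: power2_eq_square power3_eq_cube power4_eq_xxxx field_simps)
    then show ?thesis using y by simp
  qed
  moreover have "0 \<le> 1 - y + y\<^sup>2"
  proof -
    have "1 - y + y\<^sup>2 = (y - 1 / 2)\<^sup>2 + 3 / 4" by (simp add: power2_eq_square algebra_simps)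
    then show ?thesis by simp
  qed
  ultimately have "1 \<le> (1 - y + y\<^sup>2) * exp y"
    by (meson mult_left_mono order_trans)
  then have "exp (- y) \<le> 1 - y + y\<^sup>2"
    by (simp add: exp_minus field_simps)
  then show ?thesis by (simp add: y_def)
qed

text \<open>As \<open>c * Z\<close> never exceeds 1, \<open>exp_le_quadratic\<close> applies
  pointwise; the linear term integrates to zero, and \<open>1 + y \<le> exp y\<close> turns the
  second moment into an exponent.\<close>

lemma (in prob_space) nn_integral_exp_le_bernstein:
  fixes Z :: "'a \<Rightarrow> real"
  assumes [measurable]: "Z \<in> borel_measurable M"
    and bnd: "\<And>x. x \<in> space M \<Longrightarrow> \<bar>Z x\<bar> \<le> b"
    and "(\<integral>x. Z x \<partial>M) = 0" and var: "(\<integral>x. (Z x)\<^sup>2 \<partial>M) \<le> v"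
    and "0 \<le> c" "c * b \<le> 1"
  shows "(\<integral>\<^sup>+x. ennreal (exp (c * Z x)) \<partial>M) \<le> ennreal (exp (c\<^sup>2 * v))"
proof -
  have le: "\<bar>c * Z x\<bar> \<le> 1" if "x \<in> space M" for x
    using mult_left_mono[OF bnd[OF that] \<open>0 \<le> c\<close>] assms by (auto simp: abs_mult)
  have iZ: "integrable M Z"
    by (rule integrable_const_bound[where B = b]) (use bnd in auto)
  have iZ2: "integrable M (\<lambda>x. (Z x)\<^sup>2)"
  proof (rule integrable_const_bound[where B = "b\<^sup>2"])
    show "AE x in M. norm ((Z x)\<^sup>2) \<le> b\<^sup>2"
    proof (rule AE_I2)
      fix x assume "x \<in> space M"
      from power_mono[OF bnd[OF this], of 2] show "norm ((Z x)\<^sup>2) \<le> b\<^sup>2" by simp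
    qed
  qed simp
  have "(\<integral>\<^sup>+x. ennreal (exp (c * Z x)) \<partial>M) \<le> (\<integral>\<^sup>+x. ennreal (1 + c * Z x + c\<^sup>2 * (Z x)\<^sup>2) \<partial>M)"
  proof (intro nn_integral_mono ennreal_leI)
    fix x assume "x \<in> space M"
    from le[OF this] have "c * Z x \<le> 1" by simp
    from exp_le_quadratic[OF this] show "exp (c * Z x) \<le> 1 + c * Z x + c\<^sup>2 * (Z x)\<^sup>2"
      by (simp add: power_mult_distrib)
  qed
  also have "\<dots> = ennreal (\<integral>x. 1 + c * Z x + c\<^sup>2 * (Z x)\<^sup>2 \<partial>M)"
  proof (rule nn_integral_eq_integral)
    show "integrable M (\<lambda>x. 1 + c * Z x + c\<^sup>2 * (Z x)\<^sup>2)" using iZ iZ2 by simp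
    show "AE x in M. 0 \<le> 1 + c * Z x + c\<^sup>2 * (Z x)\<^sup>2"
    proof (rule AE_I2)
      fix x assume "x \<in> space M"
      from le[OF this] have "0 \<le> 1 + c * Z x" by (simp add: abs_le_iff)
      then show "0 \<le> 1 + c * Z x + c\<^sup>2 * (Z x)\<^sup>2" by simp
    qed
  qed
  also have "(\<integral>x. 1 + c * Z x + c\<^sup>2 * (Z x)\<^sup>2 \<partial>M) = 1 + c\<^sup>2 * (\<integral>x. (Z x)\<^sup>2 \<partial>M)"
    using iZ iZ2 assms by (simp add: prob_space)
  also have "\<dots> \<le> 1 + c\<^sup>2 * v" using var by (simp add: mult_left_mono)
  also have "\<dots> \<le> exp (c\<^sup>2 * v)" by simp
  finally show ?thesis by (simp add: ennreal_leI)
qed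

text \<open>Markov's inequality for the exponential of the sum, which independence factorises into
  moments that are each at most 1. Centring and scaling are left to the choice of
  \<open>Y\<close>.\<close>

lemma (in prob_space) chernoff_iid:
  fixes Y :: "'a \<Rightarrow> real" and N :: nat
  assumes [measurable]: "Y \<in> borel_measurable M"
    and "(\<integral>\<^sup>+x. ennreal (exp (Y x)) \<partial>M) \<le> 1"
  shows "emeasure (\<Pi>\<^sub>M i\<in>{..<N}. M) {X \<in> space (\<Pi>\<^sub>M i\<in>{..<N}. M). u \<le> (\<Sum>i<N. Y (X i))}
    \<le> ennreal (exp (- u))"
proof -
  interpret product_prob_space "\<lambda>_. M" "{..<N}" ..
  let ?P = "\<Pi>\<^sub>M i\<in>{..<N}. M"
  have "emeasure ?P {X \<in> space ?P. u \<le> (\<Sum>i<N. Y (X i))} =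
    emeasure ?P ({X \<in> space ?P. 1 \<le> ennreal (exp (- u)) * ennreal (exp (\<Sum>i<N. Y (X i)))})"
    by (intro arg_cong[where f = "emeasure ?P"] Collect_cong)
      (auto simp: ennreal_mult[symmetric] exp_add[symmetric] simp flip: ennreal_1)
  also have "\<dots> \<le> ennreal (exp (- u)) * (\<integral>\<^sup>+X. ennreal (exp (\<Sum>i<N. Y (X i))) * indicator (space ?P) X \<partial>?P)"
    by (rule nn_integral_Markov_inequality[where A = "space ?P" and u = "\<lambda>X. ennreal (exp (\<Sum>i<N. Y (X i)))", THEN order_trans]) auto
  also have "(\<integral>\<^sup>+X. ennreal (exp (\<Sum>i<N. Y (X i))) * indicator (space ?P) X \<partial>?P)
     = (\<integral>\<^sup>+X. (\<Prod>i<N. ennreal (exp (Y (X i)))) \<partial>?P)"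
  proof (rule nn_integral_cong)
    fix X assume X: "X \<in> space ?P"
    have "(\<Prod>i<N. ennreal (exp (Y (X i)))) = ennreal (\<Prod>i<N. exp (Y (X i)))"
      by (rule prod_ennreal) simp
    also have "\<dots> = ennreal (exp (\<Sum>i<N. Y (X i)))"
      by (subst exp_sum) auto
    finally show "ennreal (exp (\<Sum>i<N. Y (X i))) * indicator (space ?P) X = (\<Prod>i<N. ennreal (exp (Y (X i))))"
      using X by simp
  qed
  also have "\<dots> = (\<Prod>i<N. (\<integral>\<^sup>+x. ennreal (exp (Y x)) \<partial>M))"
    by (rule product_nn_integral_prod) auto
  also have "\<dots> \<le> 1"
    using assms(2) by (intro prod_le_1) auto
  finally show ?thesis by (simp add: mult_left_mono)
qed

text \<open>The choice \<open>c = 1 / (2 * b)\<close> makes the variance term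
  \<open>r / (4 * b)\<close>, which after division by \<open>c\<close> becomes
  \<open>N * r / 2\<close>. Since the second moment is at most \<open>b\<close> times
  \<open>r\<close>, later the mean excess, no square root of \<open>u / N\<close> appears, and the
  leftover half of the mean can be absorbed by the caller: this is the source of the fast rate.
  \<open>Z\<close> is truncated by the indicator of \<open>U\<close>, so the conclusion concerns
  samples inside \<open>U\<close>.\<close>

lemma (in prob_space) bernstein_event:
  fixes Z :: "'a \<Rightarrow> real" and N :: nat
  assumes [measurable]: "Z \<in> borel_measurable M" "U \<in> sets M"
    and bnd: "\<And>x. x \<in> U \<Longrightarrow> \<bar>Z x\<bar> \<le> b" and "0 < b"
    and mean: "(\<integral>x. indicat_real U x * Z x \<partial>M) = 0"
    and var: "(\<integral>x. indicat_real U x * (Z x)\<^sup>2 \<partial>M) \<le> b * r"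
  obtains E where "E \<in> sets (\<Pi>\<^sub>M i\<in>{..<N}. M)"
    "emeasure (\<Pi>\<^sub>M i\<in>{..<N}. M) (space (\<Pi>\<^sub>M i\<in>{..<N}. M) - E) \<le> ennreal (exp (- u))"
    "\<And>X. X \<in> E \<Longrightarrow> (\<And>i. i < N \<Longrightarrow> X i \<in> U) \<Longrightarrow> (\<Sum>i<N. Z (X i)) \<le> 2 * b * u + real N * r / 2"
proof -
  let ?P = "\<Pi>\<^sub>M i\<in>{..<N}. M"
  define c where "c = 1 / (2 * b)"
  \<comment> \<open>The subtracted constant is exactly the Bernstein exponent, so
    \<open>exp (Y x)\<close> has mean at most 1.\<close>
  define Y where "Y x = c * (indicat_real U x * Z x) - r / (4 * b)" for x
  have [measurable]: "Y \<in> borel_measurable M" unfolding Y_def by measurable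
  have "(\<integral>\<^sup>+x. ennreal (exp (c * (indicat_real U x * Z x))) \<partial>M) \<le> ennreal (exp (c\<^sup>2 * (b * r)))"
  proof (rule nn_integral_exp_le_bernstein[where b = b])
    show "\<bar>indicat_real U x * Z x\<bar> \<le> b" for x
      using bnd[of x] \<open>0 < b\<close> by (auto simp: indicator_def)
    have "(\<integral>x. (indicat_real U x * Z x)\<^sup>2 \<partial>M) = (\<integral>x. indicat_real U x * (Z x)\<^sup>2 \<partial>M)"
      by (intro Bochner_Integration.integral_cong) (auto simp: indicator_def)
    then show "(\<integral>x. (indicat_real U x * Z x)\<^sup>2 \<partial>M) \<le> b * r" using var by simp
    show "0 \<le> c" "c * b \<le> 1" using \<open>0 < b\<close> by (auto simp: c_def)
  qed (use mean in auto)
  moreover have "c\<^sup>2 * (b * r) = r / (4 * b)"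
    using \<open>0 < b\<close> by (simp add: c_def power2_eq_square)
  ultimately have *: "(\<integral>\<^sup>+x. ennreal (exp (c * (indicat_real U x * Z x))) \<partial>M) \<le> ennreal (exp (r / (4 * b)))"
    by simp
  have "(\<integral>\<^sup>+x. ennreal (exp (Y x)) \<partial>M) =
     (\<integral>\<^sup>+x. ennreal (exp (c * (indicat_real U x * Z x))) * ennreal (exp (- (r / (4 * b)))) \<partial>M)"
    by (intro nn_integral_cong) (simp add: Y_def ennreal_mult[symmetric] exp_add[symmetric])
  also have "\<dots> \<le> ennreal (exp (r / (4 * b))) * ennreal (exp (- (r / (4 * b))))"
    using * by (simp add: nn_integral_multc mult_right_mono)
  also have "\<dots> = 1" by (simp add: ennreal_mult[symmetric] exp_add[symmetric])
  finally have 1: "(\<integral>\<^sup>+x. ennreal (exp (Y x)) \<partial>M) \<le> 1" .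
  let ?E = "{X \<in> space ?P. (\<Sum>i<N. Y (X i)) < u}"
  show ?thesis
  proof (rule that[of ?E])
    show "?E \<in> sets ?P" by measurable
    have "space ?P - ?E = {X \<in> space ?P. u \<le> (\<Sum>i<N. Y (X i))}" by auto
    then show "emeasure ?P (space ?P - ?E) \<le> ennreal (exp (- u))"
      using chernoff_iid[OF _ 1] by simp
    fix X assume X: "X \<in> ?E" and XU: "\<And>i. i < N \<Longrightarrow> X i \<in> U"
    have "(\<Sum>i<N. Y (X i)) = c * (\<Sum>i<N. Z (X i)) - real N * (r / (4 * b))"
      using XU by (simp add: Y_def sum_subtractf sum_distrib_left)
    then have "c * (\<Sum>i<N. Z (X i)) \<le> u + real N * (r / (4 * b))" using X by simp
    then show "(\<Sum>i<N. Z (X i)) \<le> 2 * b * u + real N * r / 2"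
      using \<open>0 < b\<close> by (simp add: c_def field_simps)
  qed
qed

section \<open>Excess loss for a noisy channel\<close>

lemma weighted_mean_square_le:
  fixes k b :: "'x \<Rightarrow> real"
  assumes k: "integrable M k" and kb: "integrable M (\<lambda>x. k x * b x)"
    and kbb: "integrable M (\<lambda>x. k x * (b x)\<^sup>2)"
    and nonneg: "\<And>x. x \<in> space M \<Longrightarrow> 0 \<le> k x" and pos: "0 < (\<integral>x. k x \<partial>M)"
  shows "(\<integral>x. k x * b x \<partial>M)\<^sup>2 / (\<integral>x. k x \<partial>M) \<le> (\<integral>x. k x * (b x)\<^sup>2 \<partial>M)"
proof -
  define p where "p = (\<integral>x. k x \<partial>M)"
  define q where "q = (\<integral>x. k x * b x \<partial>M)"
  define c where "c = q / p"
  have "0 \<le> (\<integral>x. k x * (b x - c)\<^sup>2 \<partial>M)"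
    using nonneg by (intro Bochner_Integration.integral_nonneg) auto
  also have "(\<lambda>x. k x * (b x - c)\<^sup>2) = (\<lambda>x. k x * (b x)\<^sup>2 - 2 * c * (k x * b x) + c\<^sup>2 * k x)"
    by (auto simp: power2_eq_square algebra_simps)
  also have "(\<integral>x. k x * (b x)\<^sup>2 - 2 * c * (k x * b x) + c\<^sup>2 * k x \<partial>M) =
     (\<integral>x. k x * (b x)\<^sup>2 \<partial>M) - 2 * c * q + c\<^sup>2 * p"
    using k kb kbb by (simp add: p_def q_def)
  finally have "0 \<le> (\<integral>x. k x * (b x)\<^sup>2 \<partial>M) - 2 * c * q + c\<^sup>2 * p" .
  moreover have "2 * c * q - c\<^sup>2 * p = q\<^sup>2 / p"
    using pos by (simp add: c_def p_def[symmetric] power2_eq_square)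
  ultimately have "q\<^sup>2 / p \<le> (\<integral>x. k x * (b x)\<^sup>2 \<partial>M)" by linarith
  then show ?thesis by (simp add: p_def q_def)
qed

lemma abs_sum_mult_le_sqrt:
  fixes f g :: "'i \<Rightarrow> real"
  assumes "(\<Sum>i\<in>I. (f i)\<^sup>2) \<le> p\<^sup>2" "(\<Sum>i\<in>I. (g i)\<^sup>2) \<le> q\<^sup>2" "0 \<le> p" "0 \<le> q"
  shows "\<bar>\<Sum>i\<in>I. f i * g i\<bar> \<le> p * q"
proof -
  have "(\<Sum>i\<in>I. f i * g i)\<^sup>2 \<le> (\<Sum>i\<in>I. (f i)\<^sup>2) * (\<Sum>i\<in>I. (g i)\<^sup>2)"
    by (rule Cauchy_Schwarz_ineq_sum)
  also have "\<dots> \<le> p\<^sup>2 * q\<^sup>2"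
    using assms by (intro mult_mono) (auto intro: sum_nonneg)
  finally have "(\<Sum>i\<in>I. f i * g i)\<^sup>2 \<le> (p * q)\<^sup>2" by (simp add: power_mult_distrib)
  then show ?thesis using assms by (simp add: abs_le_square_iff[symmetric] abs_mult)
qed

lemma sum_square_diff_le:
  fixes f g :: "'i \<Rightarrow> real"
  shows "(\<Sum>i\<in>I. (f i - g i)\<^sup>2) \<le> 2 * (\<Sum>i\<in>I. (f i)\<^sup>2) + 2 * (\<Sum>i\<in>I. (g i)\<^sup>2)"
proof -
  have "(f i - g i)\<^sup>2 \<le> 2 * (f i)\<^sup>2 + 2 * (g i)\<^sup>2" for i
    using zero_le_power2[of "f i + g i"] by (simp add: power2_eq_square algebra_simps)
  then have "(\<Sum>i\<in>I. (f i - g i)\<^sup>2) \<le> (\<Sum>i\<in>I. 2 * (f i)\<^sup>2 + 2 * (g i)\<^sup>2)" by (rule sum_mono)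
  then show ?thesis by (simp add: sum.distrib sum_distrib_left)
qed

text \<open>Integrating \<open>k\<close> times the squared norm of \<open>s * u + t * v\<close>
  gives a nonnegative quadratic form in \<open>s\<close> and \<open>t\<close>; the claim is its
  discriminant condition.\<close>

lemma integral_mult_square_le:
  fixes u v :: "'w \<Rightarrow> 'i \<Rightarrow> real" and k :: "'w \<Rightarrow> real"
  assumes uu: "integrable M (\<lambda>w. k w * (\<Sum>i\<in>I. (u w i)\<^sup>2))"
    and vv: "integrable M (\<lambda>w. k w * (\<Sum>i\<in>I. (v w i)\<^sup>2))"
    and uv: "integrable M (\<lambda>w. k w * (\<Sum>i\<in>I. u w i * v w i))"
    and nonneg: "\<And>w. w \<in> space M \<Longrightarrow> 0 \<le> k w"
  shows "(\<integral>w. k w * (\<Sum>i\<in>I. u w i * v w i) \<partial>M)\<^sup>2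
     \<le> (\<integral>w. k w * (\<Sum>i\<in>I. (u w i)\<^sup>2) \<partial>M) * (\<integral>w. k w * (\<Sum>i\<in>I. (v w i)\<^sup>2) \<partial>M)"
proof -
  define A B C where "A = (\<integral>w. k w * (\<Sum>i\<in>I. (u w i)\<^sup>2) \<partial>M)"
    and "B = (\<integral>w. k w * (\<Sum>i\<in>I. (v w i)\<^sup>2) \<partial>M)"
    and "C = (\<integral>w. k w * (\<Sum>i\<in>I. u w i * v w i) \<partial>M)"
  have A0: "0 \<le> A" and B0: "0 \<le> B" unfolding A_def B_def
    using nonneg by (auto intro!: Bochner_Integration.integral_nonneg mult_nonneg_nonneg sum_nonneg)
  have *: "0 \<le> A * s\<^sup>2 + 2 * s * t * C + t\<^sup>2 * B" for s t :: real
  proof -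
    have "0 \<le> (\<integral>w. k w * (\<Sum>i\<in>I. (s * u w i + t * v w i)\<^sup>2) \<partial>M)"
      using nonneg by (intro Bochner_Integration.integral_nonneg mult_nonneg_nonneg sum_nonneg) auto
    also have "(\<lambda>w. k w * (\<Sum>i\<in>I. (s * u w i + t * v w i)\<^sup>2)) =
       (\<lambda>w. s\<^sup>2 * (k w * (\<Sum>i\<in>I. (u w i)\<^sup>2)) + 2 * s * t * (k w * (\<Sum>i\<in>I. u w i * v w i))
            + t\<^sup>2 * (k w * (\<Sum>i\<in>I. (v w i)\<^sup>2)))"
      by (auto simp: power2_eq_square algebra_simps sum.distrib sum_distrib_left)
    also have "(\<integral>w. \<dots> w \<partial>M) = s\<^sup>2 * A + 2 * s * t * C + t\<^sup>2 * B"
      using uu vv uv by (simp add: A_def B_def C_def)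
    finally show ?thesis by (simp add: algebra_simps)
  qed
  have "C\<^sup>2 \<le> A * B"
  proof (cases "B = 0")
    case True
    have "C = 0"
    proof (rule ccontr)
      assume "C \<noteq> 0"
      \<comment> \<open>With \<open>B = 0\<close> the form is linear in \<open>t\<close>, and this
        choice of \<open>t\<close> makes it equal to -1.\<close>
      have "A + 2 * (- (A + 1) / (2 * C)) * C \<ge> 0"
        using *[of 1 "- (A + 1) / (2 * C)"] True by simp
      then show False using \<open>C \<noteq> 0\<close> by (simp add: field_simps)
    qed
    then show ?thesis using True by simp
  next
    case False
    then have "0 < B" using B0 by simp
    have "0 \<le> A * B\<^sup>2 - 2 * B * C * C + C\<^sup>2 * B" using *[of B "- C"] by simp
    also have "\<dots> = B * (A * B - C\<^sup>2)" by (simp add: power2_eq_square algebra_simps)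
    finally show ?thesis using \<open>0 < B\<close> by (simp add: zero_le_mult_iff)
  qed
  then show ?thesis by (simp add: A_def B_def C_def)
qed

text \<open>The conditions on the channel are bounds on extended integrals; this is the passage to
  integrability and to real bounds.\<close>

lemma integrable_integral_le:
  fixes f :: "'w \<Rightarrow> real"
  assumes "f \<in> borel_measurable M" "\<And>w. w \<in> space M \<Longrightarrow> 0 \<le> f w"
    and "(\<integral>\<^sup>+w. ennreal (f w) \<partial>M) \<le> ennreal c" "0 \<le> c"
  shows "integrable M f" "(\<integral>w. f w \<partial>M) \<le> c"
proof -
  show "integrable M f"
    using assms by (intro integrableI_nonneg AE_I2) (auto simp: le_less_trans[OF _ ennreal_less_top])
  then have "ennreal (\<integral>w. f w \<partial>M) \<le> ennreal c"
    using assms nn_integral_eq_integral[of M f] by auto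
  then show "(\<integral>w. f w \<partial>M) \<le> c" using assms by simp
qed

text \<open>A point \<open>x\<close> is seen through \<open>w\<close> with the unnormalised density
  \<open>k x w\<close>, and the signal \<open>a i x w\<close> is to be predicted from
  \<open>w\<close>. \<open>\<rho>\<close> bounds the signal energy for points of \<open>U\<close>;
  \<open>\<theta>\<close> is a normalised squared size, at most 1 on \<open>U\<close>, that pays for
  points outside. Everything that enters a deviation shares the budget \<open>B\<close>, while
  \<open>\<kappa>\<close> bounds the total mass of \<open>k\<close> and secures integrability. In
  \<open>k_diff_bound\<close> one point is arbitrary and the other lies in \<open>U\<close>, so that
  an outlier can be compared with the average over \<open>U\<close>.\<close>

locale denoising_channel = prob_space P + mu: sigma_finite_measure \<mu>
  for P :: "'x measure" and \<mu> :: "'w measure" +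
  fixes k :: "'x \<Rightarrow> 'w \<Rightarrow> real" and a :: "nat \<Rightarrow> 'x \<Rightarrow> 'w \<Rightarrow> real" and D :: nat
    and U :: "'x set" and \<rho> :: "'w \<Rightarrow> real" and \<theta> :: "'x \<Rightarrow> real" and K B \<kappa> :: real
  assumes k_measurable [measurable]: "(\<lambda>(x, w). k x w) \<in> borel_measurable (P \<Otimes>\<^sub>M \<mu>)"
    and a_measurable [measurable]: "\<And>i. (\<lambda>(x, w). a i x w) \<in> borel_measurable (P \<Otimes>\<^sub>M \<mu>)"
    and k_pos: "\<And>x w. x \<in> space P \<Longrightarrow> w \<in> space \<mu> \<Longrightarrow> 0 < k x w"
    and U_sets [measurable]: "U \<in> sets P" and U_prob: "1 / 2 \<le> prob U"
    and k_integrable: "\<And>w. w \<in> space \<mu> \<Longrightarrow> integrable P (\<lambda>x. k x w)"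
    and ka_integrable: "\<And>w i. w \<in> space \<mu> \<Longrightarrow> integrable P (\<lambda>x. k x w * a i x w)"
    and kaa_integrable: "\<And>w i. w \<in> space \<mu> \<Longrightarrow> integrable P (\<lambda>x. k x w * (a i x w)\<^sup>2)"
    and \<rho>_measurable [measurable]: "\<rho> \<in> borel_measurable \<mu>"
    and \<rho>_nonneg: "\<And>w. w \<in> space \<mu> \<Longrightarrow> 0 \<le> \<rho> w"
    and a_bound: "\<And>x w. x \<in> U \<Longrightarrow> w \<in> space \<mu> \<Longrightarrow> (\<Sum>i<D. (a i x w)\<^sup>2) \<le> \<rho> w"
    and \<theta>_measurable [measurable]: "\<theta> \<in> borel_measurable P"
    and \<theta>_nonneg: "\<And>x. x \<in> space P \<Longrightarrow> 0 \<le> \<theta> x"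
    and \<theta>_le_1: "\<And>x. x \<in> U \<Longrightarrow> \<theta> x \<le> 1"
    and K_nonneg: "0 \<le> K" and B_pos: "0 < B" and \<kappa>_nonneg: "0 \<le> \<kappa>"
    and k_bound: "\<And>x. x \<in> space P \<Longrightarrow> (\<integral>\<^sup>+w. ennreal (k x w) \<partial>\<mu>) \<le> ennreal \<kappa>"
    and k\<rho>_bound: "\<And>x. x \<in> space P \<Longrightarrow> (\<integral>\<^sup>+w. ennreal (k x w * \<rho> w) \<partial>\<mu>) \<le> ennreal B"
    and kaa_bound: "\<And>x. x \<in> space P \<Longrightarrow>
      (\<integral>\<^sup>+w. ennreal (k x w * (\<Sum>i<D. (a i x w)\<^sup>2)) \<partial>\<mu>) \<le> ennreal (B * \<theta> x)"
    and k_diff_bound: "\<And>x x'. x \<in> space P \<Longrightarrow> x' \<in> U \<Longrightarrow>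
      (\<integral>\<^sup>+w. ennreal (\<bar>k x w - k x' w\<bar> * (K\<^sup>2 + \<rho> w)) \<partial>\<mu>) \<le> ennreal (B * (1 + \<theta> x))"
    and kK_bound: "\<And>x. x \<in> space P \<Longrightarrow>
      (\<integral>\<^sup>+w. ennreal (k x w * (K * sqrt (\<rho> w))) \<partial>\<mu>) \<le> ennreal B"
begin

lemma U_subset: "x \<in> U \<Longrightarrow> x \<in> space P"
  using sets.sets_into_space[OF U_sets] by auto

lemma k_nonneg: "x \<in> space P \<Longrightarrow> w \<in> space \<mu> \<Longrightarrow> 0 \<le> k x w"
  using k_pos by (simp add: less_imp_le)

lemma k_measurable_fst [measurable]: "w \<in> space \<mu> \<Longrightarrow> (\<lambda>x. k x w) \<in> borel_measurable P"
  and k_measurable_snd [measurable]: "x \<in> space P \<Longrightarrow> (\<lambda>w. k x w) \<in> borel_measurable \<mu>"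
  and a_measurable_fst [measurable]: "w \<in> space \<mu> \<Longrightarrow> (\<lambda>x. a i x w) \<in> borel_measurable P"
  and a_measurable_snd [measurable]: "x \<in> space P \<Longrightarrow> (\<lambda>w. a i x w) \<in> borel_measurable \<mu>"
  using k_measurable a_measurable[of i] by (auto dest: measurable_Pair1 measurable_Pair2)

text \<open>Not divided by \<open>prob S\<close>, which makes it additive in \<open>S\<close>. The
  normalisation would cancel in \<open>post_mean\<close> anyway, which is the posterior mean under
  the law conditioned on \<open>S\<close>.\<close>

definition evidence :: "'x set \<Rightarrow> 'w \<Rightarrow> real" where
  "evidence S w = (\<integral>x. indicat_real S x * k x w \<partial>P)"

definition post_mean :: "'x set \<Rightarrow> nat \<Rightarrow> 'w \<Rightarrow> real" where
  "post_mean S i w = (\<integral>x. indicat_real S x * (k x w * a i x w) \<partial>P) / evidence S w"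

definition tail_mass :: ennreal where
  "tail_mass = (\<integral>\<^sup>+x. ennreal (indicat_real (space P - U) x * (1 + \<theta> x)) \<partial>P)"

lemma evidence_measurable [measurable]:
  assumes [measurable]: "S \<in> sets P" shows "evidence S \<in> borel_measurable \<mu>"
  unfolding evidence_def[abs_def] by (intro borel_measurable_lebesgue_integral) measurable

lemma post_mean_measurable [measurable]:
  assumes [measurable]: "S \<in> sets P" shows "post_mean S i \<in> borel_measurable \<mu>"
  unfolding post_mean_def[abs_def]
  by (intro borel_measurable_divide evidence_measurable assms borel_measurable_lebesgue_integral) measurable


lemma evidence_pos:
  assumes [measurable]: "S \<in> sets P" and "0 < prob S" and w: "w \<in> space \<mu>"
  shows "0 < evidence S w"
proof -
  have int: "integrable P (\<lambda>x. indicat_real S x * k x w)"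
    using integrable_mult_indicator[OF assms(1) k_integrable[OF w]] by simp
  have "0 \<le> evidence S w"
    unfolding evidence_def using k_nonneg w
    by (intro Bochner_Integration.integral_nonneg) (auto simp: indicator_def)
  moreover have "evidence S w \<noteq> 0"
  proof
    assume "evidence S w = 0"
    then have "AE x in P. indicat_real S x * k x w = 0"
      unfolding evidence_def
      using integral_nonneg_eq_0_iff_AE[OF int] k_nonneg w
      by (auto simp: indicator_def)
    moreover have "AE x in P. 0 < k x w" using k_pos w by (intro AE_I2) auto
    ultimately have "AE x in P. x \<notin> S" by eventually_elim (auto simp: indicator_def split: if_splits)
    then have "prob S = 0" by (simp add: prob_eq_0)
    then show False using assms by simp
  qed
  ultimately show ?thesis by simp
qed

lemma U_prob_pos: "0 < prob U" using U_prob by linarith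

lemma indicator_integrable:
  assumes w: "w \<in> space \<mu>" and [measurable]: "S \<in> sets P"
  shows "integrable P (\<lambda>x. indicat_real S x * k x w)"
    and "\<And>i. integrable P (\<lambda>x. indicat_real S x * (k x w * a i x w))"
    and "\<And>i. integrable P (\<lambda>x. indicat_real S x * (k x w * (a i x w)\<^sup>2))"
  using integrable_mult_indicator[OF assms(2) k_integrable[OF w]]
    integrable_mult_indicator[OF assms(2) ka_integrable[OF w]]
    integrable_mult_indicator[OF assms(2) kaa_integrable[OF w]]
  by simp_all

text \<open>Jensen's inequality for the predictor that is the posterior mean given \<open>U\<close> on \<open>U\<close> and the signal
  itself outside \<open>U\<close>.\<close>

lemma evidence_post_mean_le:
  assumes w: "w \<in> space \<mu>"
  shows "evidence (space P) w * (c - post_mean (space P) i w)\<^sup>2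
    \<le> evidence U w * (c - post_mean U i w)\<^sup>2
      + (\<integral>x. indicat_real (space P - U) x * (k x w * (c - a i x w)\<^sup>2) \<partial>P)"
proof -
  note int = indicator_integrable[OF w]
  have [measurable]: "space P \<in> sets P" "space P - U \<in> sets P" by auto
  let ?m = "post_mean U i w"
  define b where "b x = (if x \<in> U then c - ?m else c - a i x w)" for x
  have p0: "0 < evidence (space P) w" and pU0: "0 < evidence U w"
    using evidence_pos[OF _ _ w] U_prob_pos by (auto simp: prob_space)
  have kp: "(\<integral>x. k x w \<partial>P) = evidence (space P) w"
    unfolding evidence_def by (intro Bochner_Integration.integral_cong) auto
  have kb_eq: "k x w * b x = c * k x w - ?m * (indicat_real U x * k x w)
      - indicat_real (space P - U) x * (k x w * a i x w)" if "x \<in> space P" for x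
    using that by (auto simp: b_def algebra_simps indicator_def)
  have kbb_eq: "k x w * (b x)\<^sup>2 = (c - ?m)\<^sup>2 * (indicat_real U x * k x w)
      + indicat_real (space P - U) x * (k x w * (c - a i x w)\<^sup>2)" if "x \<in> space P" for x
    using that by (auto simp: b_def algebra_simps indicator_def)
  have sq: "indicat_real (space P - U) x * (k x w * (c - a i x w)\<^sup>2) =
     c\<^sup>2 * (indicat_real (space P - U) x * k x w) - 2 * c * (indicat_real (space P - U) x * (k x w * a i x w))
     + indicat_real (space P - U) x * (k x w * (a i x w)\<^sup>2)" for x
    by (simp add: power2_eq_square algebra_simps)
  have int_sq: "integrable P (\<lambda>x. indicat_real (space P - U) x * (k x w * (c - a i x w)\<^sup>2))"
    unfolding sq using int[of "space P - U"] by simp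
  have int_b: "integrable P (\<lambda>x. k x w * b x)"
    using k_integrable[OF w] int[of U] int[of "space P - U"]
    by (subst Bochner_Integration.integrable_cong[OF refl kb_eq]) auto
  have int_bb: "integrable P (\<lambda>x. k x w * (b x)\<^sup>2)"
    using int[of U] int_sq by (subst Bochner_Integration.integrable_cong[OF refl kbb_eq]) auto
  have "(\<integral>x. indicat_real U x * (k x w * a i x w) \<partial>P) = ?m * evidence U w"
    using pU0 by (simp add: post_mean_def)
  moreover have "(\<integral>x. indicat_real (space P) x * (k x w * a i x w) \<partial>P)
      = post_mean (space P) i w * evidence (space P) w"
    using p0 by (simp add: post_mean_def)
  moreover have "(\<integral>x. indicat_real (space P) x * (k x w * a i x w) \<partial>P) =
     (\<integral>x. indicat_real U x * (k x w * a i x w) + indicat_real (space P - U) x * (k x w * a i x w) \<partial>P)"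
    using U_subset by (intro Bochner_Integration.integral_cong) (auto simp: indicator_def)
  moreover have "\<dots> = (\<integral>x. indicat_real U x * (k x w * a i x w) \<partial>P)
      + (\<integral>x. indicat_real (space P - U) x * (k x w * a i x w) \<partial>P)"
    using int[of U] int[of "space P - U"] by simp
  moreover have "(\<integral>x. k x w * b x \<partial>P) = c * evidence (space P) w - ?m * evidence U w
     - (\<integral>x. indicat_real (space P - U) x * (k x w * a i x w) \<partial>P)"
    using k_integrable[OF w] int[of U] int[of "space P - U"]
    by (subst Bochner_Integration.integral_cong[OF refl kb_eq]) (auto simp: kp, simp add: evidence_def)
  ultimately have kb: "(\<integral>x. k x w * b x \<partial>P) = evidence (space P) w * (c - post_mean (space P) i w)"
    by (simp add: algebra_simps)
  have kbb: "(\<integral>x. k x w * (b x)\<^sup>2 \<partial>P) = evidence U w * (c - ?m)\<^sup>2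
      + (\<integral>x. indicat_real (space P - U) x * (k x w * (c - a i x w)\<^sup>2) \<partial>P)"
    using int[of U] int_sq
    by (subst Bochner_Integration.integral_cong[OF refl kbb_eq]) (auto simp: evidence_def)
  from weighted_mean_square_le[OF k_integrable[OF w] int_b int_bb]
  have "(\<integral>x. k x w * b x \<partial>P)\<^sup>2 / evidence (space P) w \<le> (\<integral>x. k x w * (b x)\<^sup>2 \<partial>P)"
    using k_nonneg w p0 by (simp add: kp)
  then show ?thesis
    unfolding kb kbb using p0 by (simp add: power_mult_distrib power2_eq_square[of "evidence (space P) w"])
qed

text \<open>Jensen's inequality in each coordinate, with posterior weights supported on
  \<open>U\<close>, where the signal energy is below \<open>\<rho>\<close>. For the posterior mean
  under the full law no such bound is available.\<close>

lemma post_mean_U_bound: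
  assumes w: "w \<in> space \<mu>"
  shows "(\<Sum>i<D. (post_mean U i w)\<^sup>2) \<le> \<rho> w"
proof -
  note int = indicator_integrable[OF w U_sets]
  have pU0: "0 < evidence U w" using evidence_pos[OF U_sets U_prob_pos w] .
  have "evidence U w * (post_mean U i w)\<^sup>2 \<le> (\<integral>x. indicat_real U x * (k x w * (a i x w)\<^sup>2) \<partial>P)" for i
  proof -
    have "(\<integral>x. (indicat_real U x * k x w) * a i x w \<partial>P)\<^sup>2 / (\<integral>x. indicat_real U x * k x w \<partial>P)
      \<le> (\<integral>x. (indicat_real U x * k x w) * (a i x w)\<^sup>2 \<partial>P)"
      using int pU0 k_nonneg w by (intro weighted_mean_square_le) (auto simp: mult.assoc evidence_def)
    then show ?thesis
      using pU0 by (simp add: post_mean_def evidence_def mult.assoc power2_eq_square)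
  qed
  then have "evidence U w * (\<Sum>i<D. (post_mean U i w)\<^sup>2)
      \<le> (\<Sum>i<D. (\<integral>x. indicat_real U x * (k x w * (a i x w)\<^sup>2) \<partial>P))"
    unfolding sum_distrib_left by (intro sum_mono)
  also have "\<dots> = (\<integral>x. indicat_real U x * k x w * (\<Sum>i<D. (a i x w)\<^sup>2) \<partial>P)"
    using int by (subst Bochner_Integration.integral_sum[symmetric])
      (auto simp: sum_distrib_left mult.assoc)
  also have "\<dots> \<le> (\<integral>x. indicat_real U x * k x w * \<rho> w \<partial>P)"
  proof (rule integral_mono)
    have "integrable P (\<lambda>x. \<Sum>i<D. indicat_real U x * (k x w * (a i x w)\<^sup>2))"
      by (intro Bochner_Integration.integrable_sum int)
    moreover have "(\<lambda>x. \<Sum>i<D. indicat_real U x * (k x w * (a i x w)\<^sup>2)) =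
        (\<lambda>x. indicat_real U x * k x w * (\<Sum>i<D. (a i x w)\<^sup>2))"
      unfolding sum_distrib_left by (simp only: mult.assoc)
    ultimately show "integrable P (\<lambda>x. indicat_real U x * k x w * (\<Sum>i<D. (a i x w)\<^sup>2))"
      by metis
    show "integrable P (\<lambda>x. indicat_real U x * k x w * \<rho> w)" using int by auto
    show "indicat_real U x * k x w * (\<Sum>i<D. (a i x w)\<^sup>2) \<le> indicat_real U x * k x w * \<rho> w"
      if "x \<in> space P" for x
      using a_bound[of x w] w k_nonneg[OF that w] by (auto simp: indicator_def mult_left_mono)
  qed
  also have "\<dots> = evidence U w * \<rho> w" by (simp add: evidence_def)
  finally show ?thesis using pU0 by simp
qed


lemma nn_integral_integral_swap:
  assumes [measurable]: "(\<lambda>(x, w). f x w) \<in> borel_measurable (P \<Otimes>\<^sub>M \<mu>)"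
    and nonneg: "\<And>x w. x \<in> space P \<Longrightarrow> w \<in> space \<mu> \<Longrightarrow> 0 \<le> f x w"
    and int: "\<And>w. w \<in> space \<mu> \<Longrightarrow> integrable P (\<lambda>x. f x w)"
  shows "(\<integral>\<^sup>+w. ennreal (\<integral>x. f x w \<partial>P) \<partial>\<mu>) = (\<integral>\<^sup>+x. (\<integral>\<^sup>+w. ennreal (f x w) \<partial>\<mu>) \<partial>P)"
proof -
  interpret pair_sigma_finite P \<mu> ..
  have "(\<integral>\<^sup>+w. ennreal (\<integral>x. f x w \<partial>P) \<partial>\<mu>) = (\<integral>\<^sup>+w. (\<integral>\<^sup>+x. ennreal (f x w) \<partial>P) \<partial>\<mu>)"
    using int nonneg by (intro nn_integral_cong nn_integral_eq_integral[symmetric] AE_I2)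
  also have "\<dots> = (\<integral>\<^sup>+x. (\<integral>\<^sup>+w. ennreal (f x w) \<partial>\<mu>) \<partial>P)"
    by (rule Fubini') measurable
  finally show ?thesis .
qed

end

locale channel_predictor = denoising_channel +
  fixes F :: "nat \<Rightarrow> 'b \<Rightarrow> real"
  assumes F_measurable [measurable]: "\<And>i. F i \<in> borel_measurable \<mu>"
    and F_bound: "\<And>w. w \<in> space \<mu> \<Longrightarrow> (\<Sum>i<D. (F i w)\<^sup>2) \<le> K\<^sup>2"
begin

abbreviation m :: "nat \<Rightarrow> 'b \<Rightarrow> real" where "m \<equiv> post_mean U"

abbreviation gap_sq :: "'b \<Rightarrow> real" where "gap_sq w \<equiv> \<Sum>i<D. (m i w - F i w)\<^sup>2"
abbreviation signal_sq :: "'a \<Rightarrow> 'b \<Rightarrow> real" where "signal_sq x w \<equiv> \<Sum>i<D. (a i x w)\<^sup>2"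
abbreviation post_sq :: "'a \<Rightarrow> 'b \<Rightarrow> real" where "post_sq x w \<equiv> \<Sum>i<D. (a i x w - m i w)\<^sup>2"
abbreviation loss_sq :: "'a \<Rightarrow> 'b \<Rightarrow> real" where "loss_sq x w \<equiv> \<Sum>i<D. (a i x w - F i w)\<^sup>2"
abbreviation cross_sum :: "'a \<Rightarrow> 'b \<Rightarrow> real" where
  "cross_sum x w \<equiv> \<Sum>i<D. (m i w - F i w) * (a i x w - m i w)"

lemma m_measurable [measurable]: "m i \<in> borel_measurable \<mu>"
  by (rule post_mean_measurable[OF U_sets])

definition gap :: "'a \<Rightarrow> real" where
  "gap x = (\<integral>w. k x w * gap_sq w \<partial>\<mu>)"

definition cross :: "'a \<Rightarrow> real" where
  "cross x = (\<integral>w. k x w * cross_sum x w \<partial>\<mu>)"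

text \<open>The mean of \<open>gap\<close> under the law conditioned on \<open>U\<close>. As
  \<open>cross\<close> integrates to zero over \<open>U\<close>, it is also the conditional mean of
  the excess loss, hence the centre in Bernstein's inequality.\<close>

definition risk_in :: real where
  "risk_in = (\<integral>x. indicat_real U x * gap x \<partial>P) / prob U"

section \<open>Integrability and size of the gap and of the cross term\<close>

lemma int_k: "x \<in> space P \<Longrightarrow> integrable \<mu> (k x)" "x \<in> space P \<Longrightarrow> (\<integral>w. k x w \<partial>\<mu>) \<le> \<kappa>"
  using integrable_integral_le[OF _ _ k_bound] k_nonneg \<kappa>_nonneg by auto

lemma int_k\<rho>: "x \<in> space P \<Longrightarrow> integrable \<mu> (\<lambda>w. k x w * \<rho> w)"
  "x \<in> space P \<Longrightarrow> (\<integral>w. k x w * \<rho> w \<partial>\<mu>) \<le> B"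
  using integrable_integral_le[OF _ _ k\<rho>_bound] k_nonneg \<rho>_nonneg B_pos by auto

lemma int_kaa: "x \<in> space P \<Longrightarrow> integrable \<mu> (\<lambda>w. k x w * signal_sq x w)"
  "x \<in> space P \<Longrightarrow> (\<integral>w. k x w * signal_sq x w \<partial>\<mu>) \<le> B * \<theta> x"
proof -
  assume x: "x \<in> space P"
  have "0 \<le> k x w * signal_sq x w" if "w \<in> space \<mu>" for w
    using k_nonneg[OF x that] by (simp add: sum_nonneg)
  then show "integrable \<mu> (\<lambda>w. k x w * signal_sq x w)"
    "(\<integral>w. k x w * signal_sq x w \<partial>\<mu>) \<le> B * \<theta> x"
    using integrable_integral_le[OF _ _ kaa_bound] x \<theta>_nonneg[OF x] B_pos by auto
qed

lemma int_kK: "x \<in> space P \<Longrightarrow> integrable \<mu> (\<lambda>w. k x w * (K * sqrt (\<rho> w)))"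
  "x \<in> space P \<Longrightarrow> (\<integral>w. k x w * (K * sqrt (\<rho> w)) \<partial>\<mu>) \<le> B"
  using integrable_integral_le[OF _ _ kK_bound] k_nonneg \<rho>_nonneg B_pos K_nonneg by auto

lemma int_k_diff:
  assumes "x \<in> space P" "x' \<in> U"
  shows "integrable \<mu> (\<lambda>w. \<bar>k x w - k x' w\<bar> * (K\<^sup>2 + \<rho> w))"
    "(\<integral>w. \<bar>k x w - k x' w\<bar> * (K\<^sup>2 + \<rho> w) \<partial>\<mu>) \<le> B * (1 + \<theta> x)"
  using integrable_integral_le[OF _ _ k_diff_bound[OF assms]] assms U_subset \<rho>_nonneg B_pos \<theta>_nonneg
  by auto

lemma gap_density_le:
  assumes w: "w \<in> space \<mu>"
  shows "gap_sq w \<le> 2 * \<rho> w + 2 * K\<^sup>2"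
  using sum_square_diff_le[of "\<lambda>i. m i w" "\<lambda>i. F i w" "{..<D}"] post_mean_U_bound[OF w] F_bound[OF w]
  by linarith

lemma gap_density_nonneg: "0 \<le> gap_sq w"
  by (simp add: sum_nonneg)

lemma int_gap:
  assumes x: "x \<in> space P"
  shows "integrable \<mu> (\<lambda>w. k x w * gap_sq w)"
proof (rule Bochner_Integration.integrable_bound)
  show "integrable \<mu> (\<lambda>w. 2 * (k x w * \<rho> w) + 2 * K\<^sup>2 * k x w)"
    using int_k[OF x] int_k\<rho>[OF x] by simp
  show "AE w in \<mu>. norm (k x w * gap_sq w) \<le> norm (2 * (k x w * \<rho> w) + 2 * K\<^sup>2 * k x w)"
  proof (rule AE_I2)
    fix w assume w: "w \<in> space \<mu>"
    have "k x w * gap_sq w \<le> k x w * (2 * \<rho> w + 2 * K\<^sup>2)"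
      by (intro mult_left_mono gap_density_le w k_nonneg x)
    moreover have "0 \<le> k x w * gap_sq w"
      using k_nonneg[OF x w] gap_density_nonneg by simp
    ultimately show "norm (k x w * gap_sq w) \<le> norm (2 * (k x w * \<rho> w) + 2 * K\<^sup>2 * k x w)"
      by (simp add: algebra_simps)
  qed
qed (use x in measurable)

lemma gap_nonneg: "x \<in> space P \<Longrightarrow> 0 \<le> gap x"
  unfolding gap_def using k_nonneg gap_density_nonneg
  by (intro Bochner_Integration.integral_nonneg mult_nonneg_nonneg)

text \<open>In the diffusion the term with \<open>\<kappa>\<close> does not decay with the horizon.
  The bound makes \<open>gap\<close> integrable over \<open>x\<close>; its fluctuations are
  controlled by \<open>gap_diff_le\<close> instead.\<close>

lemma gap_le: assumes x: "x \<in> space P" shows "gap x \<le> 2 * B + 2 * K\<^sup>2 * \<kappa>"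
proof -
  have "gap x \<le> (\<integral>w. 2 * (k x w * \<rho> w) + 2 * K\<^sup>2 * k x w \<partial>\<mu>)"
    unfolding gap_def
  proof (rule integral_mono)
    show "k x w * gap_sq w \<le> 2 * (k x w * \<rho> w) + 2 * K\<^sup>2 * k x w" if w: "w \<in> space \<mu>" for w
      using mult_left_mono[OF gap_density_le[OF w] k_nonneg[OF x w]] by (simp add: algebra_simps)
  qed (use int_gap[OF x] int_k[OF x] int_k\<rho>[OF x] in auto)
  also have "\<dots> = 2 * (\<integral>w. k x w * \<rho> w \<partial>\<mu>) + 2 * K\<^sup>2 * (\<integral>w. k x w \<partial>\<mu>)"
    using int_k[OF x] int_k\<rho>[OF x] by simp
  also have "\<dots> \<le> 2 * B + 2 * K\<^sup>2 * \<kappa>"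
    using int_k(2)[OF x] int_k\<rho>(2)[OF x] by (intro add_mono mult_left_mono) auto
  finally show ?thesis .
qed

lemma gap_measurable [measurable]: "gap \<in> borel_measurable P"
  unfolding gap_def[abs_def] by measurable

lemma cross_measurable [measurable]: "cross \<in> borel_measurable P"
  unfolding cross_def[abs_def] by measurable

lemma int_indicator_gap: "integrable P (\<lambda>x. indicat_real S x * gap x)" if [measurable]: "S \<in> sets P"
proof (rule integrable_const_bound[where B = "2 * B + 2 * K\<^sup>2 * \<kappa>"])
  show "AE x in P. norm (indicat_real S x * gap x) \<le> 2 * B + 2 * K\<^sup>2 * \<kappa>"
    using gap_nonneg gap_le B_pos \<kappa>_nonneg by (intro AE_I2) (auto simp: indicator_def)
qed measurable

lemma risk_in_nonneg: "0 \<le> risk_in"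
  unfolding risk_in_def using gap_nonneg
  by (intro divide_nonneg_nonneg Bochner_Integration.integral_nonneg) (auto simp: indicator_def)

lemma integral_gap: "(\<integral>x. indicat_real U x * gap x \<partial>P) = risk_in * prob U"
  using U_prob_pos by (simp add: risk_in_def)

text \<open>The factor \<open>gap_sq w\<close> is the same at both points, so only the kernels
  differ, and \<open>K\<^sup>2\<close> is integrated against a difference of kernels. In the
  diffusion such a difference fades at large times although each kernel keeps its mass.\<close>

lemma gap_diff_le:
  assumes x: "x \<in> space P" and x': "x' \<in> U"
  shows "\<bar>gap x - gap x'\<bar> \<le> 2 * B * (1 + \<theta> x)"
proof -
  note x'' = U_subset[OF x']
  have "gap x - gap x' = (\<integral>w. (k x w - k x' w) * gap_sq w \<partial>\<mu>)"
    unfolding gap_def using int_gap[OF x] int_gap[OF x'']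
    by (subst Bochner_Integration.integral_diff[symmetric]) (auto simp: left_diff_distrib)
  also have "\<bar>\<dots>\<bar> \<le> (\<integral>w. 2 * (\<bar>k x w - k x' w\<bar> * (K\<^sup>2 + \<rho> w)) \<partial>\<mu>)"
  proof (rule order_trans[OF integral_abs_bound], rule integral_mono)
    show "integrable \<mu> (\<lambda>w. \<bar>(k x w - k x' w) * gap_sq w\<bar>)"
      using int_gap[OF x] int_gap[OF x''] by (simp add: left_diff_distrib)
    show "integrable \<mu> (\<lambda>w. 2 * (\<bar>k x w - k x' w\<bar> * (K\<^sup>2 + \<rho> w)))"
      using int_k_diff[OF x x'] by simp
    show "\<bar>(k x w - k x' w) * gap_sq w\<bar> \<le> 2 * (\<bar>k x w - k x' w\<bar> * (K\<^sup>2 + \<rho> w))"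
      if w: "w \<in> space \<mu>" for w
      using mult_left_mono[OF gap_density_le[OF w], of "\<bar>k x w - k x' w\<bar>"] gap_density_nonneg[of w]
      unfolding abs_mult by (simp add: algebra_simps)
  qed
  also have "\<dots> \<le> 2 * B * (1 + \<theta> x)" using int_k_diff[OF x x'] by simp
  finally show ?thesis .
qed

text \<open>Average \<open>gap_diff_le\<close> over \<open>x'\<close> in \<open>U\<close>. The point
  \<open>x\<close> stays arbitrary, so that even outside \<open>U\<close> the gap is tied to
  \<open>risk_in\<close>, up to a price in \<open>\<theta>\<close>.\<close>

lemma gap_risk_diff_le:
  assumes x: "x \<in> space P"
  shows "\<bar>gap x - risk_in\<bar> \<le> 2 * B * (1 + \<theta> x)"
proof -
  have i2: "integrable P (\<lambda>x'. indicat_real U x' * c)" for c :: real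
    by (rule integrable_const_bound[where B = "\<bar>c\<bar>"]) (auto simp: indicator_def)
  have e: "(\<integral>x'. indicat_real U x' * c \<partial>P) = prob U * c" for c :: real
    using U_subset by (simp add: Int_absorb2 subsetI)
  have "risk_in * prob U \<le> (\<integral>x'. indicat_real U x' * (gap x + 2 * B * (1 + \<theta> x)) \<partial>P)"
    unfolding integral_gap[symmetric] using gap_diff_le[OF x] int_indicator_gap[OF U_sets]
    by (intro integral_mono i2) (auto simp: indicator_def abs_le_iff algebra_simps)
  then have 1: "risk_in \<le> gap x + 2 * B * (1 + \<theta> x)"
    using U_prob_pos unfolding e by (simp add: mult.commute)
  have "(\<integral>x'. indicat_real U x' * (gap x - 2 * B * (1 + \<theta> x)) \<partial>P) \<le> risk_in * prob U"
    unfolding integral_gap[symmetric] using gap_diff_le[OF x] int_indicator_gap[OF U_sets]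
    by (intro integral_mono i2) (auto simp: indicator_def abs_le_iff algebra_simps)
  then have 2: "gap x - 2 * B * (1 + \<theta> x) \<le> risk_in"
    using U_prob_pos unfolding e by (simp add: mult.commute)
  from 1 2 show ?thesis by (simp add: abs_le_iff)
qed


lemma post_diff_le:
  assumes x: "x \<in> space P" and w: "w \<in> space \<mu>"
  shows "k x w * post_sq x w \<le> 2 * (k x w * signal_sq x w) + 2 * (k x w * \<rho> w)"
  using mult_left_mono[OF order_trans[OF sum_square_diff_le[of "\<lambda>i. a i x w" "\<lambda>i. m i w" "{..<D}"]
      add_left_mono[OF mult_left_mono[OF post_mean_U_bound[OF w], of 2]]] k_nonneg[OF x w]]
  by (simp add: algebra_simps)

lemma int_post_diff:
  assumes x: "x \<in> space P"
  shows "integrable \<mu> (\<lambda>w. k x w * post_sq x w)"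
    and "(\<integral>w. k x w * post_sq x w \<partial>\<mu>) \<le> 2 * B * (1 + \<theta> x)"
proof -
  have i: "integrable \<mu> (\<lambda>w. 2 * (k x w * signal_sq x w) + 2 * (k x w * \<rho> w))"
    using int_kaa[OF x] int_k\<rho>[OF x] by simp
  show 1: "integrable \<mu> (\<lambda>w. k x w * post_sq x w)"
  proof (rule Bochner_Integration.integrable_bound[OF i])
    show "AE w in \<mu>. norm (k x w * post_sq x w)
      \<le> norm (2 * (k x w * signal_sq x w) + 2 * (k x w * \<rho> w))"
    proof (rule AE_I2)
      fix w assume w: "w \<in> space \<mu>"
      have "0 \<le> k x w * post_sq x w"
        using k_nonneg[OF x w] by (simp add: sum_nonneg)
      then show "norm (k x w * post_sq x w)
      \<le> norm (2 * (k x w * signal_sq x w) + 2 * (k x w * \<rho> w))"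
        using post_diff_le[OF x w] by simp
    qed
  qed (use x in measurable)
  have "(\<integral>w. k x w * post_sq x w \<partial>\<mu>)
     \<le> (\<integral>w. 2 * (k x w * signal_sq x w) + 2 * (k x w * \<rho> w) \<partial>\<mu>)"
    using 1 i post_diff_le[OF x] by (intro integral_mono)
  also have "\<dots> \<le> 2 * (B * \<theta> x) + 2 * B"
    using int_kaa[OF x] int_k\<rho>[OF x] by simp
  finally show "(\<integral>w. k x w * post_sq x w \<partial>\<mu>) \<le> 2 * B * (1 + \<theta> x)"
    by (simp add: algebra_simps)
qed

lemma int_cross:
  assumes x: "x \<in> space P"
  shows "integrable \<mu> (\<lambda>w. k x w * cross_sum x w)"
proof (rule Bochner_Integration.integrable_bound)
  show "integrable \<mu> (\<lambda>w. k x w * gap_sq w + k x w * post_sq x w)"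
    using int_gap[OF x] int_post_diff[OF x] by simp
  show "AE w in \<mu>. norm (k x w * cross_sum x w)
      \<le> norm (k x w * gap_sq w + k x w * post_sq x w)"
  proof (rule AE_I2)
    fix w assume w: "w \<in> space \<mu>"
    have "\<bar>u * v\<bar> \<le> u\<^sup>2 + v\<^sup>2" for u v :: real
    proof -
      have "2 * (\<bar>u\<bar> * \<bar>v\<bar>) \<le> u\<^sup>2 + v\<^sup>2"
        using zero_le_power2[of "\<bar>u\<bar> - \<bar>v\<bar>"] by (simp add: power2_diff)
      moreover have "0 \<le> \<bar>u\<bar> * \<bar>v\<bar>" by simp
      ultimately show ?thesis unfolding abs_mult by linarith
    qed
    then have "(\<Sum>i<D. \<bar>(m i w - F i w) * (a i x w - m i w)\<bar>)
        \<le> (\<Sum>i<D. (m i w - F i w)\<^sup>2 + (a i x w - m i w)\<^sup>2)"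
      by (intro sum_mono)
    then have "\<bar>\<Sum>i<D. (m i w - F i w) * (a i x w - m i w)\<bar>
        \<le> gap_sq w + post_sq x w"
      using order_trans[OF sum_abs] by (simp only: sum.distrib)
    from mult_left_mono[OF this k_nonneg[OF x w]] k_nonneg[OF x w]
    show "norm (k x w * cross_sum x w)
      \<le> norm (k x w * gap_sq w + k x w * post_sq x w)"
      by (simp add: abs_mult distrib_left)
  qed
qed (use x in measurable)

text \<open>Expansion of the square around the posterior mean. The first integral does not involve
  \<open>F\<close> and cancels whenever two predictors are compared; what remains is the excess
  loss.\<close>

lemma loss_difference:
  assumes x: "x \<in> space P"
  shows "integrable \<mu> (\<lambda>w. k x w * loss_sq x w)"
    and "(\<integral>w. k x w * loss_sq x w \<partial>\<mu>)
      = (\<integral>w. k x w * post_sq x w \<partial>\<mu>) + (gap x + 2 * cross x)"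
proof -
  have "(a i x w - F i w)\<^sup>2 = (a i x w - m i w)\<^sup>2 + ((m i w - F i w)\<^sup>2
      + 2 * ((m i w - F i w) * (a i x w - m i w)))" for i w
    by (simp add: power2_eq_square algebra_simps)
  then have eq: "k x w * loss_sq x w = k x w * post_sq x w
     + (k x w * gap_sq w + 2 * (k x w * cross_sum x w))" for w
    by (simp add: sum.distrib sum_distrib_left[symmetric] distrib_left)
  show "integrable \<mu> (\<lambda>w. k x w * loss_sq x w)"
    unfolding eq using int_post_diff[OF x] int_gap[OF x] int_cross[OF x] by simp
  show "(\<integral>w. k x w * loss_sq x w \<partial>\<mu>)
      = (\<integral>w. k x w * post_sq x w \<partial>\<mu>) + (gap x + 2 * cross x)"
    unfolding eq gap_def cross_def using int_post_diff[OF x] int_gap[OF x] int_cross[OF x] by simp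
qed

text \<open>Meant for points outside \<open>U\<close>, where \<open>cross\<close> has no uniform
  bound: the cross term is absorbed by doubling both squares.\<close>

lemma loss_le:
  assumes x: "x \<in> space P"
  shows "(\<integral>w. k x w * loss_sq x w \<partial>\<mu>) \<le> 2 * gap x + 4 * B * (1 + \<theta> x)"
proof -
  have "(\<integral>w. k x w * loss_sq x w \<partial>\<mu>) \<le>
     (\<integral>w. 2 * (k x w * gap_sq w) + 2 * (k x w * post_sq x w) \<partial>\<mu>)"
  proof (rule integral_mono)
    fix w assume w: "w \<in> space \<mu>"
    have "(a i x w - F i w)\<^sup>2 \<le> 2 * (m i w - F i w)\<^sup>2 + 2 * (a i x w - m i w)\<^sup>2" for i
      using zero_le_power2[of "(m i w - F i w) - (a i x w - m i w)"]
      by (simp add: power2_eq_square algebra_simps)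
    then have "loss_sq x w \<le> (\<Sum>i<D. 2 * (m i w - F i w)\<^sup>2 + 2 * (a i x w - m i w)\<^sup>2)"
      by (intro sum_mono)
    then have "loss_sq x w \<le> 2 * gap_sq w + 2 * post_sq x w"
      by (simp add: sum.distrib sum_distrib_left[symmetric])
    from mult_left_mono[OF this k_nonneg[OF x w]]
    show "k x w * loss_sq x w \<le>
       2 * (k x w * gap_sq w) + 2 * (k x w * post_sq x w)"
      by (simp add: algebra_simps)
  qed (use int_post_diff[OF x] int_gap[OF x] loss_difference[OF x] in auto)
  then show ?thesis
    using int_post_diff[OF x] int_gap[OF x] by (simp add: gap_def)
qed

text \<open>The two distances are bounded separately: predictor to posterior mean by
  \<open>2 * sqrt (\<rho> w) + 2 * K\<close>, signal to posterior mean by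
  \<open>2 * sqrt (\<rho> w)\<close>. Every term of the product keeps a factor
  \<open>sqrt (\<rho> w)\<close>, so no bare \<open>K\<^sup>2\<close> is left to be integrated
  against the kernel.\<close>

lemma cross_density_le:
  assumes xU: "x \<in> U" and w: "w \<in> space \<mu>"
  shows "\<bar>\<Sum>i<D. (m i w - F i w) * (a i x w - m i w)\<bar> \<le> 4 * \<rho> w + 4 * (K * sqrt (\<rho> w))"
proof -
  have r: "0 \<le> \<rho> w" by (rule \<rho>_nonneg[OF w])
  have "\<bar>\<Sum>i<D. (m i w - F i w) * (a i x w - m i w)\<bar> \<le> (2 * sqrt (\<rho> w) + 2 * K) * (2 * sqrt (\<rho> w))"
  proof (rule abs_sum_mult_le_sqrt)
    have "2 * \<rho> w + 2 * K\<^sup>2 \<le> (2 * sqrt (\<rho> w) + 2 * K)\<^sup>2"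
      using r K_nonneg by (simp add: power2_sum)
    then show "gap_sq w \<le> (2 * sqrt (\<rho> w) + 2 * K)\<^sup>2"
      using gap_density_le[OF w] by linarith
    show "post_sq x w \<le> (2 * sqrt (\<rho> w))\<^sup>2"
      using sum_square_diff_le[of "\<lambda>i. a i x w" "\<lambda>i. m i w" "{..<D}"] post_mean_U_bound[OF w]
        a_bound[OF xU w] r by (simp add: power_mult_distrib)
  qed (use r K_nonneg in auto)
  also have "\<dots> = 4 * \<rho> w + 4 * (K * sqrt (\<rho> w))"
    using r by (simp add: algebra_simps)
  finally show ?thesis .
qed

lemma cross_bound:
  assumes xU: "x \<in> U"
  shows "\<bar>cross x\<bar> \<le> 8 * B"
proof -
  note x = U_subset[OF xU]
  have "\<bar>cross x\<bar> \<le> (\<integral>w. 4 * (k x w * \<rho> w) + 4 * (k x w * (K * sqrt (\<rho> w))) \<partial>\<mu>)"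
    unfolding cross_def
  proof (rule order_trans[OF integral_abs_bound], rule integral_mono)
    show "\<bar>k x w * cross_sum x w\<bar>
      \<le> 4 * (k x w * \<rho> w) + 4 * (k x w * (K * sqrt (\<rho> w)))" if w: "w \<in> space \<mu>" for w
      using mult_left_mono[OF cross_density_le[OF xU w] k_nonneg[OF x w]] k_nonneg[OF x w]
      unfolding abs_mult by (simp add: algebra_simps)
  qed (use int_cross[OF x] int_k\<rho>[OF x] int_kK[OF x] in auto)
  also have "\<dots> \<le> 8 * B" using int_k\<rho>[OF x] int_kK[OF x] by simp
  finally show ?thesis .
qed

text \<open>Cauchy-Schwarz with the kernel as weight; on \<open>U\<close> the second factor is at
  most \<open>4 * B\<close>. A small gap thus forces a small cross term, which is what makes the
  variance proportional to the mean.\<close>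

lemma cross_square_le:
  assumes xU: "x \<in> U"
  shows "(cross x)\<^sup>2 \<le> 4 * B * gap x"
proof -
  note x = U_subset[OF xU]
  have "(cross x)\<^sup>2 \<le> gap x * (\<integral>w. k x w * post_sq x w \<partial>\<mu>)"
    unfolding cross_def gap_def
    by (rule integral_mult_square_le) (use int_gap[OF x] int_post_diff[OF x] int_cross[OF x] k_nonneg[OF x] in auto)
  also have "\<dots> \<le> gap x * (2 * B * (1 + \<theta> x))"
    using int_post_diff[OF x] gap_nonneg[OF x] by (intro mult_left_mono)
  also have "\<dots> \<le> gap x * (4 * B)"
    using \<theta>_le_1[OF xU] gap_nonneg[OF x] B_pos by (intro mult_left_mono) auto
  finally show ?thesis by (simp add: mult_ac)
qed

text \<open>For fixed \<open>w\<close>, the average of \<open>k x w * (a i x w - m i w)\<close> over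
  \<open>U\<close> vanishes by the definition of \<open>post_mean\<close>, and
  \<open>m i w - F i w\<close> does not depend on \<open>x\<close>. Most of the work is the absolute
  integrability that lets the two integrals be exchanged.\<close>

lemma cross_mean_zero: "(\<integral>x. indicat_real U x * cross x \<partial>P) = 0"
proof -
  interpret pair_sigma_finite P \<mu> ..
  define f where "f x w = indicat_real U x * (k x w * cross_sum x w)" for x w
  have [measurable]: "(\<lambda>(x, w). f x w) \<in> borel_measurable (P \<Otimes>\<^sub>M \<mu>)"
    unfolding f_def by measurable
  have int_f: "integrable (P \<Otimes>\<^sub>M \<mu>) (\<lambda>(x, w). f x w)"
  proof (rule Fubini_integrable)
    have "(\<integral>w. norm (case (x, w) of (x, w) \<Rightarrow> f x w) \<partial>\<mu>) \<le> 8 * B" if "x \<in> space P" for x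
    proof (cases "x \<in> U")
      case True
      have "(\<integral>w. norm (case (x, w) of (x, w) \<Rightarrow> f x w) \<partial>\<mu>)
        \<le> (\<integral>w. 4 * (k x w * \<rho> w) + 4 * (k x w * (K * sqrt (\<rho> w))) \<partial>\<mu>)"
      proof (rule integral_mono)
        show "norm (case (x, w) of (x, w) \<Rightarrow> f x w)
          \<le> 4 * (k x w * \<rho> w) + 4 * (k x w * (K * sqrt (\<rho> w)))" if w: "w \<in> space \<mu>" for w
          using mult_left_mono[OF cross_density_le[OF True w] k_nonneg[OF \<open>x \<in> space P\<close> w]]
            k_nonneg[OF \<open>x \<in> space P\<close> w] True
          unfolding f_def by (simp add: abs_mult algebra_simps)
      qed (use int_cross[OF that] int_k\<rho>[OF that] int_kK[OF that] in \<open>auto simp: f_def\<close>)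
      also have "\<dots> \<le> 8 * B" using int_k\<rho>[OF that] int_kK[OF that] by simp
      finally show ?thesis .
    qed (use B_pos in \<open>simp add: f_def\<close>)
    then show "integrable P (\<lambda>x. \<integral>w. norm (case (x, w) of (x, w) \<Rightarrow> f x w) \<partial>\<mu>)"
      by (intro integrable_const_bound[where B = "8 * B"] AE_I2) auto
    show "AE x in P. integrable \<mu> (\<lambda>w. case (x, w) of (x, w) \<Rightarrow> f x w)"
      using int_cross by (intro AE_I2) (auto simp: f_def)
  qed measurable
  have "(\<integral>x. indicat_real U x * cross x \<partial>P) = (\<integral>x. (\<integral>w. f x w \<partial>\<mu>) \<partial>P)"
    by (intro Bochner_Integration.integral_cong) (auto simp: f_def cross_def)
  also have "\<dots> = (\<integral>w. (\<integral>x. f x w \<partial>P) \<partial>\<mu>)"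
    by (rule Fubini_integral[symmetric]) (rule int_f)
  also have "\<dots> = (\<integral>w. 0 \<partial>\<mu>)"
  proof (rule Bochner_Integration.integral_cong[OF refl])
    fix w assume w: "w \<in> space \<mu>"
    note int = indicator_integrable[OF w U_sets]
    have "f x w = (\<Sum>i<D. (m i w - F i w) * (indicat_real U x * (k x w * a i x w) - m i w * (indicat_real U x * k x w)))" for x
      unfolding f_def by (simp add: sum_distrib_left algebra_simps)
    then have "(\<integral>x. f x w \<partial>P) = (\<Sum>i<D. (m i w - F i w) * ((\<integral>x. indicat_real U x * (k x w * a i x w) \<partial>P) - m i w * evidence U w))"
      using int by (simp add: evidence_def)
    also have "\<dots> = 0"
      using evidence_pos[OF U_sets U_prob_pos w] by (simp add: post_mean_def)
    finally show "(\<integral>x. f x w \<partial>P) = 0" .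
  qed
  finally show ?thesis by simp
qed


section \<open>Mean, range and second moment of the excess loss on the truncation set\<close>

definition excess :: "'a \<Rightarrow> real" where "excess x = gap x + 2 * cross x"

lemma excess_measurable [measurable]: "excess \<in> borel_measurable P"
  unfolding excess_def[abs_def] by measurable

lemma gap_risk_diff_le_U:
  assumes "x \<in> U"
  shows "\<bar>gap x - risk_in\<bar> \<le> 4 * B"
proof -
  have "2 * B * (1 + \<theta> x) \<le> 2 * B * 2"
    using \<theta>_le_1[OF assms] B_pos by (intro mult_left_mono) auto
  then show ?thesis using gap_risk_diff_le[OF U_subset[OF assms]] by linarith
qed

text \<open>The estimates give \<open>20 * B\<close>. The value \<open>48 * B\<close> is the one
  that the second moment requires, and \<open>bernstein_event\<close> takes the same number for
  both.\<close>

lemma excess_bound: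
  assumes xU: "x \<in> U"
  shows "\<bar>excess x - risk_in\<bar> \<le> 48 * B"
  using gap_risk_diff_le_U[OF xU] cross_bound[OF xU] B_pos by (auto simp: excess_def)

lemma int_indicator_cross: "integrable P (\<lambda>x. indicat_real U x * cross x)"
  by (rule integrable_const_bound[where B = "8 * B"])
    (use cross_bound B_pos in \<open>auto simp: indicator_def\<close>)

lemma excess_mean: "(\<integral>x. indicat_real U x * (excess x - risk_in) \<partial>P) = 0"
proof -
  have i: "integrable P (\<lambda>x. risk_in * indicat_real U x)"
    by (rule integrable_const_bound[where B = "\<bar>risk_in\<bar>"]) (auto simp: indicator_def)
  have "(\<integral>x. indicat_real U x * (excess x - risk_in) \<partial>P) =
     (\<integral>x. indicat_real U x * gap x + 2 * (indicat_real U x * cross x) - risk_in * indicat_real U x \<partial>P)"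
    by (intro Bochner_Integration.integral_cong) (auto simp: excess_def algebra_simps)
  also have "\<dots> = 0"
    using i int_indicator_gap[OF U_sets] int_indicator_cross U_subset
    by (simp add: cross_mean_zero integral_gap Int_absorb2 subsetI)
  finally show ?thesis .
qed

text \<open>The deviation splits into the part from \<open>gap\<close> and the part from
  \<open>cross\<close>; the square of each is of order \<open>B\<close> times a quantity of mean at
  most \<open>risk_in\<close>. The coefficients 40 of the gap and 8 of \<open>risk_in\<close> add up
  to 48.\<close>

lemma excess_second_moment:
  "(\<integral>x. indicat_real U x * (excess x - risk_in)\<^sup>2 \<partial>P) \<le> 48 * B * risk_in"
proof -
  have i: "integrable P (\<lambda>x. 8 * B * risk_in * indicat_real U x)"
    by (rule integrable_const_bound[where B = "\<bar>8 * B * risk_in\<bar>"]) (auto simp: indicator_def)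
  have "(\<integral>x. indicat_real U x * (excess x - risk_in)\<^sup>2 \<partial>P)
    \<le> (\<integral>x. 40 * B * (indicat_real U x * gap x) + 8 * B * risk_in * indicat_real U x \<partial>P)"
  proof (rule integral_mono)
    show "integrable P (\<lambda>x. indicat_real U x * (excess x - risk_in)\<^sup>2)"
    proof (rule integrable_const_bound[where B = "(48 * B)\<^sup>2"])
      show "AE x in P. norm (indicat_real U x * (excess x - risk_in)\<^sup>2) \<le> (48 * B)\<^sup>2"
      proof (rule AE_I2)
        fix x
        show "norm (indicat_real U x * (excess x - risk_in)\<^sup>2) \<le> (48 * B)\<^sup>2"
          using power_mono[OF excess_bound, of x 2] by (simp add: indicator_def)
      qed
    qed measurable
    show "indicat_real U x * (excess x - risk_in)\<^sup>2
       \<le> 40 * B * (indicat_real U x * gap x) + 8 * B * risk_in * indicat_real U x" for x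
    proof (cases "x \<in> U")
      case True
      have g: "0 \<le> gap x" using gap_nonneg[OF U_subset[OF True]] .
      \<comment> \<open>One factor is bounded by \<open>4 * B\<close>, the other by the sum of the
        two nonnegative numbers.\<close>
      have "(gap x - risk_in)\<^sup>2 = \<bar>gap x - risk_in\<bar> * \<bar>gap x - risk_in\<bar>"
        by (simp add: power2_eq_square)
      also have "\<dots> \<le> 4 * B * (gap x + risk_in)"
        using gap_risk_diff_le_U[OF True] g risk_in_nonneg by (intro mult_mono) auto
      finally have 1: "(gap x - risk_in)\<^sup>2 \<le> 4 * B * (gap x + risk_in)" .
      have "(excess x - risk_in)\<^sup>2 \<le> 2 * (gap x - risk_in)\<^sup>2 + 2 * (2 * cross x)\<^sup>2"
        using zero_le_power2[of "(gap x - risk_in) - 2 * cross x"]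
        by (simp add: excess_def power2_eq_square algebra_simps)
      also have "\<dots> \<le> 2 * (4 * B * (gap x + risk_in)) + 8 * (4 * B * gap x)"
        using 1 cross_square_le[OF True] by (simp add: power_mult_distrib)
      finally show ?thesis using True by (simp add: algebra_simps)
    qed simp
  qed (use i int_indicator_gap[OF U_sets] in auto)
  also have "\<dots> = 48 * B * risk_in * prob U"
    using i int_indicator_gap[OF U_sets] U_subset
    by (simp add: integral_gap Int_absorb2 subsetI)
  also have "\<dots> \<le> 48 * B * risk_in"
    using prob_le_1[of U] risk_in_nonneg B_pos by (intro mult_left_le) auto
  finally show ?thesis .
qed

section \<open>Excess risk under the full law against excess risk under the conditioned law\<close>

definition risk :: ennreal where
  "risk = (\<integral>\<^sup>+w. ennreal (evidence (space P) w * (\<Sum>i<D. (F i w - post_mean (space P) i w)\<^sup>2)) \<partial>\<mu>)"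

lemma nn_integral_evidence_U:
  "(\<integral>\<^sup>+w. ennreal (evidence U w * (\<Sum>i<D. (F i w - m i w)\<^sup>2)) \<partial>\<mu>) = ennreal (risk_in * prob U)"
proof -
  have sym: "(\<Sum>i<D. (F i w - m i w)\<^sup>2) = gap_sq w" for w
    by (simp add: power2_commute)
  have "(\<integral>\<^sup>+w. ennreal (evidence U w * (\<Sum>i<D. (F i w - m i w)\<^sup>2)) \<partial>\<mu>) =
    (\<integral>\<^sup>+w. ennreal (\<integral>x. indicat_real U x * (k x w * gap_sq w) \<partial>P) \<partial>\<mu>)"
    unfolding sym
    by (intro nn_integral_cong arg_cong[where f = ennreal])
      (simp add: evidence_def mult.assoc[symmetric] indicator_integrable[OF _ U_sets])
  also have "\<dots> = (\<integral>\<^sup>+x. (\<integral>\<^sup>+w. ennreal (indicat_real U x * (k x w * gap_sq w)) \<partial>\<mu>) \<partial>P)"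
    using k_nonneg gap_density_nonneg indicator_integrable[OF _ U_sets]
    by (intro nn_integral_integral_swap) (auto simp: mult.assoc[symmetric])
  also have "\<dots> = (\<integral>\<^sup>+x. ennreal (indicat_real U x * gap x) \<partial>P)"
  proof (rule nn_integral_cong)
    fix x assume x: "x \<in> space P"
    have "(\<integral>\<^sup>+w. ennreal (indicat_real U x * (k x w * gap_sq w)) \<partial>\<mu>)
      = ennreal (\<integral>w. indicat_real U x * (k x w * gap_sq w) \<partial>\<mu>)"
      using int_gap[OF x] k_nonneg[OF x] gap_density_nonneg
      by (intro nn_integral_eq_integral AE_I2) auto
    then show "(\<integral>\<^sup>+w. ennreal (indicat_real U x * (k x w * gap_sq w)) \<partial>\<mu>)
      = ennreal (indicat_real U x * gap x)" by (simp add: gap_def)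
  qed
  also have "\<dots> = ennreal (\<integral>x. indicat_real U x * gap x \<partial>P)"
    using gap_nonneg int_indicator_gap[OF U_sets]
    by (intro nn_integral_eq_integral AE_I2) auto
  finally show ?thesis by (simp add: integral_gap)
qed

lemma nn_integral_loss_outside:
  assumes [measurable]: "\<And>i. G i \<in> borel_measurable \<mu>"
  shows "(\<integral>\<^sup>+w. ennreal (\<Sum>i<D. \<integral>x. indicat_real (space P - U) x * (k x w * (G i w - a i x w)\<^sup>2) \<partial>P) \<partial>\<mu>)
    = (\<integral>\<^sup>+x. ennreal (indicat_real (space P - U) x) *
         (\<integral>\<^sup>+w. ennreal (k x w * (\<Sum>i<D. (a i x w - G i w)\<^sup>2)) \<partial>\<mu>) \<partial>P)"
proof -
  have int: "integrable P (\<lambda>x. indicat_real (space P - U) x * (k x w * (G i w - a i x w)\<^sup>2))"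
    if w: "w \<in> space \<mu>" for w i
  proof -
    have "indicat_real (space P - U) x * (k x w * (G i w - a i x w)\<^sup>2) =
     (G i w)\<^sup>2 * (indicat_real (space P - U) x * k x w) - 2 * G i w * (indicat_real (space P - U) x * (k x w * a i x w))
     + indicat_real (space P - U) x * (k x w * (a i x w)\<^sup>2)" for x
      by (simp add: power2_eq_square algebra_simps)
    then show ?thesis using indicator_integrable[OF w, of "space P - U"] by simp
  qed
  have eq: "(\<Sum>i<D. \<integral>x. indicat_real (space P - U) x * (k x w * (G i w - a i x w)\<^sup>2) \<partial>P) =
    (\<integral>x. indicat_real (space P - U) x * (k x w * (\<Sum>i<D. (a i x w - G i w)\<^sup>2)) \<partial>P)"
    if w: "w \<in> space \<mu>" for w
  proof -
    have "(\<Sum>i<D. \<integral>x. indicat_real (space P - U) x * (k x w * (G i w - a i x w)\<^sup>2) \<partial>P) =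
      (\<integral>x. (\<Sum>i<D. indicat_real (space P - U) x * (k x w * (G i w - a i x w)\<^sup>2)) \<partial>P)"
      using int[OF w] by (intro Bochner_Integration.integral_sum[symmetric])
    also have "\<dots> = (\<integral>x. indicat_real (space P - U) x * (k x w * (\<Sum>i<D. (a i x w - G i w)\<^sup>2)) \<partial>P)"
      unfolding sum_distrib_left power2_commute[of "G _ w"] ..
    finally show ?thesis .
  qed
  have int': "integrable P (\<lambda>x. indicat_real (space P - U) x * (k x w * (\<Sum>i<D. (a i x w - G i w)\<^sup>2)))"
    if w: "w \<in> space \<mu>" for w
  proof -
    have "integrable P (\<lambda>x. \<Sum>i<D. indicat_real (space P - U) x * (k x w * (G i w - a i x w)\<^sup>2))"
      using int[OF w] by (intro Bochner_Integration.integrable_sum)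
    then show ?thesis unfolding sum_distrib_left power2_commute[of "G _ w"] .
  qed
  have "(\<integral>\<^sup>+w. ennreal (\<Sum>i<D. \<integral>x. indicat_real (space P - U) x * (k x w * (G i w - a i x w)\<^sup>2) \<partial>P) \<partial>\<mu>)
     = (\<integral>\<^sup>+w. ennreal (\<integral>x. indicat_real (space P - U) x * (k x w * (\<Sum>i<D. (a i x w - G i w)\<^sup>2)) \<partial>P) \<partial>\<mu>)"
    by (intro nn_integral_cong) (simp add: eq)
  also have "\<dots> = (\<integral>\<^sup>+x. (\<integral>\<^sup>+w. ennreal (indicat_real (space P - U) x * (k x w * (\<Sum>i<D. (a i x w - G i w)\<^sup>2))) \<partial>\<mu>) \<partial>P)"
    using k_nonneg int' by (intro nn_integral_integral_swap) (auto simp: sum_nonneg)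
  also have "\<dots> = (\<integral>\<^sup>+x. ennreal (indicat_real (space P - U) x) *
         (\<integral>\<^sup>+w. ennreal (k x w * (\<Sum>i<D. (a i x w - G i w)\<^sup>2)) \<partial>\<mu>) \<partial>P)"
  proof (rule nn_integral_cong)
    fix x assume x[measurable]: "x \<in> space P"
    show "(\<integral>\<^sup>+w. ennreal (indicat_real (space P - U) x * (k x w * (\<Sum>i<D. (a i x w - G i w)\<^sup>2))) \<partial>\<mu>)
      = ennreal (indicat_real (space P - U) x) * (\<integral>\<^sup>+w. ennreal (k x w * (\<Sum>i<D. (a i x w - G i w)\<^sup>2)) \<partial>\<mu>)"
      by (subst nn_integral_cmult[symmetric]) (auto simp: ennreal_mult' intro!: nn_integral_cong)
  qed
  finally show ?thesis .
qed

lemma evidence_nonneg: "w \<in> space \<mu> \<Longrightarrow> 0 \<le> evidence S w"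
  unfolding evidence_def using k_nonneg
  by (intro Bochner_Integration.integral_nonneg) (auto simp: indicator_def)

text \<open>Jensen's inequality charges \<open>U\<close> with \<open>risk_in\<close> and the
  complement with the full loss there. Since the gap at any point is close to
  \<open>risk_in\<close>, that loss is at most
  \<open>2 * risk_in + 8 * B * (1 + \<theta> x)\<close>, so the complement adds a multiple of its
  probability to the leading term and otherwise only \<open>tail_mass\<close>.\<close>

lemma risk_le_risk_in: "risk \<le> 2 * ennreal risk_in + ennreal (8 * B) * tail_mass"
proof -
  have [measurable]: "space P \<in> sets P" "space P - U \<in> sets P" by auto
  let ?V = "space P - U"
  have "risk \<le> (\<integral>\<^sup>+w. ennreal (evidence U w * (\<Sum>i<D. (F i w - m i w)\<^sup>2))
     + ennreal (\<Sum>i<D. \<integral>x. indicat_real ?V x * (k x w * (F i w - a i x w)\<^sup>2) \<partial>P) \<partial>\<mu>)"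
    unfolding risk_def
  proof (rule nn_integral_mono)
    fix w assume w: "w \<in> space \<mu>"
    have nn: "0 \<le> (\<integral>x. indicat_real ?V x * (k x w * (F i w - a i x w)\<^sup>2) \<partial>P)" for i
      using k_nonneg[OF _ w] by (intro Bochner_Integration.integral_nonneg) (auto simp: indicator_def)
    have "evidence (space P) w * (\<Sum>i<D. (F i w - post_mean (space P) i w)\<^sup>2)
      \<le> evidence U w * (\<Sum>i<D. (F i w - m i w)\<^sup>2)
        + (\<Sum>i<D. \<integral>x. indicat_real ?V x * (k x w * (F i w - a i x w)\<^sup>2) \<partial>P)"
      unfolding sum_distrib_left sum.distrib[symmetric]
      by (intro sum_mono evidence_post_mean_le w)
    then show "ennreal (evidence (space P) w * (\<Sum>i<D. (F i w - post_mean (space P) i w)\<^sup>2)) \<le>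
      ennreal (evidence U w * (\<Sum>i<D. (F i w - m i w)\<^sup>2))
       + ennreal (\<Sum>i<D. \<integral>x. indicat_real ?V x * (k x w * (F i w - a i x w)\<^sup>2) \<partial>P)"
      using nn evidence_nonneg[OF w, of U]
      by (subst ennreal_plus[symmetric]) (auto intro!: sum_nonneg mult_nonneg_nonneg ennreal_leI)
  qed
  also have "\<dots> = ennreal (risk_in * prob U) + (\<integral>\<^sup>+x. ennreal (indicat_real ?V x) *
         (\<integral>\<^sup>+w. ennreal (k x w * loss_sq x w) \<partial>\<mu>) \<partial>P)"
    by (subst nn_integral_add) (auto simp: nn_integral_evidence_U nn_integral_loss_outside)
  also have "(\<integral>\<^sup>+x. ennreal (indicat_real ?V x) *
         (\<integral>\<^sup>+w. ennreal (k x w * loss_sq x w) \<partial>\<mu>) \<partial>P)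
     \<le> (\<integral>\<^sup>+x. 2 * ennreal risk_in * indicator ?V x + ennreal (8 * B) * ennreal (indicat_real ?V x * (1 + \<theta> x)) \<partial>P)"
  proof (rule nn_integral_mono)
    fix x assume x: "x \<in> space P"
    have "(\<integral>\<^sup>+w. ennreal (k x w * loss_sq x w) \<partial>\<mu>)
       = ennreal (\<integral>w. k x w * loss_sq x w \<partial>\<mu>)"
      using loss_difference[OF x] k_nonneg[OF x] by (intro nn_integral_eq_integral AE_I2) (auto simp: sum_nonneg)
    also have "\<dots> \<le> ennreal (2 * risk_in + 8 * B * (1 + \<theta> x))"
      using loss_le[OF x] gap_risk_diff_le[OF x] by (intro ennreal_leI) auto
    also have "\<dots> = 2 * ennreal risk_in + ennreal (8 * B) * ennreal (1 + \<theta> x)"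
      using risk_in_nonneg B_pos \<theta>_nonneg[OF x] by (simp add: ennreal_mult' ennreal_mult)
    finally show "ennreal (indicat_real ?V x) * (\<integral>\<^sup>+w. ennreal (k x w * loss_sq x w) \<partial>\<mu>)
      \<le> 2 * ennreal risk_in * indicator ?V x + ennreal (8 * B) * ennreal (indicat_real ?V x * (1 + \<theta> x))"
      by (auto simp: indicator_def)
  qed
  also have "\<dots> = ennreal (2 * risk_in * prob ?V) + ennreal (8 * B) * tail_mass"
    using risk_in_nonneg by (subst nn_integral_add) (auto simp: nn_integral_cmult tail_mass_def
        emeasure_eq_measure ennreal_mult')
  finally have "risk \<le> ennreal (risk_in * prob U) + (ennreal (2 * risk_in * prob ?V) + ennreal (8 * B) * tail_mass)"
    by (simp add: add_left_mono)
  also have "\<dots> = ennreal (risk_in * prob U + 2 * risk_in * prob ?V) + ennreal (8 * B) * tail_mass"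
    using risk_in_nonneg by (simp add: add.assoc)
  also have "\<dots> \<le> ennreal (2 * risk_in) + ennreal (8 * B) * tail_mass"
  proof -
    have "risk_in * prob U + 2 * risk_in * prob ?V = risk_in * (2 - prob U)"
      by (simp add: prob_compl algebra_simps)
    also have "\<dots> \<le> risk_in * 2" using risk_in_nonneg by (intro mult_left_mono) auto
    finally show ?thesis by (intro add_right_mono ennreal_leI) simp
  qed
  finally show ?thesis using risk_in_nonneg by (simp add: ennreal_mult')
qed

text \<open>The factor 4 consists of a 2 for moving between the two posterior means by the squared
  triangle inequality and a 2 for \<open>prob U\<close> being at least one half.\<close>

lemma risk_in_le_risk: "ennreal risk_in \<le> 4 * risk + ennreal (8 * B) * tail_mass"
proof -
  have [measurable]: "space P \<in> sets P" "space P - U \<in> sets P" by auto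
  let ?V = "space P - U"
  have "ennreal (risk_in * prob U) \<le> (\<integral>\<^sup>+w. 2 * ennreal (evidence (space P) w * (\<Sum>i<D. (F i w - post_mean (space P) i w)\<^sup>2))
     + 2 * ennreal (\<Sum>i<D. \<integral>x. indicat_real ?V x * (k x w * (m i w - a i x w)\<^sup>2) \<partial>P) \<partial>\<mu>)"
    unfolding nn_integral_evidence_U[symmetric]
  proof (rule nn_integral_mono)
    fix w assume w: "w \<in> space \<mu>"
    let ?T = "\<lambda>i. (\<integral>x. indicat_real ?V x * (k x w * (m i w - a i x w)\<^sup>2) \<partial>P)"
    have nn: "0 \<le> ?T i" for i
      using k_nonneg[OF _ w] by (intro Bochner_Integration.integral_nonneg) (auto simp: indicator_def)
    have eU: "evidence U w \<le> evidence (space P) w"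
      unfolding evidence_def using indicator_integrable[OF w] k_nonneg[OF _ w]
      by (intro integral_mono) (auto simp: indicator_def)
    have "evidence U w * (F i w - m i w)\<^sup>2 \<le> 2 * (evidence (space P) w * (F i w - post_mean (space P) i w)\<^sup>2) + 2 * ?T i" for i
    proof -
      have "(F i w - m i w)\<^sup>2 \<le> 2 * (F i w - post_mean (space P) i w)\<^sup>2 + 2 * (m i w - post_mean (space P) i w)\<^sup>2"
        using zero_le_power2[of "F i w - post_mean (space P) i w + (m i w - post_mean (space P) i w)"]
        by (simp add: power2_eq_square algebra_simps)
      then have "evidence U w * (F i w - m i w)\<^sup>2 \<le> evidence (space P) w *
        (2 * (F i w - post_mean (space P) i w)\<^sup>2 + 2 * (m i w - post_mean (space P) i w)\<^sup>2)"
        using eU evidence_nonneg[OF w] by (intro mult_mono) auto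
      also have "\<dots> = 2 * (evidence (space P) w * (F i w - post_mean (space P) i w)\<^sup>2)
          + 2 * (evidence (space P) w * (m i w - post_mean (space P) i w)\<^sup>2)"
        by (simp add: algebra_simps)
      \<comment> \<open>Taking the constant to be the posterior mean on \<open>U\<close> makes the
        first term of the Jensen bound vanish, so the distance between the two posterior means is
        charged to points outside \<open>U\<close> only.\<close>
      also have "evidence (space P) w * (m i w - post_mean (space P) i w)\<^sup>2 \<le> ?T i"
        using evidence_post_mean_le[OF w, of "m i w" i] by simp
      finally show ?thesis by simp
    qed
    then have "evidence U w * (\<Sum>i<D. (F i w - m i w)\<^sup>2) \<le>
       2 * (evidence (space P) w * (\<Sum>i<D. (F i w - post_mean (space P) i w)\<^sup>2)) + 2 * (\<Sum>i<D. ?T i)"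
      unfolding sum_distrib_left sum.distrib[symmetric] by (intro sum_mono)
    then have "ennreal (evidence U w * (\<Sum>i<D. (F i w - m i w)\<^sup>2)) \<le>
       ennreal (2 * (evidence (space P) w * (\<Sum>i<D. (F i w - post_mean (space P) i w)\<^sup>2)) + 2 * (\<Sum>i<D. ?T i))"
      by (rule ennreal_leI)
    then show "ennreal (evidence U w * (\<Sum>i<D. (F i w - m i w)\<^sup>2)) \<le>
      2 * ennreal (evidence (space P) w * (\<Sum>i<D. (F i w - post_mean (space P) i w)\<^sup>2)) + 2 * ennreal (\<Sum>i<D. ?T i)"
      using nn evidence_nonneg[OF w]
      by (subst (asm) ennreal_plus) (auto simp: ennreal_mult' sum_nonneg)
  qed
  also have "\<dots> = 2 * risk + 2 * (\<integral>\<^sup>+x. ennreal (indicat_real ?V x) *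
         (\<integral>\<^sup>+w. ennreal (k x w * post_sq x w) \<partial>\<mu>) \<partial>P)"
    by (subst nn_integral_add) (auto simp: nn_integral_cmult risk_def nn_integral_loss_outside)
  also have "(\<integral>\<^sup>+x. ennreal (indicat_real ?V x) *
         (\<integral>\<^sup>+w. ennreal (k x w * post_sq x w) \<partial>\<mu>) \<partial>P)
     \<le> (\<integral>\<^sup>+x. ennreal (2 * B) * ennreal (indicat_real ?V x * (1 + \<theta> x)) \<partial>P)"
  proof (rule nn_integral_mono)
    fix x assume x: "x \<in> space P"
    have "(\<integral>\<^sup>+w. ennreal (k x w * post_sq x w) \<partial>\<mu>)
       = ennreal (\<integral>w. k x w * post_sq x w \<partial>\<mu>)"
      using int_post_diff[OF x] k_nonneg[OF x] by (intro nn_integral_eq_integral AE_I2) (auto simp: sum_nonneg)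
    also have "\<dots> \<le> ennreal (2 * B * (1 + \<theta> x))"
      using int_post_diff[OF x] by (intro ennreal_leI) auto
    finally show "ennreal (indicat_real ?V x) * (\<integral>\<^sup>+w. ennreal (k x w * post_sq x w) \<partial>\<mu>)
      \<le> ennreal (2 * B) * ennreal (indicat_real ?V x * (1 + \<theta> x))"
      using B_pos by (auto simp: indicator_def ennreal_mult')
  qed
  also have "\<dots> = ennreal (2 * B) * tail_mass" by (simp add: nn_integral_cmult tail_mass_def)
  finally have *: "ennreal (risk_in * prob U) \<le> 2 * risk + 2 * (ennreal (2 * B) * tail_mass)"
    by (simp add: add_left_mono mult_left_mono)
  have "ennreal risk_in \<le> ennreal (2 * (risk_in * prob U))"
    using U_prob risk_in_nonneg mult_left_mono[of "1/2" "prob U" "2 * risk_in"] by (intro ennreal_leI) simp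
  also have "\<dots> = 2 * ennreal (risk_in * prob U)" using risk_in_nonneg by (simp add: ennreal_mult')
  also have "\<dots> \<le> 2 * (2 * risk + 2 * (ennreal (2 * B) * tail_mass))" using * by (rule mult_left_mono) simp
  also have "\<dots> = 4 * risk + ennreal (8 * B) * tail_mass"
    using B_pos by (simp add: distrib_left mult.assoc[symmetric] ennreal_mult')
  finally show ?thesis .
qed

end

section \<open>Gaussian channel on \<open>\<real>\<^sup>n\<close>\<close>

lemma hvar_pos: "0 < t \<Longrightarrow> 0 < hvar t" by (simp add: hvar_def)
lemma hvar_le_1: "hvar t \<le> 1" by (simp add: hvar_def)
lemma alpha_pos: "0 < alpha t" by (simp add: alpha_def)
lemma alpha_le_1: "0 \<le> t \<Longrightarrow> alpha t \<le> 1" by (simp add: alpha_def)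
lemma hvar_alpha: "hvar t = 1 - (alpha t)\<^sup>2"
  by (simp add: hvar_def alpha_def power2_eq_square flip: exp_add)

lemma exp_sub_exp_minus_ge:
  fixes u :: real
  assumes "0 \<le> u"
  shows "2 * u \<le> exp u - exp (- u)"
proof -
  have 1: "1 + u + u\<^sup>2 / 2 \<le> exp u"
    using exp_lower_Taylor_quadratic[OF assms] by simp
  have "1 \<le> 1 + (u ^ 2)\<^sup>2 / 4" by simp
  also have "\<dots> = (1 - u + u\<^sup>2 / 2) * (1 + u + u\<^sup>2 / 2)"
    by (simp add: power2_eq_square field_simps)
  also have "\<dots> \<le> (1 - u + u\<^sup>2 / 2) * exp u"
  proof (rule mult_left_mono[OF 1])
    have eq: "1 - u + u\<^sup>2 / 2 = (u - 1)\<^sup>2 / 2 + 1 / 2" by (simp add: power2_eq_square field_simps)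
    show "0 \<le> 1 - u + u\<^sup>2 / 2" unfolding eq by simp
  qed
  finally have "exp (- u) \<le> 1 - u + u\<^sup>2 / 2" by (simp add: exp_minus field_simps)
  with 1 show ?thesis by linarith
qed

text \<open>Multiplying h(t) by exp(t/4) gives exp(t/4) - exp(-3t/4), which is at least 2 sinh(t/4)
  and hence at least t/2. Squaring and inserting \<alpha>(t) = exp(-t/2) yields one bound that has
  the right singularity at 0 and is integrable at infinity.\<close>

lemma alpha_div_hvar_square_le:
  assumes "0 < t"
  shows "alpha t / (hvar t)\<^sup>2 \<le> 4 / t\<^sup>2"
proof -
  have "exp (- 3 * (t / 4)) \<le> exp (- (t / 4))" using assms by simp
  then have "t / 2 \<le> exp (t / 4) - exp (- 3 * (t / 4))"
    using exp_sub_exp_minus_ge[of "t / 4"] assms by linarith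
  also have "\<dots> = exp (t / 4) * hvar t"
    by (simp add: hvar_def right_diff_distrib flip: exp_add)
  finally have "(t / 2)\<^sup>2 \<le> (exp (t / 4) * hvar t)\<^sup>2"
    using assms by (intro power_mono) auto
  also have "\<dots> = exp (t / 2) * (hvar t)\<^sup>2"
    by (simp add: power_mult_distrib flip: exp_of_nat_mult)
  finally have "t\<^sup>2 * exp (- (t / 2)) \<le> 4 * (hvar t)\<^sup>2"
    by (simp add: exp_minus field_simps power2_eq_square)
  then show ?thesis
    using assms hvar_pos[of t] by (simp add: alpha_def field_simps)
qed

lemma alpha_square_div_hvar_square_le:
  assumes "0 < t"
  shows "(alpha t)\<^sup>2 / (hvar t)\<^sup>2 \<le> 4 / t\<^sup>2"
proof -
  have "(alpha t)\<^sup>2 \<le> alpha t"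
    using alpha_pos[of t] alpha_le_1[of t] assms by (simp add: power2_eq_square mult_left_le)
  then have "(alpha t)\<^sup>2 / (hvar t)\<^sup>2 \<le> alpha t / (hvar t)\<^sup>2" by (simp add: divide_right_mono)
  with alpha_div_hvar_square_le[OF assms] show ?thesis by linarith
qed

text \<open>Writing 1/h^2 as 1 plus terms with a factor 1 - h = \<alpha>^2 separates the constant
  part from the short-time singularity, which is O(1/t^2). The constant part is multiplied by the
  minimum, a total variation bound: it is trivial until t is of order \<Lambda> and exponentially
  small afterwards, and \<Lambda>^2/t^2 dominates it in both regimes.\<close>

lemma inverse_hvar_square_min_le:
  assumes t: "0 < t" and R: "0 \<le> R" "R \<le> exp \<Lambda>" and \<Lambda>: "1 \<le> \<Lambda>"
  shows "min 2 (alpha t * R / sqrt (hvar t)) / (hvar t)\<^sup>2 \<le> 144 * \<Lambda>\<^sup>2 / t\<^sup>2"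
proof -
  define h where "h = hvar t"
  define u where "u = min 2 (alpha t * R / sqrt h)"
  have h: "0 < h" "h \<le> 1" using t by (auto simp: h_def hvar_pos hvar_le_1)
  have u0: "0 \<le> u" "u \<le> 2"
    using R alpha_pos[of t] h by (auto simp: u_def)
  have a2: "(alpha t)\<^sup>2 = 1 - h" by (simp add: h_def hvar_alpha)
  have "1 / h\<^sup>2 = 1 + (1 - h) / h + (1 - h) / h\<^sup>2"
    using h by (simp add: power2_eq_square field_simps)
  also have "(1 - h) / h \<le> (1 - h) / h\<^sup>2"
    using h by (intro divide_left_mono) (auto simp: power2_eq_square mult_left_le)
  also have "1 + (1 - h) / h\<^sup>2 + (1 - h) / h\<^sup>2 \<le> 1 + 8 / t\<^sup>2"
  proof -
    have "(1 - h) / h\<^sup>2 \<le> 4 / t\<^sup>2"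
      using alpha_square_div_hvar_square_le[OF t] unfolding a2 h_def[symmetric] .
    then show ?thesis by linarith
  qed
  finally have "1 / h\<^sup>2 \<le> 1 + 8 / t\<^sup>2" by simp
  then have "u * (1 / h\<^sup>2) \<le> u * (1 + 8 / t\<^sup>2)" using u0(1) by (rule mult_left_mono)
  also have "\<dots> = u + u * (8 / t\<^sup>2)" by (simp add: distrib_left)
  also have "u * (8 / t\<^sup>2) \<le> 2 * (8 / t\<^sup>2)" using u0 by (intro mult_right_mono) auto
  finally have 1: "u / h\<^sup>2 \<le> u + 16 / t\<^sup>2" by simp
  \<comment> \<open>Up to time \<open>8 * \<Lambda>\<close> the trivial bound
    \<open>u \<le> 2\<close> is enough. Beyond it \<open>R\<close> is at most
    \<open>exp (t / 8)\<close>, so \<open>alpha t * R\<close> decays like exp(-3t/8).\<close>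
  have 2: "u \<le> 128 * \<Lambda>\<^sup>2 / t\<^sup>2"
  proof (cases "t \<le> 8 * \<Lambda>")
    case True
    have "t\<^sup>2 \<le> (8 * \<Lambda>)\<^sup>2" using t True by (intro power_mono) auto
    then have "u * t\<^sup>2 \<le> 2 * (8 * \<Lambda>)\<^sup>2" using u0 by (intro mult_mono) auto
    then show ?thesis using t by (simp add: field_simps power2_eq_square)
  next
    case False
    then have t8: "8 \<le> t" using \<Lambda> by linarith
    have "exp (- t) \<le> 1 / 4"
    proof -
      have "4 \<le> exp t" using exp_ge_add_one_self[of t] t8 by linarith
      then show ?thesis by (simp add: exp_minus field_simps)
    qed
    then have "(1 / 2)\<^sup>2 \<le> h" by (simp add: h_def hvar_def power2_eq_square)
    then have sh: "1 / 2 \<le> sqrt h" by (intro real_le_rsqrt)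
    have "u \<le> alpha t * R / sqrt h" by (simp add: u_def)
    also have "\<dots> \<le> alpha t * R / (1 / 2)"
      using sh R alpha_pos[of t] h by (intro divide_left_mono) auto
    also have "\<dots> \<le> 2 * (alpha t * exp (t / 8))"
    proof -
      have "exp \<Lambda> \<le> exp (t / 8)" using False by simp
      with R(2) have "R \<le> exp (t / 8)" by linarith
      then show ?thesis using alpha_pos[of t] by (simp add: mult_left_mono)
    qed
    also have "\<dots> \<le> 2 * exp (- (t / 4))"
      using t by (simp add: alpha_def flip: exp_add)
    also have "\<dots> \<le> 64 / t\<^sup>2"
    proof -
      have "1 + t / 4 + (t / 4)\<^sup>2 / 2 \<le> exp (t / 4)"
        using exp_lower_Taylor_quadratic[of "t / 4"] t by simp
      then have "t\<^sup>2 / 32 \<le> exp (t / 4)" using t by (simp add: power2_eq_square)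
      then show ?thesis using t by (simp add: exp_minus field_simps)
    qed
    also have "\<dots> \<le> 128 * \<Lambda>\<^sup>2 / t\<^sup>2"
    proof -
      have "1 \<le> \<Lambda>\<^sup>2" using \<Lambda> by simp
      then have "64 \<le> 128 * \<Lambda>\<^sup>2" by linarith
      then show ?thesis by (intro divide_right_mono) auto
    qed
    finally show ?thesis .
  qed
  have "16 / t\<^sup>2 \<le> 16 * \<Lambda>\<^sup>2 / t\<^sup>2"
    using \<Lambda> by (intro divide_right_mono) auto
  with 1 2 have "u / h\<^sup>2 \<le> 128 * \<Lambda>\<^sup>2 / t\<^sup>2 + 16 * \<Lambda>\<^sup>2 / t\<^sup>2" by linarith
  also have "\<dots> = 144 * \<Lambda>\<^sup>2 / t\<^sup>2" by (simp add: add_divide_distrib[symmetric])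
  finally show ?thesis unfolding u_def h_def .
qed

lemma nn_integral_inverse_square_le:
  assumes "0 < t0" "t0 \<le> (T :: real)"
  shows "(\<integral>\<^sup>+t. ennreal (1 / t\<^sup>2) * indicator {t0..T} t \<partial>lborel) \<le> ennreal (1 / t0)"
proof -
  have "(\<integral>\<^sup>+t. ennreal (1 / t\<^sup>2) * indicator {t0..T} t \<partial>lborel) = ennreal ((- 1 / T) - (- 1 / t0))"
  proof (rule nn_integral_FTC_Icc)
    show "((\<lambda>t. - 1 / t) has_real_derivative 1 / x\<^sup>2) (at x)"
      if "x \<in> {t0..T}" for x
      using that assms by (auto intro!: derivative_eq_intros simp: power2_eq_square)
  qed (use assms in auto)
  also have "\<dots> \<le> ennreal (1 / t0)" using assms by (intro ennreal_leI) auto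
  finally show ?thesis .
qed

section \<open>Lebesgue measure on vectors\<close>

lemma space_lborel_vec [simp]: "space (lborel_vec n) = carrier_vec n"
proof -
  have image: "(\<lambda>x. Matrix.vec n x) ` (\<Pi>\<^sub>E i\<in>{..<n}. UNIV) = (carrier_vec n :: rvec set)"
  proof (intro equalityI subsetI)
    fix v :: rvec assume v: "v \<in> carrier_vec n"
    have "v = Matrix.vec n (restrict (vec_index v) {..<n})" using v by (intro eq_vecI) auto
    then show "v \<in> (\<lambda>x. Matrix.vec n x) ` (\<Pi>\<^sub>E i\<in>{..<n}. UNIV)"
      by (rule image_eqI[of v "Matrix.vec n" "restrict (vec_index v) {..<n}"]) auto
  next
    fix v :: rvec assume "v \<in> Matrix.vec n ` (\<Pi>\<^sub>E i\<in>{..<n}. UNIV)"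
    then show "v \<in> carrier_vec n" by (elim imageE) (simp only: vec_carrier)
  qed
  have "space (lborel_vec n) = Matrix.vec n ` space (\<Pi>\<^sub>M i\<in>{..<n}. (lborel :: real measure))"
    unfolding lborel_vec_def by (rule space_embed_measure)
  also have "space (\<Pi>\<^sub>M i\<in>{..<n}. (lborel :: real measure)) = (\<Pi>\<^sub>E i\<in>{..<n}. UNIV)"
    by (simp add: space_PiM)
  finally show ?thesis using image by (rule trans)
qed

lemma carrier_vec_sets [measurable, simp]: "carrier_vec n \<in> sets (lborel_vec n)"
  using sets.top[of "lborel_vec n"] by simp

lemma inj_on_vec: "inj_on (Matrix.vec n) (space (\<Pi>\<^sub>M i\<in>{..<n}. (lborel :: real measure)))"
proof (rule inj_onI)
  fix x y :: "nat \<Rightarrow> real"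
  assume x: "x \<in> space (\<Pi>\<^sub>M i\<in>{..<n}. lborel)" and y: "y \<in> space (\<Pi>\<^sub>M i\<in>{..<n}. lborel)"
    and eq: "Matrix.vec n x = Matrix.vec n y"
  have "x i = y i" if "i < n" for i using arg_cong[OF eq, of "\<lambda>v. vec_index v i"] that by simp
  with x y show "x = y" by (auto simp: space_PiM intro: PiE_ext)
qed

lemma vec_measurable: "Matrix.vec n \<in> (\<Pi>\<^sub>M i\<in>{..<n}. (lborel :: real measure)) \<rightarrow>\<^sub>M lborel_vec n"
  unfolding lborel_vec_def by (rule measurable_embed_measure2'[OF inj_on_vec])

text \<open>The value at an index out of range is unspecified, but it depends on the dimension and
  the index alone. Coordinates are therefore measurable for every index, without a range
  condition.\<close>

lemma vec_index_beyond:
  assumes "v \<in> carrier_vec n" "n \<le> i"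
  shows "vec_index v i = vec_index (Matrix.vec n (\<lambda>_. 0)) i"
  using assms unfolding carrier_vec_def by transfer (auto simp: mk_vec_def)

lemma vec_index_measurable [measurable]: "(\<lambda>v. vec_index v i) \<in> borel_measurable (lborel_vec n)"
proof (cases "i < n")
  case True
  have "(\<lambda>v. vec_index v i) \<in> embed_measure (\<Pi>\<^sub>M i\<in>{..<n}. (lborel :: real measure)) (Matrix.vec n) \<rightarrow>\<^sub>M borel"
  proof (rule measurable_embed_measure1)
    have "(\<lambda>x. x i) \<in> borel_measurable (\<Pi>\<^sub>M i\<in>{..<n}. (lborel :: real measure))"
      using measurable_component_singleton[of i "{..<n}" "\<lambda>_. lborel :: real measure"] True by simp
    moreover have "(\<lambda>x :: nat \<Rightarrow> real. vec_index (Matrix.vec n x) i) = (\<lambda>x. x i)" using True by auto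
    ultimately show "(\<lambda>x. vec_index (Matrix.vec n x) i) \<in> borel_measurable (\<Pi>\<^sub>M i\<in>{..<n}. (lborel :: real measure))"
      by simp
  qed
  then show ?thesis by (simp add: lborel_vec_def)
next
  case False
  have "(\<lambda>v. vec_index (Matrix.vec n (\<lambda>_. 0)) i :: real) \<in> borel_measurable (lborel_vec n)" by simp
  then show ?thesis
    by (rule measurable_cong[THEN iffD1, rotated])
      (use False in \<open>simp add: vec_index_beyond[of _ n i, symmetric]\<close>)
qed

lemma measurable_vecI:
  assumes "\<And>i. i < n \<Longrightarrow> (\<lambda>x. vec_index (f x) i) \<in> borel_measurable M"
    and "\<And>x. x \<in> space M \<Longrightarrow> f x \<in> carrier_vec n"
  shows "f \<in> M \<rightarrow>\<^sub>M lborel_vec n"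
proof -
  have "(\<lambda>x. Matrix.vec n (\<lambda>i\<in>{..<n}. vec_index (f x) i)) \<in> M \<rightarrow>\<^sub>M lborel_vec n"
    by (rule measurable_compose[OF _ vec_measurable], rule measurable_restrict) (use assms in auto)
  then show ?thesis
  proof (rule measurable_cong[THEN iffD1, rotated])
    fix x assume "x \<in> space M"
    then have "dim_vec (f x) = n" by (rule carrier_vecD[OF assms(2)])
    then show "Matrix.vec n (\<lambda>i\<in>{..<n}. vec_index (f x) i) = f x"
      by (intro eq_vecI) simp_all
  qed
qed

lemma nn_integral_lborel_vec:
  assumes "f \<in> borel_measurable (lborel_vec n)"
  shows "(\<integral>\<^sup>+v. f v \<partial>lborel_vec n) = (\<integral>\<^sup>+y. f (Matrix.vec n y) \<partial>(\<Pi>\<^sub>M i\<in>{..<n}. lborel))"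
  unfolding lborel_vec_def
  by (rule nn_integral_embed_measure'[OF inj_on_vec]) (use assms in \<open>simp add: lborel_vec_def\<close>)

interpretation lborel_product: product_sigma_finite "\<lambda>_ :: nat. (lborel :: real measure)"
  by standard

lemma sigma_finite_lborel_vec: "sigma_finite_measure (lborel_vec n)"
proof -
  interpret finite_product_sigma_finite "\<lambda>_. (lborel :: real measure)" "{..<n}"
    by standard simp
  obtain A :: "nat \<Rightarrow> (nat \<Rightarrow> real) set" where A: "range A \<subseteq> sets (\<Pi>\<^sub>M i\<in>{..<n}. lborel)"
    "(\<Union>i. A i) = space (\<Pi>\<^sub>M i\<in>{..<n}. lborel)" "\<And>i. emeasure (\<Pi>\<^sub>M i\<in>{..<n}. lborel) (A i) \<noteq> \<infinity>"
    using sigma_finite by blast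
  show ?thesis
  proof
    let ?A = "range (\<lambda>i. Matrix.vec n ` A i)"
    have s: "A i \<subseteq> space (\<Pi>\<^sub>M i\<in>{..<n}. lborel)" for i using A(2) by auto
    have em: "emeasure (lborel_vec n) (Matrix.vec n ` A i) = emeasure (\<Pi>\<^sub>M i\<in>{..<n}. lborel) (A i)" for i
      unfolding lborel_vec_def using A by (intro emeasure_embed_measure_image' inj_on_vec) auto
    have "countable ?A \<and> ?A \<subseteq> sets (lborel_vec n) \<and> \<Union> ?A = space (lborel_vec n) \<and>
      (\<forall>a\<in>?A. emeasure (lborel_vec n) a \<noteq> \<infinity>)"
    proof (intro conjI)
      show "?A \<subseteq> sets (lborel_vec n)"
        using A(1) unfolding lborel_vec_def by (auto intro!: in_sets_embed_measure)
      have "\<Union> ?A = Matrix.vec n ` (\<Union>i. A i)" by auto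
      then show "\<Union> ?A = space (lborel_vec n)"
        unfolding A(2) lborel_vec_def space_embed_measure .
    qed (use A(3) em in auto)
    then show "\<exists>A. countable A \<and> A \<subseteq> sets (lborel_vec n) \<and> \<Union> A = space (lborel_vec n) \<and>
      (\<forall>a\<in>A. emeasure (lborel_vec n) a \<noteq> \<infinity>)" by (rule exI)
  qed
qed

lemma nn_integral_lborel_vec_prod:
  assumes [measurable]: "\<And>i. f i \<in> borel_measurable lborel"
  shows "(\<integral>\<^sup>+v. (\<Prod>i<n. f i (vec_index v i)) \<partial>lborel_vec n) = (\<Prod>i<n. (\<integral>\<^sup>+y. f i y \<partial>lborel))"
proof -
  have "(\<integral>\<^sup>+v. (\<Prod>i<n. f i (vec_index v i)) \<partial>lborel_vec n) =
    (\<integral>\<^sup>+y. (\<Prod>i<n. f i (y i)) \<partial>(\<Pi>\<^sub>M i\<in>{..<n}. lborel))"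
    by (subst nn_integral_lborel_vec) auto
  also have "\<dots> = (\<Prod>i<n. (\<integral>\<^sup>+y. f i y \<partial>lborel))"
    by (rule lborel_product.product_nn_integral_prod) auto
  finally show ?thesis .
qed

lemma vnorm_square: "v \<in> carrier_vec n \<Longrightarrow> (vnorm v)\<^sup>2 = (\<Sum>i<n. (vec_index v i)\<^sup>2)"
  unfolding vnorm_def scalar_prod_def carrier_vec_def
  by (simp add: sum_nonneg power2_eq_square lessThan_atLeast0)

lemma vnorm_nonneg: "0 \<le> vnorm v"
  by (simp add: vnorm_def scalar_prod_def sum_nonneg)

section \<open>Isotropic Gaussian densities\<close>

lemma gauss_pdf_pos: "0 < v \<Longrightarrow> 0 < gauss_pdf n m v y"
  unfolding gauss_pdf_def by (intro prod_pos) (auto intro!: normal_density_pos)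

lemma gauss_pdf_nonneg: "0 \<le> gauss_pdf n m v y"
  unfolding gauss_pdf_def by (intro prod_nonneg) auto

lemma normal_density_le: "normal_density \<mu> \<sigma> x \<le> 1 / sqrt (2 * pi * \<sigma>\<^sup>2)"
  unfolding normal_density_def by (intro mult_left_le) auto

lemma gauss_pdf_le: "gauss_pdf n m v y \<le> (1 / sqrt (2 * pi * (sqrt v)\<^sup>2)) ^ n"
proof -
  have "gauss_pdf n m v y \<le> (\<Prod>i<n. 1 / sqrt (2 * pi * (sqrt v)\<^sup>2))"
    unfolding gauss_pdf_def by (intro prod_mono conjI normal_density_le) simp
  then show ?thesis by simp
qed

lemma gauss_pdf_cong:
  assumes "\<And>i. i < n \<Longrightarrow> vec_index m i = vec_index m' i" "\<And>i. i < n \<Longrightarrow> vec_index y i = vec_index y' i"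
  shows "gauss_pdf n m v y = gauss_pdf n m' v y'"
  unfolding gauss_pdf_def by (intro prod.cong) (use assms in auto)

lemma gauss_pdf_measurable:
  assumes [measurable]: "\<And>i. i < n \<Longrightarrow> (\<lambda>x. vec_index (f x) i) \<in> borel_measurable M"
    "\<And>i. i < n \<Longrightarrow> (\<lambda>x. vec_index (g x) i) \<in> borel_measurable M" "v \<in> borel_measurable M"
  shows "(\<lambda>x. gauss_pdf n (f x) (v x) (g x)) \<in> borel_measurable M"
  unfolding gauss_pdf_def normal_density_def by (intro borel_measurable_prod) measurable

lemma gauss_pdf_measurable_snd [measurable]: "gauss_pdf n m v \<in> borel_measurable (lborel_vec n)"
  by (rule gauss_pdf_measurable) auto

lemma nn_integral_normal_density: "0 < \<sigma> \<Longrightarrow> (\<integral>\<^sup>+x. ennreal (normal_density \<mu> \<sigma> x) \<partial>lborel) = 1"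
  using integrable_normal_density[of \<sigma> \<mu>] integral_normal_density[of \<sigma> \<mu>]
  by (subst nn_integral_eq_integral) auto

lemma nn_integral_gauss_pdf:
  assumes "0 < v"
  shows "(\<integral>\<^sup>+y. ennreal (gauss_pdf n m v y) \<partial>lborel_vec n) = 1"
proof -
  have "(\<integral>\<^sup>+y. ennreal (gauss_pdf n m v y) \<partial>lborel_vec n) =
    (\<integral>\<^sup>+y. (\<Prod>i<n. ennreal (normal_density (vec_index m i) (sqrt v) (vec_index y i))) \<partial>lborel_vec n)"
    by (intro nn_integral_cong) (simp add: gauss_pdf_def prod_ennreal)
  also have "\<dots> = (\<Prod>i<n. (\<integral>\<^sup>+y. ennreal (normal_density (vec_index m i) (sqrt v) y) \<partial>lborel))"
    by (rule nn_integral_lborel_vec_prod) simp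
  also have "\<dots> = 1" using assms by (simp add: nn_integral_normal_density)
  finally show ?thesis .
qed

lemma integrable_gauss_pdf: "0 < v \<Longrightarrow> integrable (lborel_vec n) (gauss_pdf n m v)"
  by (rule integrableI_nonneg) (simp_all add: gauss_pdf_nonneg nn_integral_gauss_pdf)

lemma integral_gauss_pdf: "0 < v \<Longrightarrow> (\<integral>y. gauss_pdf n m v y \<partial>lborel_vec n) = 1"
  by (rule integral_eq_nn_integral[THEN trans]) (simp_all add: gauss_pdf_nonneg nn_integral_gauss_pdf)

lemma prob_space_gaussian:
  assumes "0 < v" shows "prob_space (gaussian n m v)"
proof (rule prob_spaceI)
  have "emeasure (gaussian n m v) (space (gaussian n m v)) =
    (\<integral>\<^sup>+y. ennreal (gauss_pdf n m v y) * indicator (space (lborel_vec n)) y \<partial>lborel_vec n)"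
    unfolding gaussian_def space_density by (rule emeasure_density) auto
  also have "\<dots> = (\<integral>\<^sup>+y. ennreal (gauss_pdf n m v y) \<partial>lborel_vec n)"
    by (rule nn_integral_cong) (simp only: indicator_simps mult_1_right)
  finally show "emeasure (gaussian n m v) (space (gaussian n m v)) = 1"
    by (simp add: nn_integral_gauss_pdf[OF assms])
qed

section \<open>Total variation between Gaussians through the Hellinger affinity\<close>

lemma sqrt_prod: "sqrt (\<Prod>i<n. f i) = (\<Prod>i<n. sqrt (f i))" for n :: nat
  by (induction n) (simp_all add: real_sqrt_mult)

text \<open>Completing the square: the geometric mean of two normal densities of equal variance is
  the normal density at the midpoint, damped by their Hellinger affinity.\<close>

lemma sqrt_normal_density_mult:
  assumes "0 < \<sigma>"
  shows "sqrt (normal_density a \<sigma> y * normal_density b \<sigma> y)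
    = exp (- (a - b)\<^sup>2 / (8 * \<sigma>\<^sup>2)) * normal_density ((a + b) / 2) \<sigma> y"
proof -
  have e: "- (y - a)\<^sup>2 / (2 * \<sigma>\<^sup>2) + - (y - b)\<^sup>2 / (2 * \<sigma>\<^sup>2)
    = 2 * (- (a - b)\<^sup>2 / (8 * \<sigma>\<^sup>2) + - (y - (a + b) / 2)\<^sup>2 / (2 * \<sigma>\<^sup>2))"
    using assms by (simp add: field_simps power2_eq_square)
  have "normal_density a \<sigma> y * normal_density b \<sigma> y
    = (1 / sqrt (2 * pi * \<sigma>\<^sup>2))\<^sup>2 * exp (- (y - a)\<^sup>2 / (2 * \<sigma>\<^sup>2) + - (y - b)\<^sup>2 / (2 * \<sigma>\<^sup>2))"
    unfolding normal_density_def exp_add by (simp add: power2_eq_square)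
  also have "\<dots> = (exp (- (a - b)\<^sup>2 / (8 * \<sigma>\<^sup>2)) * normal_density ((a + b) / 2) \<sigma> y)\<^sup>2"
    unfolding e exp_double exp_add normal_density_def by (simp only: power_mult_distrib mult_ac)
  finally show ?thesis by simp
qed

lemma nn_integral_sqrt_gauss_pdf_mult:
  assumes "0 < v"
  shows "(\<integral>\<^sup>+y. ennreal (sqrt (gauss_pdf n m v y * gauss_pdf n m' v y)) \<partial>lborel_vec n)
    = ennreal (exp (- (\<Sum>i<n. (vec_index m i - vec_index m' i)\<^sup>2) / (8 * v)))"
proof -
  define c where "c i = exp (- (vec_index m i - vec_index m' i)\<^sup>2 / (8 * (sqrt v)\<^sup>2))" for i
  have "sqrt (gauss_pdf n m v y * gauss_pdf n m' v y)
    = (\<Prod>i<n. c i * normal_density ((vec_index m i + vec_index m' i) / 2) (sqrt v) (vec_index y i))" for y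
    unfolding gauss_pdf_def prod.distrib[symmetric] c_def sqrt_prod
    by (intro prod.cong refl sqrt_normal_density_mult) (simp add: assms)
  then have "(\<integral>\<^sup>+y. ennreal (sqrt (gauss_pdf n m v y * gauss_pdf n m' v y)) \<partial>lborel_vec n) =
    (\<integral>\<^sup>+y. (\<Prod>i<n. ennreal (c i) * ennreal (normal_density ((vec_index m i + vec_index m' i) / 2) (sqrt v) (vec_index y i))) \<partial>lborel_vec n)"
    by (intro nn_integral_cong) (simp add: prod_ennreal ennreal_mult[symmetric] c_def)
  also have "\<dots> = (\<Prod>i<n. (\<integral>\<^sup>+y. ennreal (c i) * ennreal (normal_density ((vec_index m i + vec_index m' i) / 2) (sqrt v) y) \<partial>lborel))"
    by (rule nn_integral_lborel_vec_prod) simp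
  also have "\<dots> = (\<Prod>i<n. ennreal (c i))"
    using assms by (intro prod.cong refl) (simp add: nn_integral_cmult nn_integral_normal_density)
  also have "\<dots> = ennreal (\<Prod>i<n. c i)" by (rule prod_ennreal) (simp add: c_def)
  also have "(\<Prod>i<n. c i) = exp (- (\<Sum>i<n. (vec_index m i - vec_index m' i)\<^sup>2) / (8 * v))"
    unfolding c_def using assms by (subst exp_sum[symmetric]) (auto simp: sum_divide_distrib sum_negf)
  finally show ?thesis .
qed

text \<open>Factor |p - q| into |sqrt p - sqrt q| and sqrt p + sqrt q and apply the weighted AM-GM
  inequality. What remains is the Hellinger affinity, which for Gaussians depends on the means only
  through their Euclidean distance, so the bound is free of the dimension.\<close>

lemma gauss_pdf_L1_distance:
  assumes v: "0 < v"
  shows "integrable (lborel_vec n) (\<lambda>y. \<bar>gauss_pdf n m v y - gauss_pdf n m' v y\<bar>)"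
    and "(\<integral>y. \<bar>gauss_pdf n m v y - gauss_pdf n m' v y\<bar> \<partial>lborel_vec n)
      \<le> min 2 (sqrt (\<Sum>i<n. (vec_index m i - vec_index m' i)\<^sup>2) / sqrt v)"
proof -
  let ?p = "gauss_pdf n m v" and ?q = "gauss_pdf n m' v"
  define d where "d = sqrt (\<Sum>i<n. (vec_index m i - vec_index m' i)\<^sup>2)"
  have d0: "0 \<le> d" unfolding d_def by (intro real_sqrt_ge_zero sum_nonneg) simp
  have d2: "d\<^sup>2 = (\<Sum>i<n. (vec_index m i - vec_index m' i)\<^sup>2)" unfolding d_def by (intro real_sqrt_pow2 sum_nonneg) simp
  note int = integrable_gauss_pdf[OF v] and one = integral_gauss_pdf[OF v]
  show int_abs: "integrable (lborel_vec n) (\<lambda>y. \<bar>?p y - ?q y\<bar>)" using int by auto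
  have nn: "(\<integral>\<^sup>+y. ennreal (sqrt (?p y * ?q y)) \<partial>lborel_vec n) = ennreal (exp (- d\<^sup>2 / (8 * v)))"
    unfolding d2 by (rule nn_integral_sqrt_gauss_pdf_mult[OF v])
  have int_s: "integrable (lborel_vec n) (\<lambda>y. sqrt (?p y * ?q y))"
    by (rule integrableI_nonneg) (simp_all add: nn gauss_pdf_nonneg)
  have s: "(\<integral>y. sqrt (?p y * ?q y) \<partial>lborel_vec n) = exp (- d\<^sup>2 / (8 * v))"
    by (rule integral_eq_nn_integral[THEN trans]) (simp_all add: nn gauss_pdf_nonneg)
  have "(\<integral>y. \<bar>?p y - ?q y\<bar> \<partial>lborel_vec n) \<le> (\<integral>y. ?p y + ?q y \<partial>lborel_vec n)"
    using int int_abs by (intro integral_mono) (auto simp: abs_le_iff gauss_pdf_nonneg)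
  also have "\<dots> = 2" using int one by simp
  finally have le2: "(\<integral>y. \<bar>?p y - ?q y\<bar> \<partial>lborel_vec n) \<le> 2" .
  have led: "(\<integral>y. \<bar>?p y - ?q y\<bar> \<partial>lborel_vec n) \<le> d / sqrt v"
  proof (cases "d = 0")
    case True
    then have "\<forall>i\<in>{..<n}. (vec_index m i - vec_index m' i)\<^sup>2 = 0"
      using d2 by (subst sum_nonneg_eq_0_iff[symmetric]) auto
    then have "?p y = ?q y" for y by (intro gauss_pdf_cong) auto
    then show ?thesis using d0 v by simp
  next
    case False
    then have dpos: "0 < d" using d0 by simp
    \<comment> \<open>This weight balances the two terms s d^2/(8v) and 2/s that arise below; each
      becomes half of \<open>d / sqrt v\<close>.\<close>
    define s where "s = 4 * sqrt v / d"
    have s0: "0 < s" using dpos v by (simp add: s_def)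
    have pw: "\<bar>?p y - ?q y\<bar> \<le> s / 2 * (?p y + ?q y - 2 * sqrt (?p y * ?q y))
       + 1 / (2 * s) * (?p y + ?q y + 2 * sqrt (?p y * ?q y))" for y
    proof -
      define f g where "f = sqrt (?p y)" and "g = sqrt (?q y)"
      have f: "0 \<le> f" "?p y = f * f" and g: "0 \<le> g" "?q y = g * g"
        by (auto simp: f_def g_def gauss_pdf_nonneg)
      have sq: "sqrt (?p y * ?q y) = f * g" by (simp add: f_def g_def real_sqrt_mult)
      have "0 \<le> (s * \<bar>f - g\<bar> - (f + g))\<^sup>2" by simp
      then have "2 * s * (\<bar>f - g\<bar> * (f + g)) \<le> s\<^sup>2 * \<bar>f - g\<bar>\<^sup>2 + (f + g)\<^sup>2"
        by (simp add: power2_eq_square algebra_simps)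
      then have "\<bar>f - g\<bar> * (f + g) \<le> (s\<^sup>2 * \<bar>f - g\<bar>\<^sup>2 + (f + g)\<^sup>2) / (2 * s)"
        using s0 by (simp add: field_simps)
      also have "\<dots> = s / 2 * (f - g)\<^sup>2 + 1 / (2 * s) * (f + g)\<^sup>2"
        using s0 by (simp add: power2_eq_square[of s] add_divide_distrib)
      also have "\<bar>f - g\<bar> * (f + g) = \<bar>f * f - g * g\<bar>"
        using f g by (simp add: square_diff_square_factored abs_mult mult.commute)
      finally show ?thesis unfolding sq unfolding f(2) g(2) by (simp add: power2_eq_square algebra_simps)
    qed
    have "(\<integral>y. \<bar>?p y - ?q y\<bar> \<partial>lborel_vec n) \<le> (\<integral>y. s / 2 * (?p y + ?q y - 2 * sqrt (?p y * ?q y))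
       + 1 / (2 * s) * (?p y + ?q y + 2 * sqrt (?p y * ?q y)) \<partial>lborel_vec n)"
      using int int_abs int_s pw by (intro integral_mono) auto
    also have "\<dots> = s / 2 * (2 - 2 * exp (- d\<^sup>2 / (8 * v))) + 1 / (2 * s) * (2 + 2 * exp (- d\<^sup>2 / (8 * v)))"
      using int int_s one by (simp add: s)
    also have "\<dots> \<le> s / 2 * (2 * (d\<^sup>2 / (8 * v))) + 1 / (2 * s) * 4"
    proof (intro add_mono mult_left_mono)
      show "2 - 2 * exp (- d\<^sup>2 / (8 * v)) \<le> 2 * (d\<^sup>2 / (8 * v))"
        using exp_ge_add_one_self[of "- d\<^sup>2 / (8 * v)"] by simp
    qed (use s0 v in auto)
    also have "\<dots> = d / sqrt v"
      using dpos v unfolding s_def by (simp add: field_simps power2_eq_square)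
    finally show ?thesis .
  qed
  from le2 led show "(\<integral>y. \<bar>?p y - ?q y\<bar> \<partial>lborel_vec n)
      \<le> min 2 (sqrt (\<Sum>i<n. (vec_index m i - vec_index m' i)\<^sup>2) / sqrt v)"
    by (simp add: d_def)
qed

section \<open>Differentiation under the integral and scores of Gaussian mixtures\<close>

lemma (in prob_space) has_real_derivative_integral:
  fixes f f' :: "real \<Rightarrow> 'a \<Rightarrow> real"
  assumes deriv: "\<And>u x. x \<in> space M \<Longrightarrow> ((\<lambda>u. f u x) has_real_derivative f' u x) (at u)"
    and bound: "\<And>u x. x \<in> space M \<Longrightarrow> \<bar>f' u x\<bar> \<le> C"
    and int: "\<And>u. integrable M (f u)" and meas: "f' u0 \<in> borel_measurable M"
  shows "((\<lambda>u. \<integral>x. f u x \<partial>M) has_real_derivative (\<integral>x. f' u0 x \<partial>M)) (at u0)"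
  unfolding has_field_derivative_iff tendsto_at_iff_sequentially comp_def
proof (intro allI impI)
  fix X :: "nat \<Rightarrow> real"
  assume X: "\<forall>i. X i \<in> UNIV - {u0}" "X \<longlonglongrightarrow> u0"
  have "(\<lambda>i. \<integral>x. (f (X i) x - f u0 x) / (X i - u0) \<partial>M) \<longlonglongrightarrow> (\<integral>x. f' u0 x \<partial>M)"
  \<comment> \<open>The mean value theorem bounds every difference quotient by \<open>C\<close>, and
    a constant is an integrable majorant on a probability space.\<close>
  proof (rule integral_dominated_convergence[where w = "\<lambda>_. C"])
    show "AE x in M. (\<lambda>i. (f (X i) x - f u0 x) / (X i - u0)) \<longlonglongrightarrow> f' u0 x"
    proof (rule AE_I2)
      fix x assume "x \<in> space M"
      from deriv[OF this, of u0] X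
      show "(\<lambda>i. (f (X i) x - f u0 x) / (X i - u0)) \<longlonglongrightarrow> f' u0 x"
        unfolding has_field_derivative_iff tendsto_at_iff_sequentially comp_def by simp
    qed
    show "AE x in M. norm ((f (X i) x - f u0 x) / (X i - u0)) \<le> C" for i
    proof (rule AE_I2)
      fix x assume x: "x \<in> space M"
      have "norm (f (X i) x - f u0 x) \<le> C * norm (X i - u0)"
        by (rule field_differentiable_bound[of UNIV "\<lambda>u. f u x" "\<lambda>u. f' u x"])
          (use deriv[OF x] bound[OF x] in auto)
      then show "norm ((f (X i) x - f u0 x) / (X i - u0)) \<le> C"
        using X(1) by (auto simp: norm_divide divide_le_eq)
    qed
    show "(\<lambda>x. (f (X i) x - f u0 x) / (X i - u0)) \<in> borel_measurable M" for i
      using borel_measurable_integrable[OF int] by measurable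
  qed (use meas in auto)
  then show "(\<lambda>i. ((\<integral>x. f (X i) x \<partial>M) - (\<integral>x. f u0 x \<partial>M)) / (X i - u0)) \<longlonglongrightarrow> (\<integral>x. f' u0 x \<partial>M)"
    using int by simp
qed

lemma abs_mult_exp_square_le: "\<bar>z\<bar> * exp (- z\<^sup>2 / 2) \<le> (1 :: real)"
proof -
  have "\<bar>z\<bar> \<le> 1 + z\<^sup>2 / 2"
    using zero_le_power2[of "\<bar>z\<bar> - 1"] by (simp add: power2_diff)
  also have "\<dots> \<le> exp (z\<^sup>2 / 2)" by (rule exp_ge_add_one_self_aux) simp
  finally show ?thesis by (simp add: exp_minus field_simps)
qed

lemma normal_density_mult_le:
  assumes "0 < \<sigma>"
  shows "\<bar>y - \<mu>\<bar> * normal_density \<mu> \<sigma> y \<le> \<sigma> * (1 / sqrt (2 * pi * \<sigma>\<^sup>2))"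
proof -
  define z where "z = (y - \<mu>) / \<sigma>"
  have y: "y - \<mu> = \<sigma> * z" using assms by (simp add: z_def)
  have "\<bar>y - \<mu>\<bar> * normal_density \<mu> \<sigma> y = \<sigma> * (1 / sqrt (2 * pi * \<sigma>\<^sup>2)) * (\<bar>z\<bar> * exp (- z\<^sup>2 / 2))"
    unfolding normal_density_def y using assms by (simp add: abs_mult power_mult_distrib)
  also have "\<dots> \<le> \<sigma> * (1 / sqrt (2 * pi * \<sigma>\<^sup>2)) * 1"
    using assms by (intro mult_left_mono abs_mult_exp_square_le) auto
  finally show ?thesis by simp
qed

lemma gauss_pdf_remove:
  "i < n \<Longrightarrow> gauss_pdf n m v y = normal_density (vec_index m i) (sqrt v) (vec_index y i)
     * (\<Prod>j\<in>{..<n} - {i}. normal_density (vec_index m j) (sqrt v) (vec_index y j))"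
  unfolding gauss_pdf_def by (rule prod.remove) auto

text \<open>The bound is uniform in the mean \<open>m\<close>: derivatives of Gaussian densities are
  bounded functions, so a mixture can be differentiated under the integral whatever its mixing
  law.\<close>

lemma gauss_pdf_mult_le:
  assumes i: "i < n" and v: "0 < v"
  shows "\<bar>vec_index y i - vec_index m i\<bar> * gauss_pdf n m v y \<le> sqrt v * (1 / sqrt (2 * pi * (sqrt v)\<^sup>2)) ^ n"
proof -
  let ?c = "1 / sqrt (2 * pi * (sqrt v)\<^sup>2)"
  have "(\<Prod>j\<in>{..<n} - {i}. normal_density (vec_index m j) (sqrt v) (vec_index y j)) \<le> (\<Prod>j\<in>{..<n} - {i}. ?c)"
    by (intro prod_mono conjI normal_density_le) simp
  also have "\<dots> = ?c ^ (n - 1)" using i by simp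
  finally have "\<bar>vec_index y i - vec_index m i\<bar> * normal_density (vec_index m i) (sqrt v) (vec_index y i) *
     (\<Prod>j\<in>{..<n} - {i}. normal_density (vec_index m j) (sqrt v) (vec_index y j)) \<le> (sqrt v * ?c) * ?c ^ (n - 1)"
    using v by (intro mult_mono normal_density_mult_le) (auto intro!: prod_nonneg)
  moreover have "(sqrt v * ?c) * ?c ^ (n - 1) = sqrt v * ?c ^ n"
    using i by (cases n) auto
  ultimately show ?thesis by (simp only: gauss_pdf_remove[OF i] mult.assoc)
qed

lemma gauss_pdf_has_derivative:
  assumes i: "i < n" and v: "0 < v"
  shows "((\<lambda>u. gauss_pdf n m v (y + u \<cdot>\<^sub>v unit_vec n i)) has_real_derivative
    gauss_pdf n m v (y + u \<cdot>\<^sub>v unit_vec n i) * ((vec_index m i - (vec_index y i + u)) / v)) (at u)"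
proof -
  let ?c = "\<Prod>j\<in>{..<n} - {i}. normal_density (vec_index m j) (sqrt v) (vec_index y j)"
  have idx: "vec_index (y + u \<cdot>\<^sub>v unit_vec n i) j = vec_index y j + (if j = i then u else 0)" if "j < n" for j u
    using that i by (simp add: unit_vec_def)
  have eq: "gauss_pdf n m v (y + u \<cdot>\<^sub>v unit_vec n i) = normal_density (vec_index m i) (sqrt v) (vec_index y i + u) * ?c" for u
    unfolding gauss_pdf_remove[OF i] by (intro arg_cong2[where f = "(*)"] prod.cong refl) (auto simp: idx i)
  have "((\<lambda>u. normal_density (vec_index m i) (sqrt v) (vec_index y i + u)) has_real_derivative
    normal_density (vec_index m i) (sqrt v) (vec_index y i + u) * ((vec_index m i - (vec_index y i + u)) / v)) (at u)"
  proof -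
    let ?b = "vec_index y i - vec_index m i"
    have "((\<lambda>u. - (?b + u)\<^sup>2 / (2 * v)) has_real_derivative - (?b + u) / v) (at u)"
      using v by (auto intro!: derivative_eq_intros simp: field_simps)
    from DERIV_cmult[OF DERIV_fun_exp[OF this], of "1 / sqrt (2 * pi * v)"]
    have D: "((\<lambda>u. 1 / sqrt (2 * pi * v) * exp (- (?b + u)\<^sup>2 / (2 * v))) has_real_derivative
      1 / sqrt (2 * pi * v) * exp (- (?b + u)\<^sup>2 / (2 * v)) * (- (?b + u) / v)) (at u)"
      by (simp only: mult.assoc)
    have nd: "normal_density (vec_index m i) (sqrt v) (vec_index y i + u) =
      1 / sqrt (2 * pi * v) * exp (- (?b + u)\<^sup>2 / (2 * v))" for u
      unfolding normal_density_def using v by (simp add: add_diff_eq diff_add_eq)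
    have "vec_index m i - (vec_index y i + u) = - (?b + u)" by simp
    with D show ?thesis unfolding nd by (simp only:)
  qed
  from DERIV_cmult_right[OF this, of ?c] show ?thesis unfolding eq by (simp add: mult_ac)
qed

text \<open>One family covers three densities: the marginal density at time \<open>t\<close>, with
  \<open>Q\<close> the data law; the low-dimensional density, with \<open>Q\<close> the latent law
  and variance \<open>htilde\<close>; and the transition density, with \<open>Q\<close> a point
  mass.\<close>

definition mixture :: "nat \<Rightarrow> rvec measure \<Rightarrow> real \<Rightarrow> real \<Rightarrow> rvec \<Rightarrow> real" where
  "mixture n Q a v y = (\<integral>x. gauss_pdf n (a \<cdot>\<^sub>v x) v y \<partial>Q)"

definition mixture_mean :: "nat \<Rightarrow> rvec measure \<Rightarrow> real \<Rightarrow> real \<Rightarrow> nat \<Rightarrow> rvec \<Rightarrow> real" where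
  "mixture_mean n Q a v i y = (\<integral>x. gauss_pdf n (a \<cdot>\<^sub>v x) v y * (a * vec_index x i) \<partial>Q) / mixture n Q a v y"

locale vec_prob = prob_space Q for Q :: "rvec measure" +
  fixes n :: nat
  assumes sets_Q [measurable_cong, simp]: "sets Q = sets (lborel_vec n)"
begin

lemma space_Q [simp]: "space Q = carrier_vec n"
  using sets_eq_imp_space_eq[OF sets_Q] by simp

lemma gauss_pdf_smult_measurable [measurable]: "(\<lambda>x. gauss_pdf n (a \<cdot>\<^sub>v x) v y) \<in> borel_measurable Q"
proof (rule gauss_pdf_measurable)
  fix i assume i: "i < n"
  have "(\<lambda>x. a * vec_index x i) \<in> borel_measurable Q" by measurable
  then show "(\<lambda>x. vec_index (a \<cdot>\<^sub>v x) i) \<in> borel_measurable Q"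
  proof (rule measurable_cong[THEN iffD1, rotated])
    fix x assume "x \<in> space Q"
    then have "dim_vec x = n" by (simp only: space_Q carrier_vecD)
    then show "a * vec_index x i = vec_index (a \<cdot>\<^sub>v x) i" using i by simp
  qed
qed auto

lemma gauss_pdf_integrable: "integrable Q (\<lambda>x. gauss_pdf n (a \<cdot>\<^sub>v x) v y)"
  by (rule integrable_const_bound[where B = "(1 / sqrt (2 * pi * (sqrt v)\<^sup>2)) ^ n"])
    (use gauss_pdf_le in \<open>auto simp: gauss_pdf_nonneg\<close>)

lemma mixture_pos:
  assumes "0 < v" shows "0 < mixture n Q a v y"
proof -
  have "0 \<le> mixture n Q a v y"
    unfolding mixture_def by (intro Bochner_Integration.integral_nonneg) (simp add: gauss_pdf_nonneg)
  moreover have "mixture n Q a v y \<noteq> 0"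
  proof
    assume "mixture n Q a v y = 0"
    then have "AE x in Q. gauss_pdf n (a \<cdot>\<^sub>v x) v y = 0"
      unfolding mixture_def using integral_nonneg_eq_0_iff_AE[OF gauss_pdf_integrable] gauss_pdf_nonneg by auto
    then have "AE x in Q. False"
      by (rule AE_mp) (use gauss_pdf_pos[OF assms, of n] in \<open>auto intro!: AE_I2 simp: less_le\<close>)
    then show False by simp
  qed
  ultimately show ?thesis by simp
qed

lemma gauss_pdf_diff_integrable:
  assumes i: "i < n" and v: "0 < v"
  shows "integrable Q (\<lambda>x. gauss_pdf n (a \<cdot>\<^sub>v x) v y * (a * vec_index x i - vec_index y i))"
proof (rule integrable_const_bound[where B = "sqrt v * (1 / sqrt (2 * pi * (sqrt v)\<^sup>2)) ^ n"])
  show "AE x in Q. norm (gauss_pdf n (a \<cdot>\<^sub>v x) v y * (a * vec_index x i - vec_index y i))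
    \<le> sqrt v * (1 / sqrt (2 * pi * (sqrt v)\<^sup>2)) ^ n"
  proof (rule AE_I2)
    fix x assume "x \<in> space Q"
    then have "dim_vec x = n" by (simp only: space_Q carrier_vecD)
    then have x: "vec_index (a \<cdot>\<^sub>v x) i = a * vec_index x i" using i by simp
    have "norm (gauss_pdf n (a \<cdot>\<^sub>v x) v y * (a * vec_index x i - vec_index y i))
      = \<bar>vec_index y i - vec_index (a \<cdot>\<^sub>v x) i\<bar> * gauss_pdf n (a \<cdot>\<^sub>v x) v y"
      unfolding x real_norm_def abs_mult abs_of_nonneg[OF gauss_pdf_nonneg]
      by (simp only: mult.commute abs_minus_commute)
    also have "\<dots> \<le> sqrt v * (1 / sqrt (2 * pi * (sqrt v)\<^sup>2)) ^ n"
      by (rule gauss_pdf_mult_le[OF i v])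
    finally show "norm (gauss_pdf n (a \<cdot>\<^sub>v x) v y * (a * vec_index x i - vec_index y i))
    \<le> sqrt v * (1 / sqrt (2 * pi * (sqrt v)\<^sup>2)) ^ n" .
  qed
qed measurable

text \<open>The Gaussian factor tames the coordinate of \<open>x\<close> by itself: the difference
  to \<open>y\<close> is bounded after multiplication by the density, and adding back
  \<open>y\<close> costs a multiple of the density.\<close>

lemma gauss_pdf_mult_integrable:
  assumes i: "i < n" and v: "0 < v"
  shows "integrable Q (\<lambda>x. gauss_pdf n (a \<cdot>\<^sub>v x) v y * (a * vec_index x i))"
proof -
  have "integrable Q (\<lambda>x. gauss_pdf n (a \<cdot>\<^sub>v x) v y * (a * vec_index x i - vec_index y i)
      + vec_index y i * gauss_pdf n (a \<cdot>\<^sub>v x) v y)"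
    by (intro Bochner_Integration.integrable_add gauss_pdf_diff_integrable i v integrable_mult_right gauss_pdf_integrable)
  then show ?thesis by (simp add: algebra_simps)
qed

text \<open>Tweedie's formula in one coordinate. The kernel's derivative is the kernel times
  \<open>(a * vec_index x i - vec_index y i) / v\<close>; dividing its integral by the mixture turns
  the first summand into the posterior mean.\<close>

lemma partial_deriv_ln_mixture:
  assumes i: "i < n" and v: "0 < v"
  shows "partial_deriv n i (\<lambda>y. ln (mixture n Q a v y)) y = (mixture_mean n Q a v i y - vec_index y i) / v"
proof -
  let ?y = "\<lambda>u. y + u \<cdot>\<^sub>v unit_vec n i"
  have y0: "gauss_pdf n m v (?y 0) = gauss_pdf n m v y" for m
    by (rule gauss_pdf_cong) (use i in \<open>auto simp: unit_vec_def\<close>)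
  have yi: "vec_index (?y u) i = vec_index y i + u" for u using i by (simp add: unit_vec_def)
  have D: "((\<lambda>u. mixture n Q a v (?y u)) has_real_derivative
    (\<integral>x. gauss_pdf n (a \<cdot>\<^sub>v x) v (?y 0) * ((a * vec_index x i - (vec_index y i + 0)) / v) \<partial>Q)) (at 0)"
    unfolding mixture_def
  proof (rule has_real_derivative_integral[where C = "sqrt v * (1 / sqrt (2 * pi * (sqrt v)\<^sup>2)) ^ n / v"])
    fix u x assume "x \<in> space Q"
    then have "dim_vec x = n" by (simp only: space_Q carrier_vecD)
    then have x: "vec_index (a \<cdot>\<^sub>v x) i = a * vec_index x i" using i by simp
    show "((\<lambda>u. gauss_pdf n (a \<cdot>\<^sub>v x) v (?y u)) has_real_derivative
      gauss_pdf n (a \<cdot>\<^sub>v x) v (?y u) * ((a * vec_index x i - (vec_index y i + u)) / v)) (at u)"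
      using gauss_pdf_has_derivative[OF i v, of "a \<cdot>\<^sub>v x" y u] unfolding x .
    have "\<bar>gauss_pdf n (a \<cdot>\<^sub>v x) v (?y u) * (a * vec_index x i - (vec_index y i + u))\<bar>
      \<le> sqrt v * (1 / sqrt (2 * pi * (sqrt v)\<^sup>2)) ^ n"
      using gauss_pdf_mult_le[OF i v, of "?y u" "a \<cdot>\<^sub>v x"] unfolding x yi
      by (simp only: abs_mult abs_of_nonneg[OF gauss_pdf_nonneg] mult.commute abs_minus_commute)
    from divide_right_mono[OF this, of v] v
    show "\<bar>gauss_pdf n (a \<cdot>\<^sub>v x) v (?y u) * ((a * vec_index x i - (vec_index y i + u)) / v)\<bar>
      \<le> sqrt v * (1 / sqrt (2 * pi * (sqrt v)\<^sup>2)) ^ n / v"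
      by (simp add: abs_mult)
  qed (auto intro: gauss_pdf_integrable)
  have m0: "mixture n Q a v (?y 0) = mixture n Q a v y" by (simp only: mixture_def y0)
  have "((\<lambda>u. ln (mixture n Q a v (?y u))) has_real_derivative
     (\<integral>x. gauss_pdf n (a \<cdot>\<^sub>v x) v (?y 0) * ((a * vec_index x i - (vec_index y i + 0)) / v) \<partial>Q)
       / mixture n Q a v (?y 0)) (at 0)"
    using D mixture_pos[OF v] by (auto intro!: derivative_eq_intros simp: less_imp_neq[symmetric])
  then have "partial_deriv n i (\<lambda>y. ln (mixture n Q a v y)) y =
    (\<integral>x. gauss_pdf n (a \<cdot>\<^sub>v x) v y * ((a * vec_index x i - vec_index y i) / v) \<partial>Q) / mixture n Q a v y"
    unfolding partial_deriv_def m0 y0 by (intro DERIV_imp_deriv) simp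
  also have "(\<integral>x. gauss_pdf n (a \<cdot>\<^sub>v x) v y * ((a * vec_index x i - vec_index y i) / v) \<partial>Q)
     = ((\<integral>x. gauss_pdf n (a \<cdot>\<^sub>v x) v y * (a * vec_index x i) \<partial>Q) - vec_index y i * mixture n Q a v y) / v"
  proof -
    have "(\<integral>x. gauss_pdf n (a \<cdot>\<^sub>v x) v y * ((a * vec_index x i - vec_index y i) / v) \<partial>Q) =
      (\<integral>x. (gauss_pdf n (a \<cdot>\<^sub>v x) v y * (a * vec_index x i) - vec_index y i * gauss_pdf n (a \<cdot>\<^sub>v x) v y) / v \<partial>Q)"
      by (intro Bochner_Integration.integral_cong refl) (simp add: algebra_simps)
    also have "\<dots> = ((\<integral>x. gauss_pdf n (a \<cdot>\<^sub>v x) v y * (a * vec_index x i) \<partial>Q)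
        - (\<integral>x. vec_index y i * gauss_pdf n (a \<cdot>\<^sub>v x) v y \<partial>Q)) / v"
      unfolding integral_divide_zero
      by (subst Bochner_Integration.integral_diff)
        (auto intro: gauss_pdf_mult_integrable[OF i v] gauss_pdf_integrable integrable_mult_right)
    finally show ?thesis unfolding mixture_def integral_mult_right_zero .
  qed
  also have "\<dots> / mixture n Q a v y = (mixture_mean n Q a v i y - vec_index y i) / v"
  proof -
    have *: "((I - c * M) / v) / M = (I / M - c) / v" if "M \<noteq> 0" for I c M :: real
      using that v by (simp add: field_simps)
    show ?thesis
      unfolding mixture_mean_def by (rule *) (use mixture_pos[OF v, of a y] in simp)
  qed
  finally show ?thesis .
qed

lemma grad_ln_mixture:
  assumes "0 < v"
  shows "grad n (\<lambda>y. ln (mixture n Q a v y)) y =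
    Matrix.vec n (\<lambda>i. (mixture_mean n Q a v i y - vec_index y i) / v)"
  unfolding grad_def by (intro eq_vecI) (simp_all add: partial_deriv_ln_mixture[OF _ assms])

end

lemma vec_prob_return: "x \<in> carrier_vec n \<Longrightarrow> vec_prob (return (lborel_vec n) x) n"
  unfolding vec_prob_def vec_prob_axioms_def by (simp add: prob_space_return)

text \<open>A single Gaussian is the mixture over a point mass, so the mixture formula applies with
  the scaled point as posterior mean.\<close>

lemma grad_ln_gauss_pdf:
  assumes x: "x \<in> carrier_vec n" and v: "0 < v"
  shows "grad n (\<lambda>y. ln (gauss_pdf n (a \<cdot>\<^sub>v x) v y)) y = Matrix.vec n (\<lambda>i. (a * vec_index x i - vec_index y i) / v)"
proof -
  interpret vec_prob "return (lborel_vec n) x" n using x by (rule vec_prob_return)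
  have [measurable]: "(\<lambda>x. gauss_pdf n (a \<cdot>\<^sub>v x) v y) \<in> borel_measurable (lborel_vec n)" for y
    by (subst measurable_cong_sets[OF sets_Q[symmetric] refl]) (rule gauss_pdf_smult_measurable)
  have m: "mixture n (return (lborel_vec n) x) a v y = gauss_pdf n (a \<cdot>\<^sub>v x) v y" for y
    unfolding mixture_def by (rule integral_return) (simp_all add: x)
  have mm: "mixture_mean n (return (lborel_vec n) x) a v i y = a * vec_index x i" for i y
  proof -
    have "(\<integral>x. gauss_pdf n (a \<cdot>\<^sub>v x) v y * (a * vec_index x i) \<partial>return (lborel_vec n) x)
      = gauss_pdf n (a \<cdot>\<^sub>v x) v y * (a * vec_index x i)"
      by (rule integral_return) (simp_all add: x)
    then show ?thesis
      using gauss_pdf_pos[OF v, of n "a \<cdot>\<^sub>v x" y] unfolding mixture_mean_def m by simp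
  qed
  from grad_ln_mixture[OF v, of a y] show ?thesis by (simp only: m mm)
qed

section \<open>The diffusion as a channel\<close>

locale time_window =
  fixes D :: nat and t0 T :: real
  assumes t0_pos: "0 < t0" and t0_less: "t0 < T"
begin

definition \<nu> :: "real measure" where "\<nu> = restrict_space lborel {t0..T}"

definition \<mu> :: "(real \<times> rvec) measure" where "\<mu> = \<nu> \<Otimes>\<^sub>M lborel_vec D"

text \<open>Conditional score, marginal score and frozen score all have the form (prediction -
  y)/h(t). Hence y cancels in every difference, and a squared error of predictions is left with the
  weight 1/h(t)^2. This weight and the factor 1/(T - t0) of the time average are absorbed
  here.\<close>

definition kern :: "rvec \<Rightarrow> real \<times> rvec \<Rightarrow> real" where
  "kern x w = gauss_pdf D (alpha (fst w) \<cdot>\<^sub>v x) (hvar (fst w)) (snd w) / ((T - t0) * (hvar (fst w))\<^sup>2)"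

definition signal :: "nat \<Rightarrow> rvec \<Rightarrow> real \<times> rvec \<Rightarrow> real" where
  "signal i x w = alpha (fst w) * vec_index x i"

lemma space_\<nu> [simp]: "space \<nu> = {t0..T}" by (simp add: \<nu>_def space_restrict_space)

lemma space_\<mu>: "space \<mu> = {t0..T} \<times> carrier_vec D" by (simp add: \<mu>_def space_pair_measure)

lemma \<mu>_cases: assumes "w \<in> space \<mu>" obtains t y where "w = (t, y)" "t0 \<le> t" "t \<le> T" "0 < t" "y \<in> carrier_vec D"
  using assms t0_pos unfolding space_\<mu> by (cases w) force

lemma borel_measurable_\<nu>: "f \<in> borel_measurable borel \<Longrightarrow> f \<in> borel_measurable \<nu>"
  unfolding \<nu>_def by (rule measurable_restrict_space1) simp

lemma fst_measurable [measurable]: "fst \<in> borel_measurable \<mu>"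
  unfolding \<mu>_def by (rule measurable_compose[OF measurable_fst borel_measurable_\<nu>]) simp

lemma snd_measurable [measurable]: "snd \<in> \<mu> \<rightarrow>\<^sub>M lborel_vec D"
  unfolding \<mu>_def by (rule measurable_snd)

lemma alpha_measurable [measurable]: "alpha \<in> borel_measurable borel"
  unfolding alpha_def[abs_def] by measurable

lemma hvar_measurable [measurable]: "hvar \<in> borel_measurable borel"
  unfolding hvar_def[abs_def] by measurable

lemma sigma_finite_\<nu>: "sigma_finite_measure \<nu>"
  unfolding \<nu>_def by (rule sigma_finite_measure_restrict_space) (auto intro: sigma_finite_lborel)

sublocale mu: sigma_finite_measure \<mu>
  unfolding \<mu>_def by (rule sigma_finite_pair_measure[OF sigma_finite_\<nu> sigma_finite_lborel_vec])

lemma nn_integral_\<mu>: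
  assumes "f \<in> borel_measurable \<mu>"
  shows "(\<integral>\<^sup>+w. f w \<partial>\<mu>) = (\<integral>\<^sup>+t. (\<integral>\<^sup>+y. f (t, y) \<partial>lborel_vec D) \<partial>\<nu>)"
  unfolding \<mu>_def
  by (rule sigma_finite_measure.nn_integral_fst[OF sigma_finite_lborel_vec, symmetric])
    (use assms in \<open>simp only: \<mu>_def\<close>)

lemma time_avg_\<nu>:
  assumes "\<And>t. t0 \<le> t \<Longrightarrow> t \<le> T \<Longrightarrow> F t = G t" and "G \<in> borel_measurable \<nu>"
  shows "time_avg t0 T F = (\<integral>\<^sup>+t. ennreal (1 / (T - t0)) * G t \<partial>\<nu>)"
proof -
  have "(\<integral>\<^sup>+t\<in>{t0..T}. F t \<partial>lborel) = (\<integral>\<^sup>+t\<in>{t0..T}. G t \<partial>lborel)"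
    by (intro nn_integral_cong) (simp add: assms(1) indicator_def)
  also have "\<dots> = (\<integral>\<^sup>+t. G t \<partial>\<nu>)"
    unfolding \<nu>_def by (rule nn_integral_restrict_space[symmetric]) simp
  finally show ?thesis unfolding time_avg_def by (simp add: nn_integral_cmult assms(2))
qed

text \<open>Weights of order 1/t^2 cost 1/t0 for every horizon: the denominator t0 (T - t0) of the
  final bound comes from here.\<close>

lemma nn_integral_\<nu>_le:
  assumes "\<And>t. t0 \<le> t \<Longrightarrow> t \<le> T \<Longrightarrow> w t \<le> C / t\<^sup>2" and C: "0 \<le> C"
  shows "(\<integral>\<^sup>+t. ennreal (w t / (T - t0)) \<partial>\<nu>) \<le> ennreal (C / (t0 * (T - t0)))"
proof -
  have "(\<integral>\<^sup>+t. ennreal (w t / (T - t0)) \<partial>\<nu>) \<le> (\<integral>\<^sup>+t. ennreal (C / (T - t0)) * ennreal (1 / t\<^sup>2) \<partial>\<nu>)"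
  proof (rule nn_integral_mono)
    fix t assume "t \<in> space \<nu>"
    then have t: "t0 \<le> t" "t \<le> T" by auto
    have "w t / (T - t0) \<le> (C / t\<^sup>2) / (T - t0)"
      using assms(1)[OF t] t0_less by (intro divide_right_mono) auto
    also have "\<dots> = C / (T - t0) * (1 / t\<^sup>2)" by simp
    finally show "ennreal (w t / (T - t0)) \<le> ennreal (C / (T - t0)) * ennreal (1 / t\<^sup>2)"
      using C t0_less by (subst ennreal_mult[symmetric]) (auto intro: ennreal_leI)
  qed
  also have "\<dots> = ennreal (C / (T - t0)) * (\<integral>\<^sup>+t. ennreal (1 / t\<^sup>2) \<partial>\<nu>)"
    by (rule nn_integral_cmult) (rule borel_measurable_\<nu>, measurable)
  also have "(\<integral>\<^sup>+t. ennreal (1 / t\<^sup>2) \<partial>\<nu>) = (\<integral>\<^sup>+t. ennreal (1 / t\<^sup>2) * indicator {t0..T} t \<partial>lborel)"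
    unfolding \<nu>_def by (rule nn_integral_restrict_space) simp
  also have "ennreal (C / (T - t0)) * \<dots> \<le> ennreal (C / (T - t0)) * ennreal (1 / t0)"
    using nn_integral_inverse_square_le[of t0 T] t0_pos t0_less by (intro mult_left_mono) auto
  also have "\<dots> = ennreal (C / (t0 * (T - t0)))"
    using C t0_less t0_pos by (subst ennreal_mult[symmetric]) (auto simp: mult.commute)
  finally show ?thesis .
qed

lemma kern_nonneg: "0 \<le> kern x w"
  unfolding kern_def using t0_less by (intro divide_nonneg_nonneg gauss_pdf_nonneg) auto

lemma kern_pos: assumes "w \<in> space \<mu>" shows "0 < kern x w"
  using assms
proof (rule \<mu>_cases)
  fix t y assume "w = (t, y)" "0 < t"
  then show ?thesis unfolding kern_def
    using t0_less hvar_pos[of t] by (intro divide_pos_pos gauss_pdf_pos) auto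
qed

lemma gauss_pdf_channel_measurable:
  assumes [measurable_cong]: "sets N = sets (lborel_vec D)"
  shows "(\<lambda>(x, w). gauss_pdf D (alpha (fst w) \<cdot>\<^sub>v x) (hvar (fst w)) (snd w)) \<in> borel_measurable (N \<Otimes>\<^sub>M \<mu>)"
  unfolding split_beta'
proof (rule gauss_pdf_measurable)
  fix i assume i: "i < D"
  have "(\<lambda>xw. alpha (fst (snd xw)) * vec_index (fst xw) i) \<in> borel_measurable (N \<Otimes>\<^sub>M \<mu>)" by measurable
  then show "(\<lambda>xw. vec_index (alpha (fst (snd xw)) \<cdot>\<^sub>v fst xw) i) \<in> borel_measurable (N \<Otimes>\<^sub>M \<mu>)"
  proof (rule measurable_cong[THEN iffD1, rotated])
    fix xw assume "xw \<in> space (N \<Otimes>\<^sub>M \<mu>)"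
    then have "fst xw \<in> carrier_vec D"
      using sets_eq_imp_space_eq[OF assms] by (simp only: space_pair_measure mem_Times_iff space_lborel_vec)
    then have "dim_vec (fst xw) = D" by (rule carrier_vecD)
    then show "alpha (fst (snd xw)) * vec_index (fst xw) i = vec_index (alpha (fst (snd xw)) \<cdot>\<^sub>v fst xw) i"
      using i by simp
  qed
qed measurable

lemma kern_measurable:
  assumes "sets N = sets (lborel_vec D)"
  shows "(\<lambda>(x, w). kern x w) \<in> borel_measurable (N \<Otimes>\<^sub>M \<mu>)"
proof -
  have [measurable]: "(\<lambda>xw. gauss_pdf D (alpha (fst (snd xw)) \<cdot>\<^sub>v fst xw) (hvar (fst (snd xw))) (snd (snd xw)))
     \<in> borel_measurable (N \<Otimes>\<^sub>M \<mu>)"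
    using gauss_pdf_channel_measurable[OF assms] by (simp only: split_beta')
  show ?thesis unfolding kern_def split_beta' by measurable
qed

lemma signal_measurable:
  assumes [measurable_cong]: "sets N = sets (lborel_vec D)"
  shows "(\<lambda>(x, w). signal i x w) \<in> borel_measurable (N \<Otimes>\<^sub>M \<mu>)"
  unfolding signal_def split_beta' by measurable

lemma kern_measurable_snd: "x \<in> carrier_vec D \<Longrightarrow> kern x \<in> borel_measurable \<mu>"
  using measurable_Pair2[OF kern_measurable[OF refl], of x] by simp

lemma nn_integral_kern:
  assumes c [measurable]: "c \<in> borel_measurable borel" and c0: "\<And>t. t0 \<le> t \<Longrightarrow> t \<le> T \<Longrightarrow> 0 \<le> c t"
    and x: "x \<in> carrier_vec D"
  shows "(\<integral>\<^sup>+w. ennreal (kern x w * c (fst w)) \<partial>\<mu>) = (\<integral>\<^sup>+t. ennreal ((c t / (hvar t)\<^sup>2) / (T - t0)) \<partial>\<nu>)"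
proof -
  have [measurable]: "kern x \<in> borel_measurable \<mu>" by (rule kern_measurable_snd[OF x])
  have "(\<integral>\<^sup>+w. ennreal (kern x w * c (fst w)) \<partial>\<mu>) = (\<integral>\<^sup>+t. (\<integral>\<^sup>+y. ennreal (kern x (t, y) * c t) \<partial>lborel_vec D) \<partial>\<nu>)"
    by (simp add: nn_integral_\<mu>)
  also have "\<dots> = (\<integral>\<^sup>+t. ennreal ((c t / (hvar t)\<^sup>2) / (T - t0)) \<partial>\<nu>)"
  proof (rule nn_integral_cong)
    fix t assume "t \<in> space \<nu>"
    then have t: "t0 \<le> t" "t \<le> T" "0 < t" using t0_pos by auto
    have "(\<integral>\<^sup>+y. ennreal (kern x (t, y) * c t) \<partial>lborel_vec D) =
      (\<integral>\<^sup>+y. ennreal ((c t / (hvar t)\<^sup>2) / (T - t0)) * ennreal (gauss_pdf D (alpha t \<cdot>\<^sub>v x) (hvar t) y) \<partial>lborel_vec D)"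
      using c0[OF t(1,2)] t0_less
      by (intro nn_integral_cong, subst ennreal_mult[symmetric]) (auto simp: kern_def gauss_pdf_nonneg mult_ac)
    also have "\<dots> = ennreal ((c t / (hvar t)\<^sup>2) / (T - t0))"
      using hvar_pos[OF t(3)] by (simp add: nn_integral_cmult nn_integral_gauss_pdf)
    finally show "(\<integral>\<^sup>+y. ennreal (kern x (t, y) * c t) \<partial>lborel_vec D) = ennreal ((c t / (hvar t)\<^sup>2) / (T - t0))" .
  qed
  finally show ?thesis .
qed

lemma nn_integral_kern_le:
  assumes "c \<in> borel_measurable borel" "\<And>t. t0 \<le> t \<Longrightarrow> t \<le> T \<Longrightarrow> 0 \<le> c t"
    and x: "x \<in> carrier_vec D"
    and "\<And>t. 0 < t \<Longrightarrow> c t / (hvar t)\<^sup>2 \<le> C / t\<^sup>2" "0 \<le> C"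
  shows "(\<integral>\<^sup>+w. ennreal (kern x w * c (fst w)) \<partial>\<mu>) \<le> ennreal (C / (t0 * (T - t0)))"
proof -
  have "(\<integral>\<^sup>+w. ennreal (kern x w * c (fst w)) \<partial>\<mu>) = (\<integral>\<^sup>+t. ennreal ((c t / (hvar t)\<^sup>2) / (T - t0)) \<partial>\<nu>)"
    by (rule nn_integral_kern) fact+
  also have "\<dots> \<le> ennreal (C / (t0 * (T - t0)))"
    using assms(4,5) t0_pos by (intro nn_integral_\<nu>_le) auto
  finally show ?thesis .
qed

text \<open>At each time the space integral is the L1 distance of two Gaussians, after which
  \<open>inverse_hvar_square_min_le\<close> handles the time weight. The point \<open>x\<close> may
  lie far outside the ball of radius \<open>R\<close>; the factor in \<open>vnorm x\<close> pays for
  that.\<close>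

lemma nn_integral_kern_diff_le:
  assumes x: "x \<in> carrier_vec D" and x': "x' \<in> carrier_vec D" "(vnorm x')\<^sup>2 \<le> R\<^sup>2"
    and R: "0 < R" "R \<le> exp \<Lambda>" and \<Lambda>: "1 \<le> \<Lambda>" and K: "0 \<le> K"
  shows "(\<integral>\<^sup>+w. ennreal (\<bar>kern x w - kern x' w\<bar> * (K\<^sup>2 + (alpha (fst w))\<^sup>2 * R\<^sup>2)) \<partial>\<mu>)
    \<le> ennreal (288 * (K\<^sup>2 + R\<^sup>2) * \<Lambda>\<^sup>2 / (t0 * (T - t0)) * (1 + (vnorm x)\<^sup>2 / R\<^sup>2))"
proof -
  have [measurable]: "kern x \<in> borel_measurable \<mu>" "kern x' \<in> borel_measurable \<mu>"
    by (rule kern_measurable_snd, fact)+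
  \<comment> \<open>The squared distance of the two points is at most \<open>R\<^sup>2 * s\<close>.
    Since \<open>s\<close> is at least 1, it may be replaced by its square there, and it can be
    pulled out of the minimum later. Its factor 2 turns 144 into 288.\<close>
  define s where "s = 2 * (1 + (vnorm x)\<^sup>2 / R\<^sup>2)"
  have s: "1 \<le> s" unfolding s_def by simp
  have dist: "sqrt (\<Sum>i<D. (vec_index (c \<cdot>\<^sub>v x) i - vec_index (c \<cdot>\<^sub>v x') i)\<^sup>2) \<le> c * (R * s)" if "0 \<le> c" for c
  proof -
    have "(\<Sum>i<D. (vec_index (c \<cdot>\<^sub>v x) i - vec_index (c \<cdot>\<^sub>v x') i)\<^sup>2) = c\<^sup>2 * (\<Sum>i<D. (vec_index x i - vec_index x' i)\<^sup>2)"
      unfolding sum_distrib_left using carrier_vecD[OF x] carrier_vecD[OF x'(1)]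
      by (intro sum.cong refl) (simp add: power_mult_distrib right_diff_distrib[symmetric])
    also have "\<dots> \<le> c\<^sup>2 * (2 * (vnorm x)\<^sup>2 + 2 * (vnorm x')\<^sup>2)"
      unfolding vnorm_square[OF x] vnorm_square[OF x'(1)] by (intro mult_left_mono sum_square_diff_le) simp
    also have "\<dots> \<le> c\<^sup>2 * (2 * (vnorm x)\<^sup>2 + 2 * R\<^sup>2)"
      using x'(2) by (intro mult_left_mono) auto
    also have "2 * (vnorm x)\<^sup>2 + 2 * R\<^sup>2 = R\<^sup>2 * s" using R by (simp add: s_def field_simps)
    also have "c\<^sup>2 * (R\<^sup>2 * s) \<le> c\<^sup>2 * (R\<^sup>2 * s\<^sup>2)"
      using s by (intro mult_left_mono) (auto simp: power2_eq_square)
    also have "\<dots> = (c * (R * s))\<^sup>2" by (simp add: power_mult_distrib)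
    finally show ?thesis using that R s by (intro real_le_lsqrt) auto
  qed
  have "(\<integral>\<^sup>+w. ennreal (\<bar>kern x w - kern x' w\<bar> * (K\<^sup>2 + (alpha (fst w))\<^sup>2 * R\<^sup>2)) \<partial>\<mu>)
     = (\<integral>\<^sup>+t. (\<integral>\<^sup>+y. ennreal (\<bar>kern x (t, y) - kern x' (t, y)\<bar> * (K\<^sup>2 + (alpha t)\<^sup>2 * R\<^sup>2)) \<partial>lborel_vec D) \<partial>\<nu>)"
    by (simp add: nn_integral_\<mu>)
  also have "\<dots> \<le> (\<integral>\<^sup>+t. ennreal (((K\<^sup>2 + R\<^sup>2) * (s * (min 2 (alpha t * R / sqrt (hvar t)) / (hvar t)\<^sup>2))) / (T - t0)) \<partial>\<nu>)"
  proof (rule nn_integral_mono)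
    fix t assume "t \<in> space \<nu>"
    then have t: "t0 \<le> t" "t \<le> T" "0 < t" using t0_pos by auto
    define h where "h = hvar t"
    have h: "0 < h" using hvar_pos[OF t(3)] by (simp add: h_def)
    define c where "c = (K\<^sup>2 + (alpha t)\<^sup>2 * R\<^sup>2) / ((T - t0) * h\<^sup>2)"
    have c0: "0 \<le> c" using t0_less unfolding c_def by (intro divide_nonneg_nonneg) auto
    let ?\<phi> = "\<lambda>x. gauss_pdf D (alpha t \<cdot>\<^sub>v x) h"
    have "\<bar>kern x (t, y) - kern x' (t, y)\<bar> * (K\<^sup>2 + (alpha t)\<^sup>2 * R\<^sup>2) = c * \<bar>?\<phi> x y - ?\<phi> x' y\<bar>" for y
      unfolding kern_def fst_conv snd_conv diff_divide_distrib[symmetric] abs_divide c_def h_def[symmetric]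
      using t0_less h by (simp add: abs_mult mult.commute)
    then have "(\<integral>\<^sup>+y. ennreal (\<bar>kern x (t, y) - kern x' (t, y)\<bar> * (K\<^sup>2 + (alpha t)\<^sup>2 * R\<^sup>2)) \<partial>lborel_vec D)
      = (\<integral>\<^sup>+y. ennreal (c * \<bar>?\<phi> x y - ?\<phi> x' y\<bar>) \<partial>lborel_vec D)" by simp
    also have "\<dots> = ennreal (\<integral>y. c * \<bar>?\<phi> x y - ?\<phi> x' y\<bar> \<partial>lborel_vec D)"
      using c0 gauss_pdf_L1_distance(1)[OF h, of D] by (intro nn_integral_eq_integral) auto
    also have "\<dots> = ennreal (c * (\<integral>y. \<bar>?\<phi> x y - ?\<phi> x' y\<bar> \<partial>lborel_vec D))" by simp
    also have "\<dots> \<le> ennreal (c * (s * min 2 (alpha t * R / sqrt h)))"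
    proof (intro ennreal_leI mult_left_mono c0)
      have "(\<integral>y. \<bar>?\<phi> x y - ?\<phi> x' y\<bar> \<partial>lborel_vec D)
        \<le> min 2 (sqrt (\<Sum>i<D. (vec_index (alpha t \<cdot>\<^sub>v x) i - vec_index (alpha t \<cdot>\<^sub>v x') i)\<^sup>2) / sqrt h)"
        by (rule gauss_pdf_L1_distance(2)[OF h])
      also have "\<dots> \<le> min 2 (alpha t * (R * s) / sqrt h)"
        using dist[of "alpha t"] alpha_pos[of t] h by (intro min.mono divide_right_mono) auto
      also have "\<dots> \<le> min (s * 2) (s * (alpha t * R / sqrt h))"
        using s by (intro min.mono) (auto simp: mult_ac)
      also have "\<dots> = s * min 2 (alpha t * R / sqrt h)"
        using s by (simp add: min_mult_distrib_left)
      finally show "(\<integral>y. \<bar>?\<phi> x y - ?\<phi> x' y\<bar> \<partial>lborel_vec D) \<le> s * min 2 (alpha t * R / sqrt h)" .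
    qed
    also have "\<dots> \<le> ennreal (((K\<^sup>2 + R\<^sup>2) / ((T - t0) * h\<^sup>2)) * (s * min 2 (alpha t * R / sqrt h)))"
    proof (intro ennreal_leI mult_right_mono)
      have "(alpha t)\<^sup>2 * R\<^sup>2 \<le> 1 * R\<^sup>2"
        using alpha_le_1[of t] alpha_pos[of t] t by (intro mult_right_mono) (auto simp: power_le_one)
      then show "c \<le> (K\<^sup>2 + R\<^sup>2) / ((T - t0) * h\<^sup>2)"
        unfolding c_def using t0_less by (intro divide_right_mono) auto
      show "0 \<le> s * min 2 (alpha t * R / sqrt h)"
        using s alpha_pos[of t] R h by (intro mult_nonneg_nonneg) auto
    qed
    also have "((K\<^sup>2 + R\<^sup>2) / ((T - t0) * h\<^sup>2)) * (s * min 2 (alpha t * R / sqrt h)) =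
      ((K\<^sup>2 + R\<^sup>2) * (s * (min 2 (alpha t * R / sqrt h) / h\<^sup>2))) / (T - t0)" by simp
    finally show "(\<integral>\<^sup>+y. ennreal (\<bar>kern x (t, y) - kern x' (t, y)\<bar> * (K\<^sup>2 + (alpha t)\<^sup>2 * R\<^sup>2)) \<partial>lborel_vec D)
      \<le> ennreal (((K\<^sup>2 + R\<^sup>2) * (s * (min 2 (alpha t * R / sqrt (hvar t)) / (hvar t)\<^sup>2))) / (T - t0))"
      unfolding h_def .
  qed
  also have "\<dots> \<le> ennreal ((K\<^sup>2 + R\<^sup>2) * (s * (144 * \<Lambda>\<^sup>2)) / (t0 * (T - t0)))"
  proof (rule nn_integral_\<nu>_le)
    fix t assume "t0 \<le> t" "t \<le> T"
    then have "0 < t" using t0_pos by linarith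
    from inverse_hvar_square_min_le[OF this _ R(2) \<Lambda>] R(1)
    have "(K\<^sup>2 + R\<^sup>2) * (s * (min 2 (alpha t * R / sqrt (hvar t)) / (hvar t)\<^sup>2))
       \<le> (K\<^sup>2 + R\<^sup>2) * (s * (144 * \<Lambda>\<^sup>2 / t\<^sup>2))"
      using s by (intro mult_left_mono) auto
    then show "(K\<^sup>2 + R\<^sup>2) * (s * (min 2 (alpha t * R / sqrt (hvar t)) / (hvar t)\<^sup>2))
       \<le> (K\<^sup>2 + R\<^sup>2) * (s * (144 * \<Lambda>\<^sup>2)) / t\<^sup>2" by simp
  qed (use s in auto)
  also have "(K\<^sup>2 + R\<^sup>2) * (s * (144 * \<Lambda>\<^sup>2)) / (t0 * (T - t0)) =
     288 * (K\<^sup>2 + R\<^sup>2) * \<Lambda>\<^sup>2 / (t0 * (T - t0)) * (1 + (vnorm x)\<^sup>2 / R\<^sup>2)"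
    by (simp add: s_def field_simps)
  finally show ?thesis .
qed

end

section \<open>The diffusion satisfies the conditions of the abstract channel\<close>

lemma vnorm_measurable [measurable]: "vnorm \<in> borel_measurable (lborel_vec n)"
proof -
  have "(\<lambda>v. sqrt (\<Sum>i<n. (vec_index v i)\<^sup>2)) \<in> borel_measurable (lborel_vec n)" by measurable
  then show ?thesis
  proof (rule measurable_cong[THEN iffD1, rotated])
    fix v :: rvec assume "v \<in> space (lborel_vec n)"
    then have "v \<in> carrier_vec n" by (simp only: space_lborel_vec)
    from vnorm_square[OF this] show "sqrt (\<Sum>i<n. (vec_index v i)\<^sup>2) = vnorm v"
      using vnorm_nonneg[of v] by (metis real_sqrt_unique)
  qed
qed

locale diffusion = time_window D t0 T + vec_prob P D for D t0 T P +
  fixes U :: "rvec set" and R K \<Lambda> :: real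
  assumes second_moment: "\<And>i. i < D \<Longrightarrow> integrable P (\<lambda>x. (vec_index x i)\<^sup>2)"
    and U_meas: "U \<in> sets P" and U_half: "1 / 2 \<le> measure P U"
    and U_norm: "\<And>x. x \<in> U \<Longrightarrow> (vnorm x)\<^sup>2 \<le> R\<^sup>2"
    and R_pos: "0 < R" and R_le: "R \<le> exp \<Lambda>" and \<Lambda>_ge: "1 \<le> \<Lambda>" and K_ge: "0 \<le> K"
begin

text \<open>The 288 is dictated by \<open>nn_integral_kern_diff_le\<close>; the other channel bounds
  hold with smaller constants and are enlarged to share this one.\<close>

definition B :: real where "B = 288 * (K\<^sup>2 + R\<^sup>2) * \<Lambda>\<^sup>2 / (t0 * (T - t0))"

definition \<rho> :: "real \<times> rvec \<Rightarrow> real" where "\<rho> w = (alpha (fst w))\<^sup>2 * R\<^sup>2"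

definition \<theta> :: "rvec \<Rightarrow> real" where "\<theta> x = (vnorm x)\<^sup>2 / R\<^sup>2"

lemma le_B:
  assumes "C \<le> 288 * (K\<^sup>2 + R\<^sup>2)"
  shows "C / (t0 * (T - t0)) \<le> B"
proof -
  have "288 * (K\<^sup>2 + R\<^sup>2) * 1 \<le> 288 * (K\<^sup>2 + R\<^sup>2) * \<Lambda>\<^sup>2"
    using \<Lambda>_ge by (intro mult_left_mono) auto
  then show ?thesis unfolding B_def
    using assms t0_pos t0_less by (intro divide_right_mono) auto
qed

lemma integrable_kern_mult:
  assumes w: "w \<in> space \<mu>" and f: "integrable P f"
  shows "integrable P (\<lambda>x. kern x w * f x)"
proof -
  define C where "C = (1 / sqrt (2 * pi * (sqrt (hvar (fst w)))\<^sup>2)) ^ D / ((T - t0) * (hvar (fst w))\<^sup>2)"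
  have le: "kern x w \<le> C" for x
    unfolding kern_def C_def using t0_less by (intro divide_right_mono gauss_pdf_le) auto
  show ?thesis
  proof (rule Bochner_Integration.integrable_bound)
    show "integrable P (\<lambda>x. C * f x)" using f by simp
    have [measurable]: "(\<lambda>x. kern x w) \<in> borel_measurable P"
      unfolding kern_def by measurable
    show "(\<lambda>x. kern x w * f x) \<in> borel_measurable P"
      using borel_measurable_integrable[OF f] by measurable
    show "AE x in P. norm (kern x w * f x) \<le> norm (C * f x)"
    proof (rule AE_I2)
      fix x
      have "\<bar>kern x w\<bar> \<le> \<bar>C\<bar>" using le[of x] kern_nonneg[of x w] by linarith
      then show "norm (kern x w * f x) \<le> norm (C * f x)" by (simp add: abs_mult mult_right_mono)
    qed
  qed
qed

lemma second_moment_all: "integrable P (\<lambda>x. (vec_index x i)\<^sup>2)"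
proof (cases "i < D")
  case False
  have "integrable P (\<lambda>x. (vec_index (Matrix.vec D (\<lambda>_. 0)) i :: real)\<^sup>2)" by simp
  then show ?thesis
  proof (rule Bochner_Integration.integrable_cong[THEN iffD1, rotated 2])
    fix x assume "x \<in> space P"
    then have "x \<in> carrier_vec D" by (simp only: space_Q)
    from vec_index_beyond[OF this, of i] False
    show "(vec_index (Matrix.vec D (\<lambda>_. 0)) i)\<^sup>2 = (vec_index x i)\<^sup>2" by simp
  qed simp
qed (rule second_moment)

lemma first_moment_all: "integrable P (\<lambda>x. vec_index x i)"
proof (rule Bochner_Integration.integrable_bound)
  show "integrable P (\<lambda>x. 1 + (vec_index x i)\<^sup>2)" using second_moment_all[of i] by simp
  have "\<bar>z\<bar> \<le> 1 + z\<^sup>2" for z :: real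
  proof -
    have "2 * \<bar>z\<bar> \<le> 1 + z\<^sup>2" using zero_le_power2[of "\<bar>z\<bar> - 1"] by (simp add: power2_diff)
    then show ?thesis by linarith
  qed
  then show "AE x in P. norm (vec_index x i) \<le> norm (1 + (vec_index x i)\<^sup>2)"
    by (intro AE_I2) simp
qed measurable

lemma vnorm_meas_P: "vnorm \<in> borel_measurable P"
  by (subst measurable_cong_sets[OF sets_Q refl]) (rule vnorm_measurable)

lemma signal_square_sum:
  assumes "x \<in> carrier_vec D"
  shows "(\<Sum>i<D. (signal i x w)\<^sup>2) = (alpha (fst w))\<^sup>2 * (vnorm x)\<^sup>2"
  unfolding signal_def vnorm_square[OF assms] by (simp add: power_mult_distrib sum_distrib_left)

text \<open>The average of 1/h(t)^2 over the window stays above 1 however long the window is, so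
  this bound serves as the finite constant \<open>\<kappa>\<close> and not as part of
  \<open>B\<close>.\<close>

lemma nn_integral_kern_const_le:
  assumes x: "x \<in> carrier_vec D"
  shows "(\<integral>\<^sup>+w. ennreal (kern x w) \<partial>\<mu>) \<le> ennreal (1 / (hvar t0)\<^sup>2)"
proof -
  have "(\<integral>\<^sup>+w. ennreal (kern x w) \<partial>\<mu>) = (\<integral>\<^sup>+w. ennreal (kern x w * 1) \<partial>\<mu>)" by simp
  also have "\<dots> = (\<integral>\<^sup>+t. ennreal ((1 / (hvar t)\<^sup>2) / (T - t0)) \<partial>\<nu>)"
    by (rule nn_integral_kern) (auto simp: x)
  also have "\<dots> \<le> (\<integral>\<^sup>+t. ennreal (1 / (hvar t0)\<^sup>2 / (T - t0)) \<partial>\<nu>)"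
  proof (rule nn_integral_mono)
    fix t assume "t \<in> space \<nu>"
    then have t: "t0 \<le> t" by simp
    then have "hvar t0 \<le> hvar t" by (simp add: hvar_def)
    then have "(hvar t0)\<^sup>2 \<le> (hvar t)\<^sup>2" using hvar_pos[OF t0_pos] by (intro power_mono) auto
    then show "ennreal ((1 / (hvar t)\<^sup>2) / (T - t0)) \<le> ennreal (1 / (hvar t0)\<^sup>2 / (T - t0))"
      using hvar_pos[OF t0_pos] hvar_pos[of t] t0_less t0_pos t
      by (intro ennreal_leI divide_right_mono divide_left_mono mult_pos_pos) auto
  qed
  also have "\<dots> = ennreal (1 / (hvar t0)\<^sup>2 / (T - t0)) * ennreal (T - t0)"
  proof -
    have "emeasure \<nu> (space \<nu>) = emeasure lborel {t0..T}"
      unfolding space_\<nu> unfolding \<nu>_def by (rule emeasure_restrict_space) auto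
    then show ?thesis using t0_less by simp
  qed
  also have "\<dots> = ennreal (1 / (hvar t0)\<^sup>2)"
    using t0_less by (subst ennreal_mult[symmetric]) auto
  finally show ?thesis .
qed

text \<open>Apart from the total mass and the kernel difference, each bound concerns a time weight
  c(t)/h(t)^2 whose numerator contains \<alpha>(t) or its square, hence is O(1/t^2). The mixed
  product of \<open>K\<close> and \<open>R\<close> is split by AM-GM into
  \<open>K\<^sup>2 + R\<^sup>2\<close>.\<close>

sublocale denoising_channel P \<mu> kern signal D U \<rho> \<theta> K B "1 / (hvar t0)\<^sup>2"
proof
  have carrier: "x \<in> carrier_vec D" if "x \<in> space P" for x using that by (simp only: space_Q)
  have Ucarrier: "x \<in> carrier_vec D" if "x \<in> U" for x
    using sets.sets_into_space[OF U_meas] carrier that by (rule_tac carrier) (rule subsetD)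
  show "(\<lambda>(x, w). kern x w) \<in> borel_measurable (P \<Otimes>\<^sub>M \<mu>)" by (rule kern_measurable) simp
  show "(\<lambda>(x, w). signal i x w) \<in> borel_measurable (P \<Otimes>\<^sub>M \<mu>)" for i by (rule signal_measurable) simp
  show "0 < kern x w" if "w \<in> space \<mu>" for x w using that by (rule kern_pos)
  show "U \<in> sets P" "1 / 2 \<le> prob U" by (fact U_meas U_half)+
  show "integrable P (\<lambda>x. kern x w)" if "w \<in> space \<mu>" for w
    using integrable_kern_mult[OF that, of "\<lambda>_. 1"] by simp
  show "integrable P (\<lambda>x. kern x w * signal i x w)" if "w \<in> space \<mu>" for w i
    unfolding signal_def by (intro integrable_kern_mult[OF that] integrable_mult_right first_moment_all)
  show "integrable P (\<lambda>x. kern x w * (signal i x w)\<^sup>2)" if "w \<in> space \<mu>" for w i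
    unfolding signal_def power_mult_distrib
    by (intro integrable_kern_mult[OF that] integrable_mult_right second_moment_all)
  show "\<rho> \<in> borel_measurable \<mu>" unfolding \<rho>_def[abs_def] by measurable
  show "0 \<le> \<rho> w" for w by (simp add: \<rho>_def)
  show "(\<Sum>i<D. (signal i x w)\<^sup>2) \<le> \<rho> w" if "x \<in> U" for x w
    unfolding signal_square_sum[OF Ucarrier[OF that]] \<rho>_def using U_norm[OF that] by (intro mult_left_mono) auto
  show "\<theta> \<in> borel_measurable P" unfolding \<theta>_def[abs_def] using vnorm_meas_P by measurable
  show "0 \<le> \<theta> x" for x by (simp add: \<theta>_def)
  show "\<theta> x \<le> 1" if "x \<in> U" for x using U_norm[OF that] R_pos by (simp add: \<theta>_def)
  show "0 \<le> K" "0 \<le> 1 / (hvar t0)\<^sup>2" by (auto simp: K_ge)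
  have KR: "0 < K\<^sup>2 + R\<^sup>2" using R_pos by (simp add: add_nonneg_pos)
  show B0: "0 < B" unfolding B_def
    using \<Lambda>_ge t0_pos t0_less KR by (intro divide_pos_pos mult_pos_pos) auto
  show "(\<integral>\<^sup>+w. ennreal (kern x w) \<partial>\<mu>) \<le> ennreal (1 / (hvar t0)\<^sup>2)" if "x \<in> space P" for x
    by (rule nn_integral_kern_const_le[OF carrier[OF that]])
  show "(\<integral>\<^sup>+w. ennreal (kern x w * \<rho> w) \<partial>\<mu>) \<le> ennreal B" if "x \<in> space P" for x
  proof -
    have "(\<integral>\<^sup>+w. ennreal (kern x w * ((alpha (fst w))\<^sup>2 * R\<^sup>2)) \<partial>\<mu>) \<le> ennreal ((4 * R\<^sup>2) / (t0 * (T - t0)))"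
    proof (rule nn_integral_kern_le[OF _ _ carrier[OF that]])
      show "(alpha t)\<^sup>2 * R\<^sup>2 / (hvar t)\<^sup>2 \<le> 4 * R\<^sup>2 / t\<^sup>2" if "0 < t" for t
        using mult_right_mono[OF alpha_square_div_hvar_square_le[OF that], of "R\<^sup>2"] by simp
    qed auto
    also have "\<dots> \<le> ennreal B" by (intro ennreal_leI le_B) auto
    finally show ?thesis unfolding \<rho>_def .
  qed
  show "(\<integral>\<^sup>+w. ennreal (kern x w * (\<Sum>i<D. (signal i x w)\<^sup>2)) \<partial>\<mu>) \<le> ennreal (B * \<theta> x)"
    if "x \<in> space P" for x
  proof -
    have "(\<integral>\<^sup>+w. ennreal (kern x w * ((alpha (fst w))\<^sup>2 * (vnorm x)\<^sup>2)) \<partial>\<mu>) \<le> ennreal ((4 * (vnorm x)\<^sup>2) / (t0 * (T - t0)))"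
    proof (rule nn_integral_kern_le[OF _ _ carrier[OF that]])
      show "(alpha t)\<^sup>2 * (vnorm x)\<^sup>2 / (hvar t)\<^sup>2 \<le> 4 * (vnorm x)\<^sup>2 / t\<^sup>2" if "0 < t" for t
        using mult_right_mono[OF alpha_square_div_hvar_square_le[OF that], of "(vnorm x)\<^sup>2"] by simp
    qed auto
    also have "(4 * (vnorm x)\<^sup>2) / (t0 * (T - t0)) = (4 * R\<^sup>2) / (t0 * (T - t0)) * \<theta> x"
      using R_pos by (simp add: \<theta>_def)
    also have "ennreal \<dots> \<le> ennreal (B * \<theta> x)"
      by (intro ennreal_leI mult_right_mono le_B) (auto simp: \<theta>_def)
    finally show ?thesis unfolding signal_square_sum[OF carrier[OF that]] .
  qed
  show "(\<integral>\<^sup>+w. ennreal (\<bar>kern x w - kern x' w\<bar> * (K\<^sup>2 + \<rho> w)) \<partial>\<mu>) \<le> ennreal (B * (1 + \<theta> x))"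
    if "x \<in> space P" "x' \<in> U" for x x'
    unfolding \<rho>_def B_def \<theta>_def
    by (rule nn_integral_kern_diff_le[OF carrier[OF that(1)] Ucarrier[OF that(2)] U_norm[OF that(2)] R_pos R_le \<Lambda>_ge K_ge])
  show "(\<integral>\<^sup>+w. ennreal (kern x w * (K * sqrt (\<rho> w))) \<partial>\<mu>) \<le> ennreal B" if "x \<in> space P" for x
  proof -
    have s: "sqrt (\<rho> w) = alpha (fst w) * R" for w
      using alpha_pos[of "fst w"] R_pos by (simp add: \<rho>_def real_sqrt_mult)
    have "(\<integral>\<^sup>+w. ennreal (kern x w * (K * (alpha (fst w) * R))) \<partial>\<mu>) \<le> ennreal ((4 * (K * R)) / (t0 * (T - t0)))"
    proof (rule nn_integral_kern_le[OF _ _ carrier[OF that]])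
      show "K * (alpha t * R) / (hvar t)\<^sup>2 \<le> 4 * (K * R) / t\<^sup>2" if "0 < t" for t
        using mult_right_mono[OF alpha_div_hvar_square_le[OF that], of "K * R"] K_ge R_pos by (simp add: mult_ac)
      show "0 \<le> K * (alpha t * R)" for t using K_ge R_pos alpha_pos[of t] by simp
    qed (use K_ge R_pos in auto)
    also have "\<dots> \<le> ennreal B"
    proof (intro ennreal_leI le_B)
      have "2 * (K * R) \<le> K\<^sup>2 + R\<^sup>2" using zero_le_power2[of "K - R"] by (simp add: power2_diff)
      then have "4 * (K * R) \<le> 2 * (K\<^sup>2 + R\<^sup>2)" by simp
      also have "\<dots> \<le> 288 * (K\<^sup>2 + R\<^sup>2)" by (intro mult_right_mono) auto
      finally show "4 * (K * R) \<le> 288 * (K\<^sup>2 + R\<^sup>2)" .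
    qed
    finally show ?thesis unfolding s .
  qed
qed

end

section \<open>Denoising loss and score risk as integrals over the channel\<close>

lemma (in time_window) time_avg_nn_integral:
  assumes "\<And>t. t0 \<le> t \<Longrightarrow> t \<le> T \<Longrightarrow> F t = (\<integral>\<^sup>+y. ennreal (\<phi> (t, y)) \<partial>lborel_vec D)"
    and [measurable]: "\<phi> \<in> borel_measurable \<mu>"
  shows "time_avg t0 T F = (\<integral>\<^sup>+w. ennreal (\<phi> w / (T - t0)) \<partial>\<mu>)"
proof -
  have m: "(\<lambda>w. ennreal (\<phi> w)) \<in> borel_measurable \<mu>" by measurable
  have G: "(\<lambda>t. \<integral>\<^sup>+y. ennreal (\<phi> (t, y)) \<partial>lborel_vec D) \<in> borel_measurable \<nu>"
    using sigma_finite_measure.borel_measurable_nn_integral_fst[OF sigma_finite_lborel_vec m[unfolded \<mu>_def]] .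
  have "time_avg t0 T F = (\<integral>\<^sup>+t. ennreal (1 / (T - t0)) * (\<integral>\<^sup>+y. ennreal (\<phi> (t, y)) \<partial>lborel_vec D) \<partial>\<nu>)"
    by (rule time_avg_\<nu>[OF assms(1) G])
  also have "\<dots> = ennreal (1 / (T - t0)) * (\<integral>\<^sup>+w. ennreal (\<phi> w) \<partial>\<mu>)"
    by (simp add: nn_integral_cmult[OF G] nn_integral_\<mu>[OF m])
  also have "\<dots> = (\<integral>\<^sup>+w. ennreal (1 / (T - t0)) * ennreal (\<phi> w) \<partial>\<mu>)"
    by (rule nn_integral_cmult[symmetric]) (rule m)
  also have "\<dots> = (\<integral>\<^sup>+w. ennreal (\<phi> w / (T - t0)) \<partial>\<mu>)"
    using t0_less by (intro nn_integral_cong) (simp add: ennreal_mult'[symmetric])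
  finally show ?thesis .
qed

lemma (in time_window) measurable_section:
  assumes "\<phi> \<in> borel_measurable \<mu>" "t0 \<le> t" "t \<le> T"
  shows "(\<lambda>y. \<phi> (t, y)) \<in> borel_measurable (lborel_vec D)"
  using assms unfolding \<mu>_def by (intro measurable_Pair2) auto

lemma (in time_window) denoising_loss_eq:
  assumes x: "x \<in> carrier_vec D"
    and G: "\<And>i. G i \<in> borel_measurable \<mu>"
    and s: "\<And>t y. t0 \<le> t \<Longrightarrow> t \<le> T \<Longrightarrow> y \<in> carrier_vec D \<Longrightarrow>
      s y t = Matrix.vec D (\<lambda>i. (G i (t, y) - vec_index y i) / hvar t)"
  shows "denoising_loss D t0 T x s = (\<integral>\<^sup>+w. ennreal (kern x w * (\<Sum>i<D. (signal i x w - G i w)\<^sup>2)) \<partial>\<mu>)"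
proof -
  note [measurable] = G kern_measurable_snd[OF x]
  define q where "q w = (\<Sum>i<D. (signal i x w - G i w)\<^sup>2)" for w
  have [measurable]: "q \<in> borel_measurable \<mu>" unfolding q_def[abs_def] signal_def by measurable
  define \<phi> where "\<phi> w = (T - t0) * (kern x w * q w)" for w
  have "denoising_loss D t0 T x s = (\<integral>\<^sup>+w. ennreal (\<phi> w / (T - t0)) \<partial>\<mu>)"
    unfolding denoising_loss_def
  proof (rule time_avg_nn_integral)
    show "\<phi> \<in> borel_measurable \<mu>" unfolding \<phi>_def[abs_def] by measurable
    fix t assume t: "t0 \<le> t" "t \<le> T"
    have h: "0 < hvar t" using hvar_pos t t0_pos by auto
    have "(\<integral>\<^sup>+y. ennreal ((vnorm (grad D (\<lambda>y. ln (trans_pdf D t x y)) y - s y t))\<^sup>2) \<partial>gaussian D (alpha t \<cdot>\<^sub>v x) (hvar t))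
      = (\<integral>\<^sup>+y. ennreal (q (t, y) / (hvar t)\<^sup>2) \<partial>gaussian D (alpha t \<cdot>\<^sub>v x) (hvar t))"
    proof (rule nn_integral_cong)
      fix y assume "y \<in> space (gaussian D (alpha t \<cdot>\<^sub>v x) (hvar t))"
      then have y: "y \<in> carrier_vec D" by (simp only: gaussian_def space_density space_lborel_vec)
      have "grad D (\<lambda>y. ln (trans_pdf D t x y)) y - s y t =
        Matrix.vec D (\<lambda>i. (signal i x (t, y) - G i (t, y)) / hvar t)"
        unfolding trans_pdf_def grad_ln_gauss_pdf[OF x h] s[OF t y] signal_def
        by (intro eq_vecI) (auto simp: diff_divide_distrib)
      also have "(vnorm \<dots>)\<^sup>2 = q (t, y) / (hvar t)\<^sup>2"
        by (subst vnorm_square[of _ D]) (auto simp: q_def power_divide sum_divide_distrib)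
      finally show "ennreal ((vnorm (grad D (\<lambda>y. ln (trans_pdf D t x y)) y - s y t))\<^sup>2) = ennreal (q (t, y) / (hvar t)\<^sup>2)"
        by simp
    qed
    also have "\<dots> = (\<integral>\<^sup>+y. ennreal (gauss_pdf D (alpha t \<cdot>\<^sub>v x) (hvar t) y) * ennreal (q (t, y) / (hvar t)\<^sup>2) \<partial>lborel_vec D)"
      unfolding gaussian_def using measurable_section[of q, OF _ t]
      by (intro nn_integral_density) auto
    also have "\<dots> = (\<integral>\<^sup>+y. ennreal (\<phi> (t, y)) \<partial>lborel_vec D)"
      using t0_less h
      by (intro nn_integral_cong, subst ennreal_mult[symmetric])
        (auto simp: \<phi>_def kern_def q_def gauss_pdf_nonneg sum_nonneg)
    finally show "(\<integral>\<^sup>+y. ennreal ((vnorm (grad D (\<lambda>y. ln (trans_pdf D t x y)) y - s y t))\<^sup>2) \<partial>gaussian D (alpha t \<cdot>\<^sub>v x) (hvar t))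
      = (\<integral>\<^sup>+y. ennreal (\<phi> (t, y)) \<partial>lborel_vec D)" .
  qed
  then show ?thesis using t0_less by (simp add: \<phi>_def q_def)
qed

context diffusion
begin

lemma evidence_mixture: "evidence (space P) w = mixture D P (alpha (fst w)) (hvar (fst w)) (snd w) / ((T - t0) * (hvar (fst w))\<^sup>2)"
proof -
  have "evidence (space P) w = (\<integral>x. gauss_pdf D (alpha (fst w) \<cdot>\<^sub>v x) (hvar (fst w)) (snd w) / ((T - t0) * (hvar (fst w))\<^sup>2) \<partial>P)"
    unfolding evidence_def kern_def by (intro Bochner_Integration.integral_cong) simp_all
  then show ?thesis by (simp only: mixture_def integral_divide_zero)
qed

text \<open>For fixed \<open>w\<close> the time-dependent constant in \<open>kern\<close> cancels in
  the ratio; this identifies the channel's posterior mean with the one in Tweedie's formula.\<close>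

lemma post_mean_mixture:
  assumes w: "w \<in> space \<mu>"
  shows "post_mean (space P) i w = mixture_mean D P (alpha (fst w)) (hvar (fst w)) i (snd w)"
proof -
  have c: "(T - t0) * (hvar (fst w))\<^sup>2 \<noteq> 0"
    using w t0_less hvar_pos[of "fst w"] by (rule_tac \<mu>_cases[OF w]) auto
  have "(\<integral>x. indicat_real (space P) x * (kern x w * signal i x w) \<partial>P) =
    (\<integral>x. gauss_pdf D (alpha (fst w) \<cdot>\<^sub>v x) (hvar (fst w)) (snd w) * (alpha (fst w) * vec_index x i) / ((T - t0) * (hvar (fst w))\<^sup>2) \<partial>P)"
    unfolding kern_def signal_def by (intro Bochner_Integration.integral_cong) simp_all
  also have "\<dots> = (\<integral>x. gauss_pdf D (alpha (fst w) \<cdot>\<^sub>v x) (hvar (fst w)) (snd w) * (alpha (fst w) * vec_index x i) \<partial>P)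
     / ((T - t0) * (hvar (fst w))\<^sup>2)" by (rule integral_divide_zero)
  finally show ?thesis unfolding post_mean_def evidence_mixture mixture_mean_def using c by simp
qed

text \<open>The marginal density at time \<open>t\<close> is the evidence of the whole space times
  \<open>(T - t0) * (hvar t)\<^sup>2\<close>, which cancels the weight of the integrand and the
  prefactor of the time average.\<close>

lemma time_avg_marginal:
  assumes q [measurable]: "q \<in> borel_measurable \<mu>" and q0: "\<And>w. 0 \<le> q w"
    and F: "\<And>t. t0 \<le> t \<Longrightarrow> t \<le> T \<Longrightarrow> F t = (\<integral>\<^sup>+y. ennreal (q (t, y) / (hvar t)\<^sup>2) \<partial>marginal_law D P t)"
  shows "time_avg t0 T F = (\<integral>\<^sup>+w. ennreal (evidence (space P) w * q w) \<partial>\<mu>)"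
proof -
  have [measurable]: "evidence (space P) \<in> borel_measurable \<mu>" by (rule evidence_measurable) simp
  define \<phi> where "\<phi> w = (T - t0) * (evidence (space P) w * q w)" for w
  have "time_avg t0 T F = (\<integral>\<^sup>+w. ennreal (\<phi> w / (T - t0)) \<partial>\<mu>)"
  proof (rule time_avg_nn_integral)
    show "\<phi> \<in> borel_measurable \<mu>" unfolding \<phi>_def[abs_def] by measurable
    fix t assume t: "t0 \<le> t" "t \<le> T"
    have h: "0 < hvar t" using hvar_pos t t0_pos by auto
    have mp: "marginal_pdf D P t y = (T - t0) * (hvar t)\<^sup>2 * evidence (space P) (t, y)" for y
      unfolding evidence_mixture marginal_pdf_def trans_pdf_def mixture_def using t0_less h by simp
    have [measurable]: "(\<lambda>y. evidence (space P) (t, y)) \<in> borel_measurable (lborel_vec D)"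
      by (rule measurable_section[OF _ t]) measurable
    have [measurable]: "(\<lambda>y. q (t, y)) \<in> borel_measurable (lborel_vec D)"
      by (rule measurable_section[OF _ t]) measurable
    have "F t = (\<integral>\<^sup>+y. ennreal (marginal_pdf D P t y) * ennreal (q (t, y) / (hvar t)\<^sup>2) \<partial>lborel_vec D)"
      unfolding F[OF t] marginal_law_def mp by (rule nn_integral_density) measurable
    also have "\<dots> = (\<integral>\<^sup>+y. ennreal (\<phi> (t, y)) \<partial>lborel_vec D)"
    proof (rule nn_integral_cong)
      fix y
      have "ennreal (marginal_pdf D P t y) * ennreal (q (t, y) / (hvar t)\<^sup>2)
         = ennreal (marginal_pdf D P t y * (q (t, y) / (hvar t)\<^sup>2))"
        using q0[of "(t, y)"] by (intro ennreal_mult''[symmetric]) simp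
      also have "marginal_pdf D P t y * (q (t, y) / (hvar t)\<^sup>2) = \<phi> (t, y)"
        unfolding mp \<phi>_def using h by simp
      finally show "ennreal (marginal_pdf D P t y) * ennreal (q (t, y) / (hvar t)\<^sup>2) = ennreal (\<phi> (t, y))" .
    qed
    finally show "F t = (\<integral>\<^sup>+y. ennreal (\<phi> (t, y)) \<partial>lborel_vec D)" .
  qed
  then show ?thesis using t0_less by (simp add: \<phi>_def)
qed

lemma score_eq:
  assumes "t0 \<le> t"
  shows "score D P y t = Matrix.vec D (\<lambda>i. (mixture_mean D P (alpha t) (hvar t) i y - vec_index y i) / hvar t)"
proof -
  have h: "0 < hvar t" using hvar_pos assms t0_pos by auto
  have "marginal_pdf D P t = mixture D P (alpha t) (hvar t)"
    by (rule ext) (simp add: marginal_pdf_def trans_pdf_def mixture_def)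
  then show ?thesis unfolding score_def using grad_ln_mixture[OF h] by simp
qed

lemma score_risk_eq:
  assumes G: "\<And>i. G i \<in> borel_measurable \<mu>"
    and s: "\<And>t y. t0 \<le> t \<Longrightarrow> t \<le> T \<Longrightarrow> y \<in> carrier_vec D \<Longrightarrow>
      s y t = Matrix.vec D (\<lambda>i. (G i (t, y) - vec_index y i) / hvar t)"
  shows "score_risk D t0 T P s =
    (\<integral>\<^sup>+w. ennreal (evidence (space P) w * (\<Sum>i<D. (G i w - post_mean (space P) i w)\<^sup>2)) \<partial>\<mu>)"
  unfolding score_risk_def
proof (rule time_avg_marginal)
  note [measurable] = G post_mean_measurable[OF sets.top]
  show "(\<lambda>w. \<Sum>i<D. (G i w - post_mean (space P) i w)\<^sup>2) \<in> borel_measurable \<mu>" by measurable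
  show "0 \<le> (\<Sum>i<D. (G i w - post_mean (space P) i w)\<^sup>2)" for w by (simp add: sum_nonneg)
  fix t assume t: "t0 \<le> t" "t \<le> T"
  show "(\<integral>\<^sup>+y. ennreal ((vnorm (s y t - score D P y t))\<^sup>2) \<partial>marginal_law D P t) =
    (\<integral>\<^sup>+y. ennreal ((\<Sum>i<D. (G i (t, y) - post_mean (space P) i (t, y))\<^sup>2) / (hvar t)\<^sup>2) \<partial>marginal_law D P t)"
  proof (rule nn_integral_cong)
    fix y assume "y \<in> space (marginal_law D P t)"
    then have y: "y \<in> carrier_vec D" by (simp only: marginal_law_def space_density space_lborel_vec)
    then have w: "(t, y) \<in> space \<mu>" using t by (simp add: space_\<mu>)
    have "s y t - score D P y t = Matrix.vec D (\<lambda>i. (G i (t, y) - post_mean (space P) i (t, y)) / hvar t)"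
      unfolding s[OF t y] score_eq[OF t(1)] post_mean_mixture[OF w]
      by (intro eq_vecI) (auto simp: diff_divide_distrib)
    also have "(vnorm \<dots>)\<^sup>2 = (\<Sum>i<D. (G i (t, y) - post_mean (space P) i (t, y))\<^sup>2) / (hvar t)\<^sup>2"
      by (subst vnorm_square[of _ D]) (auto simp: power_divide sum_divide_distrib)
    finally show "ennreal ((vnorm (s y t - score D P y t))\<^sup>2) =
      ennreal ((\<Sum>i<D. (G i (t, y) - post_mean (space P) i (t, y))\<^sup>2) / (hvar t)\<^sup>2)" by simp
  qed
qed

end

lemma orthonormal_cols_sum:
  assumes V: "orthonormal_cols D d V" and u: "u \<in> carrier_vec d"
  shows "(\<Sum>i<D. (vec_index (V *\<^sub>v u) i)\<^sup>2) = (\<Sum>i<d. (vec_index u i)\<^sup>2)"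
proof -
  have Vc: "V \<in> carrier_mat D d" and VV: "transpose_mat V * V = 1\<^sub>m d"
    using V by (auto simp: orthonormal_cols_def)
  have Vu: "V *\<^sub>v u \<in> carrier_vec D" using Vc u by simp
  have tV: "transpose_mat V \<in> carrier_mat d D" using Vc by simp
  have "scalar_prod (V *\<^sub>v u) (V *\<^sub>v u) = scalar_prod (transpose_mat V *\<^sub>v (V *\<^sub>v u)) u"
    using transpose_vec_mult_scalar[OF Vc u Vu] by simp
  also have "transpose_mat V *\<^sub>v (V *\<^sub>v u) = (transpose_mat V * V) *\<^sub>v u"
    by (rule assoc_mult_mat_vec[OF tV Vc u, symmetric])
  also have "\<dots> = u" unfolding VV using u by simp
  finally have "(vnorm (V *\<^sub>v u))\<^sup>2 = (vnorm u)\<^sup>2" by (simp add: vnorm_def)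
  then show ?thesis by (simp add: vnorm_square[OF Vu] vnorm_square[OF u])
qed

section \<open>Networks, comparator and frozen scores\<close>

lemma measurable_vec_index:
  assumes "g \<in> N \<rightarrow>\<^sub>M lborel_vec n" shows "(\<lambda>w. vec_index (g w) i) \<in> borel_measurable N"
  by (rule measurable_compose[OF assms vec_index_measurable])

lemma measurable_vec_carrier:
  assumes "g \<in> N \<rightarrow>\<^sub>M lborel_vec n" "w \<in> space N" shows "g w \<in> carrier_vec n"
  using measurable_space[OF assms] by (simp only: space_lborel_vec)

lemma mult_mat_vec_index_measurable:
  assumes g: "g \<in> N \<rightarrow>\<^sub>M lborel_vec n"
  shows "(\<lambda>w. vec_index (M *\<^sub>v g w) i) \<in> borel_measurable N"
proof (cases "i < dim_row M")
  case True
  note [measurable] = measurable_vec_index[OF g]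
  have "(\<lambda>w. \<Sum>k\<in>{0..<n}. vec_index (row M i) k * vec_index (g w) k) \<in> borel_measurable N" by measurable
  then show ?thesis
  proof (rule measurable_cong[THEN iffD1, rotated])
    fix w assume "w \<in> space N"
    then have "dim_vec (g w) = n" by (rule carrier_vecD[OF measurable_vec_carrier[OF g]])
    then show "(\<Sum>k\<in>{0..<n}. vec_index (row M i) k * vec_index (g w) k) = vec_index (M *\<^sub>v g w) i"
      using True by (simp add: scalar_prod_def)
  qed
next
  case False
  have "vec_index (M *\<^sub>v g w) i = vec_index (Matrix.vec (dim_row M) (\<lambda>_. 0)) i" for w
    by (rule vec_index_beyond[OF carrier_vecI]) (use False in simp_all)
  then show ?thesis by simp
qed

lemma mult_mat_vec_measurable:
  assumes g: "g \<in> N \<rightarrow>\<^sub>M lborel_vec n" and "dim_row M = m"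
  shows "(\<lambda>w. M *\<^sub>v g w) \<in> N \<rightarrow>\<^sub>M lborel_vec m"
  by (rule measurable_vecI[OF mult_mat_vec_index_measurable[OF g] carrier_vecI]) (simp add: assms(2))

lemma net_eval_measurable:
  assumes "net_shape W n m ls" "g \<in> N \<rightarrow>\<^sub>M lborel_vec n"
  shows "(\<lambda>w. net_eval ls (g w)) \<in> N \<rightarrow>\<^sub>M lborel_vec m"
  using assms
proof (induction W n m ls arbitrary: g rule: net_shape.induct)
  case (2 M n m W b)
  then have W: "dim_row W = m" "b \<in> carrier_vec m" by auto
  have [measurable]: "(\<lambda>w. vec_index (W *\<^sub>v g w) i) \<in> borel_measurable N" for i
    by (rule mult_mat_vec_index_measurable[OF 2(2)])
  have "(\<lambda>w. W *\<^sub>v g w + b) \<in> N \<rightarrow>\<^sub>M lborel_vec m"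
  proof (rule measurable_vecI)
    fix i assume "i < m"
    then have "(\<lambda>w. vec_index (W *\<^sub>v g w + b) i) = (\<lambda>w. vec_index (W *\<^sub>v g w) i + vec_index b i)"
      using carrier_vecD[OF W(2)] by auto
    then show "(\<lambda>w. vec_index (W *\<^sub>v g w + b) i) \<in> borel_measurable N" by simp
  qed (rule carrier_vecI, simp add: carrier_vecD[OF W(2)])
  then show ?case by simp
next
  case (3 M n m W b l ls)
  then have b: "dim_vec b = dim_row W" using carrier_vecD by auto
  have [measurable]: "(\<lambda>w. vec_index (W *\<^sub>v g w) i) \<in> borel_measurable N" for i
    by (rule mult_mat_vec_index_measurable[OF 3(3)])
  have "(\<lambda>w. map_vec (max 0) (W *\<^sub>v g w + b)) \<in> N \<rightarrow>\<^sub>M lborel_vec (dim_row W)"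
  proof (rule measurable_vecI)
    fix i assume "i < dim_row W"
    then have "(\<lambda>w. vec_index (map_vec (max 0) (W *\<^sub>v g w + b)) i) = (\<lambda>w. max 0 (vec_index (W *\<^sub>v g w) i + vec_index b i))"
      using b by auto
    then show "(\<lambda>w. vec_index (map_vec (max 0) (W *\<^sub>v g w + b)) i) \<in> borel_measurable N" by simp
  qed (rule carrier_vecI, simp add: b)
  from 3(1)[OF _ this] 3(2) show ?case by simp
qed simp

text \<open>Prepares the measurability of the comparator in space and time: its score is defined
  through \<open>deriv\<close>, and Tweedie's formula replaces that by ratios of parameter
  integrals.\<close>

lemma mixture_mean_measurable:
  assumes Q: "vec_prob Q n"
    and [measurable]: "a \<in> borel_measurable N" "v \<in> borel_measurable N"
    and y: "\<And>k. k < n \<Longrightarrow> (\<lambda>w. vec_index (y w) k) \<in> borel_measurable N"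
  shows "(\<lambda>w. mixture_mean n Q (a w) (v w) i (y w)) \<in> borel_measurable N"
proof -
  interpret vec_prob Q n by fact
  have [measurable]: "(\<lambda>(w, x). gauss_pdf n (a w \<cdot>\<^sub>v x) (v w) (y w)) \<in> borel_measurable (N \<Otimes>\<^sub>M Q)"
    unfolding split_beta'
  proof (rule gauss_pdf_measurable)
    fix k assume k: "k < n"
    have "(\<lambda>wx. a (fst wx) * vec_index (snd wx) k) \<in> borel_measurable (N \<Otimes>\<^sub>M Q)" by measurable
    then show "(\<lambda>wx. vec_index (a (fst wx) \<cdot>\<^sub>v snd wx) k) \<in> borel_measurable (N \<Otimes>\<^sub>M Q)"
    proof (rule measurable_cong[THEN iffD1, rotated])
      fix wx assume "wx \<in> space (N \<Otimes>\<^sub>M Q)"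
      then have "snd wx \<in> carrier_vec n" by (simp only: space_pair_measure mem_Times_iff space_Q)
      then have "dim_vec (snd wx) = n" by (rule carrier_vecD)
      then show "a (fst wx) * vec_index (snd wx) k = vec_index (a (fst wx) \<cdot>\<^sub>v snd wx) k" using k by simp
    qed
    show "(\<lambda>wx. vec_index (y (fst wx)) k) \<in> borel_measurable (N \<Otimes>\<^sub>M Q)"
      by (rule measurable_compose[OF measurable_fst y[OF k]])
  qed measurable
  show ?thesis unfolding mixture_mean_def mixture_def
    by (intro borel_measurable_divide borel_measurable_lebesgue_integral) (simp_all add: split_beta', measurable)
qed

section \<open>The latent law and its score\<close>

definition latent_law :: "nat \<Rightarrow> (rvec \<Rightarrow> real) \<Rightarrow> rvec measure" where
  "latent_law d pz = density (lborel_vec d) (\<lambda>z. ennreal (pz z))"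

text \<open>Continuity is stated on sequences with the product topology; padding a vector by zeros
  is a measurable map back to sequences.\<close>

lemma continuous_vec_measurable:
  assumes "continuous_vec n F" shows "F \<in> borel_measurable (lborel_vec n)"
proof -
  have "(\<lambda>y :: nat \<Rightarrow> real. F (Matrix.vec n y)) \<in> borel_measurable borel"
    using assms unfolding continuous_vec_def by (rule borel_measurable_continuous_onI)
  moreover have "(\<lambda>v i. if i < n then vec_index v i else 0 :: real) \<in> lborel_vec n \<rightarrow>\<^sub>M borel"
    by (rule measurable_coordinatewise_then_product) simp
  ultimately have "(\<lambda>v. F (Matrix.vec n (\<lambda>i. if i < n then vec_index v i else 0))) \<in> borel_measurable (lborel_vec n)"
    by (rule measurable_compose[rotated])
  then show ?thesis
  proof (rule measurable_cong[THEN iffD1, rotated])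
    fix v :: rvec assume "v \<in> space (lborel_vec n)"
    then have "v \<in> carrier_vec n" by (simp only: space_lborel_vec)
    then have "dim_vec v = n" by (rule carrier_vecD)
    then have "Matrix.vec n (\<lambda>i. if i < n then vec_index v i else 0) = v" by (intro eq_vecI) simp_all
    then show "F (Matrix.vec n (\<lambda>i. if i < n then vec_index v i else 0)) = F v" by simp
  qed
qed

lemma latent_density_measurable: "latent_density d pz \<Longrightarrow> pz \<in> borel_measurable (lborel_vec d)"
  unfolding latent_density_def numeral_2_eq_2 by (auto intro: continuous_vec_measurable)

lemma vec_prob_latent_law:
  assumes "latent_density d pz" shows "vec_prob (latent_law d pz) d"
proof -
  have [measurable]: "pz \<in> borel_measurable (lborel_vec d)" by (rule latent_density_measurable[OF assms])
  have "prob_space (latent_law d pz)"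
  proof (rule prob_spaceI)
    have "emeasure (latent_law d pz) (space (latent_law d pz)) =
      (\<integral>\<^sup>+z. ennreal (pz z) * indicator (space (lborel_vec d)) z \<partial>lborel_vec d)"
      unfolding latent_law_def space_density by (rule emeasure_density) auto
    also have "\<dots> = (\<integral>\<^sup>+z. ennreal (pz z) \<partial>lborel_vec d)"
      by (rule nn_integral_cong) (simp only: indicator_simps mult_1_right)
    finally show "emeasure (latent_law d pz) (space (latent_law d pz)) = 1"
      using assms by (simp add: latent_density_def)
  qed
  then show ?thesis unfolding vec_prob_def vec_prob_axioms_def by (simp add: latent_law_def)
qed

lemma htilde_pos: "0 < \<sigma> \<Longrightarrow> 0 < t \<Longrightarrow> 0 < htilde \<sigma> t"
  unfolding htilde_def using hvar_pos[of t] alpha_pos[of t] by (intro add_pos_pos) auto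

text \<open>The low-dimensional density is a Gaussian mixture over the latent law with variance
  \<open>htilde\<close>, so the same formula gives its score.\<close>

lemma ld_score_index:
  assumes pz: "latent_density d pz" and "0 < \<sigma>" "0 < t" and i: "i < d"
  shows "vec_index (ld_score d pz \<sigma> y t) i =
    (mixture_mean d (latent_law d pz) (alpha t) (htilde \<sigma> t) i y - vec_index y i) / htilde \<sigma> t"
proof -
  interpret vec_prob "latent_law d pz" d by (rule vec_prob_latent_law[OF pz])
  have [measurable]: "pz \<in> borel_measurable (lborel_vec d)" by (rule latent_density_measurable[OF pz])
  have "ld_pdf d pz \<sigma> t y = mixture d (latent_law d pz) (alpha t) (htilde \<sigma> t) y" for y
  proof -
    have [measurable]: "(\<lambda>z. gauss_pdf d (alpha t \<cdot>\<^sub>v z) (htilde \<sigma> t) y) \<in> borel_measurable (lborel_vec d)"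
      by (subst measurable_cong_sets[OF sets_Q[symmetric] refl]) (rule gauss_pdf_smult_measurable)
    have "AE z in lborel_vec d. 0 \<le> pz z"
      using pz by (intro AE_I2) (auto simp: latent_density_def less_imp_le)
    then show ?thesis
      unfolding ld_pdf_def mixture_def latent_law_def
      by (subst integral_density) (auto simp: mult.commute)
  qed
  then have "ld_pdf d pz \<sigma> t = mixture d (latent_law d pz) (alpha t) (htilde \<sigma> t)" by (rule ext)
  then show ?thesis
    unfolding ld_score_def using grad_ln_mixture[OF htilde_pos[OF assms(2,3)], of "alpha t" y] i by simp
qed

context time_window
begin

abbreviation compressed :: "rmat \<Rightarrow> vfield \<Rightarrow> real \<times> rvec \<Rightarrow> rvec" where
  "compressed V f \<equiv> \<lambda>w. f (transpose_mat V *\<^sub>v snd w) (fst w)"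

text \<open>The pseudoinverse is treated as a matrix \<open>X\<close> of unknown shape. The sum in
  \<open>g_target\<close> takes its dimension from the second summand, so an index may exceed
  \<open>d2\<close>; there the entry of the score is the out-of-range default, a constant.\<close>

lemma f_comp_measurable:
  assumes pz: "latent_density d2 pz" and \<sigma>: "0 < \<sigma>" and V: "V \<in> carrier_mat D d1"
  shows "compressed V (f_comp d2 pz \<sigma> A V) \<in> \<mu> \<rightarrow>\<^sub>M lborel_vec d1"
proof -
  define X where "X = pinv (transpose_mat V * A)"
  define u where "u w = X *\<^sub>v (transpose_mat V *\<^sub>v snd w)" for w :: "real \<times> rvec"
  have z: "(\<lambda>w. transpose_mat V *\<^sub>v snd w) \<in> \<mu> \<rightarrow>\<^sub>M lborel_vec d1"
    using V by (intro mult_mat_vec_measurable[OF snd_measurable]) simp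
  have u [measurable]: "(\<lambda>w. vec_index (u w) k) \<in> borel_measurable \<mu>" for k
    unfolding u_def by (rule mult_mat_vec_index_measurable[OF z])
  have [measurable]: "(\<lambda>w. htilde \<sigma> (fst w)) \<in> borel_measurable \<mu>" unfolding htilde_def by measurable
  have ld: "(\<lambda>w. vec_index (hvar (fst w) \<cdot>\<^sub>v ld_score d2 pz \<sigma> (u w) (fst w)) k) \<in> borel_measurable \<mu>" for k
  proof (cases "k < d2")
    case True
    have [measurable]: "(\<lambda>w. mixture_mean d2 (latent_law d2 pz) (alpha (fst w)) (htilde \<sigma> (fst w)) k (u w)) \<in> borel_measurable \<mu>"
      by (rule mixture_mean_measurable[OF vec_prob_latent_law[OF pz]]) measurable
    have "(\<lambda>w. hvar (fst w) * ((mixture_mean d2 (latent_law d2 pz) (alpha (fst w)) (htilde \<sigma> (fst w)) k (u w)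
      - vec_index (u w) k) / htilde \<sigma> (fst w))) \<in> borel_measurable \<mu>" by measurable
    then show ?thesis
    proof (rule measurable_cong[THEN iffD1, rotated])
      fix w assume "w \<in> space \<mu>"
      then have "0 < fst w" by (rule \<mu>_cases) auto
      from ld_score_index[OF pz \<sigma> this True]
      show "hvar (fst w) * ((mixture_mean d2 (latent_law d2 pz) (alpha (fst w)) (htilde \<sigma> (fst w)) k (u w)
        - vec_index (u w) k) / htilde \<sigma> (fst w)) = vec_index (hvar (fst w) \<cdot>\<^sub>v ld_score d2 pz \<sigma> (u w) (fst w)) k"
        using True by (simp add: ld_score_def grad_def)
    qed
  next
    case False
    have "vec_index (hvar (fst w) \<cdot>\<^sub>v ld_score d2 pz \<sigma> (u w) (fst w)) k = vec_index (Matrix.vec d2 (\<lambda>_. 0)) k" for w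
      by (rule vec_index_beyond[OF carrier_vecI]) (use False in \<open>simp_all add: ld_score_def grad_def\<close>)
    then show ?thesis by simp
  qed
  have "(\<lambda>w. g_target d2 pz \<sigma> (u w) (fst w)) \<in> \<mu> \<rightarrow>\<^sub>M lborel_vec (dim_row X)"
  proof (rule measurable_vecI)
    fix k assume "k < dim_row X"
    then have "(\<lambda>w. vec_index (g_target d2 pz \<sigma> (u w) (fst w)) k) =
      (\<lambda>w. vec_index (hvar (fst w) \<cdot>\<^sub>v ld_score d2 pz \<sigma> (u w) (fst w)) k + vec_index (u w) k)"
      unfolding g_target_def by (intro ext index_add_vec(1)) (simp add: u_def)
    with ld[of k] show "(\<lambda>w. vec_index (g_target d2 pz \<sigma> (u w) (fst w)) k) \<in> borel_measurable \<mu>" by simp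
  qed (rule carrier_vecI, simp add: g_target_def u_def)
  then have "(\<lambda>w. (transpose_mat V * A) *\<^sub>v g_target d2 pz \<sigma> (u w) (fst w)) \<in> \<mu> \<rightarrow>\<^sub>M lborel_vec d1"
    by (rule mult_mat_vec_measurable) (use V in simp)
  then show ?thesis unfolding f_comp_def u_def X_def .
qed

lemma relu_class_measurable:
  assumes f: "f \<in> relu_class d1 T' L W J K \<kappa> \<gamma> \<gamma>t" and V: "V \<in> carrier_mat D d1"
  shows "compressed V f \<in> \<mu> \<rightarrow>\<^sub>M lborel_vec d1"
proof -
  obtain ls where shape: "net_shape W (d1 + 1) d1 ls" and fls: "f = (\<lambda>z t. net_eval ls (z @\<^sub>v vec_of_list [t]))"
    using f unfolding relu_class_def by auto
  have z: "(\<lambda>w. transpose_mat V *\<^sub>v snd w) \<in> \<mu> \<rightarrow>\<^sub>M lborel_vec d1"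
    using V by (intro mult_mat_vec_measurable[OF snd_measurable]) simp
  note [measurable] = measurable_vec_index[OF z]
  have d: "dim_vec (transpose_mat V *\<^sub>v y) = d1" for y using V by simp
  have "(\<lambda>w. (transpose_mat V *\<^sub>v snd w) @\<^sub>v vec_of_list [fst w]) \<in> \<mu> \<rightarrow>\<^sub>M lborel_vec (d1 + 1)"
  proof (rule measurable_vecI)
    fix i assume i: "i < d1 + 1"
    have "(\<lambda>w. if i < d1 then vec_index (transpose_mat V *\<^sub>v snd w) i else fst w) \<in> borel_measurable \<mu>"
      by measurable
    also have "(\<lambda>w. if i < d1 then vec_index (transpose_mat V *\<^sub>v snd w) i else fst w) =
      (\<lambda>w. vec_index ((transpose_mat V *\<^sub>v snd w) @\<^sub>v vec_of_list [fst w]) i)"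
      using i V by (intro ext) (auto simp: append_vec_def Let_def vec_of_list_index)
    finally show "(\<lambda>w. vec_index ((transpose_mat V *\<^sub>v snd w) @\<^sub>v vec_of_list [fst w]) i) \<in> borel_measurable \<mu>" .
  qed (rule carrier_vecI, use V in simp)
  from net_eval_measurable[OF shape this] show ?thesis unfolding fls .
qed

definition lifted :: "rmat \<Rightarrow> vfield \<Rightarrow> nat \<Rightarrow> real \<times> rvec \<Rightarrow> real" where
  "lifted V f i w = (if i < D then vec_index (V *\<^sub>v f (transpose_mat V *\<^sub>v snd w) (fst w)) i else 0)"

lemma lifted_measurable:
  assumes "compressed V f \<in> \<mu> \<rightarrow>\<^sub>M lborel_vec d1"
  shows "lifted V f i \<in> borel_measurable \<mu>"
  unfolding lifted_def[abs_def] using mult_mat_vec_index_measurable[OF assms, of V i] by simp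

lemma frozen_score_eq:
  assumes "V \<in> carrier_mat D d1" "y \<in> carrier_vec D"
  shows "frozen_score V f y t = Matrix.vec D (\<lambda>i. (lifted V f i (t, y) - vec_index y i) / hvar t)"
  unfolding frozen_score_def lifted_def using carrier_vecD[OF assms(2)] assms(1)
  by (intro eq_vecI) (auto simp: diff_divide_distrib)

lemma sum_lifted_square:
  assumes V: "orthonormal_cols D d1 V"
    and f: "compressed V f \<in> \<mu> \<rightarrow>\<^sub>M lborel_vec d1" and w: "w \<in> space \<mu>"
  shows "(\<Sum>i<D. (lifted V f i w)\<^sup>2) = (vnorm (f (transpose_mat V *\<^sub>v snd w) (fst w)))\<^sup>2"
  using orthonormal_cols_sum[OF V measurable_vec_carrier[OF f w]]
  by (simp add: lifted_def vnorm_square[OF measurable_vec_carrier[OF f w]])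

lemma sum_lifted_diff_square:
  assumes V: "orthonormal_cols D d1 V"
    and f: "compressed V f \<in> \<mu> \<rightarrow>\<^sub>M lborel_vec d1"
    and g: "compressed V g \<in> \<mu> \<rightarrow>\<^sub>M lborel_vec d1" and w: "w \<in> space \<mu>"
  shows "(\<Sum>i<D. (lifted V f i w - lifted V g i w)\<^sup>2) =
    (vnorm (f (transpose_mat V *\<^sub>v snd w) (fst w) - g (transpose_mat V *\<^sub>v snd w) (fst w)))\<^sup>2"
proof -
  let ?f = "f (transpose_mat V *\<^sub>v snd w) (fst w)" and ?g = "g (transpose_mat V *\<^sub>v snd w) (fst w)"
  have fc: "?f \<in> carrier_vec d1" and gc: "?g \<in> carrier_vec d1"
    using measurable_vec_carrier[OF f w] measurable_vec_carrier[OF g w] by auto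
  have Vc: "V \<in> carrier_mat D d1" using V by (simp add: orthonormal_cols_def)
  have dc: "?f - ?g \<in> carrier_vec d1" using fc gc by simp
  have "lifted V f i w - lifted V g i w = vec_index (V *\<^sub>v (?f - ?g)) i" if "i < D" for i
    using that Vc unfolding mult_minus_distrib_mat_vec[OF Vc fc gc] by (simp add: lifted_def)
  then have "(\<Sum>i<D. (lifted V f i w - lifted V g i w)\<^sup>2) = (\<Sum>i<D. (vec_index (V *\<^sub>v (?f - ?g)) i)\<^sup>2)"
    by (intro sum.cong) auto
  then show ?thesis using orthonormal_cols_sum[OF V dc] by (simp add: vnorm_square[OF dc])
qed

end

context diffusion
begin

lemma score_risk_frozen:
  assumes V: "V \<in> carrier_mat D d1"
    and f: "compressed V f \<in> \<mu> \<rightarrow>\<^sub>M lborel_vec d1"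
  shows "score_risk D t0 T P (frozen_score V f) =
    (\<integral>\<^sup>+w. ennreal (evidence (space P) w * (\<Sum>i<D. (lifted V f i w - post_mean (space P) i w)\<^sup>2)) \<partial>\<mu>)"
  by (rule score_risk_eq) (rule lifted_measurable[OF f], rule frozen_score_eq[OF V])

lemma denoising_loss_frozen:
  assumes V: "V \<in> carrier_mat D d1" and x: "x \<in> carrier_vec D"
    and f: "compressed V f \<in> \<mu> \<rightarrow>\<^sub>M lborel_vec d1"
  shows "denoising_loss D t0 T x (frozen_score V f) =
    (\<integral>\<^sup>+w. ennreal (kern x w * (\<Sum>i<D. (signal i x w - lifted V f i w)\<^sup>2)) \<partial>\<mu>)"
  by (rule denoising_loss_eq[OF x]) (rule lifted_measurable[OF f], rule frozen_score_eq[OF V])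

text \<open>The isometry \<open>V\<close> turns the distance of two latent maps into the distance of
  the lifted predictors, so the first term is an evidence-weighted integral like the two risks. The
  factors 2 come from the squared triangle inequality, applied pointwise.\<close>

lemma score_risk_frozen_triangle:
  assumes V: "orthonormal_cols D d1 V"
    and f: "compressed V f \<in> \<mu> \<rightarrow>\<^sub>M lborel_vec d1"
    and g: "compressed V g \<in> \<mu> \<rightarrow>\<^sub>M lborel_vec d1"
  shows "score_risk D t0 T P (frozen_score V f) \<le>
    2 * time_avg t0 T (\<lambda>t. ennreal (1 / (hvar t)\<^sup>2) *
        (\<integral>\<^sup>+x. ennreal ((vnorm (f (transpose_mat V *\<^sub>v x) t - g (transpose_mat V *\<^sub>v x) t))\<^sup>2) \<partial>marginal_law D P t))
    + 2 * score_risk D t0 T P (frozen_score V g)"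
proof -
  have Vc: "V \<in> carrier_mat D d1" using V by (simp add: orthonormal_cols_def)
  note [measurable] = lifted_measurable[OF f] lifted_measurable[OF g] post_mean_measurable[OF sets.top] evidence_measurable[OF sets.top]
  define q where "q w = (\<Sum>i<D. (lifted V f i w - lifted V g i w)\<^sup>2)" for w
  have [measurable]: "q \<in> borel_measurable \<mu>" unfolding q_def[abs_def] by measurable
  have q0: "0 \<le> q w" for w unfolding q_def by (simp add: sum_nonneg)
  have approx: "time_avg t0 T (\<lambda>t. ennreal (1 / (hvar t)\<^sup>2) *
        (\<integral>\<^sup>+x. ennreal ((vnorm (f (transpose_mat V *\<^sub>v x) t - g (transpose_mat V *\<^sub>v x) t))\<^sup>2) \<partial>marginal_law D P t))
     = (\<integral>\<^sup>+w. ennreal (evidence (space P) w * q w) \<partial>\<mu>)"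
  proof (rule time_avg_marginal)
    fix t assume t: "t0 \<le> t" "t \<le> T"
    have qt: "(\<lambda>y. q (t, y)) \<in> borel_measurable (lborel_vec D)" by (rule measurable_section[OF _ t]) measurable
    have eq: "(\<integral>\<^sup>+x. ennreal ((vnorm (f (transpose_mat V *\<^sub>v x) t - g (transpose_mat V *\<^sub>v x) t))\<^sup>2) \<partial>marginal_law D P t)
      = (\<integral>\<^sup>+x. ennreal (q (t, x)) \<partial>marginal_law D P t)"
    proof (rule nn_integral_cong)
      fix y assume "y \<in> space (marginal_law D P t)"
      then have "y \<in> carrier_vec D" by (simp only: marginal_law_def space_density space_lborel_vec)
      then have w: "(t, y) \<in> space \<mu>" using t by (simp add: space_\<mu>)
      show "ennreal ((vnorm (f (transpose_mat V *\<^sub>v y) t - g (transpose_mat V *\<^sub>v y) t))\<^sup>2) = ennreal (q (t, y))"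
        using sum_lifted_diff_square[OF V f g w] by (simp add: q_def)
    qed
    have "(\<lambda>y. ennreal (q (t, y))) \<in> borel_measurable (marginal_law D P t)"
      using qt unfolding marginal_law_def by simp
    then show "ennreal (1 / (hvar t)\<^sup>2) * (\<integral>\<^sup>+x. ennreal ((vnorm (f (transpose_mat V *\<^sub>v x) t - g (transpose_mat V *\<^sub>v x) t))\<^sup>2) \<partial>marginal_law D P t)
       = (\<integral>\<^sup>+y. ennreal (q (t, y) / (hvar t)\<^sup>2) \<partial>marginal_law D P t)"
      unfolding eq by (simp add: nn_integral_cmult[symmetric] ennreal_mult'[symmetric])
  qed (use q0 in auto)
  have "score_risk D t0 T P (frozen_score V f) \<le>
    (\<integral>\<^sup>+w. 2 * ennreal (evidence (space P) w * q w) +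
        2 * ennreal (evidence (space P) w * (\<Sum>i<D. (lifted V g i w - post_mean (space P) i w)\<^sup>2)) \<partial>\<mu>)"
    unfolding score_risk_frozen[OF Vc f]
  proof (rule nn_integral_mono)
    fix w
    assume w: "w \<in> space \<mu>"
    have e: "0 \<le> evidence (space P) w"
      unfolding evidence_def using kern_nonneg by (intro Bochner_Integration.integral_nonneg) simp
    let ?g = "\<Sum>i<D. (lifted V g i w - post_mean (space P) i w)\<^sup>2"
    have "(lifted V f i w - post_mean (space P) i w)\<^sup>2 \<le>
      2 * (lifted V f i w - lifted V g i w)\<^sup>2 + 2 * (lifted V g i w - post_mean (space P) i w)\<^sup>2" for i
      using zero_le_power2[of "(lifted V f i w - lifted V g i w) - (lifted V g i w - post_mean (space P) i w)"]
      by (simp add: power2_eq_square algebra_simps)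
    then have "(\<Sum>i<D. (lifted V f i w - post_mean (space P) i w)\<^sup>2) \<le> 2 * q w + 2 * ?g"
      unfolding q_def sum_distrib_left sum.distrib[symmetric] by (intro sum_mono)
    from mult_left_mono[OF this e]
    have "evidence (space P) w * (\<Sum>i<D. (lifted V f i w - post_mean (space P) i w)\<^sup>2)
      \<le> 2 * (evidence (space P) w * q w) + 2 * (evidence (space P) w * ?g)" by (simp add: algebra_simps)
    then have "ennreal (evidence (space P) w * (\<Sum>i<D. (lifted V f i w - post_mean (space P) i w)\<^sup>2))
      \<le> ennreal (2 * (evidence (space P) w * q w) + 2 * (evidence (space P) w * ?g))" by (rule ennreal_leI)
    also have "\<dots> = 2 * ennreal (evidence (space P) w * q w) + 2 * ennreal (evidence (space P) w * ?g)"
      using e q0[of w] by (subst ennreal_plus) (auto simp: ennreal_mult' sum_nonneg)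
    finally show "ennreal (evidence (space P) w * (\<Sum>i<D. (lifted V f i w - post_mean (space P) i w)\<^sup>2))
      \<le> 2 * ennreal (evidence (space P) w * q w) + 2 * ennreal (evidence (space P) w * ?g)" .
  qed
  also have "\<dots> = 2 * (\<integral>\<^sup>+w. ennreal (evidence (space P) w * q w) \<partial>\<mu>) + 2 * score_risk D t0 T P (frozen_score V g)"
    unfolding score_risk_frozen[OF Vc g] by (subst nn_integral_add) (auto simp: nn_integral_cmult)
  finally show ?thesis unfolding approx .
qed

end

section \<open>Tails of the target law\<close>

text \<open>Boxes determine the product measure, and on a box the claim is translation invariance in
  each coordinate.\<close>

lemma nn_integral_lborel_vec_translate:
  assumes f [measurable]: "f \<in> borel_measurable (lborel_vec n)" and b: "b \<in> carrier_vec n"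
  shows "(\<integral>\<^sup>+v. f (v + b) \<partial>lborel_vec n) = (\<integral>\<^sup>+v. f v \<partial>lborel_vec n)"
proof -
  let ?M = "\<Pi>\<^sub>M i\<in>{..<n}. (lborel :: real measure)"
  let ?t = "\<lambda>y. \<lambda>i\<in>{..<n}. y i + vec_index b i"
  have t [measurable]: "?t \<in> ?M \<rightarrow>\<^sub>M ?M" by (rule measurable_restrict) simp
  have "?M = distr ?M ?M ?t"
  proof (rule lborel_product.PiM_eqI[symmetric])
    fix A :: "nat \<Rightarrow> real set" assume A: "\<And>i. i \<in> {..<n} \<Longrightarrow> A i \<in> sets lborel"
    have "?t -` Pi\<^sub>E {..<n} A \<inter> space ?M = Pi\<^sub>E {..<n} (\<lambda>i. (\<lambda>y. y + vec_index b i) -` A i)"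
      by (auto simp: space_PiM PiE_def Pi_def restrict_def extensional_def)
    moreover have "emeasure (distr ?M ?M ?t) (Pi\<^sub>E {..<n} A) = emeasure ?M (?t -` Pi\<^sub>E {..<n} A \<inter> space ?M)"
      by (rule emeasure_distr[OF t]) (auto intro: sets_PiM_I_finite A)
    moreover have "emeasure ?M (Pi\<^sub>E {..<n} (\<lambda>i. (\<lambda>y. y + vec_index b i) -` A i))
      = (\<Prod>i<n. emeasure lborel ((\<lambda>y. y + vec_index b i) -` A i))"
    proof (rule lborel_product.emeasure_PiM)
      fix i assume i: "i \<in> {..<n}"
      have "(\<lambda>y. y + vec_index b i) -` A i \<inter> space lborel \<in> sets (lborel :: real measure)"
        by (rule measurable_sets[OF _ A[OF i]]) simp
      then show "(\<lambda>y. y + vec_index b i) -` A i \<in> sets lborel" by simp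
    qed simp
    moreover have "emeasure lborel ((\<lambda>y. y + vec_index b i) -` A i) = emeasure lborel (A i)" if "i < n" for i
    proof -
      have "emeasure lborel (A i) = emeasure (distr lborel borel ((+) (vec_index b i))) (A i)"
        by (simp only: lborel_distr_plus)
      also have "\<dots> = emeasure lborel ((+) (vec_index b i) -` A i \<inter> space lborel)"
        by (rule emeasure_distr) (use A[of i] that in auto)
      also have "(+) (vec_index b i) -` A i \<inter> space lborel = (\<lambda>y. y + vec_index b i) -` A i"
        by (auto simp: add.commute)
      finally show ?thesis by simp
    qed
    ultimately show "emeasure (distr ?M ?M ?t) (Pi\<^sub>E {..<n} A) = (\<Prod>i<n. emeasure lborel (A i))" by simp
  qed simp_all
  note M = this
  have [measurable]: "(\<lambda>y. f (Matrix.vec n y)) \<in> borel_measurable ?M"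
    by (rule measurable_compose[OF vec_measurable f])
  have s: "(\<lambda>v. v + b) \<in> lborel_vec n \<rightarrow>\<^sub>M lborel_vec n"
  proof (rule measurable_vecI)
    fix i assume "i < n"
    then have "(\<lambda>v. vec_index (v + b) i) = (\<lambda>v. vec_index v i + vec_index b i)"
      using carrier_vecD[OF b] by (intro ext index_add_vec(1)) simp
    then show "(\<lambda>v. vec_index (v + b) i) \<in> borel_measurable (lborel_vec n)" by simp
  qed (rule carrier_vecI, simp add: carrier_vecD[OF b])
  have "(\<integral>\<^sup>+v. f (v + b) \<partial>lborel_vec n) = (\<integral>\<^sup>+y. f (Matrix.vec n y + b) \<partial>?M)"
    by (rule nn_integral_lborel_vec[OF measurable_compose[OF s f]])
  also have "\<dots> = (\<integral>\<^sup>+y. f (Matrix.vec n (?t y)) \<partial>?M)"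
  proof (rule nn_integral_cong)
    fix y
    have "Matrix.vec n y + b = Matrix.vec n (?t y)"
      using carrier_vecD[OF b] by (intro eq_vecI) simp_all
    then show "f (Matrix.vec n y + b) = f (Matrix.vec n (?t y))" by simp
  qed
  also have "\<dots> = (\<integral>\<^sup>+y. f (Matrix.vec n y) \<partial>distr ?M ?M ?t)"
    by (rule nn_integral_distr[symmetric]) measurable
  also have "\<dots> = (\<integral>\<^sup>+v. f v \<partial>lborel_vec n)"
    unfolding M[symmetric] by (rule nn_integral_lborel_vec[symmetric]) fact
  finally show ?thesis .
qed

section \<open>Exponential moments of Gaussian vectors\<close>

lemma exp_mult_normal_density:
  assumes "0 < \<sigma>"
  shows "exp (c * y) * normal_density 0 \<sigma> y = exp (c\<^sup>2 * \<sigma>\<^sup>2 / 2) * normal_density (c * \<sigma>\<^sup>2) \<sigma> y"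
proof -
  have e: "c * y + - (y - 0)\<^sup>2 / (2 * \<sigma>\<^sup>2) = c\<^sup>2 * \<sigma>\<^sup>2 / 2 + - (y - c * \<sigma>\<^sup>2)\<^sup>2 / (2 * \<sigma>\<^sup>2)"
    using assms by (simp add: field_simps power2_eq_square)
  have "exp (c * y) * normal_density 0 \<sigma> y = 1 / sqrt (2 * pi * \<sigma>\<^sup>2) * exp (c * y + - (y - 0)\<^sup>2 / (2 * \<sigma>\<^sup>2))"
    unfolding normal_density_def exp_add by (simp only: mult_ac)
  also have "\<dots> = exp (c\<^sup>2 * \<sigma>\<^sup>2 / 2) * normal_density (c * \<sigma>\<^sup>2) \<sigma> y"
    unfolding normal_density_def e exp_add by (simp only: mult_ac)
  finally show ?thesis .
qed

text \<open>The rate 1/(4 \<sigma>^2) is half of the critical one, so the weight merely doubles the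
  variance, at the price of \<open>sqrt 2\<close> per dimension.\<close>

lemma exp_square_mult_normal_density:
  assumes "0 < \<sigma>"
  shows "exp (y\<^sup>2 / (4 * \<sigma>\<^sup>2)) * normal_density 0 \<sigma> y = sqrt 2 * normal_density 0 (sqrt 2 * \<sigma>) y"
proof -
  have e: "y\<^sup>2 / (4 * \<sigma>\<^sup>2) + - (y - 0)\<^sup>2 / (2 * \<sigma>\<^sup>2) = - (y - 0)\<^sup>2 / (2 * (sqrt 2 * \<sigma>)\<^sup>2)"
    using assms by (simp add: field_simps power_mult_distrib)
  have "exp (y\<^sup>2 / (4 * \<sigma>\<^sup>2)) * normal_density 0 \<sigma> y
     = 1 / sqrt (2 * pi * \<sigma>\<^sup>2) * exp (y\<^sup>2 / (4 * \<sigma>\<^sup>2) + - (y - 0)\<^sup>2 / (2 * \<sigma>\<^sup>2))"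
    unfolding normal_density_def exp_add by (simp only: mult_ac)
  also have "1 / sqrt (2 * pi * \<sigma>\<^sup>2) = sqrt 2 * (1 / sqrt (2 * pi * (sqrt 2 * \<sigma>)\<^sup>2))"
  proof -
    have "sqrt (2 * pi * (sqrt 2 * \<sigma>)\<^sup>2) = sqrt 2 * sqrt (2 * pi * \<sigma>\<^sup>2)"
      by (subst real_sqrt_mult[symmetric]) (simp add: power_mult_distrib)
    then show ?thesis by simp
  qed
  finally show ?thesis unfolding normal_density_def e by (simp only: mult_ac)
qed

lemma gaussian_sets [measurable_cong, simp]: "sets (gaussian n m v) = sets (lborel_vec n)"
  by (simp add: gaussian_def)

lemma gaussian_space [simp]: "space (gaussian n m v) = carrier_vec n"
  by (simp add: gaussian_def)

lemma nn_integral_gaussian: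
  "f \<in> borel_measurable (lborel_vec n) \<Longrightarrow>
    (\<integral>\<^sup>+y. f y \<partial>gaussian n m v) = (\<integral>\<^sup>+y. ennreal (gauss_pdf n m v y) * f y \<partial>lborel_vec n)"
  unfolding gaussian_def by (rule nn_integral_density) auto

lemma gauss_pdf_0: "gauss_pdf n (0\<^sub>v n) v y = (\<Prod>i<n. normal_density 0 (sqrt v) (vec_index y i))"
  unfolding gauss_pdf_def by (intro prod.cong) auto

lemma nn_integral_gaussian_exp_square:
  assumes "0 < \<sigma>"
  shows "(\<integral>\<^sup>+y. ennreal (exp ((vnorm y)\<^sup>2 / (4 * \<sigma>\<^sup>2))) \<partial>gaussian n (0\<^sub>v n) (\<sigma>\<^sup>2)) = ennreal (sqrt 2 ^ n)"
proof -
  have "(\<integral>\<^sup>+y. ennreal (exp ((vnorm y)\<^sup>2 / (4 * \<sigma>\<^sup>2))) \<partial>gaussian n (0\<^sub>v n) (\<sigma>\<^sup>2))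
    = (\<integral>\<^sup>+y. ennreal (gauss_pdf n (0\<^sub>v n) (\<sigma>\<^sup>2) y) * ennreal (exp ((vnorm y)\<^sup>2 / (4 * \<sigma>\<^sup>2))) \<partial>lborel_vec n)"
    by (rule nn_integral_gaussian) measurable
  also have "\<dots> = (\<integral>\<^sup>+y. (\<Prod>i<n. ennreal (sqrt 2) * ennreal (normal_density 0 (sqrt 2 * \<sigma>) (vec_index y i))) \<partial>lborel_vec n)"
  proof (rule nn_integral_cong)
    fix y :: rvec assume "y \<in> space (lborel_vec n)"
    then have y: "y \<in> carrier_vec n" by (simp only: space_lborel_vec)
    have "gauss_pdf n (0\<^sub>v n) (\<sigma>\<^sup>2) y * exp ((vnorm y)\<^sup>2 / (4 * \<sigma>\<^sup>2))
      = (\<Prod>i<n. normal_density 0 \<sigma> (vec_index y i)) * (\<Prod>i<n. exp ((vec_index y i)\<^sup>2 / (4 * \<sigma>\<^sup>2)))"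
      unfolding gauss_pdf_0 vnorm_square[OF y] sum_divide_distrib using assms by (simp add: exp_sum)
    also have "\<dots> = (\<Prod>i<n. sqrt 2 * normal_density 0 (sqrt 2 * \<sigma>) (vec_index y i))"
      unfolding prod.distrib[symmetric] exp_square_mult_normal_density[OF assms, symmetric]
      by (simp only: mult.commute)
    finally show "ennreal (gauss_pdf n (0\<^sub>v n) (\<sigma>\<^sup>2) y) * ennreal (exp ((vnorm y)\<^sup>2 / (4 * \<sigma>\<^sup>2))) =
      (\<Prod>i<n. ennreal (sqrt 2) * ennreal (normal_density 0 (sqrt 2 * \<sigma>) (vec_index y i)))"
      by (simp add: ennreal_mult[symmetric] gauss_pdf_nonneg prod_ennreal)
  qed
  also have "\<dots> = (\<Prod>i<n. (\<integral>\<^sup>+y. ennreal (sqrt 2) * ennreal (normal_density 0 (sqrt 2 * \<sigma>) y) \<partial>lborel))"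
    by (rule nn_integral_lborel_vec_prod) simp
  also have "\<dots> = ennreal (sqrt 2 ^ n)"
    using assms by (simp add: nn_integral_cmult nn_integral_normal_density ennreal_power)
  finally show ?thesis .
qed

text \<open>Cameron-Martin: an exponential tilt of a centred Gaussian is a translation.\<close>

lemma nn_integral_gaussian_tilt:
  assumes \<sigma>: "0 < \<sigma>" and b: "b \<in> carrier_vec n" and g: "g \<in> borel_measurable (lborel_vec n)"
  shows "(\<integral>\<^sup>+y. ennreal (exp (\<Sum>i<n. vec_index b i * vec_index y i)) * g y \<partial>gaussian n (0\<^sub>v n) (\<sigma>\<^sup>2))
    = ennreal (exp (\<sigma>\<^sup>2 * (vnorm b)\<^sup>2 / 2)) * (\<integral>\<^sup>+y. g (y + \<sigma>\<^sup>2 \<cdot>\<^sub>v b) \<partial>gaussian n (0\<^sub>v n) (\<sigma>\<^sup>2))"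
proof -
  have g' [measurable]: "g \<in> borel_measurable (lborel_vec n)" by (rule g)
  have sb: "\<sigma>\<^sup>2 \<cdot>\<^sub>v b \<in> carrier_vec n" using b by simp
  have db: "dim_vec b = n" by (rule carrier_vecD[OF b])
  have s: "(\<lambda>v. v + \<sigma>\<^sup>2 \<cdot>\<^sub>v b) \<in> lborel_vec n \<rightarrow>\<^sub>M lborel_vec n"
  proof (rule measurable_vecI)
    fix i assume "i < n"
    then have "(\<lambda>v. vec_index (v + \<sigma>\<^sup>2 \<cdot>\<^sub>v b) i) = (\<lambda>v. vec_index v i + vec_index (\<sigma>\<^sup>2 \<cdot>\<^sub>v b) i)"
      using db by (intro ext index_add_vec(1)) simp
    then show "(\<lambda>v. vec_index (v + \<sigma>\<^sup>2 \<cdot>\<^sub>v b) i) \<in> borel_measurable (lborel_vec n)" by simp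
  qed (rule carrier_vecI, simp add: db)
  have gs: "(\<lambda>y. g (y + \<sigma>\<^sup>2 \<cdot>\<^sub>v b)) \<in> borel_measurable (lborel_vec n)" by (rule measurable_compose[OF s g])
  have pdf: "gauss_pdf n (0\<^sub>v n) (\<sigma>\<^sup>2) y * exp (\<Sum>i<n. vec_index b i * vec_index y i)
    = exp (\<sigma>\<^sup>2 * (vnorm b)\<^sup>2 / 2) * gauss_pdf n (\<sigma>\<^sup>2 \<cdot>\<^sub>v b) (\<sigma>\<^sup>2) y" for y
  proof -
    have "gauss_pdf n (0\<^sub>v n) (\<sigma>\<^sup>2) y * exp (\<Sum>i<n. vec_index b i * vec_index y i)
      = (\<Prod>i<n. exp (vec_index b i * vec_index y i) * normal_density 0 \<sigma> (vec_index y i))"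
      unfolding gauss_pdf_0 using \<sigma> by (simp add: exp_sum prod.distrib mult.commute)
    also have "\<dots> = (\<Prod>i<n. exp ((vec_index b i)\<^sup>2 * \<sigma>\<^sup>2 / 2) * normal_density (vec_index b i * \<sigma>\<^sup>2) \<sigma> (vec_index y i))"
      unfolding exp_mult_normal_density[OF \<sigma>] ..
    also have "\<dots> = exp (\<Sum>i<n. (vec_index b i)\<^sup>2 * \<sigma>\<^sup>2 / 2) * gauss_pdf n (\<sigma>\<^sup>2 \<cdot>\<^sub>v b) (\<sigma>\<^sup>2) y"
      unfolding prod.distrib gauss_pdf_def using \<sigma> db by (simp add: exp_sum mult.commute)
    also have "(\<Sum>i<n. (vec_index b i)\<^sup>2 * \<sigma>\<^sup>2 / 2) = \<sigma>\<^sup>2 * (vnorm b)\<^sup>2 / 2"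
      unfolding vnorm_square[OF b] by (simp add: sum_distrib_left sum_divide_distrib mult.commute)
    finally show ?thesis .
  qed
  have shift: "gauss_pdf n (\<sigma>\<^sup>2 \<cdot>\<^sub>v b) (\<sigma>\<^sup>2) (y + \<sigma>\<^sup>2 \<cdot>\<^sub>v b) = gauss_pdf n (0\<^sub>v n) (\<sigma>\<^sup>2) y" for y
    unfolding gauss_pdf_def normal_density_def using db by (intro prod.cong refl) simp
  have "(\<integral>\<^sup>+y. ennreal (exp (\<Sum>i<n. vec_index b i * vec_index y i)) * g y \<partial>gaussian n (0\<^sub>v n) (\<sigma>\<^sup>2))
    = (\<integral>\<^sup>+y. ennreal (gauss_pdf n (0\<^sub>v n) (\<sigma>\<^sup>2) y) * (ennreal (exp (\<Sum>i<n. vec_index b i * vec_index y i)) * g y) \<partial>lborel_vec n)"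
    by (rule nn_integral_gaussian) measurable
  also have "\<dots> = (\<integral>\<^sup>+y. ennreal (exp (\<sigma>\<^sup>2 * (vnorm b)\<^sup>2 / 2)) * (ennreal (gauss_pdf n (\<sigma>\<^sup>2 \<cdot>\<^sub>v b) (\<sigma>\<^sup>2) y) * g y) \<partial>lborel_vec n)"
  proof (rule nn_integral_cong)
    fix y
    have "ennreal (gauss_pdf n (0\<^sub>v n) (\<sigma>\<^sup>2) y) * ennreal (exp (\<Sum>i<n. vec_index b i * vec_index y i))
      = ennreal (exp (\<sigma>\<^sup>2 * (vnorm b)\<^sup>2 / 2)) * ennreal (gauss_pdf n (\<sigma>\<^sup>2 \<cdot>\<^sub>v b) (\<sigma>\<^sup>2) y)"
      using pdf[of y] by (simp add: ennreal_mult[symmetric] gauss_pdf_nonneg)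
    then show "ennreal (gauss_pdf n (0\<^sub>v n) (\<sigma>\<^sup>2) y) * (ennreal (exp (\<Sum>i<n. vec_index b i * vec_index y i)) * g y)
      = ennreal (exp (\<sigma>\<^sup>2 * (vnorm b)\<^sup>2 / 2)) * (ennreal (gauss_pdf n (\<sigma>\<^sup>2 \<cdot>\<^sub>v b) (\<sigma>\<^sup>2) y) * g y)"
      by (simp only: mult.assoc[symmetric])
  qed
  also have "\<dots> = ennreal (exp (\<sigma>\<^sup>2 * (vnorm b)\<^sup>2 / 2)) * (\<integral>\<^sup>+y. ennreal (gauss_pdf n (\<sigma>\<^sup>2 \<cdot>\<^sub>v b) (\<sigma>\<^sup>2) y) * g y \<partial>lborel_vec n)"
    by (rule nn_integral_cmult) measurable
  also have "(\<integral>\<^sup>+y. ennreal (gauss_pdf n (\<sigma>\<^sup>2 \<cdot>\<^sub>v b) (\<sigma>\<^sup>2) y) * g y \<partial>lborel_vec n)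
     = (\<integral>\<^sup>+y. ennreal (gauss_pdf n (\<sigma>\<^sup>2 \<cdot>\<^sub>v b) (\<sigma>\<^sup>2) (y + \<sigma>\<^sup>2 \<cdot>\<^sub>v b)) * g (y + \<sigma>\<^sup>2 \<cdot>\<^sub>v b) \<partial>lborel_vec n)"
    by (rule nn_integral_lborel_vec_translate[OF _ sb, symmetric]) measurable
  also have "\<dots> = (\<integral>\<^sup>+y. g (y + \<sigma>\<^sup>2 \<cdot>\<^sub>v b) \<partial>gaussian n (0\<^sub>v n) (\<sigma>\<^sup>2))"
    unfolding shift by (rule nn_integral_gaussian[OF gs, symmetric])
  finally show ?thesis .
qed

lemma orthonormal_colsD:
  assumes "orthonormal_cols D d A"
  shows "A \<in> carrier_mat D d" "dim_row A = D" "dim_col A = d" "transpose_mat A * A = 1\<^sub>m d"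
  using assms by (auto simp: orthonormal_cols_def)

lemma sum_scalar_prod:
  "v \<in> carrier_vec n \<Longrightarrow> (\<Sum>i<n. vec_index u i * vec_index v i) = scalar_prod u v"
  unfolding scalar_prod_def using carrier_vecD[of v n] by (simp add: lessThan_atLeast0)

text \<open>The Gaussian weight of the coordinates along \<open>A\<close> is linearised by an independent standard Gaussian
  on \<open>\<real>\<^sup>d\<close>; the resulting tilt is a translation along \<open>A\<close>, which \<open>g\<close> does not see.\<close>

lemma nn_integral_gaussian_exp_along:
  assumes A: "orthonormal_cols D d A" and \<sigma>: "0 < \<sigma>" and g: "g \<in> borel_measurable (lborel_vec D)"
    and inv: "\<And>e w. e \<in> carrier_vec D \<Longrightarrow> w \<in> carrier_vec d \<Longrightarrow> g (e + A *\<^sub>v w) = g e"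
  shows "(\<integral>\<^sup>+e. ennreal (exp ((vnorm (transpose_mat A *\<^sub>v e))\<^sup>2 / (4 * \<sigma>\<^sup>2))) * g e \<partial>gaussian D (0\<^sub>v D) (\<sigma>\<^sup>2))
    = ennreal (sqrt 2 ^ d) * (\<integral>\<^sup>+e. g e \<partial>gaussian D (0\<^sub>v D) (\<sigma>\<^sup>2))"
proof -
  note AD = orthonormal_colsD[OF A]
  have g' [measurable]: "g \<in> borel_measurable (lborel_vec D)" by (rule g)
  \<comment> \<open>With this scale the moment generating function of a standard Gaussian reproduces
    the weight, as c^2/2 = 1/(4 \<sigma>^2). After the translation the weight left in
    \<open>w\<close> is exp(|w|^2/4), whose mean is \<open>sqrt 2 ^ d\<close>.\<close>
  define c where "c = 1 / (sqrt 2 * \<sigma>)"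
  have c2: "c\<^sup>2 = 1 / (2 * \<sigma>\<^sup>2)" using \<sigma> by (simp add: c_def power_divide power_mult_distrib)
  let ?G = "gaussian D (0\<^sub>v D) (\<sigma>\<^sup>2)" and ?W = "gaussian d (0\<^sub>v d) (1\<^sup>2)"
  interpret G: prob_space ?G using \<sigma> by (intro prob_space_gaussian) simp
  interpret W: prob_space ?W by (rule prob_space_gaussian) simp
  interpret GW: pair_sigma_finite ?G ?W ..
  have At: "(\<lambda>e. transpose_mat A *\<^sub>v e) \<in> lborel_vec D \<rightarrow>\<^sub>M lborel_vec d"
    by (rule mult_mat_vec_measurable[OF measurable_ident_sets[OF refl]]) (use AD in simp)
  have Am: "(\<lambda>w. A *\<^sub>v w) \<in> lborel_vec d \<rightarrow>\<^sub>M lborel_vec D"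
    by (rule mult_mat_vec_measurable[OF measurable_ident_sets[OF refl]]) (use AD in simp)
  note [measurable] = measurable_vec_index[OF At] measurable_vec_index[OF Am]
  let ?h = "\<lambda>e w. ennreal (exp (\<Sum>i<d. vec_index (c \<cdot>\<^sub>v (transpose_mat A *\<^sub>v e)) i * vec_index w i))"
  have scal: "(\<Sum>i<d. vec_index (c \<cdot>\<^sub>v (transpose_mat A *\<^sub>v e)) i * vec_index w i)
     = (\<Sum>j<D. vec_index (c \<cdot>\<^sub>v (A *\<^sub>v w)) j * vec_index e j)"
    if e: "e \<in> carrier_vec D" and w: "w \<in> carrier_vec d" for e w
  proof -
    have Ate: "transpose_mat A *\<^sub>v e \<in> carrier_vec d" using AD by (intro carrier_vecI) simp
    have Aw: "A *\<^sub>v w \<in> carrier_vec D" using AD by (intro carrier_vecI) simp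
    have "scalar_prod (c \<cdot>\<^sub>v (transpose_mat A *\<^sub>v e)) w = c * scalar_prod (transpose_mat A *\<^sub>v e) w"
      by (rule scalar_prod_smult_left) (simp add: carrier_vecD[OF w] AD(3))
    also have "scalar_prod (transpose_mat A *\<^sub>v e) w = scalar_prod e (A *\<^sub>v w)"
      by (rule transpose_vec_mult_scalar[OF AD(1) w e])
    also have "\<dots> = scalar_prod (A *\<^sub>v w) e" by (rule comm_scalar_prod[OF e Aw])
    also have "c * scalar_prod (A *\<^sub>v w) e = scalar_prod (c \<cdot>\<^sub>v (A *\<^sub>v w)) e"
      by (rule scalar_prod_smult_left[symmetric]) (simp add: carrier_vecD[OF e] AD(2))
    finally show ?thesis by (simp only: sum_scalar_prod[OF w] sum_scalar_prod[OF e])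
  qed
  have hm: "(\<lambda>(e, w). ?h e w * g e) \<in> borel_measurable (?G \<Otimes>\<^sub>M ?W)"
  proof -
    have "(\<lambda>ew. ennreal (exp (\<Sum>i<d. (c * vec_index (transpose_mat A *\<^sub>v fst ew) i) * vec_index (snd ew) i)) * g (fst ew))
      \<in> borel_measurable (?G \<Otimes>\<^sub>M ?W)" by measurable
    moreover have "vec_index (c \<cdot>\<^sub>v (transpose_mat A *\<^sub>v e)) i = c * vec_index (transpose_mat A *\<^sub>v e) i" if "i < d" for e i
      using that AD by simp
    ultimately show ?thesis by (simp add: split_beta')
  qed
  have one: "(\<integral>\<^sup>+w. ?h e w \<partial>?W) = ennreal (exp ((vnorm (transpose_mat A *\<^sub>v e))\<^sup>2 / (4 * \<sigma>\<^sup>2)))" for e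
  proof -
    have b: "c \<cdot>\<^sub>v (transpose_mat A *\<^sub>v e) \<in> carrier_vec d" using AD by (intro carrier_vecI) simp
    have bt: "transpose_mat A *\<^sub>v e \<in> carrier_vec d" using AD by (intro carrier_vecI) simp
    have "(vnorm (c \<cdot>\<^sub>v (transpose_mat A *\<^sub>v e)))\<^sup>2 = c\<^sup>2 * (vnorm (transpose_mat A *\<^sub>v e))\<^sup>2"
      unfolding vnorm_square[OF b] vnorm_square[OF bt] sum_distrib_left using carrier_vecD[OF bt]
      by (intro sum.cong refl) (simp add: power_mult_distrib)
    moreover have "(\<integral>\<^sup>+w. ?h e w * 1 \<partial>?W) = ennreal (exp (1\<^sup>2 * (vnorm (c \<cdot>\<^sub>v (transpose_mat A *\<^sub>v e)))\<^sup>2 / 2)) * (\<integral>\<^sup>+w. 1 \<partial>?W)"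
      by (rule nn_integral_gaussian_tilt[OF _ b]) simp_all
    moreover have "(\<integral>\<^sup>+w. 1 \<partial>?W) = 1" by (simp only: nn_integral_const W.emeasure_space_1 mult_1)
    ultimately have "(\<integral>\<^sup>+w. ?h e w \<partial>?W) = ennreal (exp (1\<^sup>2 * (c\<^sup>2 * (vnorm (transpose_mat A *\<^sub>v e))\<^sup>2) / 2))"
      by (simp only: mult_1_right)
    then show ?thesis by (simp add: c2)
  qed
  have "(\<integral>\<^sup>+e. ennreal (exp ((vnorm (transpose_mat A *\<^sub>v e))\<^sup>2 / (4 * \<sigma>\<^sup>2))) * g e \<partial>?G)
     = (\<integral>\<^sup>+e. (\<integral>\<^sup>+w. ?h e w * g e \<partial>?W) \<partial>?G)"
  proof (rule nn_integral_cong)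
    fix e
    have "(\<lambda>w. ?h e w) \<in> borel_measurable ?W" by measurable
    then show "ennreal (exp ((vnorm (transpose_mat A *\<^sub>v e))\<^sup>2 / (4 * \<sigma>\<^sup>2))) * g e = (\<integral>\<^sup>+w. ?h e w * g e \<partial>?W)"
      by (subst nn_integral_multc) (simp_all only: one)
  qed
  also have "\<dots> = (\<integral>\<^sup>+w. (\<integral>\<^sup>+e. ?h e w * g e \<partial>?G) \<partial>?W)"
    by (rule GW.Fubini'[OF hm, symmetric])
  also have "\<dots> = (\<integral>\<^sup>+w. ennreal (exp ((vnorm w)\<^sup>2 / (4 * 1\<^sup>2))) * (\<integral>\<^sup>+e. g e \<partial>?G) \<partial>?W)"
  proof (rule nn_integral_cong)
    fix w assume "w \<in> space ?W"
    then have w: "w \<in> carrier_vec d" by (simp only: gaussian_space)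
    have Aw: "A *\<^sub>v w \<in> carrier_vec D" using AD by (intro carrier_vecI) simp
    have b: "c \<cdot>\<^sub>v (A *\<^sub>v w) \<in> carrier_vec D" using Aw by simp
    have "(vnorm (c \<cdot>\<^sub>v (A *\<^sub>v w)))\<^sup>2 = c\<^sup>2 * (\<Sum>i<D. (vec_index (A *\<^sub>v w) i)\<^sup>2)"
      unfolding vnorm_square[OF b] sum_distrib_left using carrier_vecD[OF Aw]
      by (intro sum.cong refl) (simp add: power_mult_distrib)
    then have nb: "\<sigma>\<^sup>2 * (vnorm (c \<cdot>\<^sub>v (A *\<^sub>v w)))\<^sup>2 / 2 = (vnorm w)\<^sup>2 / (4 * 1\<^sup>2)"
      using \<sigma> by (simp add: orthonormal_cols_sum[OF A w] vnorm_square[OF w] c2)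
    have "(\<integral>\<^sup>+e. ?h e w * g e \<partial>?G) = (\<integral>\<^sup>+e. ennreal (exp (\<Sum>j<D. vec_index (c \<cdot>\<^sub>v (A *\<^sub>v w)) j * vec_index e j)) * g e \<partial>?G)"
      by (rule nn_integral_cong) (simp only: gaussian_space scal[OF _ w])
    also have "\<dots> = ennreal (exp ((vnorm w)\<^sup>2 / (4 * 1\<^sup>2))) * (\<integral>\<^sup>+e. g (e + \<sigma>\<^sup>2 \<cdot>\<^sub>v (c \<cdot>\<^sub>v (A *\<^sub>v w))) \<partial>?G)"
      unfolding nn_integral_gaussian_tilt[OF \<sigma> b g] nb ..
    also have "(\<integral>\<^sup>+e. g (e + \<sigma>\<^sup>2 \<cdot>\<^sub>v (c \<cdot>\<^sub>v (A *\<^sub>v w))) \<partial>?G) = (\<integral>\<^sup>+e. g e \<partial>?G)"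
    proof (rule nn_integral_cong)
      fix e assume "e \<in> space ?G"
      then have e: "e \<in> carrier_vec D" by (simp only: gaussian_space)
      have "\<sigma>\<^sup>2 \<cdot>\<^sub>v (c \<cdot>\<^sub>v (A *\<^sub>v w)) = A *\<^sub>v ((\<sigma>\<^sup>2 * c) \<cdot>\<^sub>v w)"
        unfolding smult_smult_assoc using mult_mat_vec[OF AD(1) w] by simp
      then show "g (e + \<sigma>\<^sup>2 \<cdot>\<^sub>v (c \<cdot>\<^sub>v (A *\<^sub>v w))) = g e" using inv[OF e] w by simp
    qed
    finally show "(\<integral>\<^sup>+e. ?h e w * g e \<partial>?G) = ennreal (exp ((vnorm w)\<^sup>2 / (4 * 1\<^sup>2))) * (\<integral>\<^sup>+e. g e \<partial>?G)" .
  qed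
  also have "\<dots> = (\<integral>\<^sup>+w. ennreal (exp ((vnorm w)\<^sup>2 / (4 * 1\<^sup>2))) \<partial>?W) * (\<integral>\<^sup>+e. g e \<partial>?G)"
    by (rule nn_integral_multc) measurable
  also have "(\<integral>\<^sup>+w. ennreal (exp ((vnorm w)\<^sup>2 / (4 * 1\<^sup>2))) \<partial>?W) = ennreal (sqrt 2 ^ d)"
    by (rule nn_integral_gaussian_exp_square) simp
  finally show ?thesis .
qed

lemma perp_proj:
  assumes A: "orthonormal_cols D d A" and x: "x \<in> carrier_vec D"
  shows "(vnorm x)\<^sup>2 = (vnorm (transpose_mat A *\<^sub>v x))\<^sup>2 + (vnorm ((1\<^sub>m D - A * transpose_mat A) *\<^sub>v x))\<^sup>2"
    and "w \<in> carrier_vec d \<Longrightarrow> transpose_mat A *\<^sub>v (A *\<^sub>v w + x) = w + transpose_mat A *\<^sub>v x"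
    and "w \<in> carrier_vec d \<Longrightarrow> (1\<^sub>m D - A * transpose_mat A) *\<^sub>v (A *\<^sub>v w + x) = (1\<^sub>m D - A * transpose_mat A) *\<^sub>v x"
proof -
  note AD = orthonormal_colsD[OF A]
  have At: "transpose_mat A \<in> carrier_mat d D" using AD(1) by simp
  have AAt: "A * transpose_mat A \<in> carrier_mat D D" using AD(1) At by simp
  let ?u = "transpose_mat A *\<^sub>v x" and ?P = "1\<^sub>m D - A * transpose_mat A"
  have P: "?P \<in> carrier_mat D D" using AAt by (rule minus_carrier_mat)
  have u: "?u \<in> carrier_vec d" using At x by simp
  have Au: "A *\<^sub>v ?u \<in> carrier_vec D" using AD(1) u by simp
  have Px: "?P *\<^sub>v x = x - A *\<^sub>v ?u"
    using minus_mult_distrib_mat_vec[OF one_carrier_mat AAt x] assoc_mult_mat_vec[OF AD(1) At x] x by simp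
  have Pxc: "?P *\<^sub>v x \<in> carrier_vec D" using P x by simp
  have "(\<Sum>i<D. vec_index (A *\<^sub>v ?u) i * vec_index x i) = (\<Sum>i<d. vec_index ?u i * vec_index ?u i)"
    unfolding sum_scalar_prod[OF x] sum_scalar_prod[OF u]
    using transpose_vec_mult_scalar[OF AD(1) u x] comm_scalar_prod[OF x Au] by simp
  then have cross: "(\<Sum>i<D. vec_index (A *\<^sub>v ?u) i * vec_index x i) = (vnorm ?u)\<^sup>2"
    unfolding vnorm_square[OF u] by (simp only: power2_eq_square)
  have Pidx: "vec_index (?P *\<^sub>v x) i = vec_index x i - vec_index (A *\<^sub>v ?u) i" if "i < D" for i
    unfolding Px using that carrier_vecD[OF x] carrier_vecD[OF Au] by simp
  have "(vnorm (?P *\<^sub>v x))\<^sup>2 = (\<Sum>i<D. (vec_index x i - vec_index (A *\<^sub>v ?u) i)\<^sup>2)"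
    unfolding vnorm_square[OF Pxc] by (intro sum.cong refl) (simp only: Pidx lessThan_iff)
  also have "\<dots> = (\<Sum>i<D. (vec_index x i)\<^sup>2) - 2 * (\<Sum>i<D. vec_index (A *\<^sub>v ?u) i * vec_index x i)
      + (\<Sum>i<D. (vec_index (A *\<^sub>v ?u) i)\<^sup>2)"
    by (simp add: power2_diff sum.distrib sum_subtractf sum_distrib_left algebra_simps)
  also have "\<dots> = (vnorm x)\<^sup>2 - (vnorm ?u)\<^sup>2"
    unfolding cross orthonormal_cols_sum[OF A u] vnorm_square[OF x] vnorm_square[OF u] by simp
  finally show "(vnorm x)\<^sup>2 = (vnorm ?u)\<^sup>2 + (vnorm (?P *\<^sub>v x))\<^sup>2" by simp
  assume w: "w \<in> carrier_vec d"
  have Aw: "A *\<^sub>v w \<in> carrier_vec D" using AD(1) w by simp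
  have "transpose_mat A *\<^sub>v (A *\<^sub>v w) = w"
    using assoc_mult_mat_vec[OF At AD(1) w, symmetric] w by (simp add: AD(4))
  then show AtA: "transpose_mat A *\<^sub>v (A *\<^sub>v w + x) = w + transpose_mat A *\<^sub>v x"
    using mult_add_distrib_mat_vec[OF At Aw x] by simp
  have "?P *\<^sub>v (A *\<^sub>v w) = 0\<^sub>v D"
  proof -
    have "?P *\<^sub>v (A *\<^sub>v w) = A *\<^sub>v w - A *\<^sub>v (transpose_mat A *\<^sub>v (A *\<^sub>v w))"
      using minus_mult_distrib_mat_vec[OF one_carrier_mat AAt Aw] assoc_mult_mat_vec[OF AD(1) At Aw] Aw by simp
    also have "\<dots> = 0\<^sub>v D"
      using \<open>transpose_mat A *\<^sub>v (A *\<^sub>v w) = w\<close> Aw by simp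
    finally show ?thesis .
  qed
  then show "?P *\<^sub>v (A *\<^sub>v w + x) = ?P *\<^sub>v x"
    using mult_add_distrib_mat_vec[OF P Aw x] Pxc by simp
qed

text \<open>Pythagoras factorises the full weight into a part along \<open>A\<close> and a part
  across, and the latter is invariant under translations along \<open>A\<close>. So the known moment
  \<open>sqrt 2 ^ D\<close> equals \<open>sqrt 2 ^ d\<close> times the wanted one, which is found by
  cancellation. As that moment is at least 1, \<open>d \<le> D\<close> falls out too.\<close>

lemma nn_integral_gaussian_exp_perp:
  assumes A: "orthonormal_cols D d A" and \<sigma>: "0 < \<sigma>"
  shows "d \<le> D"
    and "(\<integral>\<^sup>+e. ennreal (exp ((vnorm ((1\<^sub>m D - A * transpose_mat A) *\<^sub>v e))\<^sup>2 / (4 * \<sigma>\<^sup>2))) \<partial>gaussian D (0\<^sub>v D) (\<sigma>\<^sup>2))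
      = ennreal (sqrt 2 ^ (D - d))"
proof -
  note AD = orthonormal_colsD[OF A]
  let ?P = "1\<^sub>m D - A * transpose_mat A" and ?G = "gaussian D (0\<^sub>v D) (\<sigma>\<^sup>2)"
  interpret G: prob_space ?G using \<sigma> by (intro prob_space_gaussian) simp
  let ?g = "\<lambda>e. ennreal (exp ((vnorm (?P *\<^sub>v e))\<^sup>2 / (4 * \<sigma>\<^sup>2)))"
  have "(\<lambda>e. ?P *\<^sub>v e) \<in> lborel_vec D \<rightarrow>\<^sub>M lborel_vec D"
    by (rule mult_mat_vec_measurable[OF measurable_ident_sets[OF refl]]) (use AD in simp)
  then have g [measurable]: "?g \<in> borel_measurable (lborel_vec D)" by measurable
  define X where "X = (\<integral>\<^sup>+e. ?g e \<partial>?G)"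
  have "(\<integral>\<^sup>+e. ennreal (exp ((vnorm (transpose_mat A *\<^sub>v e))\<^sup>2 / (4 * \<sigma>\<^sup>2))) * ?g e \<partial>?G) = ennreal (sqrt 2 ^ d) * X"
    unfolding X_def
  proof (rule nn_integral_gaussian_exp_along[OF A \<sigma> g])
    fix e w :: rvec assume e: "e \<in> carrier_vec D" and w: "w \<in> carrier_vec d"
    have Aw: "A *\<^sub>v w \<in> carrier_vec D" using AD by (intro carrier_vecI) simp
    have "?P *\<^sub>v (e + A *\<^sub>v w) = ?P *\<^sub>v e"
      unfolding comm_add_vec[OF e Aw] by (rule perp_proj(3)[OF A e w])
    then show "?g (e + A *\<^sub>v w) = ?g e" by simp
  qed
  moreover have "(\<integral>\<^sup>+e. ennreal (exp ((vnorm (transpose_mat A *\<^sub>v e))\<^sup>2 / (4 * \<sigma>\<^sup>2))) * ?g e \<partial>?G)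
    = (\<integral>\<^sup>+e. ennreal (exp ((vnorm e)\<^sup>2 / (4 * \<sigma>\<^sup>2))) \<partial>?G)"
  proof (rule nn_integral_cong)
    fix e assume "e \<in> space ?G"
    then have e: "e \<in> carrier_vec D" by (simp only: gaussian_space)
    show "ennreal (exp ((vnorm (transpose_mat A *\<^sub>v e))\<^sup>2 / (4 * \<sigma>\<^sup>2))) * ?g e = ennreal (exp ((vnorm e)\<^sup>2 / (4 * \<sigma>\<^sup>2)))"
      unfolding perp_proj(1)[OF A e] by (simp add: ennreal_mult[symmetric] exp_add[symmetric] add_divide_distrib)
  qed
  ultimately have eq: "ennreal (sqrt 2 ^ D) = ennreal (sqrt 2 ^ d) * X"
    using nn_integral_gaussian_exp_square[OF \<sigma>, of D] by simp
  have "(\<integral>\<^sup>+e. 1 \<partial>?G) \<le> X"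
    unfolding X_def by (intro nn_integral_mono) (simp flip: ennreal_1)
  then have X1: "1 \<le> X" using G.emeasure_space_1 by (simp del: gaussian_space)
  have "ennreal (sqrt 2 ^ d) * 1 \<le> ennreal (sqrt 2 ^ D)" unfolding eq using X1 by (intro mult_left_mono) auto
  then have "sqrt 2 ^ d \<le> sqrt 2 ^ D" by simp
  then show dD: "d \<le> D" by (subst (asm) power_increasing_iff) auto
  have "ennreal (sqrt 2 ^ d) * X = ennreal (sqrt 2 ^ d) * ennreal (sqrt 2 ^ (D - d))"
    unfolding eq[symmetric] using dD by (simp add: ennreal_mult[symmetric] power_add[symmetric])
  then show "X = ennreal (sqrt 2 ^ (D - d))"
    by (subst (asm) ennreal_mult_cancel_left) auto
qed

lemma nn_integral_gaussian_exp_along_1: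
  assumes A: "orthonormal_cols D d A" and \<sigma>: "0 < \<sigma>"
  shows "(\<integral>\<^sup>+e. ennreal (exp ((vnorm (transpose_mat A *\<^sub>v e))\<^sup>2 / (4 * \<sigma>\<^sup>2))) \<partial>gaussian D (0\<^sub>v D) (\<sigma>\<^sup>2))
    = ennreal (sqrt 2 ^ d)"
proof -
  interpret G: prob_space "gaussian D (0\<^sub>v D) (\<sigma>\<^sup>2)" using \<sigma> by (intro prob_space_gaussian) simp
  show ?thesis
    using nn_integral_gaussian_exp_along[OF A \<sigma>, of "\<lambda>_. 1"] G.emeasure_space_1 by (simp del: gaussian_space)
qed

text \<open>Inside the ball of radius \<open>B\<close> the weight is at most
  \<open>exp (a * B\<^sup>2)\<close>. Outside, half of the Gaussian decay absorbs the weight, and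
  what is left is a multiple of the centred Gaussian density of variance
  \<open>2 / C2\<close>.\<close>

lemma nn_integral_latent_exp_square:
  assumes pz: "latent_density d pz" and tail: "latent_tail d pz B C1 C2" and a: "0 \<le> a" "a \<le> C2 / 4"
  shows "(\<integral>\<^sup>+z. ennreal (exp (a * (vnorm z)\<^sup>2)) \<partial>latent_law d pz) \<le> ennreal (exp (a * B\<^sup>2) + C1 * sqrt (2 / C2) ^ d)"
proof -
  have B: "0 < B" "0 < C1" "0 < C2" using tail by (auto simp: latent_tail_def)
  have [measurable]: "pz \<in> borel_measurable (lborel_vec d)" by (rule latent_density_measurable[OF pz])
  have nn: "0 \<le> pz z" if "z \<in> carrier_vec d" for z using pz that by (auto simp: latent_density_def less_imp_le)
  let ?K = "C1 * sqrt (2 / C2) ^ d"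
  have "(\<integral>\<^sup>+z. ennreal (exp (a * (vnorm z)\<^sup>2)) \<partial>latent_law d pz)
    = (\<integral>\<^sup>+z. ennreal (pz z) * ennreal (exp (a * (vnorm z)\<^sup>2)) \<partial>lborel_vec d)"
    unfolding latent_law_def by (rule nn_integral_density) measurable
  also have "\<dots> \<le> (\<integral>\<^sup>+z. ennreal (exp (a * B\<^sup>2)) * ennreal (pz z) + ennreal ?K * ennreal (gauss_pdf d (0\<^sub>v d) (2 / C2) z) \<partial>lborel_vec d)"
  proof (rule nn_integral_mono)
    fix z :: rvec assume "z \<in> space (lborel_vec d)"
    then have z: "z \<in> carrier_vec d" by (simp only: space_lborel_vec)
    have g0: "0 \<le> ?K * gauss_pdf d (0\<^sub>v d) (2 / C2) z"
      using B by (intro mult_nonneg_nonneg gauss_pdf_nonneg) auto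
    have "pz z * exp (a * (vnorm z)\<^sup>2) \<le> exp (a * B\<^sup>2) * pz z + ?K * gauss_pdf d (0\<^sub>v d) (2 / C2) z"
    proof (cases "B \<le> vnorm z")
      case False
      then have "(vnorm z)\<^sup>2 \<le> B\<^sup>2" using vnorm_nonneg[of z] by (intro power_mono) auto
      then have "exp (a * (vnorm z)\<^sup>2) \<le> exp (a * B\<^sup>2)" using a by (simp add: mult_left_mono)
      then have "pz z * exp (a * (vnorm z)\<^sup>2) \<le> pz z * exp (a * B\<^sup>2)" using nn[OF z] by (rule mult_left_mono)
      then show ?thesis using g0 by (simp add: mult.commute)
    next
      case True
      have pdf: "gauss_pdf d (0\<^sub>v d) (2 / C2) z = (1 / sqrt (2 * pi * (2 / C2))) ^ d * exp (- C2 * (vnorm z)\<^sup>2 / 4)"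
      proof -
        have "gauss_pdf d (0\<^sub>v d) (2 / C2) z = (\<Prod>i<d. 1 / sqrt (2 * pi * (2 / C2)) * exp (- C2 * (vec_index z i)\<^sup>2 / 4))"
          unfolding gauss_pdf_0 normal_density_def using B by (intro prod.cong refl) simp
        also have "\<dots> = (1 / sqrt (2 * pi * (2 / C2))) ^ d * exp (\<Sum>i<d. - C2 * (vec_index z i)\<^sup>2 / 4)"
          unfolding prod.distrib by (simp add: exp_sum)
        also have "(\<Sum>i<d. - C2 * (vec_index z i)\<^sup>2 / 4) = - C2 * (vnorm z)\<^sup>2 / 4"
          unfolding vnorm_square[OF z] by (simp add: sum_distrib_left sum_divide_distrib)
        finally show ?thesis .
      qed
      have pw: "sqrt (2 / C2) ^ d * (1 / sqrt (2 * pi * (2 / C2))) ^ d = (2 * pi) powr (- real d / 2)"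
      proof -
        have "sqrt (2 / C2) * (1 / sqrt (2 * pi * (2 / C2))) = 1 / sqrt (2 * pi)"
          unfolding real_sqrt_mult[of "2 * pi" "2 / C2"] using B by simp
        also have "\<dots> = (2 * pi) powr (- 1 / 2)"
          by (simp add: powr_half_sqrt powr_minus_divide)
        finally have "sqrt (2 / C2) ^ d * (1 / sqrt (2 * pi * (2 / C2))) ^ d = ((2 * pi) powr (- 1 / 2)) ^ d"
          unfolding power_mult_distrib[symmetric] by simp
        also have "\<dots> = (2 * pi) powr (- real d / 2)"
          by (subst powr_realpow[symmetric]) (simp_all add: powr_powr)
        finally show ?thesis .
      qed
      have "pz z * exp (a * (vnorm z)\<^sup>2) \<le> ((2 * pi) powr (- real d / 2) * C1 * exp (- C2 * (vnorm z)\<^sup>2 / 2)) * exp (a * (vnorm z)\<^sup>2)"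
        using tail z True by (intro mult_right_mono) (auto simp: latent_tail_def)
      also have "\<dots> = (2 * pi) powr (- real d / 2) * C1 * exp (- C2 * (vnorm z)\<^sup>2 / 2 + a * (vnorm z)\<^sup>2)"
        by (simp only: exp_add mult.assoc)
      also have "\<dots> \<le> (2 * pi) powr (- real d / 2) * C1 * exp (- C2 * (vnorm z)\<^sup>2 / 4)"
      proof (intro mult_left_mono)
        have "a * (vnorm z)\<^sup>2 \<le> C2 / 4 * (vnorm z)\<^sup>2" using a by (intro mult_right_mono) auto
        then show "exp (- C2 * (vnorm z)\<^sup>2 / 2 + a * (vnorm z)\<^sup>2) \<le> exp (- C2 * (vnorm z)\<^sup>2 / 4)" by simp
      qed (use B in auto)
      also have "\<dots> = ?K * gauss_pdf d (0\<^sub>v d) (2 / C2) z" unfolding pdf pw[symmetric] by (simp only: mult_ac)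
      finally show ?thesis using nn[OF z] by (simp add: add_increasing)
    qed
    then have "ennreal (pz z * exp (a * (vnorm z)\<^sup>2)) \<le> ennreal (exp (a * B\<^sup>2) * pz z + ?K * gauss_pdf d (0\<^sub>v d) (2 / C2) z)"
      by (rule ennreal_leI)
    then show "ennreal (pz z) * ennreal (exp (a * (vnorm z)\<^sup>2)) \<le>
      ennreal (exp (a * B\<^sup>2)) * ennreal (pz z) + ennreal ?K * ennreal (gauss_pdf d (0\<^sub>v d) (2 / C2) z)"
      using nn[OF z] g0 B by (simp add: ennreal_mult ennreal_plus gauss_pdf_nonneg)
  qed
  also have "\<dots> = ennreal (exp (a * B\<^sup>2)) * (\<integral>\<^sup>+z. ennreal (pz z) \<partial>lborel_vec d)
    + ennreal ?K * (\<integral>\<^sup>+z. ennreal (gauss_pdf d (0\<^sub>v d) (2 / C2) z) \<partial>lborel_vec d)"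
    by (subst nn_integral_add) (auto simp: nn_integral_cmult)
  also have "\<dots> = ennreal (exp (a * B\<^sup>2)) + ennreal ?K"
    using pz B by (simp add: latent_density_def nn_integral_gauss_pdf)
  also have "\<dots> = ennreal (exp (a * B\<^sup>2) + ?K)" using B by simp
  finally show ?thesis .
qed

text \<open>One cap is for the noise, the other for the latent tail. Both have an eighth because the
  rate doubles when latent variable and noise are separated, and the doubled rate must stay below
  \<open>1 / 4\<close> and \<open>C2 / 4\<close>.\<close>

definition tail_rate :: "real \<Rightarrow> real" where "tail_rate C2 = min (1 / 8) (C2 / 8)"

text \<open>Bounds, per latent dimension, the logarithm of the exponential moment of the component
  along \<open>A\<close>.\<close>

definition tail_entropy :: "real \<Rightarrow> real \<Rightarrow> real \<Rightarrow> real" where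
  "tail_entropy B C1 C2 = 2 + 2 * tail_rate C2 * B\<^sup>2 + \<bar>ln C1\<bar> + \<bar>ln (2 / C2)\<bar>"

text \<open>Chosen so that \<open>tail_rate C2\<close> times its square is
  \<open>tail_entropy B C1 C2 + 2\<close>: the entropy pays for the exponential moment, the 2 for
  two factors \<delta>/(8N).\<close>

definition latent_const :: "real \<Rightarrow> real \<Rightarrow> real \<Rightarrow> real" where
  "latent_const B C1 C2 = sqrt ((tail_entropy B C1 C2 + 2) / tail_rate C2)"

lemma tail_rate_pos: "0 < C2 \<Longrightarrow> 0 < tail_rate C2" by (simp add: tail_rate_def)

lemma tail_entropy_ge: "0 < C2 \<Longrightarrow> 2 \<le> tail_entropy B C1 C2"
  using tail_rate_pos[of C2] by (simp add: tail_entropy_def)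

lemma latent_const_pos: "0 < C2 \<Longrightarrow> 0 < latent_const B C1 C2"
  using tail_rate_pos[of C2] tail_entropy_ge[of C2 B C1] by (simp add: latent_const_def)

text \<open>As \<open>d\<close> is at least 1, exponents that do not grow with the dimension may be
  multiplied by it. The summand 2 of \<open>tail_entropy\<close> pays once for adding two terms and
  once for \<open>sqrt 2 ^ d\<close>.\<close>

lemma exp_moment_le_entropy:
  assumes "0 < C1" "0 < C2" and d: "0 < d"
  shows "(exp (2 * tail_rate C2 * B\<^sup>2) + C1 * sqrt (2 / C2) ^ d) * sqrt 2 ^ d \<le> exp (real d * tail_entropy B C1 C2)"
proof -
  define a b where "a = 2 * tail_rate C2 * B\<^sup>2" and "b = \<bar>ln C1\<bar> + \<bar>ln (2 / C2)\<bar>"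
  have a0: "0 \<le> a" unfolding a_def using tail_rate_pos[OF assms(2)] by simp
  have b0: "0 \<le> b" by (simp add: b_def)
  have d1: "1 \<le> real d" using d by simp
  have mul: "y \<le> real d * y" if "0 \<le> y" for y using mult_right_mono[OF d1 that] by simp
  have 1: "exp a \<le> exp (real d * (a + b))"
    using mul[OF a0] mul[OF b0] b0 by (simp add: distrib_left)
  have "C1 \<le> exp (real d * \<bar>ln C1\<bar>)"
  proof -
    have "C1 = exp (ln C1)" using assms by simp
    also have "\<dots> \<le> exp (real d * \<bar>ln C1\<bar>)" using mul[of "\<bar>ln C1\<bar>"] by simp
    finally show ?thesis .
  qed
  moreover have "sqrt (2 / C2) ^ d \<le> exp (real d * \<bar>ln (2 / C2)\<bar>)"
  proof -
    have "sqrt (2 / C2) = exp (ln (2 / C2) / 2)" using assms by (simp add: ln_sqrt[symmetric])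
    also have "\<dots> \<le> exp \<bar>ln (2 / C2)\<bar>" by simp
    finally have "sqrt (2 / C2) ^ d \<le> exp \<bar>ln (2 / C2)\<bar> ^ d" using assms by (intro power_mono) auto
    then show ?thesis by (simp add: exp_of_nat_mult)
  qed
  ultimately have "C1 * sqrt (2 / C2) ^ d \<le> exp (real d * \<bar>ln C1\<bar>) * exp (real d * \<bar>ln (2 / C2)\<bar>)"
    using assms by (intro mult_mono) auto
  also have "\<dots> = exp (real d * b)" by (simp add: b_def exp_add[symmetric] distrib_left)
  also have "\<dots> \<le> exp (real d * (a + b))" using a0 by (simp add: distrib_left)
  finally have 2: "C1 * sqrt (2 / C2) ^ d \<le> exp (real d * (a + b))" .
  have "2 \<le> exp (real d)" using exp_ge_add_one_self[of "real d"] d1 by linarith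
  then have "2 * exp (real d * (a + b)) \<le> exp (real d) * exp (real d * (a + b))"
    by (intro mult_right_mono) auto
  then have "exp a + C1 * sqrt (2 / C2) ^ d \<le> exp (real d) * exp (real d * (a + b))"
    using 1 2 by linarith
  moreover have "sqrt 2 ^ d \<le> exp (real d)"
  proof -
    have "sqrt 2 \<le> 2" by (rule real_le_lsqrt) auto
    also have "2 \<le> exp (1 :: real)" using exp_ge_add_one_self[of 1] by simp
    finally have "sqrt 2 ^ d \<le> exp 1 ^ d" by (intro power_mono) auto
    then show ?thesis by (simp add: exp_of_nat_mult[symmetric])
  qed
  ultimately have "(exp a + C1 * sqrt (2 / C2) ^ d) * sqrt 2 ^ d \<le> exp (real d) * exp (real d * (a + b)) * exp (real d)"
    using assms by (intro mult_mono) auto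
  also have "\<dots> = exp (real d * (2 + a + b))" by (simp add: exp_add[symmetric] distrib_left)
  finally show ?thesis by (simp add: a_def b_def tail_entropy_def add.assoc)
qed

section \<open>Moments and truncation of the target law\<close>

locale target =
  fixes D d :: nat and A :: rmat and pz :: "rvec \<Rightarrow> real" and \<sigma> :: real
  assumes A: "orthonormal_cols D d A" and pz: "latent_density d pz" and \<sigma>: "0 < \<sigma>"
begin

abbreviation noise :: "rvec measure" where "noise \<equiv> gaussian D (0\<^sub>v D) (\<sigma>\<^sup>2)"
abbreviation latent :: "rvec measure" where "latent \<equiv> latent_law d pz"
abbreviation law :: "rvec measure" where "law \<equiv> target_law D d A pz \<sigma>"
abbreviation perp :: rmat where "perp \<equiv> 1\<^sub>m D - A * transpose_mat A"

sublocale noise: prob_space noise using \<sigma> by (intro prob_space_gaussian) simp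
sublocale latent: vec_prob latent d by (rule vec_prob_latent_law[OF pz])

lemma affine_measurable: "(\<lambda>(z, e). A *\<^sub>v z + e) \<in> latent \<Otimes>\<^sub>M noise \<rightarrow>\<^sub>M lborel_vec D"
proof (rule measurable_vecI)
  have fst: "fst \<in> latent \<Otimes>\<^sub>M noise \<rightarrow>\<^sub>M lborel_vec d"
    by (subst measurable_cong_sets[OF refl latent.sets_Q[symmetric]]) (rule measurable_fst)
  have snd: "snd \<in> latent \<Otimes>\<^sub>M noise \<rightarrow>\<^sub>M lborel_vec D"
    by (subst measurable_cong_sets[OF refl gaussian_sets[symmetric]]) (rule measurable_snd)
  note [measurable] = mult_mat_vec_index_measurable[OF fst] measurable_vec_index[OF snd]
  fix i assume i: "i < D"
  have "(\<lambda>w. vec_index (A *\<^sub>v fst w) i + vec_index (snd w) i) \<in> borel_measurable (latent \<Otimes>\<^sub>M noise)" by measurable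
  then show "(\<lambda>w. vec_index (case w of (z, e) \<Rightarrow> A *\<^sub>v z + e) i) \<in> borel_measurable (latent \<Otimes>\<^sub>M noise)"
  proof (rule measurable_cong[THEN iffD1, rotated])
    fix w assume "w \<in> space (latent \<Otimes>\<^sub>M noise)"
    then have "dim_vec (snd w) = D" by (intro carrier_vecD measurable_vec_carrier[OF snd])
    then show "vec_index (A *\<^sub>v fst w) i + vec_index (snd w) i = vec_index (case w of (z, e) \<Rightarrow> A *\<^sub>v z + e) i"
      using i by (simp add: split_beta)
  qed
next
  fix w assume "w \<in> space (latent \<Otimes>\<^sub>M noise)"
  then have "snd w \<in> carrier_vec D" by (simp only: space_pair_measure mem_Times_iff gaussian_space)
  then show "(case w of (z, e) \<Rightarrow> A *\<^sub>v z + e) \<in> carrier_vec D"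
    by (intro carrier_vecI) (simp add: split_beta carrier_vecD)
qed

lemma law_def: "law = distr (latent \<Otimes>\<^sub>M noise) (lborel_vec D) (\<lambda>(z, e). A *\<^sub>v z + e)"
  by (simp only: target_law_def latent_law_def)

sublocale law: vec_prob law D
proof -
  interpret pair: pair_prob_space latent noise ..
  show "vec_prob law D"
    unfolding vec_prob_def vec_prob_axioms_def law_def
    by (intro conjI pair.P.prob_space_distr affine_measurable sets_distr)
qed

lemma nn_integral_law:
  assumes f: "f \<in> borel_measurable (lborel_vec D)"
  shows "(\<integral>\<^sup>+x. f x \<partial>law) = (\<integral>\<^sup>+z. (\<integral>\<^sup>+e. f (A *\<^sub>v z + e) \<partial>noise) \<partial>latent)"
proof -
  have "(\<integral>\<^sup>+x. f x \<partial>law) = (\<integral>\<^sup>+w. f (case w of (z, e) \<Rightarrow> A *\<^sub>v z + e) \<partial>(latent \<Otimes>\<^sub>M noise))"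
    unfolding law_def by (rule nn_integral_distr[OF affine_measurable]) (simp add: f)
  also have "\<dots> = (\<integral>\<^sup>+z. (\<integral>\<^sup>+e. f (A *\<^sub>v z + e) \<partial>noise) \<partial>latent)"
    by (subst noise.nn_integral_fst[symmetric]) (use measurable_compose[OF affine_measurable f] in \<open>simp_all only: prod.case\<close>)
  finally show ?thesis .
qed

lemma along_measurable: "(\<lambda>x. vnorm (transpose_mat A *\<^sub>v x)) \<in> borel_measurable (lborel_vec D)"
  by (rule measurable_compose[OF mult_mat_vec_measurable[OF measurable_ident_sets[OF refl]] vnorm_measurable])
    (use orthonormal_colsD[OF A] in simp)

lemma perp_measurable: "(\<lambda>x. vnorm (perp *\<^sub>v x)) \<in> borel_measurable (lborel_vec D)"
  by (rule measurable_compose[OF mult_mat_vec_measurable[OF measurable_ident_sets[OF refl]] vnorm_measurable])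
    (use orthonormal_colsD[OF A] in simp)

lemma trunc_set_sets: "trunc_set D A Rz Rp \<in> sets (lborel_vec D)"
proof -
  note [measurable] = along_measurable perp_measurable
  have "trunc_set D A Rz Rp = {x \<in> space (lborel_vec D). vnorm (transpose_mat A *\<^sub>v x) \<le> Rz \<and> vnorm (perp *\<^sub>v x) \<le> Rp}"
    by (simp only: trunc_set_def space_lborel_vec)
  also have "\<dots> \<in> sets (lborel_vec D)" by measurable
  finally show ?thesis .
qed

lemma perp_moment:
  "(\<integral>\<^sup>+x. ennreal (exp ((vnorm (perp *\<^sub>v x))\<^sup>2 / (4 * \<sigma>\<^sup>2))) \<partial>law) = ennreal (sqrt 2 ^ (D - d))"
proof -
  note [measurable] = perp_measurable
  have "(\<integral>\<^sup>+x. ennreal (exp ((vnorm (perp *\<^sub>v x))\<^sup>2 / (4 * \<sigma>\<^sup>2))) \<partial>law)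
    = (\<integral>\<^sup>+z. (\<integral>\<^sup>+e. ennreal (exp ((vnorm (perp *\<^sub>v (A *\<^sub>v z + e)))\<^sup>2 / (4 * \<sigma>\<^sup>2))) \<partial>noise) \<partial>latent)"
    by (rule nn_integral_law) measurable
  also have "\<dots> = (\<integral>\<^sup>+z. ennreal (sqrt 2 ^ (D - d)) \<partial>latent)"
  proof (rule nn_integral_cong)
    fix z assume "z \<in> space latent"
    then have z: "z \<in> carrier_vec d" by (simp only: latent.space_Q)
    have "(\<integral>\<^sup>+e. ennreal (exp ((vnorm (perp *\<^sub>v (A *\<^sub>v z + e)))\<^sup>2 / (4 * \<sigma>\<^sup>2))) \<partial>noise)
      = (\<integral>\<^sup>+e. ennreal (exp ((vnorm (perp *\<^sub>v e))\<^sup>2 / (4 * \<sigma>\<^sup>2))) \<partial>noise)"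
      by (rule nn_integral_cong) (simp only: gaussian_space perp_proj(3)[OF A _ z])
    then show "(\<integral>\<^sup>+e. ennreal (exp ((vnorm (perp *\<^sub>v (A *\<^sub>v z + e)))\<^sup>2 / (4 * \<sigma>\<^sup>2))) \<partial>noise) = ennreal (sqrt 2 ^ (D - d))"
      using nn_integral_gaussian_exp_perp(2)[OF A \<sigma>] by simp
  qed
  also have "\<dots> = ennreal (sqrt 2 ^ (D - d))"
    by (simp only: nn_integral_const latent.emeasure_space_1 mult_1_right)
  finally show ?thesis .
qed

text \<open>The inequality |z + u|^2 \<le> 2|z|^2 + 2|u|^2 separates latent variable and noise.
  Dividing the rate by \<open>(1 + \<sigma>)\<^sup>2\<close> keeps it below both thresholds,
  \<open>C2 / 4\<close> for the latent part and \<open>1 / (4 * \<sigma>\<^sup>2)\<close> for the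
  noise, so the bound does not depend on \<open>\<sigma>\<close>.\<close>

lemma along_moment:
  assumes tail: "latent_tail d pz B C1 C2" and d: "0 < d"
  shows "(\<integral>\<^sup>+x. ennreal (exp (tail_rate C2 / (1 + \<sigma>)\<^sup>2 * (vnorm (transpose_mat A *\<^sub>v x))\<^sup>2)) \<partial>law)
    \<le> ennreal (exp (real d * tail_entropy B C1 C2))"
proof -
  have C: "0 < C1" "0 < C2" using tail by (auto simp: latent_tail_def)
  define c0 where "c0 = tail_rate C2"
  define c where "c = c0 / (1 + \<sigma>)\<^sup>2"
  have c0: "0 < c0" "c0 \<le> 1 / 8" "2 * c0 \<le> C2 / 4" using C tail_rate_pos[of C2] by (auto simp: c0_def tail_rate_def)
  have s1: "1 \<le> (1 + \<sigma>)\<^sup>2" and s2: "\<sigma>\<^sup>2 \<le> (1 + \<sigma>)\<^sup>2" using \<sigma> by (auto simp: power2_eq_square algebra_simps)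
  have cle1: "2 * c \<le> 2 * c0"
    using c0 s1 mult_left_mono[of 1 "(1 + \<sigma>)\<^sup>2" c0] by (simp add: c_def divide_le_eq)
  have cle2: "2 * c \<le> 1 / (4 * \<sigma>\<^sup>2)"
  proof -
    have "2 * c = (2 * c0) / (1 + \<sigma>)\<^sup>2" by (simp add: c_def)
    also have "\<dots> \<le> (1 / 4) / (1 + \<sigma>)\<^sup>2" using c0 by (intro divide_right_mono) auto
    also have "\<dots> \<le> (1 / 4) / \<sigma>\<^sup>2" using s2 \<sigma> by (intro divide_left_mono) auto
    finally show ?thesis by simp
  qed
  note [measurable] = along_measurable
  have At: "(\<lambda>x. transpose_mat A *\<^sub>v x) \<in> lborel_vec D \<rightarrow>\<^sub>M lborel_vec d"
    by (rule mult_mat_vec_measurable[OF measurable_ident_sets[OF refl]]) (use orthonormal_colsD[OF A] in simp)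
  have "(\<integral>\<^sup>+x. ennreal (exp (c * (vnorm (transpose_mat A *\<^sub>v x))\<^sup>2)) \<partial>law)
    = (\<integral>\<^sup>+z. (\<integral>\<^sup>+e. ennreal (exp (c * (vnorm (transpose_mat A *\<^sub>v (A *\<^sub>v z + e)))\<^sup>2)) \<partial>noise) \<partial>latent)"
    by (rule nn_integral_law) measurable
  also have "\<dots> \<le> (\<integral>\<^sup>+z. ennreal (exp (2 * c0 * (vnorm z)\<^sup>2)) * ennreal (sqrt 2 ^ d) \<partial>latent)"
  proof (rule nn_integral_mono)
    fix z assume "z \<in> space latent"
    then have z: "z \<in> carrier_vec d" by (simp only: latent.space_Q)
    have "(\<integral>\<^sup>+e. ennreal (exp (c * (vnorm (transpose_mat A *\<^sub>v (A *\<^sub>v z + e)))\<^sup>2)) \<partial>noise)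
      \<le> (\<integral>\<^sup>+e. ennreal (exp (2 * c0 * (vnorm z)\<^sup>2)) * ennreal (exp ((vnorm (transpose_mat A *\<^sub>v e))\<^sup>2 / (4 * \<sigma>\<^sup>2))) \<partial>noise)"
    proof (rule nn_integral_mono)
      fix e assume "e \<in> space noise"
      then have e: "e \<in> carrier_vec D" by (simp only: gaussian_space)
      let ?u = "transpose_mat A *\<^sub>v e"
      have u: "?u \<in> carrier_vec d" using orthonormal_colsD[OF A] by (intro carrier_vecI) simp
      have zu: "z + ?u \<in> carrier_vec d" using z u by simp
      have "(vnorm (z + ?u))\<^sup>2 = (\<Sum>i<d. (vec_index z i - - vec_index ?u i)\<^sup>2)"
        unfolding vnorm_square[OF zu] using carrier_vecD[OF u] by (intro sum.cong refl) simp
      also have "\<dots> \<le> 2 * (\<Sum>i<d. (vec_index z i)\<^sup>2) + 2 * (\<Sum>i<d. (- vec_index ?u i)\<^sup>2)"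
        by (rule sum_square_diff_le)
      also have "\<dots> = 2 * (vnorm z)\<^sup>2 + 2 * (vnorm ?u)\<^sup>2"
        unfolding vnorm_square[OF z] vnorm_square[OF u] by simp
      finally have "(vnorm (z + ?u))\<^sup>2 \<le> 2 * (vnorm z)\<^sup>2 + 2 * (vnorm ?u)\<^sup>2" .
      then have "c * (vnorm (z + ?u))\<^sup>2 \<le> c * (2 * (vnorm z)\<^sup>2 + 2 * (vnorm ?u)\<^sup>2)"
        using c0 by (intro mult_left_mono) (auto simp: c_def)
      also have "\<dots> = 2 * c * (vnorm z)\<^sup>2 + 2 * c * (vnorm ?u)\<^sup>2" by (simp add: algebra_simps)
      also have "\<dots> \<le> 2 * c0 * (vnorm z)\<^sup>2 + 1 / (4 * \<sigma>\<^sup>2) * (vnorm ?u)\<^sup>2"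
        using cle1 cle2 by (intro add_mono mult_right_mono) auto
      finally have "exp (c * (vnorm (transpose_mat A *\<^sub>v (A *\<^sub>v z + e)))\<^sup>2)
        \<le> exp (2 * c0 * (vnorm z)\<^sup>2 + 1 / (4 * \<sigma>\<^sup>2) * (vnorm ?u)\<^sup>2)"
        unfolding perp_proj(2)[OF A e z] by (simp only: exp_le_cancel_iff)
      then show "ennreal (exp (c * (vnorm (transpose_mat A *\<^sub>v (A *\<^sub>v z + e)))\<^sup>2))
        \<le> ennreal (exp (2 * c0 * (vnorm z)\<^sup>2)) * ennreal (exp ((vnorm ?u)\<^sup>2 / (4 * \<sigma>\<^sup>2)))"
        by (simp add: ennreal_mult[symmetric] exp_add ennreal_leI)
    qed
    also have "\<dots> = ennreal (exp (2 * c0 * (vnorm z)\<^sup>2)) * (\<integral>\<^sup>+e. ennreal (exp ((vnorm (transpose_mat A *\<^sub>v e))\<^sup>2 / (4 * \<sigma>\<^sup>2))) \<partial>noise)"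
      by (rule nn_integral_cmult) measurable
    finally show "(\<integral>\<^sup>+e. ennreal (exp (c * (vnorm (transpose_mat A *\<^sub>v (A *\<^sub>v z + e)))\<^sup>2)) \<partial>noise)
      \<le> ennreal (exp (2 * c0 * (vnorm z)\<^sup>2)) * ennreal (sqrt 2 ^ d)"
      by (simp only: nn_integral_gaussian_exp_along_1[OF A \<sigma>])
  qed
  also have "\<dots> = (\<integral>\<^sup>+z. ennreal (exp (2 * c0 * (vnorm z)\<^sup>2)) \<partial>latent) * ennreal (sqrt 2 ^ d)"
  proof (rule nn_integral_multc)
    have "vnorm \<in> borel_measurable latent"
      by (subst measurable_cong_sets[OF latent.sets_Q refl]) (rule vnorm_measurable)
    then show "(\<lambda>z. ennreal (exp (2 * c0 * (vnorm z)\<^sup>2))) \<in> borel_measurable latent" by measurable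
  qed
  also have "\<dots> \<le> ennreal (exp (2 * c0 * B\<^sup>2) + C1 * sqrt (2 / C2) ^ d) * ennreal (sqrt 2 ^ d)"
    using c0 by (intro mult_right_mono nn_integral_latent_exp_square[OF pz tail]) auto
  also have "\<dots> \<le> ennreal (exp (real d * tail_entropy B C1 C2))"
    using exp_moment_le_entropy[OF C d, of B] C
    by (subst ennreal_mult[symmetric]) (auto simp: c0_def intro!: ennreal_leI)
  finally show ?thesis by (simp add: c_def c0_def)
qed

text \<open>Since a number is at most its exponential, the two exponential moments, along and across
  \<open>A\<close>, dominate the squared norm.\<close>

lemma second_moments:
  assumes tail: "latent_tail d pz B C1 C2" and d: "0 < d" and i: "i < D"
  shows "integrable law (\<lambda>x. (vec_index x i)\<^sup>2)"
proof (rule integrableI_bounded)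
  define c where "c = tail_rate C2 / (1 + \<sigma>)\<^sup>2"
  have c: "0 < c" using tail_rate_pos[of C2] tail \<sigma> by (simp add: c_def latent_tail_def)
  let ?u = "\<lambda>x. exp (c * (vnorm (transpose_mat A *\<^sub>v x))\<^sup>2)" and ?v = "\<lambda>x. exp ((vnorm (perp *\<^sub>v x))\<^sup>2 / (4 * \<sigma>\<^sup>2))"
  have [measurable]: "?u \<in> borel_measurable law" "?v \<in> borel_measurable law"
    using along_measurable perp_measurable
    by (subst measurable_cong_sets[OF law.sets_Q refl], measurable)+
  have "(\<integral>\<^sup>+x. ennreal (norm ((vec_index x i)\<^sup>2)) \<partial>law)
    \<le> (\<integral>\<^sup>+x. ennreal (1 / c) * ennreal (?u x) + ennreal (4 * \<sigma>\<^sup>2) * ennreal (?v x) \<partial>law)"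
  proof (rule nn_integral_mono)
    fix x assume "x \<in> space law"
    then have x: "x \<in> carrier_vec D" by (simp only: law.space_Q)
    have "(vec_index x i)\<^sup>2 \<le> (vnorm x)\<^sup>2"
      unfolding vnorm_square[OF x] using i by (intro member_le_sum) auto
    also have "\<dots> = (vnorm (transpose_mat A *\<^sub>v x))\<^sup>2 + (vnorm (perp *\<^sub>v x))\<^sup>2" by (rule perp_proj(1)[OF A x])
    also have "\<dots> \<le> 1 / c * ?u x + 4 * \<sigma>\<^sup>2 * ?v x"
    proof (rule add_mono)
      have "c * (vnorm (transpose_mat A *\<^sub>v x))\<^sup>2 \<le> ?u x"
        using exp_ge_add_one_self[of "c * (vnorm (transpose_mat A *\<^sub>v x))\<^sup>2"] by linarith
      then show "(vnorm (transpose_mat A *\<^sub>v x))\<^sup>2 \<le> 1 / c * ?u x" using c by (simp add: field_simps)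
      have "(vnorm (perp *\<^sub>v x))\<^sup>2 / (4 * \<sigma>\<^sup>2) \<le> ?v x"
        using exp_ge_add_one_self[of "(vnorm (perp *\<^sub>v x))\<^sup>2 / (4 * \<sigma>\<^sup>2)"] by linarith
      then show "(vnorm (perp *\<^sub>v x))\<^sup>2 \<le> 4 * \<sigma>\<^sup>2 * ?v x" using \<sigma> by (simp add: divide_le_eq mult.commute)
    qed
    finally have "ennreal ((vec_index x i)\<^sup>2) \<le> ennreal (1 / c * ?u x + 4 * \<sigma>\<^sup>2 * ?v x)" by (rule ennreal_leI)
    then show "ennreal (norm ((vec_index x i)\<^sup>2)) \<le> ennreal (1 / c) * ennreal (?u x) + ennreal (4 * \<sigma>\<^sup>2) * ennreal (?v x)"
      using c by (simp add: ennreal_mult[symmetric])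
  qed
  also have "\<dots> = ennreal (1 / c) * (\<integral>\<^sup>+x. ennreal (?u x) \<partial>law) + ennreal (4 * \<sigma>\<^sup>2) * (\<integral>\<^sup>+x. ennreal (?v x) \<partial>law)"
    by (subst nn_integral_add) (auto simp: nn_integral_cmult)
  also have "\<dots> \<le> ennreal (1 / c) * ennreal (exp (real d * tail_entropy B C1 C2)) + ennreal (4 * \<sigma>\<^sup>2) * ennreal (sqrt 2 ^ (D - d))"
    unfolding perp_moment using along_moment[OF tail d] by (intro add_right_mono mult_left_mono) (simp_all add: c_def)
  also have "\<dots> < \<infinity>"
    by (simp add: ennreal_mult_less_top)
  finally show "(\<integral>\<^sup>+x. ennreal (norm ((vec_index x i)\<^sup>2)) \<partial>law) < \<infinity>" .
  show "(\<lambda>x. (vec_index x i)\<^sup>2) \<in> borel_measurable law" by measurable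
qed

text \<open>Outside the truncation set the larger relative squared radius \<open>m\<close> exceeds
  1, and \<open>1 + (vnorm x)\<^sup>2 / (Rz\<^sup>2 + Rp\<^sup>2)\<close> is at most
  \<open>2 * m\<close>, hence at most \<open>2 * exp (s * (m - 1))\<close> for any
  \<open>s \<ge> 1\<close>. A single Chernoff argument thus covers the mass and the second
  moment.\<close>

lemma tail_bound:
  assumes tail: "latent_tail d pz B C1 C2" and d: "0 < d" and N: "0 < N" and \<delta>: "0 < \<delta>" "\<delta> < 1"
    and Rz: "Rz = latent_radius (latent_const B C1 C2) d \<sigma> N \<delta>" and Rp: "Rp = perp_radius 3 D d \<sigma> N \<delta>"
  shows "0 < Rz" "0 < Rp"
    and "(\<integral>\<^sup>+x. ennreal (indicat_real (space law - trunc_set D A Rz Rp) x * (1 + (vnorm x)\<^sup>2 / (Rz\<^sup>2 + Rp\<^sup>2))) \<partial>law)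
      \<le> ennreal (\<delta> / (16 * real N))"
proof -
  have C: "0 < C1" "0 < C2" using tail by (auto simp: latent_tail_def)
  define l where "l = ln (8 * real N / \<delta>)"
  have arg: "8 \<le> 8 * real N / \<delta>"
  proof -
    have "8 * \<delta> \<le> 8 * real N" using \<delta> N by linarith
    then show ?thesis using \<delta> by (simp add: le_divide_eq)
  qed
  have l1: "1 \<le> l"
  proof -
    have "exp 1 \<le> (8 :: real)" using exp_le by linarith
    then have "exp 1 \<le> 8 * real N / \<delta>" using arg by linarith
    then show ?thesis unfolding l_def using arg by (subst ln_ge_iff) auto
  qed
  have el: "exp (- l) = \<delta> / (8 * real N)"
    unfolding l_def using arg \<delta> N by (simp add: exp_minus)
  have dD: "d \<le> D" by (rule nn_integral_gaussian_exp_perp(1)[OF A \<sigma>])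
  define H where "H = tail_entropy B C1 C2"
  have H: "2 \<le> H" unfolding H_def by (rule tail_entropy_ge[OF C(2)])
  define c where "c = tail_rate C2 / (1 + \<sigma>)\<^sup>2"
  have c: "0 < c" using tail_rate_pos[OF C(2)] \<sigma> by (simp add: c_def)
  define sz where "sz = c * Rz\<^sup>2"
  define sp where "sp = Rp\<^sup>2 / (4 * \<sigma>\<^sup>2)"
  show Rz0: "0 < Rz"
    unfolding Rz latent_radius_def l_def[symmetric]
    using latent_const_pos[OF C(2), of B C1] \<sigma> l1 by (intro mult_pos_pos add_nonneg_pos) auto
  show Rp0: "0 < Rp"
    unfolding Rp perp_radius_def l_def[symmetric]
    using \<sigma> l1 dD by (intro mult_pos_pos add_nonneg_pos) auto
  have sq: "a + b \<le> (sqrt a + sqrt b)\<^sup>2" if "0 \<le> a" "0 \<le> b" for a b :: real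
    using that by (simp add: power2_sum)
  have "c * Rz\<^sup>2 = tail_rate C2 * (latent_const B C1 C2)\<^sup>2 * (sqrt (real d) + sqrt l)\<^sup>2"
    unfolding c_def Rz latent_radius_def l_def using \<sigma> by (simp add: power_mult_distrib)
  also have "tail_rate C2 * (latent_const B C1 C2)\<^sup>2 = H + 2"
    unfolding latent_const_def H_def[symmetric] using tail_rate_pos[OF C(2)] H by simp
  finally have "sz = (H + 2) * (sqrt (real d) + sqrt l)\<^sup>2" by (simp add: sz_def)
  moreover have "(H + 2) * (real d + l) \<le> (H + 2) * (sqrt (real d) + sqrt l)\<^sup>2"
    using sq[of "real d" l] l1 H by (intro mult_left_mono) auto
  ultimately have sz_ge: "(H + 2) * (real d + l) \<le> sz" by simp
  \<comment> \<open>The exponent at the boundary exceeds the logarithm of the moment by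
    \<open>2 * l\<close>. The doubled \<open>l\<close> produces the square of \<delta>/(8N), and one
    of the two factors, being at most 1/8, absorbs the constant 4 at the end.\<close>
  have szl: "real d * H + 2 * l \<le> sz"
  proof -
    have "0 \<le> 2 * real d + H * l" using H l1 by simp
    moreover have "(H + 2) * (real d + l) = real d * H + 2 * l + (2 * real d + H * l)" by (simp add: algebra_simps)
    ultimately show ?thesis using sz_ge by linarith
  qed
  moreover have "0 \<le> real d * H" using H by simp
  ultimately have sz1: "1 \<le> sz" using l1 by linarith
  \<comment> \<open>The 9/4 is 3^2/4 from the radius constant 3; it exceeds both coefficients
    wanted, 1 for the codimension and 2 for \<open>l\<close>.\<close>
  have "sp = (9 / 4) * (sqrt (real D - real d) + sqrt l)\<^sup>2"
    unfolding sp_def Rp perp_radius_def l_def[symmetric] using \<sigma> by (simp add: power_mult_distrib)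
  moreover have "(9 / 4) * ((real D - real d) + l) \<le> (9 / 4) * (sqrt (real D - real d) + sqrt l)\<^sup>2"
    using sq[of "real D - real d" l] l1 dD by (intro mult_left_mono) auto
  moreover have "(9 / 4) * ((real D - real d) + l) = 9 / 4 * (real D - real d) + 9 / 4 * l" by (rule distrib_left)
  moreover have "0 \<le> real D - real d" using dD by simp
  ultimately have spl: "real (D - d) + 2 * l \<le> sp" using l1 dD by (simp add: of_nat_diff)
  then have sp1: "1 \<le> sp" using l1 by (smt (verit) of_nat_0_le_iff)
  let ?u = "\<lambda>x. exp (c * (vnorm (transpose_mat A *\<^sub>v x))\<^sup>2)" and ?v = "\<lambda>x. exp ((vnorm (perp *\<^sub>v x))\<^sup>2 / (4 * \<sigma>\<^sup>2))"
  have [measurable]: "?u \<in> borel_measurable law" "?v \<in> borel_measurable law"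
    using along_measurable perp_measurable
    by (subst measurable_cong_sets[OF law.sets_Q refl], measurable)+
  have "(\<integral>\<^sup>+x. ennreal (indicat_real (space law - trunc_set D A Rz Rp) x * (1 + (vnorm x)\<^sup>2 / (Rz\<^sup>2 + Rp\<^sup>2))) \<partial>law)
    \<le> (\<integral>\<^sup>+x. ennreal (2 * exp (- sz)) * ennreal (?u x) + ennreal (2 * exp (- sp)) * ennreal (?v x) \<partial>law)"
  proof (rule nn_integral_mono)
    fix x assume "x \<in> space law"
    then have x: "x \<in> carrier_vec D" by (simp only: law.space_Q)
    define p q where "p = (vnorm (transpose_mat A *\<^sub>v x))\<^sup>2 / Rz\<^sup>2" and "q = (vnorm (perp *\<^sub>v x))\<^sup>2 / Rp\<^sup>2"
    have pu: "exp (- sz) * ?u x = exp (sz * (p - 1))"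
      unfolding exp_add[symmetric] sz_def p_def using Rz0 by (simp add: algebra_simps)
    have qv: "exp (- sp) * ?v x = exp (sp * (q - 1))"
      unfolding exp_add[symmetric] sp_def q_def using Rp0 \<sigma> by (simp add: field_simps)
    have big: "2 * m \<le> 2 * exp (s * (m - 1))" if "1 \<le> m" "1 \<le> s" for m s :: real
    proof -
      have "m \<le> exp (m - 1)" using exp_ge_add_one_self[of "m - 1"] by simp
      also have "\<dots> \<le> exp (s * (m - 1))" using that by (simp add: mult_le_cancel_right1)
      finally show ?thesis by simp
    qed
    have "indicat_real (space law - trunc_set D A Rz Rp) x * (1 + (vnorm x)\<^sup>2 / (Rz\<^sup>2 + Rp\<^sup>2))
      \<le> 2 * exp (sz * (p - 1)) + 2 * exp (sp * (q - 1))"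
    proof (cases "x \<in> trunc_set D A Rz Rp")
      case False
      have pq: "1 < p \<or> 1 < q"
      proof (rule ccontr)
        assume "\<not> (1 < p \<or> 1 < q)"
        then have "(vnorm (transpose_mat A *\<^sub>v x))\<^sup>2 \<le> Rz\<^sup>2" "(vnorm (perp *\<^sub>v x))\<^sup>2 \<le> Rp\<^sup>2"
          using Rz0 Rp0 by (auto simp: p_def q_def)
        then have "vnorm (transpose_mat A *\<^sub>v x) \<le> Rz" "vnorm (perp *\<^sub>v x) \<le> Rp"
          using Rz0 Rp0 by (auto intro: power2_le_imp_le)
        with False x show False by (simp add: trunc_set_def)
      qed
      define m where "m = max p q"
      have m1: "1 \<le> m" using pq by (auto simp: m_def)
      have "(vnorm x)\<^sup>2 = p * Rz\<^sup>2 + q * Rp\<^sup>2"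
        unfolding perp_proj(1)[OF A x] p_def q_def using Rz0 Rp0 by simp
      also have "\<dots> \<le> m * Rz\<^sup>2 + m * Rp\<^sup>2" by (intro add_mono mult_right_mono) (auto simp: m_def)
      finally have "(vnorm x)\<^sup>2 / (Rz\<^sup>2 + Rp\<^sup>2) \<le> m"
        using Rz0 Rp0 by (simp add: divide_le_eq add_pos_pos distrib_left)
      then have "1 + (vnorm x)\<^sup>2 / (Rz\<^sup>2 + Rp\<^sup>2) \<le> 2 * m" using m1 by linarith
      also have "\<dots> \<le> 2 * exp (sz * (p - 1)) + 2 * exp (sp * (q - 1))"
      proof (cases "p \<le> q")
        case True
        then have "2 * m \<le> 2 * exp (sp * (q - 1))" using big[of m sp] m1 sp1 by (simp add: m_def max_def)
        then show ?thesis using exp_ge_zero[of "sz * (p - 1)"] by linarith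
      next
        case False
        then have "2 * m \<le> 2 * exp (sz * (p - 1))" using big[of m sz] m1 sz1 by (simp add: m_def max_def)
        then show ?thesis using exp_ge_zero[of "sp * (q - 1)"] by linarith
      qed
      finally show ?thesis by (auto simp: indicator_def)
    qed simp
    then have "ennreal (indicat_real (space law - trunc_set D A Rz Rp) x * (1 + (vnorm x)\<^sup>2 / (Rz\<^sup>2 + Rp\<^sup>2)))
      \<le> ennreal (2 * exp (- sz) * ?u x + 2 * exp (- sp) * ?v x)"
      by (intro ennreal_leI) (simp add: pu qv mult.assoc)
    also have "\<dots> = ennreal (2 * exp (- sz)) * ennreal (?u x) + ennreal (2 * exp (- sp)) * ennreal (?v x)"
      by (subst ennreal_plus) (simp_all add: ennreal_mult)
    finally show "ennreal (indicat_real (space law - trunc_set D A Rz Rp) x * (1 + (vnorm x)\<^sup>2 / (Rz\<^sup>2 + Rp\<^sup>2)))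
      \<le> ennreal (2 * exp (- sz)) * ennreal (?u x) + ennreal (2 * exp (- sp)) * ennreal (?v x)" .
  qed
  also have "\<dots> = ennreal (2 * exp (- sz)) * (\<integral>\<^sup>+x. ennreal (?u x) \<partial>law) + ennreal (2 * exp (- sp)) * (\<integral>\<^sup>+x. ennreal (?v x) \<partial>law)"
    by (subst nn_integral_add) (auto simp: nn_integral_cmult)
  also have "\<dots> \<le> ennreal (2 * exp (- sz)) * ennreal (exp (real d * H)) + ennreal (2 * exp (- sp)) * ennreal (sqrt 2 ^ (D - d))"
    unfolding perp_moment using along_moment[OF tail d] by (intro add_right_mono mult_left_mono) (simp_all add: c_def H_def)
  also have "\<dots> = ennreal (2 * exp (- sz) * exp (real d * H) + 2 * exp (- sp) * sqrt 2 ^ (D - d))"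
    by (subst ennreal_plus) (simp_all add: ennreal_mult)
  also have "\<dots> \<le> ennreal (2 * exp (- (2 * l)) + 2 * exp (- (2 * l)))"
  proof (intro ennreal_leI add_mono)
    show "2 * exp (- sz) * exp (real d * H) \<le> 2 * exp (- (2 * l))"
      using szl by (simp add: mult.assoc exp_add[symmetric])
    have "sqrt 2 ^ (D - d) \<le> exp 1 ^ (D - d)"
    proof (rule power_mono)
      have "sqrt 2 \<le> 2" by (rule real_le_lsqrt) auto
      also have "2 \<le> exp (1 :: real)" using exp_ge_add_one_self[of 1] by simp
      finally show "sqrt 2 \<le> exp (1 :: real)" .
    qed simp
    also have "\<dots> = exp (real (D - d))" by (simp add: exp_of_nat_mult[symmetric])
    finally have "2 * exp (- sp) * sqrt 2 ^ (D - d) \<le> 2 * exp (- sp) * exp (real (D - d))"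
      by (intro mult_left_mono) auto
    also have "\<dots> \<le> 2 * exp (- (2 * l))"
      using spl by (simp add: mult.assoc exp_add[symmetric])
    finally show "2 * exp (- sp) * sqrt 2 ^ (D - d) \<le> 2 * exp (- (2 * l))" .
  qed
  also have "2 * exp (- (2 * l)) + 2 * exp (- (2 * l)) = 4 * (exp (- l) * exp (- l))"
    by (simp add: exp_add[symmetric])
  also have "ennreal \<dots> \<le> ennreal (\<delta> / (16 * real N))"
  proof (rule ennreal_leI)
    have "exp (- l) * (\<delta> / (8 * real N)) \<le> 1 / 8 * (\<delta> / (8 * real N))"
    proof (rule mult_right_mono)
      have "\<delta> / (8 * real N) \<le> 1 / 8" using \<delta> N by (simp add: divide_le_eq)
      then show "exp (- l) \<le> 1 / 8" by (simp only: el)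
    qed (use \<delta> in simp)
    then show "4 * (exp (- l) * exp (- l)) \<le> \<delta> / (16 * real N)" unfolding el by simp
  qed
  finally show "(\<integral>\<^sup>+x. ennreal (indicat_real (space law - trunc_set D A Rz Rp) x * (1 + (vnorm x)\<^sup>2 / (Rz\<^sup>2 + Rp\<^sup>2))) \<partial>law)
      \<le> ennreal (\<delta> / (16 * real N))" .
qed

end

section \<open>Oracle inequality for the empirical minimizer\<close>

lemma numeral_mult_ennreal: "numeral w * ennreal a = ennreal (numeral w * a)"
  by (simp add: ennreal_mult')

locale estimation = diffusion D t0 T P U R K \<Lambda> for D t0 T P U R K \<Lambda> +
  fixes d1 :: nat and V :: rmat and F :: "vfield set"
  assumes V: "orthonormal_cols D d1 V"
    and F_meas: "\<And>f. f \<in> F \<Longrightarrow> compressed V f \<in> \<mu> \<rightarrow>\<^sub>M lborel_vec d1"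
    and F_norm: "\<And>f z t. f \<in> F \<Longrightarrow> z \<in> carrier_vec d1 \<Longrightarrow> t0 \<le> t \<Longrightarrow> t \<le> T \<Longrightarrow> vnorm (f z t) \<le> K"
begin

lemma V_carrier: "V \<in> carrier_mat D d1" using V by (simp add: orthonormal_cols_def)

definition base :: "rvec \<Rightarrow> real" where
  "base x = (\<integral>w. kern x w * (\<Sum>i<D. (signal i x w - post_mean U i w)\<^sup>2) \<partial>\<mu>)"

lemma channel_predictor_lifted:
  assumes f: "f \<in> F"
  shows "channel_predictor P \<mu> kern signal D U \<rho> \<theta> K B (1 / (hvar t0)\<^sup>2) (lifted V f)"
proof unfold_locales
  show "lifted V f i \<in> borel_measurable \<mu>" for i by (rule lifted_measurable[OF F_meas[OF f]])
  fix w assume w: "w \<in> space \<mu>"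
  then obtain t y where ty: "w = (t, y)" "t0 \<le> t" "t \<le> T" by (rule \<mu>_cases)
  have z: "transpose_mat V *\<^sub>v snd w \<in> carrier_vec d1" using V_carrier by (intro carrier_vecI) simp
  have "vnorm (f (transpose_mat V *\<^sub>v snd w) (fst w)) \<le> K"
    by (rule F_norm[OF f z]) (simp_all add: ty)
  then show "(\<Sum>i<D. (lifted V f i w)\<^sup>2) \<le> K\<^sup>2"
    unfolding sum_lifted_square[OF V F_meas[OF f] w] by (intro power_mono vnorm_nonneg)
qed

text \<open>The facts about a predictor live in an interpretation that depends on \<open>f\<close>.
  Bundled as a predicate on an excess function \<open>g\<close> and its conditional mean
  \<open>r\<close>, they can be chosen for all networks at once.\<close>

definition excess_pair :: "vfield \<Rightarrow> (rvec \<Rightarrow> real) \<Rightarrow> real \<Rightarrow> bool" where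
  "excess_pair f g r \<longleftrightarrow> g \<in> borel_measurable P \<and> 0 \<le> r \<and> (\<forall>x\<in>U. \<bar>g x - r\<bar> \<le> 48 * B) \<and>
    (\<integral>x. indicat_real U x * (g x - r) \<partial>P) = 0 \<and>
    (\<integral>x. indicat_real U x * (g x - r)\<^sup>2 \<partial>P) \<le> 48 * B * r \<and>
    (\<forall>x\<in>carrier_vec D. 0 \<le> base x + g x \<and> denoising_loss D t0 T x (frozen_score V f) = ennreal (base x + g x)) \<and>
    score_risk D t0 T P (frozen_score V f) \<le> 2 * ennreal r + ennreal (8 * B) * tail_mass \<and>
    ennreal r \<le> 4 * score_risk D t0 T P (frozen_score V f) + ennreal (8 * B) * tail_mass"

lemma excess_pair_exists:
  assumes f: "f \<in> F"
  shows "\<exists>g r. excess_pair f g r"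
proof -
  interpret pr: channel_predictor P \<mu> kern signal D U \<rho> \<theta> K B "1 / (hvar t0)\<^sup>2" "lifted V f"
    by (rule channel_predictor_lifted[OF f])
  have risk: "score_risk D t0 T P (frozen_score V f) = pr.risk"
    unfolding pr.risk_def by (rule score_risk_frozen[OF V_carrier F_meas[OF f]])
  have loss: "0 \<le> base x + pr.excess x \<and> denoising_loss D t0 T x (frozen_score V f) = ennreal (base x + pr.excess x)"
    if x: "x \<in> carrier_vec D" for x
  proof -
    have xP: "x \<in> space P" using x by simp
    have eq: "base x + pr.excess x = (\<integral>w. kern x w * (\<Sum>i<D. (signal i x w - lifted V f i w)\<^sup>2) \<partial>\<mu>)"
      unfolding base_def pr.excess_def pr.loss_difference(2)[OF xP] ..
    have nn: "0 \<le> kern x w * (\<Sum>i<D. (signal i x w - lifted V f i w)\<^sup>2)" for w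
      by (intro mult_nonneg_nonneg kern_nonneg sum_nonneg) simp
    have "denoising_loss D t0 T x (frozen_score V f) =
      ennreal (\<integral>w. kern x w * (\<Sum>i<D. (signal i x w - lifted V f i w)\<^sup>2) \<partial>\<mu>)"
      unfolding denoising_loss_frozen[OF V_carrier x F_meas[OF f]]
      using pr.loss_difference(1)[OF xP] nn by (intro nn_integral_eq_integral AE_I2)
    moreover have "0 \<le> (\<integral>w. kern x w * (\<Sum>i<D. (signal i x w - lifted V f i w)\<^sup>2) \<partial>\<mu>)"
      using nn by (intro Bochner_Integration.integral_nonneg)
    ultimately show ?thesis unfolding eq by simp
  qed
  show ?thesis
    by (rule exI[of _ pr.excess], rule exI[of _ pr.risk_in])
      (use pr.excess_measurable pr.risk_in_nonneg pr.excess_bound pr.excess_mean pr.excess_second_moment loss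
        pr.risk_le_risk_in pr.risk_in_le_risk in \<open>simp add: risk excess_pair_def\<close>)
qed

text \<open>Two kinds of deviation suffice: from below at the net points, so that the minimizer does
  not look better than it is, and from above at the reference \<open>f0\<close>. Bernstein's
  inequality loses half of \<open>r h\<close> and adds half of \<open>r f0\<close>, which gives a
  factor 3; passing from the score risk to \<open>r\<close> and back contributes 2 and 4, hence the
  24.\<close>

lemma erm_oracle_inequality:
  fixes N m :: nat and \<delta> \<iota> :: real
  assumes N: "0 < N" and \<delta>: "0 < \<delta>" "\<delta> < 1" and \<iota>: "0 \<le> \<iota>"
    and tail: "tail_mass \<le> ennreal (\<delta> / (16 * real N))"
    and G: "finite G" "G \<subseteq> F" "card G \<le> m" "0 < m"
    and net: "\<And>f. f \<in> F \<Longrightarrow> \<exists>g\<in>G. \<forall>x\<in>U. \<bar>enn2real (denoising_loss D t0 T x (frozen_score V f))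
        - enn2real (denoising_loss D t0 T x (frozen_score V g))\<bar> \<le> \<iota>"
    and f0: "f0 \<in> F"
  shows "\<exists>E\<in>sets (\<Pi>\<^sub>M i\<in>{..<N}. P). 1 - \<delta> \<le> measure (\<Pi>\<^sub>M i\<in>{..<N}. P) E \<and>
    (\<forall>X\<in>E. \<forall>s\<in>empirical_minimizers D t0 T N X (frozen_class V F).
      score_risk D t0 T P s \<le> ennreal (6 * \<iota>) + ennreal (800 * B * (ln (real m) + ln (8 / \<delta>)) / real N)
        + 24 * score_risk D t0 T P (frozen_score V f0))"
proof -
  let ?PN = "\<Pi>\<^sub>M i\<in>{..<N}. P"
  interpret PN': prob_space ?PN by (rule prob_space_PiM) unfold_locales
  interpret PN: product_prob_space "\<lambda>_. P" "{..<N}" ..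
  have U_vec [simp]: "U \<in> sets (lborel_vec D)" using U_sets by simp
  have "\<forall>f\<in>F. \<exists>gr. excess_pair f (fst gr) (snd gr)" using excess_pair_exists by simp
  from bchoice[OF this] obtain gr where gr: "\<forall>f\<in>F. excess_pair f (fst (gr f)) (snd (gr f))" by (elim exE)
  define g r where "g f = fst (gr f)" and "r f = snd (gr f)" for f
  have g_meas [measurable]: "g f \<in> borel_measurable P" and r0: "0 \<le> r f"
    and bnd: "\<And>x. x \<in> U \<Longrightarrow> \<bar>g f x - r f\<bar> \<le> 48 * B"
    and mean: "(\<integral>x. indicat_real U x * (g f x - r f) \<partial>P) = 0"
    and var: "(\<integral>x. indicat_real U x * (g f x - r f)\<^sup>2 \<partial>P) \<le> 48 * B * r f"
    and loss: "\<And>x. x \<in> carrier_vec D \<Longrightarrow> 0 \<le> base x + g f x"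
      "\<And>x. x \<in> carrier_vec D \<Longrightarrow> denoising_loss D t0 T x (frozen_score V f) = ennreal (base x + g f x)"
    and up: "score_risk D t0 T P (frozen_score V f) \<le> 2 * ennreal (r f) + ennreal (8 * B) * tail_mass"
    and low: "ennreal (r f) \<le> 4 * score_risk D t0 T P (frozen_score V f) + ennreal (8 * B) * tail_mass"
    if "f \<in> F" for f
    using bspec[OF gr that] unfolding g_def r_def excess_pair_def by auto
  have Uc: "x \<in> carrier_vec D" if "x \<in> U" for x using U_subset[OF that] by (simp only: space_Q)
  \<comment> \<open>Each of the at most \<open>m\<close> net events, and the event for
    \<open>f0\<close>, fails with probability at most \<open>\<delta> / (8 * real m)\<close>. With
    the chance \<open>\<delta> / 16\<close> that some sample point leaves \<open>U\<close>, the
    total stays below \<open>\<delta>\<close>.\<close>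
  define u where "u = ln (real m) + ln (8 / \<delta>)"
  have l8: "1 \<le> ln (8 / \<delta>)"
  proof -
    have "exp 1 \<le> (8 :: real)" using exp_le by linarith
    also have "8 \<le> 8 / \<delta>" using \<delta> by (simp add: le_divide_eq)
    finally show ?thesis using \<delta> by (subst ln_ge_iff) auto
  qed
  have "0 \<le> ln (real m)" using G by (intro ln_ge_zero) simp
  with l8 have u1: "1 \<le> u" by (simp add: u_def)
  have eu: "exp (- u) = \<delta> / (8 * real m)"
    using \<delta> G by (simp add: u_def exp_add exp_minus exp_diff field_simps)
  have event: "\<exists>E. E \<in> sets ?PN \<and> emeasure ?PN (space ?PN - E) \<le> ennreal (exp (- u)) \<and>
    (\<forall>X\<in>E. (\<forall>i<N. X i \<in> U) \<longrightarrow> (\<Sum>i<N. s * (g f (X i) - r f)) \<le> 2 * (48 * B) * u + real N * r f / 2)"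
    if f: "f \<in> F" and s: "s = 1 \<or> s = - 1" for f and s :: real
  proof -
    note [measurable] = g_meas[OF f]
    have ss: "s\<^sup>2 = 1" "\<bar>s\<bar> = 1" using s by auto
    obtain E where "E \<in> sets ?PN" "emeasure ?PN (space ?PN - E) \<le> ennreal (exp (- u))"
      "\<And>X. X \<in> E \<Longrightarrow> (\<And>i. i < N \<Longrightarrow> X i \<in> U) \<Longrightarrow> (\<Sum>i<N. s * (g f (X i) - r f)) \<le> 2 * (48 * B) * u + real N * r f / 2"
    proof (rule bernstein_event[where Z = "\<lambda>x. s * (g f x - r f)" and U = U and b = "48 * B" and r = "r f" and N = N and u = u])
      show "\<bar>s * (g f x - r f)\<bar> \<le> 48 * B" if "x \<in> U" for x using bnd[OF f that] by (simp add: abs_mult ss)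
      have "(\<integral>x. indicat_real U x * (s * (g f x - r f)) \<partial>P) = (\<integral>x. s * (indicat_real U x * (g f x - r f)) \<partial>P)"
        by (simp only: mult.left_commute)
      then show "(\<integral>x. indicat_real U x * (s * (g f x - r f)) \<partial>P) = 0" by (simp add: mean[OF f])
      show "(\<integral>x. indicat_real U x * (s * (g f x - r f))\<^sup>2 \<partial>P) \<le> 48 * B * r f"
        using var[OF f] by (simp add: power_mult_distrib ss)
      show "U \<in> sets P" by (rule U_sets)
      show "(\<lambda>x. s * (g f x - r f)) \<in> borel_measurable P" by measurable
      show "0 < 48 * B" using B_pos by simp
    qed auto
    then show ?thesis by blast
  qed
  \<comment> \<open>Lower deviations: the sign -1 in \<open>event\<close>. An event is chosen for
    every network, but only those of the finite net are intersected.\<close>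
  have "\<forall>f\<in>F. \<exists>E. E \<in> sets ?PN \<and> emeasure ?PN (space ?PN - E) \<le> ennreal (exp (- u)) \<and>
    (\<forall>X\<in>E. (\<forall>i<N. X i \<in> U) \<longrightarrow> (\<Sum>i<N. (- 1) * (g f (X i) - r f)) \<le> 2 * (48 * B) * u + real N * r f / 2)"
  proof
    fix f assume "f \<in> F"
    from event[OF this, of "- 1"]
    show "\<exists>E. E \<in> sets ?PN \<and> emeasure ?PN (space ?PN - E) \<le> ennreal (exp (- u)) \<and>
    (\<forall>X\<in>E. (\<forall>i<N. X i \<in> U) \<longrightarrow> (\<Sum>i<N. (- 1) * (g f (X i) - r f)) \<le> 2 * (48 * B) * u + real N * r f / 2)"
      by simp
  qed
  from bchoice[OF this] obtain EG where EG_all: "\<forall>f\<in>F. EG f \<in> sets ?PN \<and>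
    emeasure ?PN (space ?PN - EG f) \<le> ennreal (exp (- u)) \<and>
    (\<forall>X\<in>EG f. (\<forall>i<N. X i \<in> U) \<longrightarrow> (\<Sum>i<N. (- 1) * (g f (X i) - r f)) \<le> 2 * (48 * B) * u + real N * r f / 2)"
    by (elim exE)
  have EG: "EG f \<in> sets ?PN" "emeasure ?PN (space ?PN - EG f) \<le> ennreal (exp (- u))"
    "\<And>X. X \<in> EG f \<Longrightarrow> (\<And>i. i < N \<Longrightarrow> X i \<in> U) \<Longrightarrow>
      (\<Sum>i<N. (- 1) * (g f (X i) - r f)) \<le> 2 * (48 * B) * u + real N * r f / 2" if "f \<in> F" for f
    using bspec[OF EG_all that] by simp_all
  from event[OF f0, of 1] obtain E0 where E0: "E0 \<in> sets ?PN" "emeasure ?PN (space ?PN - E0) \<le> ennreal (exp (- u))"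
    "\<And>X. X \<in> E0 \<Longrightarrow> (\<And>i. i < N \<Longrightarrow> X i \<in> U) \<Longrightarrow>
      (\<Sum>i<N. 1 * (g f0 (X i) - r f0)) \<le> 2 * (48 * B) * u + real N * r f0 / 2"
    by auto
  define EU where "EU = (\<Pi>\<^sub>E i\<in>{..<N}. U)"
  have EU: "EU \<in> sets ?PN" unfolding EU_def by (rule sets_PiM_I_finite) (simp, rule U_sets)
  define E where "E = EU \<inter> E0 \<inter> (\<Inter>f\<in>G. EG f)"
  have GF: "f \<in> F" if "f \<in> G" for f using G that by auto
  have Gne: "G \<noteq> {}" using net[OF f0] by auto
  have E_sets: "E \<in> sets ?PN"
    unfolding E_def using EU E0(1) EG(1) GF G(1) Gne by (intro sets.Int sets.finite_INT) auto
  have meas_le: "measure ?PN (space ?PN - S) \<le> exp (- u)" if "emeasure ?PN (space ?PN - S) \<le> ennreal (exp (- u))" for S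
    using that by (simp add: PN'.emeasure_eq_measure)
  have pU: "measure P (space P - U) \<le> \<delta> / (16 * real N)"
  proof -
    have "emeasure P (space P - U) = (\<integral>\<^sup>+x. indicator (space P - U) x \<partial>P)"
      by (rule nn_integral_indicator[symmetric]) auto
    also have "\<dots> \<le> tail_mass"
      unfolding tail_mass_def using \<theta>_nonneg by (intro nn_integral_mono) (auto simp: indicator_def simp flip: ennreal_1)
    also have "\<dots> \<le> ennreal (\<delta> / (16 * real N))" by (rule tail)
    finally show ?thesis using \<delta> by (simp add: emeasure_eq_measure)
  qed
  have mEU: "measure ?PN (space ?PN - EU) \<le> \<delta> / 16"
  proof -
    have "emeasure ?PN EU = (\<Prod>i<N. emeasure P U)"
      unfolding EU_def by (rule PN.emeasure_PiM) (simp, rule U_sets)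
    then have "measure ?PN EU = prob U ^ N"
      by (simp add: PN'.emeasure_eq_measure emeasure_eq_measure ennreal_power)
    also have "\<dots> = (1 + (- prob (space P - U))) ^ N" unfolding prob_compl[OF U_sets] by simp
    also have "\<dots> \<ge> 1 + real N * (- prob (space P - U))"
      by (rule Bernoulli_inequality) (use prob_le_1[of "space P - U"] in simp)
    finally have "1 - real N * prob (space P - U) \<le> measure ?PN EU" by simp
    moreover have "real N * prob (space P - U) \<le> real N * (\<delta> / (16 * real N))" using pU by (intro mult_left_mono) auto
    moreover have "real N * (\<delta> / (16 * real N)) = \<delta> / 16" using N by simp
    ultimately show ?thesis using PN'.prob_compl[OF EU] by linarith
  qed
  have "measure ?PN (space ?PN - E) \<le> \<delta>"
  proof -
    have sU: "space ?PN - EU \<in> sets ?PN" using EU by (rule sets.compl_sets)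
    have s0: "space ?PN - E0 \<in> sets ?PN" using E0(1) by (rule sets.compl_sets)
    have sG: "space ?PN - EG f \<in> sets ?PN" if "f \<in> G" for f using EG(1)[OF GF[OF that]] by (rule sets.compl_sets)
    have sUn: "(\<Union>f\<in>G. space ?PN - EG f) \<in> sets ?PN" using G(1) sG by (rule sets.finite_UN)
    have "space ?PN - E \<subseteq> (space ?PN - EU) \<union> ((space ?PN - E0) \<union> (\<Union>f\<in>G. space ?PN - EG f))"
      unfolding E_def by auto
    then have "measure ?PN (space ?PN - E) \<le> measure ?PN ((space ?PN - EU) \<union> ((space ?PN - E0) \<union> (\<Union>f\<in>G. space ?PN - EG f)))"
      by (rule PN'.finite_measure_mono) (intro sets.Un sU s0 sUn)
    also have "\<dots> \<le> measure ?PN (space ?PN - EU) + measure ?PN ((space ?PN - E0) \<union> (\<Union>f\<in>G. space ?PN - EG f))"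
      by (intro measure_Un_le sets.Un sU s0 sUn)
    also have "measure ?PN ((space ?PN - E0) \<union> (\<Union>f\<in>G. space ?PN - EG f))
      \<le> measure ?PN (space ?PN - E0) + measure ?PN (\<Union>f\<in>G. space ?PN - EG f)"
      by (intro measure_Un_le sets.Un sU s0 sUn)
    also have "measure ?PN (\<Union>f\<in>G. space ?PN - EG f) \<le> (\<Sum>f\<in>G. measure ?PN (space ?PN - EG f))"
      using G(1) sG by (rule measure_UNION_le)
    also have "\<dots> \<le> (\<Sum>f\<in>G. exp (- u))" by (intro sum_mono meas_le EG(2) GF)
    also have "\<dots> = real (card G) * exp (- u)" by simp
    also have "\<dots> \<le> real m * exp (- u)" using G by (intro mult_right_mono) auto
    also have "\<dots> = \<delta> / 8" unfolding eu using G by simp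
    finally have "measure ?PN (space ?PN - E) \<le> \<delta> / 16 + (exp (- u) + \<delta> / 8)"
      using mEU meas_le[OF E0(2)] by linarith
    moreover have "exp (- u) \<le> \<delta> / 8"
      unfolding eu using \<delta> G by (intro divide_left_mono) auto
    ultimately show ?thesis using \<delta> by linarith
  qed
  then have E_prob: "1 - \<delta> \<le> measure ?PN E" using PN'.prob_compl[OF E_sets] by linarith
  have concl: "score_risk D t0 T P s \<le> ennreal (6 * \<iota>) + ennreal (800 * B * u / real N)
        + 24 * score_risk D t0 T P (frozen_score V f0)"
    if X: "X \<in> E" and s: "s \<in> empirical_minimizers D t0 T N X (frozen_class V F)" for X s
  proof -
    have XU: "X i \<in> U" if "i < N" for i using X that by (auto simp: E_def EU_def)
    obtain f where f: "f \<in> F" and sf: "s = frozen_score V f"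
      using s by (auto simp: empirical_minimizers_def frozen_class_def)
    obtain h where h: "h \<in> G" and hx: "\<And>x. x \<in> U \<Longrightarrow> \<bar>enn2real (denoising_loss D t0 T x (frozen_score V f))
        - enn2real (denoising_loss D t0 T x (frozen_score V h))\<bar> \<le> \<iota>"
      using net[OF f] by blast
    note hF = GF[OF h]
    \<comment> \<open>Both losses contain the same summand \<open>base x\<close>, so closeness of
      the losses is closeness of the excess functions.\<close>
    have fh: "\<bar>g f x - g h x\<bar> \<le> \<iota>" if "x \<in> U" for x
      using hx[OF that] loss[OF f Uc[OF that]] loss[OF hF Uc[OF that]] by simp
    have emp: "empirical_loss D t0 T N X (frozen_score V f') = ennreal (1 / real N * (\<Sum>i<N. base (X i) + g f' (X i)))"
      if f': "f' \<in> F" for f'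
    proof -
      have "(\<Sum>i<N. denoising_loss D t0 T (X i) (frozen_score V f')) = (\<Sum>i<N. ennreal (base (X i) + g f' (X i)))"
        using loss(2)[OF f'] Uc XU by (intro sum.cong) auto
      also have "\<dots> = ennreal (\<Sum>i<N. base (X i) + g f' (X i))"
        using loss(1)[OF f'] Uc XU by (intro sum_ennreal) auto
      finally have "empirical_loss D t0 T N X (frozen_score V f') = ennreal (1 / real N) * ennreal (\<Sum>i<N. base (X i) + g f' (X i))"
        unfolding empirical_loss_def by simp
      also have "\<dots> = ennreal (1 / real N * (\<Sum>i<N. base (X i) + g f' (X i)))"
        using loss(1)[OF f' Uc[OF XU]] by (intro ennreal_mult[symmetric] sum_nonneg) auto
      finally show ?thesis .
    qed
    have "empirical_loss D t0 T N X (frozen_score V f) \<le> empirical_loss D t0 T N X (frozen_score V f0)"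
      using s f0 unfolding sf empirical_minimizers_def frozen_class_def by auto
    moreover have "0 \<le> 1 / real N * (\<Sum>i<N. base (X i) + g f0 (X i))"
      using loss(1)[OF f0] Uc XU by (intro mult_nonneg_nonneg sum_nonneg) auto
    ultimately have "1 / real N * (\<Sum>i<N. base (X i) + g f (X i)) \<le> 1 / real N * (\<Sum>i<N. base (X i) + g f0 (X i))"
      unfolding emp[OF f] emp[OF f0] by simp
    \<comment> \<open>\<open>base\<close> cancels here as well: minimising the empirical denoising
      loss is minimising the empirical excess.\<close>
    then have erm: "(\<Sum>i<N. g f (X i)) \<le> (\<Sum>i<N. g f0 (X i))"
      using N by (simp add: sum.distrib divide_le_cancel)
    have "(\<Sum>i<N. g h (X i)) \<le> (\<Sum>i<N. g f (X i) + \<iota>)"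
    proof (rule sum_mono)
      fix i assume "i \<in> {..<N}"
      then show "g h (X i) \<le> g f (X i) + \<iota>" using fh[of "X i"] XU[of i] by auto
    qed
    then have near: "(\<Sum>i<N. g h (X i)) \<le> (\<Sum>i<N. g f (X i)) + real N * \<iota>" by (simp add: sum.distrib)
    have dev_h: "real N * r h / 2 \<le> 96 * B * u + (\<Sum>i<N. g h (X i))"
      using EG(3)[OF hF, of X] X h XU by (auto simp: E_def sum_subtractf sum_negf)
    have dev_0: "(\<Sum>i<N. g f0 (X i)) \<le> 96 * B * u + 3 * (real N * r f0) / 2"
      using E0(3)[of X] X XU by (auto simp: E_def sum_subtractf)
    have "real N * r h / 2 \<le> 192 * B * u + real N * \<iota> + 3 * (real N * r f0) / 2"
      using dev_h near erm dev_0 by linarith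
    moreover have "real N * (384 * B * u / real N + 2 * \<iota> + 3 * r f0) = 384 * B * u + 2 * (real N * \<iota>) + 3 * (real N * r f0)"
      using N by (simp add: distrib_left)
    ultimately have "real N * r h \<le> real N * (384 * B * u / real N + 2 * \<iota> + 3 * r f0)" by linarith
    then have rh: "r h \<le> 384 * B * u / real N + 2 * \<iota> + 3 * r f0" using N by simp
    have int: "integrable P (\<lambda>x. indicat_real U x * g f' x)" if f': "f' \<in> F" for f'
    proof (rule integrable_const_bound[where B = "48 * B + r f'"])
      show "AE x in P. norm (indicat_real U x * g f' x) \<le> 48 * B + r f'"
      proof (rule AE_I2)
        fix x show "norm (indicat_real U x * g f' x) \<le> 48 * B + r f'"
          using bnd[OF f', of x] r0[OF f'] B_pos by (auto simp: indicator_def)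
      qed
      show "(\<lambda>x. indicat_real U x * g f' x) \<in> borel_measurable P" using g_meas[OF f'] by measurable
    qed
    have iU: "integrable P (\<lambda>x. c * indicat_real U x)" for c
      by (rule integrable_const_bound[where B = "\<bar>c\<bar>"]) (auto simp: indicator_def)
    have Ur: "(\<integral>x. indicat_real U x * g f' x \<partial>P) = r f' * prob U" if f': "f' \<in> F" for f'
    proof -
      have "(\<integral>x. indicat_real U x * (g f' x - r f') \<partial>P) = (\<integral>x. indicat_real U x * g f' x - r f' * indicat_real U x \<partial>P)"
        by (intro Bochner_Integration.integral_cong) (auto simp: algebra_simps)
      also have "\<dots> = (\<integral>x. indicat_real U x * g f' x \<partial>P) - r f' * prob U"
        using int[OF f'] iU[of "r f'"] U_subset by (simp add: Int_absorb2 subsetI)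
      finally show ?thesis using mean[OF f'] by simp
    qed
    \<comment> \<open>The net distance is inherited by the conditional means, since
      \<open>r f * prob U\<close> is the integral of the excess over \<open>U\<close>.\<close>
    have "r f * prob U \<le> (\<integral>x. indicat_real U x * g h x + \<iota> * indicat_real U x \<partial>P)"
      unfolding Ur[OF f, symmetric]
    proof (rule integral_mono)
      show "indicat_real U x * g f x \<le> indicat_real U x * g h x + \<iota> * indicat_real U x" for x
        using fh[of x] by (auto simp: indicator_def)
    qed (use int[OF f] int[OF hF] iU[of \<iota>] in auto)
    also have "\<dots> = (r h + \<iota>) * prob U"
      using int[OF hF] iU[of \<iota>] U_subset by (simp add: Ur[OF hF] Int_absorb2 subsetI distrib_right)
    finally have "r f \<le> r h + \<iota>" using U_prob_pos by simp
    with rh have rf: "r f \<le> 384 * B * u / real N + 3 * \<iota> + 3 * r f0" by linarith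
    define \<tau> where "\<tau> = \<delta> / (16 * real N)"
    have \<tau>: "0 \<le> \<tau>" "\<tau> \<le> u / (16 * real N)" using \<delta> u1 by (auto simp: \<tau>_def intro!: divide_right_mono)
    have tm: "ennreal (8 * B) * tail_mass \<le> ennreal (8 * B * \<tau>)"
    proof -
      have "ennreal (8 * B) * tail_mass \<le> ennreal (8 * B) * ennreal \<tau>"
        using tail unfolding \<tau>_def by (rule mult_left_mono) simp
      then show ?thesis using \<tau> B_pos by (simp add: ennreal_mult)
    qed
    let ?L = "384 * B * u / real N"
    have L0: "0 \<le> ?L" using B_pos u1 by (intro divide_nonneg_nonneg mult_nonneg_nonneg) auto
    have "score_risk D t0 T P s \<le> 2 * ennreal (r f) + ennreal (8 * B * \<tau>)"
      unfolding sf using up[OF f] tm by (meson add_left_mono order_trans)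
    also have "\<dots> \<le> 2 * ennreal (?L + 3 * \<iota> + 3 * r f0) + ennreal (8 * B * \<tau>)"
      using rf by (intro add_right_mono mult_left_mono ennreal_leI) auto
    also have "\<dots> = ennreal (2 * ?L + 6 * \<iota> + 8 * B * \<tau>) + 6 * ennreal (r f0)"
    proof -
      have "2 * ennreal (?L + 3 * \<iota> + 3 * r f0) + ennreal (8 * B * \<tau>)
         = ennreal (2 * (?L + 3 * \<iota> + 3 * r f0) + 8 * B * \<tau>)"
        unfolding numeral_mult_ennreal using L0 \<iota> r0[OF f0] \<tau> B_pos
        by (intro ennreal_plus[symmetric] mult_nonneg_nonneg add_nonneg_nonneg) auto
      also have "2 * (?L + 3 * \<iota> + 3 * r f0) + 8 * B * \<tau> = (2 * ?L + 6 * \<iota> + 8 * B * \<tau>) + 6 * r f0" by simp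
      also have "ennreal \<dots> = ennreal (2 * ?L + 6 * \<iota> + 8 * B * \<tau>) + ennreal (6 * r f0)"
        using L0 \<iota> r0[OF f0] \<tau> B_pos by (intro ennreal_plus) auto
      finally show ?thesis unfolding numeral_mult_ennreal[of _ "r f0"] .
    qed
    also have "\<dots> \<le> ennreal (2 * ?L + 6 * \<iota> + 8 * B * \<tau>) + 6 * (4 * score_risk D t0 T P (frozen_score V f0) + ennreal (8 * B * \<tau>))"
      using low[OF f0] tm by (intro add_left_mono mult_left_mono) (meson add_left_mono order_trans, simp)
    also have "\<dots> = (ennreal (2 * ?L + 6 * \<iota> + 8 * B * \<tau>) + ennreal (48 * B * \<tau>)) + 24 * score_risk D t0 T P (frozen_score V f0)"
    proof -
      have "6 * ennreal (8 * B * \<tau>) = ennreal (48 * B * \<tau>)"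
        unfolding numeral_mult_ennreal by (simp add: mult.assoc)
      then show ?thesis by (simp add: distrib_left mult.assoc[symmetric] add_ac)
    qed
    also have "ennreal (2 * ?L + 6 * \<iota> + 8 * B * \<tau>) + ennreal (48 * B * \<tau>) = ennreal (6 * \<iota> + (2 * ?L + 56 * B * \<tau>))"
    proof -
      have "0 \<le> 2 * ?L" "0 \<le> 6 * \<iota>" "0 \<le> 8 * B * \<tau>" "0 \<le> 48 * B * \<tau>"
        using L0 \<iota> \<tau> B_pos by simp_all
      then have "ennreal (2 * ?L + 6 * \<iota> + 8 * B * \<tau>) + ennreal (48 * B * \<tau>) = ennreal (2 * ?L + 6 * \<iota> + 8 * B * \<tau> + 48 * B * \<tau>)"
        by (intro ennreal_plus[symmetric] add_nonneg_nonneg)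
      also have "2 * ?L + 6 * \<iota> + 8 * B * \<tau> + 48 * B * \<tau> = 6 * \<iota> + (2 * ?L + 56 * B * \<tau>)" by simp
      finally show ?thesis .
    qed
    \<comment> \<open>The tail terms, 8 + 48 = 56 times \<open>B * \<tau>\<close>, merge into the
      statistical term because \<open>\<tau>\<close> is at most \<open>u / (16 * real N)\<close>;
      768 + 56/16 is rounded up to 800.\<close>
    also have "\<dots> \<le> ennreal (6 * \<iota> + 800 * B * u / real N)"
    proof (intro ennreal_leI add_left_mono)
      have "56 * B * \<tau> \<le> 56 * B * (u / (16 * real N))" using \<tau> B_pos by (intro mult_left_mono) auto
      also have "\<dots> = 56 / 16 * (B * u / real N)" using N by simp
      finally have 1: "56 * B * \<tau> \<le> 56 / 16 * (B * u / real N)" .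
      have 2: "0 \<le> B * u / real N" using B_pos u1 by (intro divide_nonneg_nonneg mult_nonneg_nonneg) auto
      have "2 * ?L = 768 * (B * u / real N)" "800 * B * u / real N = 800 * (B * u / real N)" by simp_all
      then show "2 * ?L + 56 * B * \<tau> \<le> 800 * B * u / real N" using 1 2 by linarith
    qed
    also have "\<dots> = ennreal (6 * \<iota>) + ennreal (800 * B * u / real N)"
      using \<iota> B_pos u1 by (intro ennreal_plus) (auto intro!: divide_nonneg_nonneg mult_nonneg_nonneg)
    finally show ?thesis by (simp add: add_right_mono)
  qed
  show ?thesis
    by (intro bexI[of _ E] conjI E_sets E_prob ballI) (use concl in \<open>simp add: u_def\<close>)
qed

end

section \<open>Covering numbers, constants and the final bound\<close>

lemma polylog_2_ge:
  "(1 + \<bar>ln Rz\<bar> + \<bar>ln Rp\<bar>)\<^sup>2 \<le> polylog 2 [a, b, c, d, e, f, g, h, Rz, Rp]"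
  unfolding polylog_def by (intro power_mono) auto

lemma polylog_ge_1: "1 \<le> polylog k qs"
  unfolding polylog_def by (intro one_le_power) (auto intro!: sum_list_nonneg)

text \<open>The extended naturals are well-ordered, so a finite infimum is attained; an empty family
  of nets would give infinity.\<close>

lemma finite_covering_number:
  assumes "covering_number \<iota> F d = enat m"
  shows "\<exists>G. finite G \<and> G \<subseteq> F \<and> card G = m \<and> (\<forall>f\<in>F. \<exists>g\<in>G. d f g \<le> ennreal \<iota>)"
proof -
  let ?A = "{enat (card G) | G. finite G \<and> G \<subseteq> F \<and> (\<forall>f\<in>F. \<exists>g\<in>G. d f g \<le> ennreal \<iota>)}"
  have inf: "Inf ?A = enat m" using assms by (simp only: covering_number_def)
  have "?A \<noteq> {}"
  proof
    assume "?A = {}"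
    then have "Inf ?A = Inf {}" by (rule arg_cong)
    also have "\<dots> = \<infinity>" by (simp add: Inf_enat_def)
    finally have "Inf ?A = \<infinity>" .
    with inf show False by simp
  qed
  then have "Inf ?A \<in> ?A" unfolding Inf_enat_def by (auto intro: LeastI)
  then show ?thesis unfolding inf by auto
qed

text \<open>The abbreviations of the theorem appear as equational hypotheses, so its unfolded
  \<open>let\<close> bindings are matched by reflexivity.\<close>

lemma frozen_estimator_bound:
  fixes D d1 d2 N2 :: nat and A2 V1 :: rmat and pz :: "rvec \<Rightarrow> real" and \<sigma>2 B2 C12 C22 t0 T K \<kappa> \<gamma> \<gamma>t \<delta> \<epsilon> \<iota> C0 \<epsilon>max C :: real
  assumes P2: "P2 = target_law D d2 A2 pz \<sigma>2"
    and F: "F = relu_class d1 T L M J K \<kappa> \<gamma> \<gamma>t"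
    and S: "S = frozen_class V1 F"
    and Rz: "Rz = latent_radius (latent_const B2 C12 C22) d2 \<sigma>2 N2 \<delta>"
    and Rperp: "Rperp = perp_radius 3 D d2 \<sigma>2 N2 \<delta>"
    and Ncov: "Ncov = covering_number \<iota> (truncated_losses D t0 T (trunc_set D A2 Rz Rperp) S) (sup_dist (carrier_vec D))"
    and rate: "rate = (real d1 + 1) * \<epsilon>\<^sup>2 / (t0 * (T - t0))"
    and C: "C = 800 * 288 * \<epsilon>max\<^sup>2 + 6 + 48 * (C0 + 1) + 48"
    and C0: "0 < C0" and d2: "0 < d2" and N2: "0 < N2"
    and A2: "orthonormal_cols D d2 A2" and V1: "orthonormal_cols D d1 V1"
    and \<sigma>2: "0 < \<sigma>2" and t0: "0 < t0" and T: "t0 < T"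
    and pz: "latent_density d2 pz" and tail: "latent_tail d2 pz B2 C12 C22"
    and \<delta>: "0 < \<delta>" "\<delta> < 1" and \<iota>: "0 < \<iota>" and \<epsilon>: "0 < \<epsilon>" "\<epsilon> \<le> \<epsilon>max"
    and approx: "(INF f\<in>F. comp_approx_error D d2 t0 T pz \<sigma>2 A2 V1 f) \<le> ennreal (C0 * rate)"
  shows "\<exists>E\<in>sets (\<Pi>\<^sub>M i\<in>{..<N2}. P2). 1 - \<delta> \<le> measure (\<Pi>\<^sub>M i\<in>{..<N2}. P2) E \<and>
    (\<forall>X\<in>E. \<forall>s\<in>empirical_minimizers D t0 T N2 X S.
      score_risk D t0 T P2 s \<le>
        ennreal (C * polylog 2 [real N2, \<delta>, \<epsilon>, \<iota>, t0, T, T - t0, K, Rz, Rperp]) *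
          (ennreal ((K\<^sup>2 + Rz\<^sup>2 + Rperp\<^sup>2) / (real N2 * t0 * (T - t0) * \<epsilon>\<^sup>2)) *
             (log_enat Ncov + ennreal (ln (8 / \<delta>))) + ennreal \<iota>)
        + ennreal (C * rate)
        + ennreal C * comp_risk D d2 t0 T pz \<sigma>2 A2 V1)"
proof -
  interpret tg: target D d2 A2 pz \<sigma>2 using A2 pz \<sigma>2 by unfold_locales
  let ?U = "trunc_set D A2 Rz Rperp"
  let ?pl = "polylog 2 [real N2, \<delta>, \<epsilon>, \<iota>, t0, T, T - t0, K, Rz, Rperp]"
  let ?PN = "\<Pi>\<^sub>M i\<in>{..<N2}. P2"
  note R_pos = tg.tail_bound(1,2)[OF tail d2 N2 \<delta> Rz Rperp] and R_tail = tg.tail_bound(3)[OF tail d2 N2 \<delta> Rz Rperp]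
  have rate_pos: "0 < rate" unfolding rate using \<epsilon> t0 T by (intro divide_pos_pos mult_pos_pos) auto
  have C_pos: "0 < C" unfolding C using C0 by (intro add_pos_pos add_nonneg_pos) auto
  have X_pos: "0 < K\<^sup>2 + Rz\<^sup>2 + Rperp\<^sup>2" using R_pos by (intro add_nonneg_pos) auto
  \<comment> \<open>Over an empty class the infimum would be infinite, against the approximation
    hypothesis.\<close>
  have F_ne: "F \<noteq> {}"
  proof
    assume "F = {}"
    with approx show False by (simp add: top_unique)
  qed
  have K0: "0 \<le> K"
  proof -
    obtain f where "f \<in> F" using F_ne by auto
    then have "vnorm (f (0\<^sub>v d1) T) \<le> K" unfolding F relu_class_def using t0 T by auto
    with vnorm_nonneg[of "f (0\<^sub>v d1) T"] show ?thesis by linarith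
  qed
  define R where "R = sqrt (Rz\<^sup>2 + Rperp\<^sup>2)"
  have R2: "R\<^sup>2 = Rz\<^sup>2 + Rperp\<^sup>2" by (simp add: R_def)
  have Rp: "0 < R" unfolding R_def using R_pos by (simp add: add_pos_pos)
  \<comment> \<open>\<open>R\<close> is at most \<open>Rz + Rperp\<close>, hence at most twice the
    exponential of the two absolute logarithms; the summand 1 absorbs the 2. Only quantities listed
    in \<open>polylog\<close> occur.\<close>
  define \<Lambda> where "\<Lambda> = 1 + \<bar>ln Rz\<bar> + \<bar>ln Rperp\<bar>"
  have R_exp: "R \<le> exp \<Lambda>"
  proof -
    have "R \<le> Rz + Rperp" unfolding R_def using R_pos by (intro real_le_lsqrt) (auto simp: power2_sum)
    also have "Rz + Rperp = exp (ln Rz) + exp (ln Rperp)" using R_pos by simp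
    also have "\<dots> \<le> exp (\<bar>ln Rz\<bar> + \<bar>ln Rperp\<bar>) + exp (\<bar>ln Rz\<bar> + \<bar>ln Rperp\<bar>)"
      by (intro add_mono) auto
    also have "\<dots> \<le> exp 1 * exp (\<bar>ln Rz\<bar> + \<bar>ln Rperp\<bar>)"
      using exp_ge_add_one_self[of 1] mult_right_mono[of 2 "exp 1" "exp (\<bar>ln Rz\<bar> + \<bar>ln Rperp\<bar>)"] by simp
    also have "\<dots> = exp \<Lambda>" by (simp add: \<Lambda>_def exp_add)
    finally show ?thesis .
  qed
  interpret dif: diffusion D t0 T P2 ?U R K \<Lambda>
  proof -
    have vp: "vec_prob P2 D" unfolding P2 by (rule tg.law.vec_prob_axioms)
    interpret vec_prob P2 D by (rule vp)
    have U: "?U \<in> sets P2" using tg.trunc_set_sets by simp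
    have "emeasure P2 (space P2 - ?U) = (\<integral>\<^sup>+x. indicator (space P2 - ?U) x \<partial>P2)"
      using U by (intro nn_integral_indicator[symmetric]) auto
    also have "\<dots> \<le> (\<integral>\<^sup>+x. ennreal (indicat_real (space P2 - ?U) x * (1 + (vnorm x)\<^sup>2 / (Rz\<^sup>2 + Rperp\<^sup>2))) \<partial>P2)"
      by (intro nn_integral_mono) (auto simp: indicator_def simp flip: ennreal_1)
    also have "\<dots> \<le> ennreal (\<delta> / (16 * real N2))" using R_tail unfolding P2 .
    also have "\<dots> \<le> ennreal (1 / 2)"
    proof (rule ennreal_leI)
      have "\<delta> \<le> 8 * real N2" using \<delta> N2 by linarith
      then show "\<delta> / (16 * real N2) \<le> 1 / 2" using N2 by (simp add: divide_le_eq)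
    qed
    finally have "ennreal (prob (space P2 - ?U)) \<le> ennreal (1 / 2)" unfolding emeasure_eq_measure .
    then have "prob (space P2 - ?U) \<le> 1 / 2" by (subst (asm) ennreal_le_iff) auto
    then have half: "1 / 2 \<le> prob ?U" using prob_compl[OF U] by linarith
    show "diffusion D t0 T P2 ?U R K \<Lambda>"
    proof (unfold_locales)
      show "integrable P2 (\<lambda>x. (vec_index x i)\<^sup>2)" if "i < D" for i
        unfolding P2 by (rule tg.second_moments[OF tail d2 that])
      show "(vnorm x)\<^sup>2 \<le> R\<^sup>2" if x: "x \<in> ?U" for x
      proof -
        have xc: "x \<in> carrier_vec D" using x by (simp add: trunc_set_def)
        have "(vnorm (transpose_mat A2 *\<^sub>v x))\<^sup>2 \<le> Rz\<^sup>2" "(vnorm ((1\<^sub>m D - A2 * transpose_mat A2) *\<^sub>v x))\<^sup>2 \<le> Rperp\<^sup>2"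
          using x vnorm_nonneg by (auto simp: trunc_set_def intro!: power_mono)
        then show ?thesis unfolding perp_proj(1)[OF A2 xc] R2 by linarith
      qed
    qed (use t0 T U half Rp R_exp K0 in \<open>auto simp: \<Lambda>_def\<close>)
  qed
  have V1c: "V1 \<in> carrier_mat D d1" using V1 by (simp add: orthonormal_cols_def)
  interpret est: estimation D t0 T P2 ?U R K \<Lambda> d1 V1 F
  proof unfold_locales
    show "orthonormal_cols D d1 V1" by (rule V1)
    show "dif.compressed V1 f \<in> dif.\<mu> \<rightarrow>\<^sub>M lborel_vec d1" if "f \<in> F" for f
      using that unfolding F by (rule dif.relu_class_measurable[OF _ V1c])
    show "vnorm (f z t) \<le> K" if "f \<in> F" "z \<in> carrier_vec d1" "t0 \<le> t" "t \<le> T" for f z t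
      using that t0 unfolding F relu_class_def by auto
  qed
  show ?thesis
  proof (cases Ncov)
    \<comment> \<open>Without a finite net the claimed bound is infinite, and the whole sample space
      serves as the event.\<close>
    case infinity
    interpret PN: prob_space ?PN by (rule prob_space_PiM) unfold_locales
    have "ennreal (C * ?pl) * (ennreal ((K\<^sup>2 + Rz\<^sup>2 + Rperp\<^sup>2) / (real N2 * t0 * (T - t0) * \<epsilon>\<^sup>2)) *
             (log_enat Ncov + ennreal (ln (8 / \<delta>))) + ennreal \<iota>) = \<infinity>"
    proof -
      have "0 < (K\<^sup>2 + Rz\<^sup>2 + Rperp\<^sup>2) / (real N2 * t0 * (T - t0) * \<epsilon>\<^sup>2)"
        using X_pos N2 t0 T \<epsilon> by (intro divide_pos_pos mult_pos_pos) auto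
      moreover have "0 < C * ?pl" using C_pos polylog_ge_1 by (intro mult_pos_pos) (auto intro: less_le_trans[of 0 1])
      moreover have "ennreal a * (ennreal q * (\<infinity> + y) + z) = \<infinity>" if "0 < q" "0 < a" for a q :: real and y z :: ennreal
        using that by (simp add: ennreal_mult_top)
      moreover have "log_enat Ncov = \<infinity>" by (simp add: infinity log_enat_def)
      ultimately show ?thesis by (simp only:)
    qed
    then show ?thesis
      by (intro bexI[of _ "space ?PN"]) (use \<delta> in \<open>simp_all add: PN.prob_space\<close>)
  next
    case (enat m)
    let ?l = "\<lambda>f x. enn2real (denoising_loss D t0 T x (frozen_score V1 f)) * indicat_real ?U x"
    have TL: "truncated_losses D t0 T ?U S = ?l ` F"
      unfolding truncated_losses_def S frozen_class_def by (simp add: image_image)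
    have "covering_number \<iota> (?l ` F) (sup_dist (carrier_vec D)) = enat m" using enat unfolding Ncov TL .
    from finite_covering_number[OF this] obtain H where H: "finite H" "H \<subseteq> ?l ` F" "card H = m"
      and H_net: "\<forall>a\<in>?l ` F. \<exists>b\<in>H. sup_dist (carrier_vec D) a b \<le> ennreal \<iota>"
      by (elim exE conjE)
    have H_ne: "H \<noteq> {}" using H_net F_ne by auto
    then have m: "0 < m" using H by auto
    \<comment> \<open>The covering number counts loss functions; choosing one network for each
      centre carries the net over to \<open>F\<close>.\<close>
    have "\<forall>b\<in>H. \<exists>f. f \<in> F \<and> b = ?l f" using H(2) by auto
    from bchoice[OF this] obtain sel where sel: "\<And>b. b \<in> H \<Longrightarrow> sel b \<in> F" "\<And>b. b \<in> H \<Longrightarrow> b = ?l (sel b)"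
      by auto
    have card: "card (sel ` H) \<le> m" using card_image_le[OF H(1), of sel] H(3) by simp
    have net: "\<exists>g\<in>sel ` H. \<forall>x\<in>?U. \<bar>enn2real (denoising_loss D t0 T x (frozen_score V1 f))
        - enn2real (denoising_loss D t0 T x (frozen_score V1 g))\<bar> \<le> \<iota>" if f: "f \<in> F" for f
    proof -
      from bspec[OF H_net imageI[OF f, of ?l]] obtain b where b: "b \<in> H" "sup_dist (carrier_vec D) (?l f) b \<le> ennreal \<iota>"
        by (elim bexE)
      have "\<bar>enn2real (denoising_loss D t0 T x (frozen_score V1 f))
        - enn2real (denoising_loss D t0 T x (frozen_score V1 (sel b)))\<bar> \<le> \<iota>" if x: "x \<in> ?U" for x
      proof -
        have xc: "x \<in> carrier_vec D" using x by (simp add: trunc_set_def)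
        have "ennreal \<bar>?l f x - b x\<bar> \<le> sup_dist (carrier_vec D) (?l f) b"
          unfolding sup_dist_def by (rule SUP_upper[OF xc])
        also have "\<dots> \<le> ennreal \<iota>" by (rule b(2))
        finally have "\<bar>?l f x - b x\<bar> \<le> \<iota>" using \<iota> by simp
        moreover have "b x = ?l (sel b) x" using sel(2)[OF b(1)] by (rule fun_cong)
        ultimately show ?thesis using x by simp
      qed
      then show ?thesis using b(1) by blast
    qed
    \<comment> \<open>The infimum need not be attained. As \<open>rate\<close> is positive, passing
      from \<open>C0\<close> to \<open>C0 + 1\<close> leaves room for an actual network
      \<open>f0\<close>.\<close>
    have "(INF f\<in>F. comp_approx_error D d2 t0 T pz \<sigma>2 A2 V1 f) < ennreal ((C0 + 1) * rate)"
      by (rule le_less_trans[OF approx]) (use C0 rate_pos in \<open>simp add: ennreal_less_iff\<close>)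
    then obtain f0 where f0: "f0 \<in> F" and "comp_approx_error D d2 t0 T pz \<sigma>2 A2 V1 f0 < ennreal ((C0 + 1) * rate)"
      by (auto simp: INF_less_iff)
    then have A0: "comp_approx_error D d2 t0 T pz \<sigma>2 A2 V1 f0 \<le> ennreal ((C0 + 1) * rate)" by simp
    let ?Uc = "comp_risk D d2 t0 T pz \<sigma>2 A2 V1"
    have "score_risk D t0 T P2 (frozen_score V1 f0) \<le> 2 * comp_approx_error D d2 t0 T pz \<sigma>2 A2 V1 f0 + 2 * ?Uc"
      using dif.score_risk_frozen_triangle[OF V1 est.F_meas[OF f0] dif.f_comp_measurable[OF pz \<sigma>2 V1c]]
      unfolding comp_approx_error_def comp_risk_def P2 .
    also have "\<dots> \<le> 2 * ennreal ((C0 + 1) * rate) + 2 * ?Uc"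
      using A0 by (intro add_right_mono mult_left_mono) auto
    finally have risk0: "24 * score_risk D t0 T P2 (frozen_score V1 f0) \<le> 24 * (2 * ennreal ((C0 + 1) * rate) + 2 * ?Uc)"
      by (rule mult_left_mono) simp
    have "24 * (2 * ennreal ((C0 + 1) * rate) + 2 * ?Uc) = ennreal (48 * (C0 + 1) * rate) + ennreal 48 * ?Uc"
    proof -
      have "24 * (2 * ennreal ((C0 + 1) * rate)) = ennreal (48 * (C0 + 1) * rate)"
        using C0 rate_pos by (simp add: ennreal_mult'' mult.assoc[symmetric])
      then show ?thesis by (simp add: distrib_left mult.assoc[symmetric])
    qed
    also have "\<dots> \<le> ennreal (C * rate) + ennreal C * ?Uc"
    proof (intro add_mono mult_right_mono ennreal_leI)
      show "48 * (C0 + 1) \<le> C" "48 \<le> C" unfolding C using C0 by auto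
    qed (use rate_pos in auto)
    finally have comp: "24 * score_risk D t0 T P2 (frozen_score V1 f0) \<le> ennreal (C * rate) + ennreal C * ?Uc"
      using risk0 by (rule order_trans[rotated])
    define u where "u = ln (real m) + ln (8 / \<delta>)"
    have lm: "0 \<le> ln (real m)" using m by (intro ln_ge_zero) simp
    have l8: "0 \<le> ln (8 / \<delta>)" using \<delta> by (intro ln_ge_zero) (simp add: le_divide_eq)
    have u0: "0 \<le> u" using lm l8 by (simp add: u_def)
    define Q where "Q = (K\<^sup>2 + Rz\<^sup>2 + Rperp\<^sup>2) / (real N2 * t0 * (T - t0) * \<epsilon>\<^sup>2)"
    have Q0: "0 \<le> Q" unfolding Q_def using X_pos N2 t0 T by (intro divide_nonneg_nonneg mult_nonneg_nonneg) auto
    define pl where "pl = ?pl"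
    have pl1: "1 \<le> pl" unfolding pl_def by (rule polylog_ge_1)
    have pl0: "0 \<le> pl" using pl1 by linarith
    have \<Lambda>pl: "\<Lambda>\<^sup>2 \<le> pl" unfolding \<Lambda>_def pl_def by (rule polylog_2_ge)
    have C_ge: "800 * 288 * \<epsilon>max\<^sup>2 \<le> C" "6 \<le> C" using C0 by (simp_all add: C)
    \<comment> \<open>\<open>dif.B\<close> contains no 1/\<epsilon>^2. Expressing it through
      \<open>Q\<close> therefore leaves a factor \<open>\<epsilon>\<^sup>2\<close>, which is at most
      \<open>\<epsilon>max\<^sup>2\<close> and is paid by the first summand of \<open>C\<close>; the
      factor \<open>\<Lambda>\<^sup>2\<close> goes into the logarithmic term.\<close>
    have "800 * dif.B * u / real N2 \<le> C * pl * (Q * u)"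
    proof -
      have "\<epsilon>\<^sup>2 \<le> \<epsilon>max\<^sup>2" using \<epsilon> by (intro power_mono) auto
      then have "\<Lambda>\<^sup>2 * \<epsilon>\<^sup>2 \<le> pl * \<epsilon>max\<^sup>2" using \<Lambda>pl pl0 by (intro mult_mono) auto
      then have "800 * 288 * \<Lambda>\<^sup>2 * \<epsilon>\<^sup>2 \<le> pl * (800 * 288 * \<epsilon>max\<^sup>2)" by simp
      also have "\<dots> \<le> pl * C" using C_ge(1) pl0 by (rule mult_left_mono)
      finally have 1: "800 * 288 * \<Lambda>\<^sup>2 * \<epsilon>\<^sup>2 \<le> C * pl" by (simp only: mult.commute)
      have "800 * dif.B * u / real N2 = (800 * 288 * \<Lambda>\<^sup>2 * \<epsilon>\<^sup>2) * (Q * u)"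
      proof -
        have gen: "800 * (288 * Y * l / (t0 * (T - t0))) * u / real N2 = (800 * 288 * l * e) * (Y / (real N2 * t0 * (T - t0) * e) * u)"
          if "e \<noteq> 0" for Y l e :: real
          using that by (simp add: mult_ac)
        have B: "dif.B = 288 * (K\<^sup>2 + Rz\<^sup>2 + Rperp\<^sup>2) * \<Lambda>\<^sup>2 / (t0 * (T - t0))"
          unfolding dif.B_def R2 by (simp only: add.assoc)
        have "\<epsilon>\<^sup>2 \<noteq> 0" using \<epsilon> by simp
        then show ?thesis unfolding Q_def B by (rule gen)
      qed
      also have "\<dots> \<le> C * pl * (Q * u)" using Q0 u0 by (intro mult_right_mono[OF 1] mult_nonneg_nonneg)
      finally show ?thesis .
    qed
    moreover have "6 * \<iota> \<le> C * pl * \<iota>"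
    proof (rule mult_right_mono)
      have "6 * 1 \<le> C * pl" using C_ge(2) pl1 by (intro mult_mono) auto
      then show "6 \<le> C * pl" by simp
    qed (use \<iota> in simp)
    ultimately have "6 * \<iota> + 800 * dif.B * u / real N2 \<le> C * pl * (Q * u + \<iota>)" by (simp add: distrib_left)
    then have "ennreal (6 * \<iota> + 800 * dif.B * u / real N2) \<le> ennreal (C * pl * (Q * u + \<iota>))" by (rule ennreal_leI)
    also have "\<dots> = ennreal (C * pl) * (ennreal Q * (log_enat Ncov + ennreal (ln (8 / \<delta>))) + ennreal \<iota>)"
    proof -
      have "log_enat Ncov + ennreal (ln (8 / \<delta>)) = ennreal u"
        unfolding enat log_enat_def u_def enat.case by (rule ennreal_plus[symmetric]) (fact lm, fact l8)
      moreover have "0 \<le> Q * u" using Q0 u0 by (rule mult_nonneg_nonneg)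
      moreover have "0 \<le> C * pl" using C_pos pl0 by simp
      ultimately show ?thesis using Q0 u0 \<iota> by (simp add: ennreal_mult ennreal_plus)
    qed
    finally have main: "ennreal (6 * \<iota>) + ennreal (800 * dif.B * u / real N2) \<le>
      ennreal (C * ?pl) * (ennreal Q * (log_enat Ncov + ennreal (ln (8 / \<delta>))) + ennreal \<iota>)"
      unfolding pl_def using \<iota> dif.B_pos u0 by (subst ennreal_plus[symmetric]) auto
    have tm: "dif.tail_mass \<le> ennreal (\<delta> / (16 * real N2))"
      using R_tail unfolding dif.tail_mass_def dif.\<theta>_def R2 unfolding P2 .
    have "\<exists>E\<in>sets ?PN. 1 - \<delta> \<le> measure ?PN E \<and>
      (\<forall>X\<in>E. \<forall>s\<in>empirical_minimizers D t0 T N2 X (frozen_class V1 F).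
        score_risk D t0 T P2 s \<le> ennreal (6 * \<iota>) + ennreal (800 * dif.B * (ln (real m) + ln (8 / \<delta>)) / real N2)
          + 24 * score_risk D t0 T P2 (frozen_score V1 f0))"
      by (rule est.erm_oracle_inequality[where G = "sel ` H"])
        (use N2 \<delta> \<iota> tm H(1) sel(1) card m net f0 in auto)
    then obtain E where E: "E \<in> sets ?PN" "1 - \<delta> \<le> measure ?PN E"
      and risk: "\<And>X s. X \<in> E \<Longrightarrow> s \<in> empirical_minimizers D t0 T N2 X S \<Longrightarrow>
        score_risk D t0 T P2 s \<le> ennreal (6 * \<iota>) + ennreal (800 * dif.B * u / real N2)
          + 24 * score_risk D t0 T P2 (frozen_score V1 f0)"
      unfolding S u_def by blast
    show ?thesis
    proof (intro bexI[OF _ E(1)] conjI ballI)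
      show "1 - \<delta> \<le> measure ?PN E" by (rule E(2))
      fix X s assume "X \<in> E" "s \<in> empirical_minimizers D t0 T N2 X S"
      from risk[OF this] have "score_risk D t0 T P2 s \<le>
        ennreal (C * ?pl) * (ennreal Q * (log_enat Ncov + ennreal (ln (8 / \<delta>))) + ennreal \<iota>)
        + (ennreal (C * rate) + ennreal C * ?Uc)"
        using main comp by (meson add_mono order_trans)
      then show "score_risk D t0 T P2 s \<le>
        ennreal (C * ?pl) * (ennreal ((K\<^sup>2 + Rz\<^sup>2 + Rperp\<^sup>2) / (real N2 * t0 * (T - t0) * \<epsilon>\<^sup>2)) *
             (log_enat Ncov + ennreal (ln (8 / \<delta>))) + ennreal \<iota>)
        + ennreal (C * rate) + ennreal C * ?Uc"
        unfolding Q_def by (simp only: add.assoc)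
    qed
  qed
qed

text \<open>Only the radius along \<open>A2\<close> has to know the latent tail constants. Across
  \<open>A2\<close> there is pure Gaussian noise, so the absolute constant 3 serves there.
  \<open>C\<close> is built from \<open>C0\<close> and \<open>\<epsilon>max\<close> alone, and the
  power of the logarithms is 2.\<close>

theorem theorem5:
  shows "\<exists>(Cz :: real \<Rightarrow> real \<Rightarrow> real \<Rightarrow> real) (Cperp :: real \<Rightarrow> real \<Rightarrow> real \<Rightarrow> real).
    (\<forall>b>0. \<forall>c1>0. \<forall>c2>0. 0 < Cz b c1 c2 \<and> 0 < Cperp b c1 c2) \<and>
    (\<forall>C0>0. \<forall>\<epsilon>max>0. \<exists>C>0. \<exists>k :: nat.
      \<forall>(D :: nat) (d1 :: nat) (d2 :: nat) (N2 :: nat)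
        (A2 :: real Matrix.mat) (V1 :: real Matrix.mat)
        (pz :: real Matrix.vec \<Rightarrow> real) (\<sigma>2 :: real)
        (B2 :: real) (C12 :: real) (C22 :: real) (\<beta>2 :: real)
        (t0 :: real) (T :: real)
        (L :: nat) (M :: nat) (J :: nat) (K :: real) (\<kappa> :: real) (\<gamma> :: real) (\<gamma>t :: real)
        (\<delta> :: real) (\<epsilon> :: real) (\<iota> :: real).
      let P2 = target_law D d2 A2 pz \<sigma>2;
          F = relu_class d1 T L M J K \<kappa> \<gamma> \<gamma>t;
          S = frozen_class V1 F;
          Rz = latent_radius (Cz B2 C12 C22) d2 \<sigma>2 N2 \<delta>;
          Rperp = perp_radius (Cperp B2 C12 C22) D d2 \<sigma>2 N2 \<delta>;
          Ncov = covering_number \<iota> (truncated_losses D t0 T (trunc_set D A2 Rz Rperp) S)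
                   (sup_dist (carrier_vec D));
          rate = (real d1 + 1) * \<epsilon>\<^sup>2 / (t0 * (T - t0))
      in
        0 < d1 \<longrightarrow> 0 < d2 \<longrightarrow> 0 < N2 \<longrightarrow>
        orthonormal_cols D d2 A2 \<longrightarrow> orthonormal_cols D d1 V1 \<longrightarrow>
        0 < \<sigma>2 \<longrightarrow> 0 < t0 \<longrightarrow> t0 < T \<longrightarrow>
        latent_density d2 pz \<longrightarrow> latent_tail d2 pz B2 C12 C22 \<longrightarrow>
        lipschitz_in_space d2 T \<beta>2 (f_star d2 pz \<sigma>2) \<longrightarrow>
        0 < \<delta> \<longrightarrow> \<delta> < 1 \<longrightarrow> 0 < \<iota> \<longrightarrow> 0 < \<epsilon> \<longrightarrow> \<epsilon> \<le> \<epsilon>max \<longrightarrow>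
        (INF f\<in>F. comp_approx_error D d2 t0 T pz \<sigma>2 A2 V1 f) \<le> ennreal (C0 * rate) \<longrightarrow>
        (\<exists>E\<in>sets (\<Pi>\<^sub>M i\<in>{..<N2}. P2).
           1 - \<delta> \<le> measure (\<Pi>\<^sub>M i\<in>{..<N2}. P2) E \<and>
           (\<forall>X\<in>E. \<forall>s\<in>empirical_minimizers D t0 T N2 X S.
              score_risk D t0 T P2 s \<le>
                ennreal (C * polylog k [real N2, \<delta>, \<epsilon>, \<iota>, t0, T, T - t0, K, Rz, Rperp]) *
                  (ennreal ((K\<^sup>2 + Rz\<^sup>2 + Rperp\<^sup>2) / (real N2 * t0 * (T - t0) * \<epsilon>\<^sup>2)) *
                     (log_enat Ncov + ennreal (ln (8 / \<delta>))) + ennreal \<iota>)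
                + ennreal (C * rate)
                + ennreal C * comp_risk D d2 t0 T pz \<sigma>2 A2 V1)))"
proof (rule exI[of _ latent_const], rule exI[of _ "\<lambda>_ _ _. 3"], rule conjI, goal_cases)
  case 1
  show ?case using latent_const_pos by simp
next
  case 2
  show ?case
  proof (intro allI impI, goal_cases)
    case (1 C0 \<epsilon>max)
    \<comment> \<open>The summands answer to the statistical term (800 from the oracle inequality,
      288 from \<open>B\<close>), to the covering radius, to the approximation error with slack
      \<open>C0 + 1\<close>, and to the comparator risk; 48 is 24 times the 2 of the squared
      triangle inequality.\<close>
    let ?C = "800 * 288 * \<epsilon>max\<^sup>2 + 6 + 48 * (C0 + 1) + 48"
    have "0 < ?C" using 1 by (intro add_pos_pos add_nonneg_pos) auto
    then show ?case
    proof (rule_tac exI[of _ ?C], rule_tac conjI, assumption, rule_tac exI[of _ 2], unfold Let_def, intro allI impI, goal_cases)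
      case 1
      show ?case
        by (rule frozen_estimator_bound[OF refl refl refl refl refl refl refl refl \<open>0 < C0\<close>]) (fact 1)+
    qed
  qed
qed

end
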